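(* Let $\mathcal K\subseteq\mathcal D$ be a fixed compact subset of positive (hyperbolic) area, and for even $k$ let $$\mathcal M_k=\sup_{z\in\mathcal K} y^{k/2}\,|g_k(z)|,\qquad z=x+iy,$$ where $g_k$ is the random weight-$k$ cusp form described in the context. \begin{enumerate} \item[(i)] There exist constants $c_1>c_0>0$, depending only on $\mathcal K$, such that $$c_0\sqrt{\log k}\le \mathbb E[\mathcal M_k]\le c_1\sqrt{\log k}.$$ \item[(ii)] Let $\mu_k$ be a median of $\mathcal M_k$. Then $\mu_k=\mathbb E[\mathcal M_k]+O_{\mathcal K}(1)$, and there exists a constant $c=c(\mathcal K)>0$ such that for every $r>0$, $$\Pr\big(|\mathcal M_k-\mu_k|>r\big)\le 2e^{-cr^2}.$$ \end{enumerate}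
   Context: For even $k\ge 2$, let $\mathcal S_k$ be the space of weight-$k$ cusp forms for the full modular group $\mathrm{SL}_2(\mathbb Z)$, viewed as holomorphic functions on the upper half-plane $\mathbb H^2=\{z=x+iy:\ y>0\}$, and let $N=N_k=\dim\mathcal S_k$ (so $N_k=k/12+O(1)$); only $k$ with $N_k\ge1$ are considered. Let $\mathcal D=\{z\in\mathbb H^2:\ |\Re z|\le 1/2,\ |z|\ge 1\}$ be the standard fundamental domain. $\mathcal S_k$ carries the Petersson inner product $\langle f,g\rangle=\int_{\mathcal D} f(z)\overline{g(z)}\,y^k\,\frac{dx\,dy}{y^2}$. Let $f_1,\dots,f_N$ be an orthonormal basis of $\mathcal S_k$ for this inner product. The random weight-$k$ cusp form is $g_k(z)=\sum_{j=1}^N a_j f_j(z)$, where $(a_1,\dots,a_N)$ is drawn uniformly from the unit sphere $\{(a_j)\in\mathbb C^N:\ \sum_j|a_j|^2=1\}$ (its law does not depend on the choice of orthonormal basis). The notation $A\ll B$, $A=O(B)$ means $|A|\le CB$ for a constant $C$; subscripts indicate dependence of $C$. *)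

theory Defs
  imports "HOL-Probability.Probability" "HOL-Library.Function_Algebras"
begin

definition upper_half_plane :: "complex set" where
  "upper_half_plane = {z. Im z > 0}"

definition fund_domain :: "complex set" where
  "fund_domain = {z \<in> upper_half_plane. \<bar>Re z\<bar> \<le> 1 / 2 \<and> cmod z \<ge> 1}"

definition hyp_area :: "complex measure" where
  "hyp_area = density lborel (\<lambda>z. indicator upper_half_plane z * ennreal (1 / (Im z)\<^sup>2))"

text \<open>
  A function on the upper half-plane is represented by its extension by zero to all of
  the complex plane, so that equality of such functions is equality in HOL and the cusp forms
  form a linear subspace of the complex vector space of all functions.
  The last condition says that the form tends to zero as the imaginary part tends to infinity,
  uniformly in the real part, i.e. that it is holomorphic and vanishes at the (only) cusp.
\<close>

definition cusp_forms :: "nat \<Rightarrow> (complex \<Rightarrow> complex) set" where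
  "cusp_forms k = {f.
     f holomorphic_on upper_half_plane \<and>
     (\<forall>z. z \<notin> upper_half_plane \<longrightarrow> f z = 0) \<and>
     (\<forall>a b c d :: int. a * d - b * c = 1 \<longrightarrow>
        (\<forall>z \<in> upper_half_plane.
           f ((of_int a * z + of_int b) / (of_int c * z + of_int d)) =
             (of_int c * z + of_int d) ^ k * f z)) \<and>
     filterlim f (nhds 0) (filtercomap Im at_top)}"

global_interpretation cfun: vector_space "\<lambda>(c :: complex) (f :: complex \<Rightarrow> complex) z. c * f z"
  by unfold_locales (auto simp: fun_eq_iff algebra_simps)

definition cusp_dim :: "nat \<Rightarrow> nat" where
  "cusp_dim k = cfun.dim (cusp_forms k)"

definition petersson :: "nat \<Rightarrow> (complex \<Rightarrow> complex) \<Rightarrow> (complex \<Rightarrow> complex) \<Rightarrow> complex" where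
  "petersson k f g =
     (LINT z:fund_domain|hyp_area. f z * cnj (g z) * complex_of_real (Im z ^ k))"

text \<open>
  The members of the basis are \<open>f 0, \<dots>, f (N - 1)\<close>, where \<open>N\<close> is the dimension;
  the other values of \<open>f\<close> are irrelevant.
\<close>

definition orthonormal_basis :: "nat \<Rightarrow> (nat \<Rightarrow> complex \<Rightarrow> complex) \<Rightarrow> bool" where
  "orthonormal_basis k f \<longleftrightarrow>
     (\<forall>i < cusp_dim k. \<forall>j < cusp_dim k. petersson k (f i) (f j) = (if i = j then 1 else 0)) \<and>
     cfun.span (f ` {..<cusp_dim k}) = cusp_forms k"

text \<open>
  A vector in \<open>N\<close>-dimensional complex space is an element of the product of \<open>N\<close> copies of the
  complex plane.  The uniform distribution on the unit sphere (the normalised surface measure)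
  is the law of the direction of a point chosen uniformly, with respect to Lebesgue measure,
  from the closed unit ball with its centre removed.  It is a measure on the whole space that
  is concentrated on the sphere.
\<close>

definition cvec_norm :: "nat \<Rightarrow> (nat \<Rightarrow> complex) \<Rightarrow> real" where
  "cvec_norm N a = sqrt (\<Sum>j<N. (cmod (a j))\<^sup>2)"

definition uniform_sphere :: "nat \<Rightarrow> (nat \<Rightarrow> complex) measure" where
  "uniform_sphere N =
     distr
       (uniform_measure (Pi\<^sub>M {..<N} (\<lambda>_. lborel))
          {a \<in> {..<N} \<rightarrow>\<^sub>E UNIV. 0 < cvec_norm N a \<and> cvec_norm N a \<le> 1})
       (Pi\<^sub>M {..<N} (\<lambda>_. borel))
       (\<lambda>a. \<lambda>j\<in>{..<N}. a j / complex_of_real (cvec_norm N a))"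

definition form_of_coeffs ::
  "nat \<Rightarrow> (nat \<Rightarrow> complex \<Rightarrow> complex) \<Rightarrow> (nat \<Rightarrow> complex) \<Rightarrow> complex \<Rightarrow> complex" where
  "form_of_coeffs k f a z = (\<Sum>j<cusp_dim k. a j * f j z)"

definition sup_on ::
  "complex set \<Rightarrow> nat \<Rightarrow> (nat \<Rightarrow> complex \<Rightarrow> complex) \<Rightarrow> (nat \<Rightarrow> complex) \<Rightarrow> real" where
  "sup_on K k f a = (SUP z\<in>K. Im z powr (real k / 2) * cmod (form_of_coeffs k f a z))"

definition is_median :: "'a measure \<Rightarrow> ('a \<Rightarrow> real) \<Rightarrow> real \<Rightarrow> bool" where
  "is_median M X m \<longleftrightarrow>
     measure M {\<omega> \<in> space M. X \<omega> \<le> m} \<ge> 1 / 2 \<and> measure M {\<omega> \<in> space M. X \<omega> \<ge> m} \<ge> 1 / 2"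

text \<open>
  The weights that are considered, each with a choice of orthonormal basis; the law of the random
  form does not depend on that choice.
\<close>

definition admissible :: "nat \<Rightarrow> (nat \<Rightarrow> complex \<Rightarrow> complex) \<Rightarrow> bool" where
  "admissible k f \<longleftrightarrow> even k \<and> k \<ge> 2 \<and> cusp_dim k \<ge> 1 \<and> orthonormal_basis k f"

end

theory Submission
  imports Defs "HOL-Complex_Analysis.Complex_Analysis" "HOL-Real_Asymp.Real_Asymp"
begin

text \<open>
  Write \<open>g = (\<Sum>j. a j * f j)\<close> and \<open>v z j = y powr (k / 2) * f j z\<close>.  Then \<open>y powr (k / 2) * |g z|\<close> is the modulus of
  the linear form \<open>(\<Sum>j. a j * v z j)\<close>, so the supremum over \<open>K\<close> is a seminorm in \<open>a\<close> whose Lipschitz constant is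
  the largest norm of \<open>v z\<close>.  A mean value inequality on squares of side about \<open>y / sqrt k\<close> shows that \<open>|v z|^2\<close> is at most a
  constant times \<open>k\<close> on compact sets.  The sums of \<open>(a w + b - cnj z * (c w + d)) powi (- k)\<close> over the modular group
  peak at \<open>z\<close> and show that \<open>|v z|^2\<close> is at least a constant times \<open>k\<close> on a compact part of positive area of the
  interior of the fundamental domain.  Integrating this gives a lower bound for the dimension of order \<open>k\<close>, and
  Siegel's argument with Fourier expansions gives the upper bound \<open>k\<close>.

  The uniform distribution on the sphere is the law of the direction of a Gaussian vector.  The Prekopa-Leindler
  inequality gives concentration of Lipschitz functions of a Gaussian vector, and division by the norm, which is
  concentrated around a multiple of \<open>sqrt k\<close>, transfers it to the sphere with constants independent of \<open>k\<close>; this is (ii).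

  For the upper bound in (i), the mean value inequality applied to \<open>g ^ p\<close> with \<open>p\<close> about \<open>ln k\<close> bounds the \<open>2 p\<close>-th moment of the
  supremum by a pointwise moment at the cost of a factor \<open>k p\<close>.  For the lower bound, the \<open>L^n\<close> norm over the compact part, with \<open>n\<close> a
  small multiple of \<open>ln k\<close>, has Lipschitz constant of order \<open>k powr (1/2 - 1/n)\<close>, because the \<open>L^2\<close> norm of \<open>g\<close> is the norm of \<open>a\<close>.
  Its fluctuations are therefore dominated by its \<open>n\<close>-th moment, which is of order \<open>sqrt (n k) ^ n\<close>.  The finitely many
  remaining weights only need a positive lower bound, uniform over the orthonormal bases.
\<close>

section \<open>The Prekopa-Leindler inequality\<close>

text \<open>The supremum is never discretised, and no correlation between the values of the form at
  different points is estimated. For the lower bound in (i) the only input is the size of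
  \<open>total_weight\<close> on a set of positive area. Passing from the supremum to an L^n norm
  lowers the Lipschitz constant from \<open>L\<close> to L^(1 - 2/n); with n a small multiple of ln
  k this gains a constant factor, and the multiple is chosen so that this factor beats a fixed
  multiple of the ratio of \<open>L\<close> to the lower bound \<open>l\<close> for the norm of v z.
  A constant gain is enough because pointwise moments and fluctuations carry the same factor sqrt n.
  Both dimension bounds matter: N of order at least k keeps L / sqrt N, the size of the fluctuations
  on the sphere, bounded; N <= k keeps the normalised mean large. Prekopa-Leindler is a convenient
  source of concentration because it passes to products by Fubini without loss, so that the
  constants do not see the dimension.\<close>

lemma emeasure_Int_atMost_approx:
  fixes A :: "real set"
  assumes A: "A \<in> sets borel" "A \<noteq> {}"
  shows "emeasure lborel A \<le> (SUP a\<in>A. emeasure lborel (A \<inter> {..a}))"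
proof (cases "bdd_above A")
  case True
  define s where "s = Sup A"
  have le: "x \<le> s" if "x \<in> A" for x unfolding s_def using cSup_upper[OF that True] .
  have inc: "incseq (\<lambda>n::nat. A \<inter> {..s - 1 / real (Suc n)})"
    by (intro incseq_SucI Int_mono) (auto simp: field_simps)
  have un: "(\<Union>n::nat. A \<inter> {..s - 1 / real (Suc n)}) = A - {s}"
  proof (intro subset_antisym subsetI)
    fix x assume x: "x \<in> A - {s}"
    then have "s - x > 0" using le[of x] by auto
    then obtain n where "1 / real (Suc n) < s - x"
      using reals_Archimedean[of "s - x"] by (auto simp: inverse_eq_divide)
    then show "x \<in> (\<Union>n::nat. A \<inter> {..s - 1 / real (Suc n)})" using x by (intro UN_I[of n]) auto
  next
    fix x assume "x \<in> (\<Union>n::nat. A \<inter> {..s - 1 / real (Suc n)})"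
    then obtain n :: nat where "x \<in> A" "x \<le> s - 1 / real (Suc n)" by auto
    moreover have "1 / real (Suc n) > 0" by simp
    ultimately show "x \<in> A - {s}" by auto
  qed
  have "emeasure lborel A = emeasure lborel (A - {s})"
    using A by (subst emeasure_Diff_null_set) (auto intro: finite_imp_null_set_lborel)
  also have "\<dots> = (SUP n::nat. emeasure lborel (A \<inter> {..s - 1 / real (Suc n)}))"
    unfolding un[symmetric] by (rule SUP_emeasure_incseq[symmetric]) (use A inc in auto)
  also have "\<dots> \<le> (SUP a\<in>A. emeasure lborel (A \<inter> {..a}))"
  proof (rule SUP_least)
    fix n :: nat
    have "\<exists>a\<in>A. s - 1 / real (Suc n) < a"
      unfolding s_def using less_cSup_iff[OF A(2) True, of "Sup A - 1 / real (Suc n)"] by auto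
    then obtain a where "a \<in> A" "s - 1 / real (Suc n) < a" by auto
    then show "emeasure lborel (A \<inter> {..s - 1 / real (Suc n)}) \<le> (SUP a\<in>A. emeasure lborel (A \<inter> {..a}))"
      using A by (intro SUP_upper2[of a] emeasure_mono) auto
  qed
  finally show ?thesis .
next
  case False
  have inc: "incseq (\<lambda>n::nat. A \<inter> {..real n})"
    by (intro incseq_SucI Int_mono) auto
  have un: "(\<Union>n::nat. A \<inter> {..real n}) = A"
    using real_arch_simple by auto
  have "emeasure lborel A = (SUP n::nat. emeasure lborel (A \<inter> {..real n}))"
    by (subst SUP_emeasure_incseq) (use A inc un in auto)
  also have "\<dots> \<le> (SUP a\<in>A. emeasure lborel (A \<inter> {..a}))"
  proof (rule SUP_least)
    fix n :: nat
    obtain a where "a \<in> A" "real n < a" using False unfolding bdd_above_def by (meson linorder_not_le)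
    then show "emeasure lborel (A \<inter> {..real n}) \<le> (SUP a\<in>A. emeasure lborel (A \<inter> {..a}))"
      using A by (intro SUP_upper2[of a] emeasure_mono) auto
  qed
  finally show ?thesis .
qed

lemma emeasure_lborel_real_affine_vimage:
  fixes A :: "real set"
  assumes "A \<in> sets borel" "c \<noteq> 0"
  shows "emeasure lborel A = ennreal \<bar>c\<bar> * emeasure lborel ((\<lambda>x. t + c * x) -` A)"
proof -
  have "emeasure lborel A = (\<integral>\<^sup>+x. indicator A x \<partial>lborel)" using assms by simp
  also have "\<dots> = \<bar>c\<bar> * (\<integral>\<^sup>+x. indicator A (t + c * x) \<partial>lborel)"
    using assms by (intro nn_integral_real_affine) auto
  also have "(\<integral>\<^sup>+x. indicator A (t + c * x) \<partial>lborel) = (\<integral>\<^sup>+x. indicator ((\<lambda>x. t + c * x) -` A) x \<partial>lborel)"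
    by (intro nn_integral_cong) (auto split: split_indicator)
  also have "\<dots> = emeasure lborel ((\<lambda>x. t + c * x) -` A)"
    using assms measurable_sets[of "\<lambda>x. t + c * x" borel borel A] by (intro nn_integral_indicator) auto
  finally show ?thesis .
qed

lemma emeasure_Int_atLeast_approx:
  fixes A :: "real set"
  assumes A: "A \<in> sets borel" "A \<noteq> {}"
  shows "emeasure lborel A \<le> (SUP a\<in>A. emeasure lborel (A \<inter> {a..}))"
proof -
  have uA: "uminus ` A = uminus -` A" for A :: "real set"
    by (auto simp: image_iff) (metis minus_minus)
  have rfl: "emeasure lborel (uminus -` B) = emeasure lborel B" if "B \<in> sets borel" for B :: "real set"
    using emeasure_lborel_real_affine_vimage[OF that, of "-1" 0] by simp
  have m: "uminus -` A \<in> sets borel" using measurable_sets[of uminus borel borel A] A by simp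
  have "emeasure lborel A \<le> (SUP a\<in>uminus ` A. emeasure lborel (uminus -` A \<inter> {..a}))"
    using emeasure_Int_atMost_approx[OF m] A uA[of A] rfl[of A] by auto
  also have "\<dots> = (SUP a\<in>A. emeasure lborel (uminus -` A \<inter> {..-a}))" by (simp add: image_image)
  also have "\<dots> = (SUP a\<in>A. emeasure lborel (A \<inter> {a..}))"
  proof (intro SUP_cong refl)
    fix a
    have "uminus -` A \<inter> {..-a} = uminus -` (A \<inter> {a..})" by auto
    then show "emeasure lborel (uminus -` A \<inter> {..-a}) = emeasure lborel (A \<inter> {a..})"
      using rfl[of "A \<inter> {a..}"] A by auto
  qed
  finally show ?thesis .
qed

text \<open>Fix a in A and b in B. The midpoints of b with the points of A up to a, and of a with
  the points of B from b on, lie in C; the two sets meet at most in (a + b) / 2, so their measures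
  add. The two approximation lemmas then remove the cuts. The cuts have to be at points of A and B
  because these points also serve as translations.\<close>

lemma brunn_minkowski_real:
  fixes A B C :: "real set"
  assumes [measurable]: "A \<in> sets borel" "B \<in> sets borel" "C \<in> sets borel"
  assumes ne: "A \<noteq> {}" "B \<noteq> {}"
  assumes mid: "\<And>a b. a \<in> A \<Longrightarrow> b \<in> B \<Longrightarrow> (a + b) / 2 \<in> C"
  shows "emeasure lborel A + emeasure lborel B \<le> 2 * emeasure lborel C"
proof -
  have key: "emeasure lborel (A \<inter> {..a}) + emeasure lborel (B \<inter> {b..}) \<le> 2 * emeasure lborel C"
    if a: "a \<in> A" and b: "b \<in> B" for a b
  proof -
    define A' where "A' = (\<lambda>x. -b + 2 * x) -` (A \<inter> {..a})"
    define B' where "B' = (\<lambda>x. -a + 2 * x) -` (B \<inter> {b..})"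
    have [measurable]: "A' \<in> sets borel" "B' \<in> sets borel"
      using measurable_sets[of "\<lambda>x. -b + 2 * x" borel borel "A \<inter> {..a}"]
        measurable_sets[of "\<lambda>x. -a + 2 * x" borel borel "B \<inter> {b..}"] by (auto simp: A'_def B'_def)
    have eA: "emeasure lborel (A \<inter> {..a}) = 2 * emeasure lborel A'"
      unfolding A'_def using emeasure_lborel_real_affine_vimage[of "A \<inter> {..a}" 2 "-b"] by simp
    have eB: "emeasure lborel (B \<inter> {b..}) = 2 * emeasure lborel B'"
      unfolding B'_def using emeasure_lborel_real_affine_vimage[of "B \<inter> {b..}" 2 "-a"] by simp
    have sub: "A' \<union> B' \<subseteq> C"
    proof
      fix x assume "x \<in> A' \<union> B'"
      then consider "-b + 2 * x \<in> A" | "-a + 2 * x \<in> B" by (auto simp: A'_def B'_def)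
      then show "x \<in> C"
      proof cases
        case 1 show ?thesis using mid[OF 1 b] by simp
      next
        case 2 show ?thesis using mid[OF a 2] by simp
      qed
    qed
    have "A' \<inter> B' \<subseteq> {(a + b) / 2}" by (auto simp: A'_def B'_def)
    then have "finite (A' \<inter> B')" by (rule finite_subset) auto
    then have null: "A' \<inter> B' \<in> null_sets lborel" by (rule finite_imp_null_set_lborel)
    have "emeasure lborel A' + emeasure lborel B' = emeasure lborel (A' \<union> B')"
      using null by (intro emeasure_Un'[symmetric]) auto
    also have "\<dots> \<le> emeasure lborel C" using sub by (intro emeasure_mono) auto
    finally show ?thesis unfolding eA eB distrib_left[symmetric] by (rule mult_left_mono) simp
  qed
  have "emeasure lborel A + emeasure lborel B \<le>
      (SUP a\<in>A. emeasure lborel (A \<inter> {..a})) + (SUP b\<in>B. emeasure lborel (B \<inter> {b..}))"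
    using ne by (intro add_mono emeasure_Int_atMost_approx emeasure_Int_atLeast_approx) auto
  also have "\<dots> = (SUP a\<in>A. emeasure lborel (A \<inter> {..a}) + (SUP b\<in>B. emeasure lborel (B \<inter> {b..})))"
    by (rule ennreal_SUP_add_left[OF ne(1), symmetric])
  also have "\<dots> = (SUP a\<in>A. SUP b\<in>B. emeasure lborel (A \<inter> {..a}) + emeasure lborel (B \<inter> {b..}))"
    using ne(2) by (intro SUP_cong refl ennreal_SUP_add_right) auto
  also have "\<dots> \<le> 2 * emeasure lborel C" using key by (intro SUP_least) auto
  finally show ?thesis .
qed

text \<open>The case of weight 1/2, squared so that no roots occur. Measure and midpoint are
  parameters, so that the line, the plane and finite products are all instances; values in
  \<open>ennreal\<close> avoid integrability conditions.\<close>

definition prekopa_leindler :: "'a measure \<Rightarrow> ('a \<Rightarrow> 'a \<Rightarrow> 'a) \<Rightarrow> bool" where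
  "prekopa_leindler M mid \<longleftrightarrow>
     (\<forall>f\<in>borel_measurable M. \<forall>g\<in>borel_measurable M. \<forall>h\<in>borel_measurable M.
        (\<forall>x\<in>space M. \<forall>y\<in>space M. f x * g y \<le> (h (mid x y) :: ennreal)\<^sup>2) \<longrightarrow>
        (\<integral>\<^sup>+x. f x \<partial>M) * (\<integral>\<^sup>+x. g x \<partial>M) \<le> (\<integral>\<^sup>+x. h x \<partial>M)\<^sup>2)"

lemma prekopa_leindlerD:
  assumes "prekopa_leindler M mid"
    and "f \<in> borel_measurable M" "g \<in> borel_measurable M" "h \<in> borel_measurable M"
    and "\<And>x y. x \<in> space M \<Longrightarrow> y \<in> space M \<Longrightarrow> f x * g y \<le> (h (mid x y) :: ennreal)\<^sup>2"
  shows "(\<integral>\<^sup>+x. f x \<partial>M) * (\<integral>\<^sup>+x. g x \<partial>M) \<le> (\<integral>\<^sup>+x. h x \<partial>M)\<^sup>2"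
  using assms unfolding prekopa_leindler_def by blast

lemma nn_integral_layer_cake:
  fixes f :: "real \<Rightarrow> real"
  assumes [measurable]: "f \<in> borel_measurable borel"
    and "\<And>x. 0 \<le> f x"
  shows "(\<integral>\<^sup>+x. ennreal (f x) \<partial>lborel) = (\<integral>\<^sup>+t. emeasure lborel {x. t < f x} * indicator {0<..} t \<partial>lborel)"
proof -
  have "(\<integral>\<^sup>+x. ennreal (f x) \<partial>lborel) = (\<integral>\<^sup>+x. (\<integral>\<^sup>+t. indicator {p. 0 < snd p \<and> snd p < f (fst p)} (x, t) \<partial>lborel) \<partial>lborel)"
  proof (intro nn_integral_cong)
    fix x
    have "(\<integral>\<^sup>+t. indicator {p. 0 < snd p \<and> snd p < f (fst p)} (x, t) \<partial>lborel) = (\<integral>\<^sup>+t. indicator {0<..<f x} t \<partial>lborel)"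
      by (intro nn_integral_cong) (auto split: split_indicator)
    also have "\<dots> = ennreal (f x)" using assms(2)[of x] by simp
    finally show "ennreal (f x) = (\<integral>\<^sup>+t. indicator {p. 0 < snd p \<and> snd p < f (fst p)} (x, t) \<partial>lborel)" ..
  qed
  also have "\<dots> = (\<integral>\<^sup>+t. (\<integral>\<^sup>+x. indicator {p. 0 < snd p \<and> snd p < f (fst p)} (x, t) \<partial>lborel) \<partial>lborel)"
    by (rule lborel_pair.Fubini'[symmetric]) measurable
  also have "\<dots> = (\<integral>\<^sup>+t. emeasure lborel {x. t < f x} * indicator {0<..} t \<partial>lborel)"
  proof (intro nn_integral_cong)
    fix t
    have "(\<integral>\<^sup>+x. indicator {p. 0 < snd p \<and> snd p < f (fst p)} (x, t) \<partial>lborel) =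
        (\<integral>\<^sup>+x. indicator {x. t < f x} x * indicator {0<..} t \<partial>lborel)"
      by (intro nn_integral_cong) (auto split: split_indicator)
    then show "(\<integral>\<^sup>+x. indicator {p. 0 < snd p \<and> snd p < f (fst p)} (x, t) \<partial>lborel) =
        emeasure lborel {x. t < f x} * indicator {0<..} t"
      by (simp add: nn_integral_multc)
  qed
  finally show ?thesis .
qed

lemma prekopa_leindler_real: "prekopa_leindler (lborel :: real measure) (\<lambda>x y. (x + y) / 2)"
proof -
  text \<open>Functions with supremum one: the level sets are then nonempty on the same range of heights.\<close>
  have norm1: "(\<integral>\<^sup>+x. ennreal (f x) \<partial>lborel) + (\<integral>\<^sup>+x. ennreal (g x) \<partial>lborel) \<le> 2 * (\<integral>\<^sup>+x. ennreal (h x) \<partial>lborel)"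
    if m[measurable]: "f \<in> borel_measurable borel" "g \<in> borel_measurable borel" "h \<in> borel_measurable borel"
      and nn: "\<And>x. 0 \<le> f x" "\<And>x. 0 \<le> g x" "\<And>x. 0 \<le> h x"
      and le1: "\<And>x. f x \<le> 1" "\<And>x. g x \<le> 1"
      and sup: "\<And>t. t < 1 \<Longrightarrow> \<exists>x. t < f x" "\<And>t. t < 1 \<Longrightarrow> \<exists>x. t < g x"
      and H: "\<And>x y. f x * g y \<le> (h ((x + y) / 2))\<^sup>2" for f g h :: "real \<Rightarrow> real"
  proof -
    have lev: "emeasure lborel {x. t < f x} * indicator {0<..} t + emeasure lborel {x. t < g x} * indicator {0<..} t
        \<le> 2 * (emeasure lborel {x. t < h x} * indicator {0<..} t)" for t
    proof (cases "0 < t \<and> t < 1")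
      case True
      have "emeasure lborel {x. t < f x} + emeasure lborel {x. t < g x} \<le> 2 * emeasure lborel {x. t < h x}"
      proof (rule brunn_minkowski_real)
        fix a b assume "a \<in> {x. t < f x}" "b \<in> {x. t < g x}"
        then have "t * t < f a * g b" using True by (intro mult_strict_mono) auto
        also have "\<dots> \<le> (h ((a + b) / 2))\<^sup>2" by (rule H)
        finally have "t\<^sup>2 < (h ((a + b) / 2))\<^sup>2" by (simp add: power2_eq_square)
        then show "(a + b) / 2 \<in> {x. t < h x}" using nn(3) power2_less_imp_less by blast
      qed (use sup[of t] True in auto)
      then show ?thesis using True by simp
    next
      case False
      then have "{x. t < f x} = {}" "{x. t < g x} = {}" if "0 < t"
        using le1 that by (auto simp: not_less) (meson le1 order_trans)+
      then show ?thesis by (cases "0 < t") auto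
    qed
    have "(\<integral>\<^sup>+x. ennreal (f x) \<partial>lborel) + (\<integral>\<^sup>+x. ennreal (g x) \<partial>lborel) =
       (\<integral>\<^sup>+t. emeasure lborel {x. t < f x} * indicator {0<..} t + emeasure lborel {x. t < g x} * indicator {0<..} t \<partial>lborel)"
      using nn by (subst nn_integral_add) (auto simp: nn_integral_layer_cake)
    also have "\<dots> \<le> (\<integral>\<^sup>+t. 2 * (emeasure lborel {x. t < h x} * indicator {0<..} t) \<partial>lborel)"
      by (intro nn_integral_mono lev)
    also have "\<dots> = 2 * (\<integral>\<^sup>+x. ennreal (h x) \<partial>lborel)"
      using nn by (subst nn_integral_cmult) (auto simp: nn_integral_layer_cake)
    finally show ?thesis .
  qed
  \<comment> \<open>Division by the suprema F and G reduces to \<open>norm1\<close>, and the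
    resulting bound on a sum yields the bound on a product because a + b <= 2 t implies a b <=
    t^2.\<close>
  have bounded: "(\<integral>\<^sup>+x. ennreal (f x) \<partial>lborel) * (\<integral>\<^sup>+x. ennreal (g x) \<partial>lborel) \<le> (\<integral>\<^sup>+x. h x \<partial>lborel)\<^sup>2"
    if m[measurable]: "f \<in> borel_measurable borel" "g \<in> borel_measurable borel" "h \<in> borel_measurable borel"
      and nn: "\<And>x. 0 \<le> f x" "\<And>x. 0 \<le> g x"
      and le: "\<And>x. f x \<le> c" "\<And>x. g x \<le> c"
      and H: "\<And>x y. ennreal (f x) * ennreal (g y) \<le> (h ((x + y) / 2))\<^sup>2"
    for f g :: "real \<Rightarrow> real" and h :: "real \<Rightarrow> ennreal" and c :: real
  proof (cases "(\<forall>x. f x = 0) \<or> (\<forall>x. g x = 0)")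
    case True then show ?thesis by auto
  next
    case False
    have bdd: "bdd_above (range f)" "bdd_above (range g)" using le by (auto intro!: bdd_aboveI[of _ c])
    define F where "F = (SUP x. f x)"
    define G where "G = (SUP x. g x)"
    have leF: "f x \<le> F" "g x \<le> G" for x unfolding F_def G_def by (auto intro!: cSUP_upper bdd)
    obtain x0 y0 where "f x0 \<noteq> 0" "g y0 \<noteq> 0" using False by auto
    then have "f x0 > 0" "g y0 > 0" using nn(1)[of x0] nn(2)[of y0] by auto
    then have pos: "F > 0" "G > 0" using leF(1)[of x0] leF(2)[of y0] by linarith+
    define s where "s = sqrt (F * G)"
    have s: "s > 0" "s\<^sup>2 = F * G" unfolding s_def using pos by auto
    \<comment> \<open>\<open>h\<close> may be infinite. Capping it at \<open>s\<close> makes it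
      real, and the hypothesis survives because the product of the scaled values of f and g is at
      most 1.\<close>
    define h' where "h' x = enn2real (min (h x) (ennreal s)) / s" for x
    have fin: "min (h x) (ennreal s) < \<top>" for x by (simp add: min_less_iff_disj)
    have h's: "ennreal (h' x) * ennreal s = min (h x) (ennreal s)" for x
      unfolding h'_def using s fin[of x] by (simp add: ennreal_mult'[symmetric])
    have h'nn: "0 \<le> h' x" for x unfolding h'_def using s by simp
    have "(\<integral>\<^sup>+x. ennreal (f x / F) \<partial>lborel) + (\<integral>\<^sup>+x. ennreal (g x / G) \<partial>lborel) \<le> 2 * (\<integral>\<^sup>+x. ennreal (h' x) \<partial>lborel)"
    proof (rule norm1)
      show "h' \<in> borel_measurable borel" unfolding h'_def by measurable
      show "0 \<le> h' x" for x by (rule h'nn)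
      show "\<exists>x. t < f x / F" if "t < 1" for t
      proof -
        have "t * F < F" using that pos by simp
        then have "\<exists>x\<in>UNIV. t * F < f x" unfolding F_def using less_cSUP_iff[OF UNIV_not_empty bdd(1)] by (auto simp: F_def)
        then show ?thesis using pos by (auto simp: field_simps)
      qed
      show "\<exists>x. t < g x / G" if "t < 1" for t
      proof -
        have "t * G < G" using that pos by simp
        then have "\<exists>x\<in>UNIV. t * G < g x" unfolding G_def using less_cSUP_iff[OF UNIV_not_empty bdd(2)] by (auto simp: G_def)
        then show ?thesis using pos by (auto simp: field_simps)
      qed
      show "f x / F * (g y / G) \<le> (h' ((x + y) / 2))\<^sup>2" for x y
      proof (cases "h ((x + y) / 2) \<le> ennreal s")
        case True
        then obtain r where r: "h ((x + y) / 2) = ennreal r" "0 \<le> r"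
          by (metis ennreal_cases ennreal_less_top neq_top_trans order_le_less top.not_eq_extremum)
        have "ennreal (f x * g y) \<le> ennreal (r\<^sup>2)" using H[of x y] nn r
          by (simp add: ennreal_mult' ennreal_power)
        then have "f x * g y \<le> r\<^sup>2" by (simp add: ennreal_le_iff)
        moreover have "h' ((x + y) / 2) = r / s" unfolding h'_def using r True by (simp add: min_absorb1)
        ultimately show ?thesis using s pos by (simp add: power_divide divide_right_mono)
      next
        case False
        then have "h' ((x + y) / 2) = 1" unfolding h'_def using s by (simp add: min_def)
        moreover have "f x / F * (g y / G) \<le> 1" using leF[of x] leF(2)[of y] pos nn
          by (intro mult_le_one) auto
        ultimately show ?thesis by simp
      qed
    qed (use pos nn leF in auto)
    then have ineq: "(\<integral>\<^sup>+x. ennreal (f x) / ennreal F \<partial>lborel) + (\<integral>\<^sup>+x. ennreal (g x) / ennreal G \<partial>lborel) \<le> 2 * (\<integral>\<^sup>+x. ennreal (h' x) \<partial>lborel)"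
      using pos nn by (simp add: divide_ennreal)
    define a b where "a = (\<integral>\<^sup>+x. ennreal (f x) / ennreal F \<partial>lborel)"
      and "b = (\<integral>\<^sup>+x. ennreal (g x) / ennreal G \<partial>lborel)"
    have fa: "(\<integral>\<^sup>+x. ennreal (f x) \<partial>lborel) = ennreal F * a"
      unfolding a_def using pos nn
      by (subst nn_integral_cmult[symmetric]) (auto simp: divide_ennreal ennreal_mult'[symmetric])
    have gb: "(\<integral>\<^sup>+x. ennreal (g x) \<partial>lborel) = ennreal G * b"
      unfolding b_def using pos nn
      by (subst nn_integral_cmult[symmetric]) (auto simp: divide_ennreal ennreal_mult'[symmetric])
    have [measurable]: "h' \<in> borel_measurable borel" unfolding h'_def by measurable
    have hh: "ennreal s * (\<integral>\<^sup>+x. ennreal (h' x) \<partial>lborel) \<le> (\<integral>\<^sup>+x. h x \<partial>lborel)"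
      by (subst nn_integral_cmult[symmetric], simp)
        (auto intro!: nn_integral_mono simp: mult.commute[of "ennreal s"] h's)
    have amgm: "a * b \<le> t\<^sup>2" if "a + b \<le> 2 * t" for a b t :: ennreal
    proof (cases t)
      case (real r)
      have "a + b < \<top>" by (rule le_less_trans[OF that]) (simp add: real ennreal_mult_less_top)
      then obtain a' b' where ab: "a = ennreal a'" "b = ennreal b'" "0 \<le> a'" "0 \<le> b'"
        by (cases a; cases b) auto
      have "ennreal (a' + b') \<le> ennreal (2 * r)" using that real ab by (simp add: ennreal_mult')
      then have "a' + b' \<le> 2 * r" using real by (simp add: ennreal_le_iff)
      then have "(a' + b')\<^sup>2 \<le> (2 * r)\<^sup>2" using ab by (intro power_mono) auto
      moreover have "0 \<le> (a' - b')\<^sup>2" by simp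
      ultimately have "a' * b' \<le> r\<^sup>2" by (simp add: power2_eq_square algebra_simps)
      then show ?thesis using real ab by (simp add: ennreal_mult'[symmetric] ennreal_power ennreal_leI)
    next
      case top then show ?thesis by (simp add: power2_eq_square)
    qed
    have "ennreal F * a * (ennreal G * b) = (ennreal s)\<^sup>2 * (a * b)"
      using pos s by (simp add: ennreal_power ennreal_mult ac_simps)
    also have "\<dots> \<le> (ennreal s)\<^sup>2 * (\<integral>\<^sup>+x. ennreal (h' x) \<partial>lborel)\<^sup>2"
      using ineq by (intro mult_left_mono amgm) (auto simp: a_def b_def)
    also have "\<dots> = (ennreal s * (\<integral>\<^sup>+x. ennreal (h' x) \<partial>lborel))\<^sup>2" by (simp add: power_mult_distrib)
    also have "\<dots> \<le> (\<integral>\<^sup>+x. h x \<partial>lborel)\<^sup>2" by (rule power_mono[OF hh]) simp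
    finally show ?thesis using fa gb by simp
  qed
  \<comment> \<open>Monotone convergence along truncations extends the bounded case to all
    functions.\<close>
  have trunc: "(\<integral>\<^sup>+x. f x \<partial>lborel) = (SUP n::nat. \<integral>\<^sup>+x. min (f x) (of_nat n) \<partial>lborel)"
    if [measurable]: "f \<in> borel_measurable borel" for f :: "real \<Rightarrow> ennreal"
  proof -
    have "f x = (SUP n::nat. min (f x) (of_nat n))" for x
    proof -
      have "(SUP n::nat. min (f x) (of_nat n)) = min (f x) (SUP n::nat. of_nat n)"
        by (simp add: inf_SUP flip: inf_min)
      then show ?thesis by (simp add: ennreal_SUP_of_nat_eq_top)
    qed
    then have "(\<integral>\<^sup>+x. f x \<partial>lborel) = (\<integral>\<^sup>+x. (SUP n::nat. min (f x) (of_nat n)) \<partial>lborel)" by simp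
    also have "\<dots> = (SUP n::nat. \<integral>\<^sup>+x. min (f x) (of_nat n) \<partial>lborel)"
      by (intro nn_integral_monotone_convergence_SUP)
        (auto simp: incseq_def le_fun_def min_le_iff_disj intro!: min.mono of_nat_mono)
    finally show ?thesis .
  qed
  show ?thesis unfolding prekopa_leindler_def
  proof (intro ballI impI)
    fix f g h :: "real \<Rightarrow> ennreal"
    assume "f \<in> borel_measurable lborel" "g \<in> borel_measurable lborel" "h \<in> borel_measurable lborel"
    then have m[measurable]: "f \<in> borel_measurable borel" "g \<in> borel_measurable borel" "h \<in> borel_measurable borel"
      by auto
    assume "\<forall>x\<in>space lborel. \<forall>y\<in>space lborel. f x * g y \<le> (h ((x + y) / 2))\<^sup>2"
    then have H: "f x * g y \<le> (h ((x + y) / 2))\<^sup>2" for x y by auto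
    have e2: "ennreal (enn2real (min t (of_nat n))) = min t (of_nat n)" for t :: ennreal and n :: nat
      by (rule ennreal_enn2real) (simp add: min_less_iff_disj of_nat_less_top)
    have "(\<integral>\<^sup>+x. min (f x) (of_nat n) \<partial>lborel) * (\<integral>\<^sup>+x. min (g x) (of_nat l) \<partial>lborel) \<le> (\<integral>\<^sup>+x. h x \<partial>lborel)\<^sup>2" for n l :: nat
    proof -
      have "(\<integral>\<^sup>+x. ennreal (enn2real (min (f x) (of_nat n))) \<partial>lborel) * (\<integral>\<^sup>+x. ennreal (enn2real (min (g x) (of_nat l))) \<partial>lborel) \<le> (\<integral>\<^sup>+x. h x \<partial>lborel)\<^sup>2"
      proof (rule bounded[where c = "real n + real l"])
        show "enn2real (min (f x) (of_nat n)) \<le> real n + real l" for x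
          by (rule enn2real_leI) (auto simp: min_le_iff_disj ennreal_of_nat_eq_real_of_nat intro!: ennreal_leI)
        show "enn2real (min (g x) (of_nat l)) \<le> real n + real l" for x
          by (rule enn2real_leI) (auto simp: min_le_iff_disj ennreal_of_nat_eq_real_of_nat intro!: ennreal_leI)
        show "ennreal (enn2real (min (f x) (of_nat n))) * ennreal (enn2real (min (g y) (of_nat l))) \<le> (h ((x + y) / 2))\<^sup>2" for x y
          unfolding e2 by (rule order_trans[OF mult_mono H]) auto
      qed auto
      then show ?thesis unfolding e2 .
    qed
    then have "(SUP n::nat. SUP l::nat. (\<integral>\<^sup>+x. min (f x) (of_nat n) \<partial>lborel) * (\<integral>\<^sup>+x. min (g x) (of_nat l) \<partial>lborel)) \<le> (\<integral>\<^sup>+x. h x \<partial>lborel)\<^sup>2"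
      by (intro SUP_least)
    then show "(\<integral>\<^sup>+x. f x \<partial>lborel) * (\<integral>\<^sup>+x. g x \<partial>lborel) \<le> (\<integral>\<^sup>+x. h x \<partial>lborel)\<^sup>2"
      unfolding trunc[OF m(1)] trunc[OF m(2)]
      by (simp only: SUP_mult_left_ennreal[symmetric] SUP_mult_right_ennreal[symmetric])
  qed
qed

section \<open>Prekopa-Leindler in the plane and in finite products\<close>

lemma borel_measurable_nn_integral_Complex:
  assumes [measurable]: "f \<in> borel_measurable borel"
  shows "(\<integral>\<^sup>+z. f z \<partial>lborel) = (\<integral>\<^sup>+y. \<integral>\<^sup>+x. f (Complex x y) \<partial>lborel \<partial>lborel)"
proof -
  have meq: "lborel = distr (lborel \<Otimes>\<^sub>M lborel) borel (\<lambda>(x, y). Complex x y)"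
  proof (rule lborel_eqI)
    fix l u :: complex
    assume le: "\<And>b. b \<in> Basis \<Longrightarrow> l \<bullet> b \<le> u \<bullet> b"
    have le': "Re l \<le> Re u" "Im l \<le> Im u" using le[of 1] le[of \<i>] by (auto simp: Basis_complex_def)
    have C[measurable]: "(\<lambda>(x, y). Complex x y) \<in> borel_measurable (lborel \<Otimes>\<^sub>M lborel)"
      by (subst Complex_eq) (auto simp: case_prod_beta)
    have "(\<lambda>(x, y). Complex x y) -` box l u \<inter> space (lborel \<Otimes>\<^sub>M lborel) = {Re l<..<Re u} \<times> {Im l<..<Im u}"
      by (auto simp: box_def Basis_complex_def space_pair_measure)
    then show "emeasure (distr (lborel \<Otimes>\<^sub>M lborel) borel (\<lambda>(x, y). Complex x y)) (box l u) = ennreal (\<Prod>b\<in>Basis. (u - l) \<bullet> b)"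
      using le' by (subst emeasure_distr[OF C]) (auto simp: lborel.emeasure_pair_measure_Times Basis_complex_def ennreal_mult')
  qed simp
  have [measurable]: "(\<lambda>(x, y). Complex x y) \<in> borel_measurable (lborel \<Otimes>\<^sub>M lborel)"
    by (subst Complex_eq) (auto simp: case_prod_beta)
  have "(\<integral>\<^sup>+z. f z \<partial>lborel) = (\<integral>\<^sup>+p. f (case p of (x, y) \<Rightarrow> Complex x y) \<partial>(lborel \<Otimes>\<^sub>M lborel))"
    by (subst meq) (auto simp: nn_integral_distr)
  also have "\<dots> = (\<integral>\<^sup>+y. \<integral>\<^sup>+x. f (Complex x y) \<partial>lborel \<partial>lborel)"
    by (subst lborel_pair.nn_integral_snd[symmetric]) auto
  finally show ?thesis .
qed

lemma prekopa_leindler_complex: "prekopa_leindler (lborel :: complex measure) (\<lambda>x y. (x + y) / 2)"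
  unfolding prekopa_leindler_def
proof (intro ballI impI)
  fix f g h :: "complex \<Rightarrow> ennreal"
  assume "f \<in> borel_measurable lborel" "g \<in> borel_measurable lborel" "h \<in> borel_measurable lborel"
  then have m[measurable]: "f \<in> borel_measurable borel" "g \<in> borel_measurable borel" "h \<in> borel_measurable borel"
    by auto
  assume "\<forall>x\<in>space lborel. \<forall>y\<in>space lborel. f x * g y \<le> (h ((x + y) / 2))\<^sup>2"
  then have H: "f x * g y \<le> (h ((x + y) / 2))\<^sup>2" for x y by auto
  have [measurable]: "(\<lambda>(x, y). Complex x y) \<in> borel_measurable (lborel \<Otimes>\<^sub>M lborel)"
    by (subst Complex_eq) (auto simp: case_prod_beta)
  have mid: "(Complex x y + Complex x' y') / 2 = Complex ((x + x') / 2) ((y + y') / 2)" for x y x' y'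
    by (simp add: complex_eq_iff)
  show "(\<integral>\<^sup>+z. f z \<partial>lborel) * (\<integral>\<^sup>+z. g z \<partial>lborel) \<le> (\<integral>\<^sup>+z. h z \<partial>lborel)\<^sup>2"
    unfolding borel_measurable_nn_integral_Complex[OF m(1)] borel_measurable_nn_integral_Complex[OF m(2)]
      borel_measurable_nn_integral_Complex[OF m(3)]
  proof (rule prekopa_leindlerD[OF prekopa_leindler_real])
    fix y y' :: real
    show "(\<integral>\<^sup>+x. f (Complex x y) \<partial>lborel) * (\<integral>\<^sup>+x. g (Complex x y') \<partial>lborel) \<le> (\<integral>\<^sup>+x. h (Complex x ((y + y') / 2)) \<partial>lborel)\<^sup>2"
    proof (rule prekopa_leindlerD[OF prekopa_leindler_real])
      fix x x' :: real
      show "f (Complex x y) * g (Complex x' y') \<le> (h (Complex ((x + x') / 2) ((y + y') / 2)))\<^sup>2"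
        using H[of "Complex x y" "Complex x' y'"] unfolding mid .
    qed (simp_all add: Complex_eq)
  qed (simp_all add: Complex_eq)
qed

text \<open>For fixed old coordinates the one-coordinate inequality says that the integrals over the
  new coordinate again satisfy the hypothesis, now as functions of the old coordinates; the
  induction hypothesis applies to them.\<close>

lemma prekopa_leindler_PiM:
  fixes M :: "'a measure"
  assumes PL: "prekopa_leindler M mid" and sf: "sigma_finite_measure M" and fin: "finite I"
  assumes midM: "\<And>x y. x \<in> space M \<Longrightarrow> y \<in> space M \<Longrightarrow> mid x y \<in> space M"
  shows "prekopa_leindler (Pi\<^sub>M I (\<lambda>_. M)) (\<lambda>x y. \<lambda>i\<in>I. mid (x i) (y i))"
  using fin
proof (induction I)
  case empty
  show ?case unfolding prekopa_leindler_def
    by (auto simp: space_PiM PiM_empty nn_integral_count_space_finite restrict_def)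
next
  case (insert i I)
  interpret product_sigma_finite "\<lambda>_. M" using sf by (simp add: product_sigma_finite_def)
  show ?case unfolding prekopa_leindler_def
  proof (intro ballI impI)
    let ?P = "Pi\<^sub>M (insert i I) (\<lambda>_. M)"
    fix f g h :: "_ \<Rightarrow> ennreal"
    assume m[measurable]: "f \<in> borel_measurable ?P" "g \<in> borel_measurable ?P" "h \<in> borel_measurable ?P"
    assume H: "\<forall>x\<in>space ?P. \<forall>y\<in>space ?P. f x * g y \<le> (h (\<lambda>i\<in>insert i I. mid (x i) (y i)))\<^sup>2"
    have upd: "(\<lambda>j\<in>insert i I. mid ((x(i := y)) j) ((x'(i := y')) j)) = (\<lambda>j\<in>I. mid (x j) (x' j))(i := mid y y')" for x x' y y'
      using insert.hyps by (auto simp: fun_eq_iff)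
    have sp: "x(i := y) \<in> space ?P" if "x \<in> space (Pi\<^sub>M I (\<lambda>_. M))" "y \<in> space M" for x y
      using that by (auto simp: space_PiM PiE_def extensional_def)
    have sp': "(\<lambda>j\<in>I. mid (x j) (x' j)) \<in> space (Pi\<^sub>M I (\<lambda>_. M))"
      if "x \<in> space (Pi\<^sub>M I (\<lambda>_. M))" "x' \<in> space (Pi\<^sub>M I (\<lambda>_. M))" for x x'
      using that midM by (auto simp: space_PiM PiE_def Pi_def)
    have mu: "(\<lambda>y. f' (x(i := y))) \<in> borel_measurable M"
      if "x \<in> space (Pi\<^sub>M I (\<lambda>_. M))" "f' \<in> borel_measurable ?P" for f' :: "_ \<Rightarrow> ennreal" and x
      using measurable_comp[OF measurable_component_update that(2), OF that(1) insert.hyps(2)]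
      unfolding comp_def .
    show "(\<integral>\<^sup>+x. f x \<partial>?P) * (\<integral>\<^sup>+x. g x \<partial>?P) \<le> (\<integral>\<^sup>+x. h x \<partial>?P)\<^sup>2"
      unfolding product_nn_integral_insert[OF insert.hyps m(1)] product_nn_integral_insert[OF insert.hyps m(2)]
        product_nn_integral_insert[OF insert.hyps m(3)]
    proof (rule prekopa_leindlerD[OF insert.IH])
      fix x x' assume x: "x \<in> space (Pi\<^sub>M I (\<lambda>_. M))" "x' \<in> space (Pi\<^sub>M I (\<lambda>_. M))"
      show "(\<integral>\<^sup>+y. f (x(i := y)) \<partial>M) * (\<integral>\<^sup>+y. g (x'(i := y)) \<partial>M) \<le> (\<integral>\<^sup>+y. h ((\<lambda>j\<in>I. mid (x j) (x' j))(i := y)) \<partial>M)\<^sup>2"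
      proof (rule prekopa_leindlerD[OF PL])
        fix y y' assume y: "y \<in> space M" "y' \<in> space M"
        show "f (x(i := y)) * g (x'(i := y')) \<le> (h ((\<lambda>j\<in>I. mid (x j) (x' j))(i := mid y y')))\<^sup>2"
          using H[rule_format, OF sp[OF x(1) y(1)] sp[OF x(2) y(2)]] unfolding upd .
      qed (intro mu m x sp')+
    qed measurable
  qed
qed

section \<open>Gaussian vectors\<close>

text \<open>Independent standard complex Gaussians: real and imaginary parts have variance 1/2, so
  each coordinate has mean square modulus 1.\<close>

definition gauss :: "nat \<Rightarrow> (nat \<Rightarrow> complex) measure" where
  "gauss N = density (Pi\<^sub>M {..<N} (\<lambda>_. lborel)) (\<lambda>x. ennreal (exp (- (cvec_norm N x)\<^sup>2) / pi ^ N))"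

text \<open>Bilinear rather than sesquilinear: with the values of the basis as second argument it is
  the value of the form with coefficients x.\<close>

definition cvec_inner :: "nat \<Rightarrow> (nat \<Rightarrow> complex) \<Rightarrow> (nat \<Rightarrow> complex) \<Rightarrow> complex" where
  "cvec_inner N x v = (\<Sum>j<N. x j * v j)"

text \<open>A one-sided inequality suffices because x and y may be exchanged. It ranges over all
  functions on the natural numbers, so F cannot depend on coordinates from N on.\<close>

definition gauss_lipschitz :: "nat \<Rightarrow> real \<Rightarrow> ((nat \<Rightarrow> complex) \<Rightarrow> real) \<Rightarrow> bool" where
  "gauss_lipschitz N L F \<longleftrightarrow> F \<in> borel_measurable (Pi\<^sub>M {..<N} (\<lambda>_. borel)) \<and> 0 \<le> L \<and>
     (\<forall>x y. F x - F y \<le> L * cvec_norm N (\<lambda>j. x j - y j))"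

lemma cvec_norm_nonneg [simp]: "0 \<le> cvec_norm N x"
  unfolding cvec_norm_def by (simp add: sum_nonneg)

lemma cvec_norm_sq: "(cvec_norm N x)\<^sup>2 = (\<Sum>j<N. (cmod (x j))\<^sup>2)"
  unfolding cvec_norm_def by (simp add: sum_nonneg)

lemma cvec_norm_eq_L2: "cvec_norm N x = L2_set (\<lambda>j. cmod (x j)) {..<N}"
  unfolding cvec_norm_def L2_set_def ..

lemma cmod_cvec_inner_le: "cmod (cvec_inner N x v) \<le> cvec_norm N x * cvec_norm N v"
proof -
  have "cmod (cvec_inner N x v) \<le> (\<Sum>j<N. \<bar>cmod (x j)\<bar> * \<bar>cmod (v j)\<bar>)"
    unfolding cvec_inner_def by (rule order_trans[OF norm_sum]) (simp add: norm_mult)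
  also have "\<dots> \<le> cvec_norm N x * cvec_norm N v"
    unfolding cvec_norm_eq_L2 by (rule L2_set_mult_ineq)
  finally show ?thesis .
qed

lemma cvec_norm_triangle: "cvec_norm N (\<lambda>j. x j + y j) \<le> cvec_norm N x + cvec_norm N y"
proof -
  have "cvec_norm N (\<lambda>j. x j + y j) \<le> L2_set (\<lambda>j. cmod (x j) + cmod (y j)) {..<N}"
    unfolding cvec_norm_eq_L2 by (intro L2_set_mono norm_triangle_ineq) auto
  also have "\<dots> \<le> cvec_norm N x + cvec_norm N y"
    unfolding cvec_norm_eq_L2 by (rule L2_set_triangle_ineq)
  finally show ?thesis .
qed

lemma cvec_norm_scale: "cvec_norm N (\<lambda>j. c * x j) = cmod c * cvec_norm N x"
  unfolding cvec_norm_eq_L2 by (simp add: norm_mult L2_set_right_distrib)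

lemma sets_PiM_lborel: "sets (Pi\<^sub>M {..<N} (\<lambda>_. lborel :: complex measure)) = sets (Pi\<^sub>M {..<N} (\<lambda>_. borel :: complex measure))"
  by (intro sets_PiM_cong) auto

lemma sets_gauss [measurable_cong]: "sets (gauss N) = sets (Pi\<^sub>M {..<N} (\<lambda>_. borel))"
  unfolding gauss_def by (simp add: sets_PiM_lborel)

lemma space_gauss: "space (gauss N) = {..<N} \<rightarrow>\<^sub>E UNIV"
  unfolding gauss_def by (simp add: space_PiM)

lemma measurable_lborel_PiM: "borel_measurable (Pi\<^sub>M {..<N} (\<lambda>_. lborel :: complex measure)) = borel_measurable (Pi\<^sub>M {..<N} (\<lambda>_. borel :: complex measure))"
  by (rule measurable_cong_sets) (auto simp: sets_PiM_lborel)

lemma cvec_norm_measurable [measurable]: "cvec_norm N \<in> borel_measurable (Pi\<^sub>M {..<N} (\<lambda>_. borel))"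
  unfolding cvec_norm_def by measurable

lemma cvec_inner_measurable [measurable]: "(\<lambda>x. cvec_inner N x v) \<in> borel_measurable (Pi\<^sub>M {..<N} (\<lambda>_. borel))"
  unfolding cvec_inner_def by measurable

lemma nn_integral_gauss:
  assumes [measurable]: "f \<in> borel_measurable (Pi\<^sub>M {..<N} (\<lambda>_. borel))"
  shows "(\<integral>\<^sup>+x. f x \<partial>gauss N) =
    (\<integral>\<^sup>+x. ennreal (exp (- (cvec_norm N x)\<^sup>2) / pi ^ N) * f x \<partial>Pi\<^sub>M {..<N} (\<lambda>_. lborel))"
  unfolding gauss_def
  by (rule nn_integral_density) (use assms in \<open>simp_all add: measurable_lborel_PiM\<close>)

lemma nn_integral_gaussian_real:
  "(\<integral>\<^sup>+x. ennreal (exp (a * x - x\<^sup>2)) \<partial>lborel) = ennreal (sqrt pi * exp (a\<^sup>2 / 4))"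
proof -
  have "(\<integral>\<^sup>+x. ennreal (exp (a * x - x\<^sup>2)) \<partial>lborel) =
     (\<integral>\<^sup>+x. ennreal (sqrt pi * exp (a\<^sup>2 / 4)) * ennreal (normal_density (a / 2) (1 / sqrt 2) x) \<partial>lborel)"
  proof (intro nn_integral_cong)
    fix x
    have "exp (a * x - x\<^sup>2) = sqrt pi * exp (a\<^sup>2 / 4) * normal_density (a / 2) (1 / sqrt 2) x"
      unfolding normal_density_def
      by (simp add: power_divide exp_add[symmetric] field_simps power2_eq_square real_sqrt_mult)
    then show "ennreal (exp (a * x - x\<^sup>2)) = ennreal (sqrt pi * exp (a\<^sup>2 / 4)) * ennreal (normal_density (a / 2) (1 / sqrt 2) x)"
      by (simp add: ennreal_mult)
  qed
  also have "\<dots> = ennreal (sqrt pi * exp (a\<^sup>2 / 4))"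
    by (subst nn_integral_cmult) (auto simp: nn_integral_eq_integral)
  finally show ?thesis .
qed

lemma nn_integral_gaussian_complex:
  "(\<integral>\<^sup>+z. ennreal (exp (Re (z * v) - (cmod z)\<^sup>2)) \<partial>lborel) = ennreal (pi * exp ((cmod v)\<^sup>2 / 4))"
proof -
  have "(\<integral>\<^sup>+z. ennreal (exp (Re (z * v) - (cmod z)\<^sup>2)) \<partial>lborel) =
      (\<integral>\<^sup>+y. \<integral>\<^sup>+x. ennreal (exp (Re v * x - x\<^sup>2)) * ennreal (exp ((- Im v) * y - y\<^sup>2)) \<partial>lborel \<partial>lborel)"
    by (subst borel_measurable_nn_integral_Complex)
      (auto intro!: nn_integral_cong simp: ennreal_mult[symmetric] exp_add[symmetric] cmod_power2 algebra_simps)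
  also have "\<dots> = ennreal (sqrt pi * exp ((Re v)\<^sup>2 / 4)) * ennreal (sqrt pi * exp ((- Im v)\<^sup>2 / 4))"
    by (simp add: nn_integral_multc nn_integral_cmult nn_integral_gaussian_real nn_integral_gaussian_real[of "- Im v", simplified])
  also have "\<dots> = ennreal (pi * exp ((cmod v)\<^sup>2 / 4))"
    by (simp add: ennreal_mult[symmetric] cmod_power2 add_divide_distrib exp_add)
  finally show ?thesis .
qed

lemma nn_integral_gauss_exp_inner:
  "(\<integral>\<^sup>+x. ennreal (exp (Re (cvec_inner N x v))) \<partial>gauss N) = ennreal (exp ((cvec_norm N v)\<^sup>2 / 4))"
proof -
  interpret product_sigma_finite "\<lambda>_::nat. lborel :: complex measure" by standard
  have "(\<integral>\<^sup>+x. ennreal (exp (Re (cvec_inner N x v))) \<partial>gauss N) =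
     (\<integral>\<^sup>+x. (\<Prod>j<N. ennreal (exp (Re (x j * v j) - (cmod (x j))\<^sup>2) / pi)) \<partial>Pi\<^sub>M {..<N} (\<lambda>_. lborel))"
  proof (subst nn_integral_gauss, simp, intro nn_integral_cong)
    fix x :: "nat \<Rightarrow> complex"
    have "(\<Prod>j<N. exp (Re (x j * v j) - (cmod (x j))\<^sup>2) / pi) = exp (\<Sum>j<N. Re (x j * v j) - (cmod (x j))\<^sup>2) / pi ^ N"
      by (simp only: prod_dividef exp_sum finite_lessThan prod_constant card_lessThan)
    also have "\<dots> = exp (- (cvec_norm N x)\<^sup>2) / pi ^ N * exp (Re (cvec_inner N x v))"
      by (simp only: sum_subtractf cvec_norm_sq cvec_inner_def Re_sum times_divide_eq_left exp_add[symmetric] uminus_add_conv_diff)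
    finally show "ennreal (exp (- (cvec_norm N x)\<^sup>2) / pi ^ N) * ennreal (exp (Re (cvec_inner N x v))) =
        (\<Prod>j<N. ennreal (exp (Re (x j * v j) - (cmod (x j))\<^sup>2) / pi))"
      by (simp add: prod_ennreal ennreal_mult[symmetric])
  qed
  also have "\<dots> = (\<Prod>j<N. \<integral>\<^sup>+z. ennreal (exp (Re (z * v j) - (cmod z)\<^sup>2) / pi) \<partial>lborel)"
    by (rule product_nn_integral_prod) auto
  also have "\<dots> = (\<Prod>j<N. ennreal (exp ((cmod (v j))\<^sup>2 / 4)))"
  proof (intro prod.cong refl)
    fix j
    have "(\<integral>\<^sup>+z. ennreal (exp (Re (z * v j) - (cmod z)\<^sup>2) / pi) \<partial>lborel) =
       (\<integral>\<^sup>+z. ennreal (exp (Re (z * v j) - (cmod z)\<^sup>2)) * ennreal (1 / pi) \<partial>lborel)"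
      by (intro nn_integral_cong) (simp add: ennreal_mult[symmetric])
    also have "\<dots> = ennreal (pi * exp ((cmod (v j))\<^sup>2 / 4)) * ennreal (1 / pi)"
      by (subst nn_integral_multc) (simp_all add: nn_integral_gaussian_complex del: times_complex.sel)
    also have "\<dots> = ennreal (exp ((cmod (v j))\<^sup>2 / 4))" by (simp add: ennreal_mult[symmetric])
    finally show "(\<integral>\<^sup>+z. ennreal (exp (Re (z * v j) - (cmod z)\<^sup>2) / pi) \<partial>lborel) = ennreal (exp ((cmod (v j))\<^sup>2 / 4))" .
  qed
  also have "\<dots> = ennreal (exp ((cvec_norm N v)\<^sup>2 / 4))"
    by (simp add: prod_ennreal cvec_norm_sq exp_sum sum_divide_distrib)
  finally show ?thesis .
qed

lemma prob_space_gauss: "prob_space (gauss N)"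
proof
  have "emeasure (gauss N) (space (gauss N)) = (\<integral>\<^sup>+x. ennreal (exp (Re (cvec_inner N x (\<lambda>_. 0)))) \<partial>gauss N)"
    by (simp add: cvec_inner_def)
  also have "\<dots> = 1" by (subst nn_integral_gauss_exp_inner) (simp add: cvec_norm_def)
  finally show "emeasure (gauss N) (space (gauss N)) = 1" .
qed

section \<open>Concentration of Lipschitz functions of a Gaussian vector\<close>

lemma gauss_lipschitz_exp_exp:
  assumes F: "gauss_lipschitz N L F"
  shows "(\<integral>\<^sup>+x. ennreal (exp (F x)) \<partial>gauss N) * (\<integral>\<^sup>+x. ennreal (exp (- F x)) \<partial>gauss N) \<le> ennreal (exp (L\<^sup>2 / 2))"
proof -
  let ?P = "Pi\<^sub>M {..<N} (\<lambda>_. lborel :: complex measure)"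
  have Fm[measurable]: "F \<in> borel_measurable (Pi\<^sub>M {..<N} (\<lambda>_. borel))" using F by (simp add: gauss_lipschitz_def)
  have FL: "F x - F y \<le> L * cvec_norm N (\<lambda>j. x j - y j)" for x y using F by (simp add: gauss_lipschitz_def)
  define dens where "dens x = exp (- (cvec_norm N x)\<^sup>2) / pi ^ N" for x
  have dens_pos: "0 < dens x" for x unfolding dens_def by simp
  have [measurable]: "dens \<in> borel_measurable (Pi\<^sub>M {..<N} (\<lambda>_. borel))" unfolding dens_def by measurable
  have PL: "prekopa_leindler ?P (\<lambda>x y. \<lambda>i\<in>{..<N}. (x i + y i) / 2)"
    by (rule prekopa_leindler_PiM[OF prekopa_leindler_complex]) (auto intro: sigma_finite_lborel)
  \<comment> \<open>Maurey's argument: the three functions are the density times exp (F - L^2/2),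
    the density times exp (- F), and the density. By the parallelogram law the densities at x and y
    multiply to exp (- d^2/2) times the squared density at the midpoint, and this factor pays for F
    x - F y <= L d <= L^2/2 + d^2/2.\<close>
  have "(\<integral>\<^sup>+x. ennreal (dens x * exp (F x - L\<^sup>2 / 2)) \<partial>?P) * (\<integral>\<^sup>+x. ennreal (dens x * exp (- F x)) \<partial>?P) \<le> (\<integral>\<^sup>+x. ennreal (dens x) \<partial>?P)\<^sup>2"
  proof (rule prekopa_leindlerD[OF PL])
    fix x y :: "nat \<Rightarrow> complex"
    define m where "m = (\<lambda>i\<in>{..<N}. (x i + y i) / 2)"
    define d where "d = cvec_norm N (\<lambda>j. x j - y j)"
    have par: "(cmod a)\<^sup>2 + (cmod b)\<^sup>2 = 2 * (cmod ((a + b) / 2))\<^sup>2 + (cmod (a - b))\<^sup>2 / 2" for a b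
    proof -
      have "(cmod ((a + b) / 2))\<^sup>2 = (cmod (a + b))\<^sup>2 / 4" by (simp add: norm_divide power_divide)
      moreover have "(cmod (a + b))\<^sup>2 + (cmod (a - b))\<^sup>2 = 2 * (cmod a)\<^sup>2 + 2 * (cmod b)\<^sup>2"
        unfolding cmod_power2 by (simp add: power2_eq_square algebra_simps)
      ultimately show ?thesis by simp
    qed
    have "(cvec_norm N x)\<^sup>2 + (cvec_norm N y)\<^sup>2 = 2 * (cvec_norm N m)\<^sup>2 + d\<^sup>2 / 2"
      unfolding cvec_norm_sq d_def m_def
      by (simp add: sum.distrib[symmetric] par sum_distrib_left sum_divide_distrib)
    moreover have "F x - F y - L\<^sup>2 / 2 \<le> d\<^sup>2 / 2"
    proof -
      have "0 \<le> (L - d)\<^sup>2" by simp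
      then show ?thesis using FL[of x y] unfolding d_def[symmetric] by (simp add: power2_eq_square field_simps)
    qed
    ultimately have e: "- (cvec_norm N x)\<^sup>2 + (F x - L\<^sup>2 / 2) + (- (cvec_norm N y)\<^sup>2 + - F y) \<le> - (cvec_norm N m)\<^sup>2 + - (cvec_norm N m)\<^sup>2"
      by linarith
    have "dens x * exp (F x - L\<^sup>2 / 2) * (dens y * exp (- F y)) =
        exp (- (cvec_norm N x)\<^sup>2 + (F x - L\<^sup>2 / 2) + (- (cvec_norm N y)\<^sup>2 + - F y)) / (pi ^ N * pi ^ N)"
      unfolding dens_def exp_add by simp
    also have "\<dots> \<le> exp (- (cvec_norm N m)\<^sup>2 + - (cvec_norm N m)\<^sup>2) / (pi ^ N * pi ^ N)"
      using e by (intro divide_right_mono) auto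
    also have "\<dots> = (dens m)\<^sup>2"
      unfolding dens_def exp_add by (simp add: power2_eq_square)
    finally show "ennreal (dens x * exp (F x - L\<^sup>2 / 2)) * ennreal (dens y * exp (- F y)) \<le> (ennreal (dens (\<lambda>i\<in>{..<N}. (x i + y i) / 2)))\<^sup>2"
      unfolding m_def using dens_pos by (simp add: ennreal_mult[symmetric] ennreal_power less_imp_le ennreal_leI)
  qed (simp_all add: measurable_lborel_PiM)
  also have "(\<integral>\<^sup>+x. ennreal (dens x) \<partial>?P) = (\<integral>\<^sup>+x. 1 \<partial>gauss N)"
    by (subst nn_integral_gauss) (auto simp: dens_def)
  also have "\<dots> = 1" using prob_space.emeasure_space_1[OF prob_space_gauss] by simp
  also have "(\<integral>\<^sup>+x. ennreal (dens x * exp (F x - L\<^sup>2 / 2)) \<partial>?P) = (\<integral>\<^sup>+x. ennreal (exp (F x - L\<^sup>2 / 2)) \<partial>gauss N)"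
    by (subst nn_integral_gauss) (auto simp: dens_def ennreal_mult[symmetric] intro!: nn_integral_cong)
  also have "\<dots> = (\<integral>\<^sup>+x. ennreal (exp (F x)) * ennreal (exp (- L\<^sup>2 / 2)) \<partial>gauss N)"
    by (intro nn_integral_cong) (simp add: ennreal_mult[symmetric] exp_add[symmetric])
  also have "\<dots> = (\<integral>\<^sup>+x. ennreal (exp (F x)) \<partial>gauss N) * ennreal (exp (- L\<^sup>2 / 2))"
    by (rule nn_integral_multc) simp
  also have "(\<integral>\<^sup>+x. ennreal (dens x * exp (- F x)) \<partial>?P) = (\<integral>\<^sup>+x. ennreal (exp (- F x)) \<partial>gauss N)"
    by (subst nn_integral_gauss) (auto simp: dens_def ennreal_mult[symmetric] intro!: nn_integral_cong)
  finally have *: "(\<integral>\<^sup>+x. ennreal (exp (F x)) \<partial>gauss N) * ennreal (exp (- L\<^sup>2 / 2)) * (\<integral>\<^sup>+x. ennreal (exp (- F x)) \<partial>gauss N) \<le> 1"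
    by simp
  have "(\<integral>\<^sup>+x. ennreal (exp (F x)) \<partial>gauss N) * (\<integral>\<^sup>+x. ennreal (exp (- F x)) \<partial>gauss N) =
     ennreal (exp (L\<^sup>2 / 2)) * ((\<integral>\<^sup>+x. ennreal (exp (F x)) \<partial>gauss N) * ennreal (exp (- L\<^sup>2 / 2)) * (\<integral>\<^sup>+x. ennreal (exp (- F x)) \<partial>gauss N))"
  proof -
    have "ennreal (exp (L\<^sup>2 / 2)) * ennreal (exp (- L\<^sup>2 / 2)) = 1"
      by (simp add: ennreal_mult[symmetric] exp_add[symmetric])
    then have "(\<integral>\<^sup>+x. ennreal (exp (F x)) \<partial>gauss N) * (\<integral>\<^sup>+x. ennreal (exp (- F x)) \<partial>gauss N) =
        (ennreal (exp (L\<^sup>2 / 2)) * ennreal (exp (- L\<^sup>2 / 2))) *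
        ((\<integral>\<^sup>+x. ennreal (exp (F x)) \<partial>gauss N) * (\<integral>\<^sup>+x. ennreal (exp (- F x)) \<partial>gauss N))"
      by simp
    then show ?thesis by (simp only: mult_ac)
  qed
  also have "\<dots> \<le> ennreal (exp (L\<^sup>2 / 2)) * 1" by (rule mult_left_mono[OF *]) simp
  finally show ?thesis by simp
qed

lemma gauss_lipschitz_scale:
  assumes "gauss_lipschitz N L F"
  shows "gauss_lipschitz N (\<bar>c\<bar> * L) (\<lambda>x. c * F x)"
proof -
  have FL: "F x - F y \<le> L * cvec_norm N (\<lambda>j. x j - y j)" for x y using assms by (simp add: gauss_lipschitz_def)
  have sym: "cvec_norm N (\<lambda>j. y j - x j) = cvec_norm N (\<lambda>j. x j - y j)" for x y
    unfolding cvec_norm_def by (simp add: norm_minus_commute)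
  have "\<bar>F x - F y\<bar> \<le> L * cvec_norm N (\<lambda>j. x j - y j)" for x y
    using FL[of x y] FL[of y x] sym[of x y] by (simp add: abs_le_iff)
  then have "\<bar>c\<bar> * \<bar>F x - F y\<bar> \<le> \<bar>c\<bar> * (L * cvec_norm N (\<lambda>j. x j - y j))" for x y
    by (rule mult_left_mono) simp
  then have "\<bar>c * F x - c * F y\<bar> \<le> \<bar>c\<bar> * L * cvec_norm N (\<lambda>j. x j - y j)" for x y
    by (simp add: abs_mult[symmetric] right_diff_distrib mult.assoc)
  then show ?thesis using assms unfolding gauss_lipschitz_def by (auto simp: abs_le_iff intro: abs_le_D1)
qed

context
  fixes N :: nat and L :: real and F :: "(nat \<Rightarrow> complex) \<Rightarrow> real"
  assumes F: "gauss_lipschitz N L F"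
begin

interpretation G: prob_space "gauss N" by (rule prob_space_gauss)

lemma gauss_lipschitz_measurable [measurable]: "F \<in> borel_measurable (gauss N)"
  using F unfolding gauss_lipschitz_def by (simp cong: measurable_cong_sets add: sets_gauss)

text \<open>Integrability comes out of \<open>gauss_lipschitz_exp_exp\<close>: the product there is
  finite and its second factor is not 0.\<close>

lemma gauss_lipschitz_integrable_exp: "integrable (gauss N) (\<lambda>x. exp (c * F x))"
proof (rule integrableI_nonneg)
  have S: "gauss_lipschitz N (\<bar>c\<bar> * L) (\<lambda>x. c * F x)" by (rule gauss_lipschitz_scale[OF F])
  let ?I = "\<integral>\<^sup>+x. ennreal (exp (- (c * F x))) \<partial>gauss N"
  have "?I \<noteq> 0"
    by (subst nn_integral_0_iff_AE) (auto simp: G.AE_False)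
  moreover have "(\<integral>\<^sup>+x. ennreal (exp (c * F x)) \<partial>gauss N) * ?I < \<top>"
    by (rule le_less_trans[OF gauss_lipschitz_exp_exp[OF S]]) simp
  ultimately show "(\<integral>\<^sup>+x. ennreal (exp (c * F x)) \<partial>gauss N) < \<infinity>"
    by (auto simp: ennreal_mult_less_top)
qed auto

lemma gauss_lipschitz_integrable: "integrable (gauss N) F"
proof (rule Bochner_Integration.integrable_bound)
  show "integrable (gauss N) (\<lambda>x. exp (1 * F x) + exp ((-1) * F x))"
    by (intro Bochner_Integration.integrable_add gauss_lipschitz_integrable_exp)
  have "\<bar>t\<bar> \<le> exp t + exp (- t)" for t :: real
    using exp_ge_add_one_self[of t] exp_ge_add_one_self[of "- t"] exp_gt_zero[of t] exp_gt_zero[of "-t"] by linarith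
  then show "AE x in gauss N. norm (F x) \<le> norm (exp (1 * F x) + exp ((-1) * F x))" by auto
qed simp

text \<open>The tangent line of exp gives the Jensen bound E exp (- c F) >= exp (- c m), which
  replaces the second factor in \<open>gauss_lipschitz_exp_exp\<close>.\<close>

lemma gauss_lipschitz_mgf:
  "(LINT x|gauss N. exp (c * (F x - (LINT x|gauss N. F x)))) \<le> exp (c\<^sup>2 * L\<^sup>2 / 2)"
proof -
  have S: "gauss_lipschitz N (\<bar>c\<bar> * L) (\<lambda>x. c * F x)" by (rule gauss_lipschitz_scale[OF F])
  define m where "m = (LINT x|gauss N. F x)"
  have i1: "integrable (gauss N) (\<lambda>x. exp (c * F x))" by (rule gauss_lipschitz_integrable_exp)
  have i2: "integrable (gauss N) (\<lambda>x. exp (- (c * F x)))" using gauss_lipschitz_integrable_exp[of "-c"] by simp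
  define A where "A = (LINT x|gauss N. exp (c * F x))"
  define B where "B = (LINT x|gauss N. exp (- (c * F x)))"
  have "ennreal A * ennreal B \<le> ennreal (exp ((\<bar>c\<bar> * L)\<^sup>2 / 2))"
    using gauss_lipschitz_exp_exp[OF S] i1 i2 unfolding A_def B_def by (simp add: nn_integral_eq_integral)
  moreover have "0 \<le> A" "0 \<le> B" unfolding A_def B_def by auto
  ultimately have AB: "A * B \<le> exp (c\<^sup>2 * L\<^sup>2 / 2)" by (simp add: ennreal_mult[symmetric] power_mult_distrib)
  have "exp (- (c * m)) * (1 + c * m - c * m) \<le> B"
  proof -
    have "(LINT x|gauss N. exp (- (c * m)) * (1 + c * m - c * F x)) \<le> B" unfolding B_def
    proof (rule integral_mono)
      show "integrable (gauss N) (\<lambda>x. exp (- (c * m)) * (1 + c * m - c * F x))"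
        using gauss_lipschitz_integrable by simp
      fix x
      have "1 + (c * m - c * F x) \<le> exp (c * m - c * F x)" by (rule exp_ge_add_one_self)
      then have "exp (- (c * m)) * (1 + (c * m - c * F x)) \<le> exp (- (c * m)) * exp (c * m - c * F x)"
        by (rule mult_left_mono) simp
      then show "exp (- (c * m)) * (1 + c * m - c * F x) \<le> exp (- (c * F x))"
        by (simp add: exp_add[symmetric] add_diff_eq)
    qed (rule i2)
    moreover have "(LINT x|gauss N. exp (- (c * m)) * (1 + c * m - c * F x)) = exp (- (c * m)) * (1 + c * m - c * m)"
      using gauss_lipschitz_integrable by (simp add: m_def G.prob_space)
    ultimately show ?thesis by simp
  qed
  then have "exp (- (c * m)) \<le> B" by simp
  then have "A * exp (- (c * m)) \<le> exp (c\<^sup>2 * L\<^sup>2 / 2)"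
    using AB \<open>0 \<le> A\<close> by (meson mult_left_mono order_trans)
  moreover have "(LINT x|gauss N. exp (c * (F x - m))) = A * exp (- (c * m))"
    unfolding A_def by (subst integral_mult_left_zero[symmetric]) (simp add: exp_add[symmetric] algebra_simps)
  ultimately show ?thesis unfolding m_def by simp
qed

lemma gauss_lipschitz_integrable_exp_centered: "integrable (gauss N) (\<lambda>x. exp (c * (F x - m)))"
proof -
  have "(\<lambda>x. exp (c * (F x - m))) = (\<lambda>x. exp (c * F x) * exp (- (c * m)))"
    by (simp add: exp_add[symmetric] right_diff_distrib)
  then show ?thesis using gauss_lipschitz_integrable_exp[of c] by simp
qed

lemma gauss_lipschitz_tail:
  assumes "L > 0" "t \<ge> 0"
  shows "measure (gauss N) {x \<in> space (gauss N). t \<le> \<bar>F x - (LINT x|gauss N. F x)\<bar>} \<le> 2 * exp (- t\<^sup>2 / (2 * L\<^sup>2))"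
proof -
  define m where "m = (LINT x|gauss N. F x)"
  have one: "measure (gauss N) {x \<in> space (gauss N). t \<le> s * (F x - m)} \<le> exp (- t\<^sup>2 / (2 * L\<^sup>2))"
    if s: "s = 1 \<or> s = -1" for s
  proof -
    \<comment> \<open>Minimises c^2 L^2 / 2 - c t.\<close>
    define c where "c = t / L\<^sup>2"
    have c: "c \<ge> 0" unfolding c_def using assms by simp
    have s2: "s\<^sup>2 = 1" using s by auto
    have "measure (gauss N) {x \<in> space (gauss N). t \<le> s * (F x - m)} \<le>
       measure (gauss N) {x \<in> space (gauss N). exp (c * t) \<le> exp ((c * s) * (F x - m))}"
      using c by (intro G.finite_measure_mono) (auto simp: mult.assoc intro: mult_left_mono)
    also have "\<dots> \<le> (LINT x|gauss N. exp ((c * s) * (F x - m))) / exp (c * t)"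
      by (rule integral_Markov_inequality_measure[where A = "{}"])
        (auto intro!: gauss_lipschitz_integrable_exp_centered)
    also have "\<dots> \<le> exp ((c * s)\<^sup>2 * L\<^sup>2 / 2) / exp (c * t)"
      unfolding m_def by (intro divide_right_mono gauss_lipschitz_mgf) auto
    also have "\<dots> = exp (- t\<^sup>2 / (2 * L\<^sup>2))"
      unfolding exp_diff[symmetric] c_def using assms s2 by (simp add: field_simps power2_eq_square)
    finally show ?thesis .
  qed
  have "{x \<in> space (gauss N). t \<le> \<bar>F x - m\<bar>} =
      {x \<in> space (gauss N). t \<le> 1 * (F x - m)} \<union> {x \<in> space (gauss N). t \<le> (-1) * (F x - m)}" by auto
  then have "measure (gauss N) {x \<in> space (gauss N). t \<le> \<bar>F x - m\<bar>} \<le>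
     measure (gauss N) {x \<in> space (gauss N). t \<le> 1 * (F x - m)} + measure (gauss N) {x \<in> space (gauss N). t \<le> (-1) * (F x - m)}"
    by (simp only:) (rule measure_Un_le; measurable)
  also have "\<dots> \<le> exp (- t\<^sup>2 / (2 * L\<^sup>2)) + exp (- t\<^sup>2 / (2 * L\<^sup>2))"
    by (intro add_mono one) auto
  finally show ?thesis unfolding m_def by simp
qed

end

lemma power_le_exp: "u ^ p \<le> real p ^ p * exp u" if "u \<ge> 0" for u :: real
proof (cases "p = 0")
  case False
  have "u / real p \<le> exp (u / real p)" using exp_ge_add_one_self[of "u / real p"] by linarith
  then have "(u / real p) ^ p \<le> exp (u / real p) ^ p" using that by (intro power_mono) auto
  also have "\<dots> = exp u" using False by (simp add: exp_of_nat_mult[symmetric])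
  finally show ?thesis using False by (simp add: power_divide field_simps)
qed (use that in simp)

lemma gauss_lipschitz_moment:
  assumes F: "gauss_lipschitz N L F" and L: "L > 0" and p: "p \<ge> 1"
  shows "integrable (gauss N) (\<lambda>x. \<bar>F x - (LINT x|gauss N. F x)\<bar> ^ p)"
    and "(LINT x|gauss N. \<bar>F x - (LINT x|gauss N. F x)\<bar> ^ p) \<le> (4 * L * sqrt p) ^ p"
proof -
  note [measurable] = gauss_lipschitz_measurable[OF F]
  define m where "m = (LINT x|gauss N. F x)"
  \<comment> \<open>Now c^2 L^2 = p, so the exponential moments cost a constant to the power p, and
    (p / c) ^ p becomes (L sqrt p) ^ p.\<close>
  define c where "c = sqrt p / L"
  have c: "c > 0" unfolding c_def using L p by simp
  define R where "R x = (real p / c) ^ p * (exp (c * (F x - m)) + exp ((- c) * (F x - m)))" for x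
  have le: "\<bar>F x - m\<bar> ^ p \<le> R x" for x
  proof -
    have "(c * \<bar>F x - m\<bar>) ^ p \<le> real p ^ p * exp (c * \<bar>F x - m\<bar>)"
      using c by (intro power_le_exp) auto
    also have "exp (c * \<bar>F x - m\<bar>) \<le> exp (c * (F x - m)) + exp ((- c) * (F x - m))"
      by (cases "F x \<ge> m") (auto simp: abs_if algebra_simps)
    finally have "c ^ p * \<bar>F x - m\<bar> ^ p \<le> real p ^ p * (exp (c * (F x - m)) + exp ((- c) * (F x - m)))"
      by (simp add: power_mult_distrib mult_left_mono)
    then show ?thesis unfolding R_def using c by (simp add: power_divide field_simps)
  qed
  have iR: "integrable (gauss N) R"
    unfolding R_def by (intro integrable_mult_right Bochner_Integration.integrable_add gauss_lipschitz_integrable_exp_centered[OF F])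
  show int: "integrable (gauss N) (\<lambda>x. \<bar>F x - (LINT x|gauss N. F x)\<bar> ^ p)"
    unfolding m_def[symmetric] by (rule Bochner_Integration.integrable_bound[OF iR]) (use le in \<open>auto intro!: order_trans[OF le]\<close>)
  have "(LINT x|gauss N. \<bar>F x - m\<bar> ^ p) \<le> (LINT x|gauss N. R x)"
    using int iR le unfolding m_def by (intro integral_mono) auto
  also have "\<dots> = (real p / c) ^ p * ((LINT x|gauss N. exp (c * (F x - m))) + (LINT x|gauss N. exp ((- c) * (F x - m))))"
    unfolding R_def by (simp add: Bochner_Integration.integral_add gauss_lipschitz_integrable_exp_centered[OF F]
        gauss_lipschitz_integrable_exp_centered[OF F, of "- c", simplified])
  also have "\<dots> \<le> (real p / c) ^ p * (exp (c\<^sup>2 * L\<^sup>2 / 2) + exp ((- c)\<^sup>2 * L\<^sup>2 / 2))"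
    unfolding m_def using c by (intro mult_left_mono add_mono gauss_lipschitz_mgf[OF F]) auto
  also have "c\<^sup>2 * L\<^sup>2 = p" unfolding c_def using L by (simp add: power_divide)
  also have "(- c)\<^sup>2 * L\<^sup>2 = p" unfolding c_def using L by (simp add: power_divide)
  also have "real p / c = L * sqrt p" unfolding c_def using L p
    by (simp add: field_simps)
  also have "(L * sqrt p) ^ p * (exp (real p / 2) + exp (real p / 2)) \<le> (L * sqrt p) ^ p * 4 ^ p"
  proof (rule mult_left_mono)
    have "exp (real p / 2) = exp (1 / 2) ^ p" by (simp add: exp_of_nat_mult[symmetric])
    also have "\<dots> \<le> 2 ^ p"
    proof (rule power_mono)
      have "exp (1 / 2 :: real) ^ 2 = exp 1" by (simp add: exp_of_nat_mult[symmetric])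
      also have "\<dots> \<le> 2 ^ 2" using exp_le by simp
      finally show "exp (1 / 2 :: real) \<le> 2" by (rule power2_le_imp_le) simp
    qed simp
    finally have "exp (real p / 2) + exp (real p / 2) \<le> 2 * 2 ^ p" by simp
    also have "\<dots> \<le> 2 ^ p * 2 ^ p" using p by (intro mult_right_mono self_le_power) auto
    finally show "exp (real p / 2) + exp (real p / 2) \<le> 4 ^ p" by (simp add: power_mult_distrib[symmetric])
  qed (use L in simp)
  also have "\<dots> = (4 * L * sqrt p) ^ p" by (simp add: power_mult_distrib)
  finally show "(LINT x|gauss N. \<bar>F x - (LINT x|gauss N. F x)\<bar> ^ p) \<le> (4 * L * sqrt p) ^ p"
    unfolding m_def by (simp add: mult_ac)
qed

section \<open>Moments of linear forms in a Gaussian vector\<close>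

lemma cvec_inner_scale: "cvec_inner N x (\<lambda>j. c * v j) = c * cvec_inner N x v"
  unfolding cvec_inner_def sum_distrib_left by (intro sum.cong) auto

lemma gauss_exp_inner:
  "integrable (gauss N) (\<lambda>x. exp (t * Re (cvec_inner N x v)))"
  "(LINT x|gauss N. exp (t * Re (cvec_inner N x v))) = exp (t\<^sup>2 * (cvec_norm N v)\<^sup>2 / 4)"
proof -
  have "t * Re (cvec_inner N x v) = Re (cvec_inner N x (\<lambda>j. of_real t * v j))" for x
    by (simp add: cvec_inner_scale)
  then have *: "(\<integral>\<^sup>+x. ennreal (exp (t * Re (cvec_inner N x v))) \<partial>gauss N) = ennreal (exp (t\<^sup>2 * (cvec_norm N v)\<^sup>2 / 4))"
    using nn_integral_gauss_exp_inner[of N "\<lambda>j. of_real t * v j"]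
    by (simp only: cvec_norm_scale power_mult_distrib norm_of_real power2_abs)
  show "integrable (gauss N) (\<lambda>x. exp (t * Re (cvec_inner N x v)))"
    by (rule integrableI_nonneg) (auto simp: *)
  show "(LINT x|gauss N. exp (t * Re (cvec_inner N x v))) = exp (t\<^sup>2 * (cvec_norm N v)\<^sup>2 / 4)"
    by (subst integral_eq_nn_integral) (auto simp: *)
qed

lemma gauss_inner_moment_upper:
  assumes p: "p \<ge> 1"
  shows "(\<integral>\<^sup>+x. ennreal (cmod (cvec_inner N x v) ^ p) \<partial>gauss N) \<le> ennreal ((16 * sqrt p * cvec_norm N v) ^ p)"
proof (cases "cvec_norm N v = 0")
  case True
  then have "cmod (cvec_inner N x v) = 0" for x using cmod_cvec_inner_le[of N x v] by simp
  then show ?thesis using p by (simp add: power_0_left)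
next
  case False
  then have V: "cvec_norm N v > 0" using cvec_norm_nonneg[of N v] by linarith
  define V where "V = cvec_norm N v"
  define c where "c = sqrt p / V"
  have Vp: "V > 0" using V by (simp add: V_def)
  have c: "c > 0" unfolding c_def using Vp p by simp
  \<comment> \<open>The imaginary part of the form given by v is the real part of the form given by
    - i v, which has the same norm.\<close>
  define w where "w j = - \<i> * v j" for j
  have wV: "cvec_norm N w = V" unfolding w_def V_def cvec_norm_scale by simp
  have Im: "Im (cvec_inner N x v) = Re (cvec_inner N x w)" for x unfolding w_def cvec_inner_scale by simp
  define E where "E u x = exp (c * Re (cvec_inner N x u)) + exp ((- c) * Re (cvec_inner N x u))" for u x
  define R where "R x = 2 ^ p * (real p / c) ^ p * (E v x + E w x)" for x
  have one: "\<bar>t\<bar> ^ p \<le> (real p / c) ^ p * (exp (c * t) + exp ((- c) * t))" for t :: real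
  proof -
    have "(c * \<bar>t\<bar>) ^ p \<le> real p ^ p * exp (c * \<bar>t\<bar>)"
      using c by (intro power_le_exp) auto
    also have "exp (c * \<bar>t\<bar>) \<le> exp (c * t) + exp ((- c) * t)"
      by (cases "t \<ge> 0") (auto simp: abs_if algebra_simps)
    finally have "c ^ p * \<bar>t\<bar> ^ p \<le> real p ^ p * (exp (c * t) + exp ((- c) * t))"
      by (simp add: power_mult_distrib mult_left_mono)
    then show ?thesis using c by (simp add: power_divide field_simps)
  qed
  have le: "cmod (cvec_inner N x v) ^ p \<le> R x" for x
  proof -
    define z where "z = cvec_inner N x v"
    have "cmod z \<le> \<bar>Re z\<bar> + \<bar>Im z\<bar>" by (rule cmod_le)
    also have "\<dots> \<le> 2 * max \<bar>Re z\<bar> \<bar>Im z\<bar>" by simp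
    finally have "cmod z ^ p \<le> (2 * max \<bar>Re z\<bar> \<bar>Im z\<bar>) ^ p" by (intro power_mono) auto
    also have "\<dots> \<le> 2 ^ p * (\<bar>Re z\<bar> ^ p + \<bar>Im z\<bar> ^ p)"
      by (simp add: power_mult_distrib max_def)
    also have "\<dots> \<le> 2 ^ p * ((real p / c) ^ p * E v x + (real p / c) ^ p * E w x)"
      unfolding E_def Im[symmetric] z_def[symmetric] by (intro mult_left_mono add_mono one) auto
    finally show ?thesis unfolding R_def z_def by (simp add: algebra_simps)
  qed
  have iE: "integrable (gauss N) (E u)" for u
    unfolding E_def by (intro Bochner_Integration.integrable_add gauss_exp_inner)
  have E: "(LINT x|gauss N. E u x) = 2 * exp (c\<^sup>2 * (cvec_norm N u)\<^sup>2 / 4)" for u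
    unfolding E_def by (subst Bochner_Integration.integral_add) (rule gauss_exp_inner, rule gauss_exp_inner, simp only: gauss_exp_inner, simp)
  have Rnn: "0 \<le> R x" for x unfolding R_def E_def using c by simp
  have iR: "integrable (gauss N) R" unfolding R_def using iE by simp
  have "(\<integral>\<^sup>+x. ennreal (cmod (cvec_inner N x v) ^ p) \<partial>gauss N) \<le> (\<integral>\<^sup>+x. ennreal (R x) \<partial>gauss N)"
    by (intro nn_integral_mono ennreal_leI le)
  also have "\<dots> = ennreal (LINT x|gauss N. R x)"
    using iR Rnn by (simp add: nn_integral_eq_integral)
  also have "(LINT x|gauss N. R x) = 2 ^ p * (real p / c) ^ p * (4 * exp (real p / 4))"
  proof -
    have "c\<^sup>2 * V\<^sup>2 = p" unfolding c_def using Vp by (simp add: power_divide)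
    then show ?thesis unfolding R_def using iE E wV by (simp add: V_def)
  qed
  also have "real p / c = V * sqrt p" unfolding c_def using Vp p by (simp add: field_simps)
  also have "2 ^ p * (V * sqrt p) ^ p * (4 * exp (real p / 4)) \<le> 2 ^ p * (V * sqrt p) ^ p * (4 ^ p * 2 ^ p)"
  proof (intro mult_left_mono mult_mono)
    have "exp (real p / 4) = exp (1 / 4) ^ p" by (simp add: exp_of_nat_mult[symmetric])
    also have "\<dots> \<le> 2 ^ p"
    proof (rule power_mono)
      have "exp (1 / 4 :: real) \<le> 1 + 1/4 + (1/4)\<^sup>2" by (rule exp_bound) auto
      then show "exp (1 / 4 :: real) \<le> 2" by (simp add: power2_eq_square)
    qed simp
    finally show "exp (real p / 4) \<le> 2 ^ p" .
    show "(4::real) \<le> 4 ^ p" using p by (intro self_le_power) auto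
  qed (use Vp in auto)
  also have "\<dots> = (16 * sqrt p * V) ^ p" by (simp add: power_mult_distrib[symmetric] mult_ac)
  finally show ?thesis unfolding V_def by (simp add: ennreal_leI)
qed

text \<open>An argument of Paley-Zygmund type for exponential moments. Off the event
  \<open>A\<close> the variable exp (t Z), with Z the real part of the form, is at most exp (s^2/4),
  far below its mean exp (s^2/2); its second moment then forces \<open>A\<close> to have probability
  at least 3/8 exp (- 4 p). On \<open>A\<close> the modulus is of order sqrt p times the norm, and
  the small probability only changes the constant inside the p-th power.\<close>

lemma gauss_inner_moment_lower:
  assumes p: "p \<ge> 1"
  shows "ennreal ((sqrt p * cvec_norm N v / 1024) ^ p) \<le> (\<integral>\<^sup>+x. ennreal (cmod (cvec_inner N x v) ^ p) \<partial>gauss N)"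
proof (cases "cvec_norm N v = 0")
  case True
  then show ?thesis using p by (simp add: power_0_left)
next
  case False
  interpret G: prob_space "gauss N" by (rule prob_space_gauss)
  define V where "V = cvec_norm N v"
  have V: "V > 0" using False cvec_norm_nonneg[of N v] unfolding V_def by linarith
  define Z where "Z x = Re (cvec_inner N x v)" for x
  have [measurable]: "Z \<in> borel_measurable (gauss N)" unfolding Z_def by measurable
  define \<sigma> where "\<sigma> = V / sqrt 2"
  have s: "\<sigma> > 0" unfolding \<sigma>_def using V by simp
  \<comment> \<open>Of the order that the p-th moment sees, and with s^2/4 = p >= 1, so that exp
    (s^2/4) >= 8/3.\<close>
  define s where "s = 2 * sqrt p"
  have s2: "s\<^sup>2 = 4 * p" unfolding s_def by (simp add: power_mult_distrib)
  define t where "t = s / \<sigma>"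
  have tp: "t > 0" unfolding t_def s_def using s p by simp
  have mgf: "integrable (gauss N) (\<lambda>x. exp (a * Z x))" "(LINT x|gauss N. exp (a * Z x)) = exp (a\<^sup>2 * \<sigma>\<^sup>2 / 2)" for a
    unfolding Z_def \<sigma>_def using gauss_exp_inner[of N a v] by (auto simp: power_divide V_def)
  define A where "A = {x \<in> space (gauss N). s * \<sigma> / 4 < Z x}"
  have A[measurable]: "A \<in> sets (gauss N)" unfolding A_def by measurable
  \<comment> \<open>The weight in the inequality of means on \<open>A\<close>, chosen so that the
    second moment exp (2 s^2) contributes a quarter of the mean exp (s^2/2).\<close>
  define q where "q = exp (- 3 / 2 * s\<^sup>2) / 2"
  have qp: "q > 0" unfolding q_def by simp
  have pt: "exp (t * Z x) \<le> exp (s\<^sup>2 / 4) + (q / 2 * exp ((2 * t) * Z x) + indicator A x / (2 * q))"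
    if "x \<in> space (gauss N)" for x
  proof (cases "x \<in> A")
    case True
    have "0 \<le> (sqrt q * exp (t * Z x) - 1 / sqrt q)\<^sup>2" by simp
    also have "\<dots> = q * exp ((2 * t) * Z x) - 2 * exp (t * Z x) + 1 / q"
      using qp by (simp add: power2_diff power_mult_distrib power_divide exp_of_nat_mult[symmetric] mult.assoc)
    finally have "exp (t * Z x) \<le> q / 2 * exp ((2 * t) * Z x) + 1 / (2 * q)" by (simp add: field_simps)
    moreover have "0 < exp (s\<^sup>2 / 4)" by simp
    moreover have "indicator A x / (2 * q) = 1 / (2 * q)" using True by simp
    ultimately show ?thesis by linarith
  next
    case False
    then have "Z x \<le> s * \<sigma> / 4" using that unfolding A_def by auto
    then have "t * Z x \<le> t * (s * \<sigma> / 4)" using tp by (intro mult_left_mono) auto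
    also have "\<dots> = s\<^sup>2 / 4" unfolding t_def using s by (simp add: power2_eq_square)
    finally have "exp (t * Z x) \<le> exp (s\<^sup>2 / 4)" by simp
    moreover have "0 \<le> q / 2 * exp ((2 * t) * Z x)" using qp by simp
    moreover have "indicator A x / (2 * q) = 0" using False by simp
    ultimately show ?thesis by linarith
  qed
  have iA: "integrable (gauss N) (indicat_real A)"
    by (rule integrable_real_indicator) (auto simp: G.emeasure_eq_measure)
  have ts: "t\<^sup>2 * \<sigma>\<^sup>2 = s\<^sup>2" unfolding t_def using s by (simp add: power_divide)
  have "exp (s\<^sup>2 / 2) = (LINT x|gauss N. exp (t * Z x))" using mgf(2)[of t] ts by simp
  also have "\<dots> \<le> (LINT x|gauss N. exp (s\<^sup>2 / 4) + (q / 2 * exp ((2 * t) * Z x) + indicator A x / (2 * q)))"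
    using pt by (intro integral_mono Bochner_Integration.integrable_add integrable_mult_right mgf integrable_divide iA) auto
  also have "\<dots> = exp (s\<^sup>2 / 4) + (q / 2 * exp ((2 * t)\<^sup>2 * \<sigma>\<^sup>2 / 2) + measure (gauss N) A / (2 * q))"
  proof -
    have "(LINT x|gauss N. q / 2 * exp ((2 * t) * Z x) + indicator A x / (2 * q)) =
        q / 2 * exp ((2 * t)\<^sup>2 * \<sigma>\<^sup>2 / 2) + measure (gauss N) A / (2 * q)"
      by (subst Bochner_Integration.integral_add) (auto intro!: mgf iA simp: mgf(2))
    then show ?thesis
      by (subst Bochner_Integration.integral_add)
        (auto intro!: Bochner_Integration.integrable_add mgf iA integrable_divide simp: G.prob_space)
  qed
  also have "(2 * t)\<^sup>2 * \<sigma>\<^sup>2 / 2 = 2 * s\<^sup>2" using ts by (simp add: power_mult_distrib mult.commute)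
  also have "q / 2 * exp (2 * s\<^sup>2) = exp (s\<^sup>2 / 2) / 4" unfolding q_def by (simp add: exp_add[symmetric])
  finally have "2 * q * (3 / 4 * exp (s\<^sup>2 / 2) - exp (s\<^sup>2 / 4)) \<le> measure (gauss N) A"
    using qp by (simp add: field_simps)
  moreover have "3 / 8 * exp (s\<^sup>2 / 2) \<le> 3 / 4 * exp (s\<^sup>2 / 2) - exp (s\<^sup>2 / 4)"
  proof -
    have "exp (s\<^sup>2 / 2) = exp (s\<^sup>2 / 4) * exp (s\<^sup>2 / 4)" by (simp add: exp_add[symmetric])
    moreover have "8 / 3 \<le> exp (s\<^sup>2 / 4)"
    proof -
      have "8 / 3 \<le> exp (1::real)" using e_approx_32 unfolding abs_le_iff by simp
      also have "\<dots> \<le> exp (s\<^sup>2 / 4)" using s2 p by simp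
      finally show ?thesis .
    qed
    ultimately have "8 / 3 * exp (s\<^sup>2 / 4) \<le> exp (s\<^sup>2 / 2)"
      using mult_right_mono[of "8 / 3" "exp (s\<^sup>2 / 4)" "exp (s\<^sup>2 / 4)"] by simp
    then show ?thesis by simp
  qed
  ultimately have "2 * q * (3 / 8 * exp (s\<^sup>2 / 2)) \<le> measure (gauss N) A"
    using qp mult_left_mono[of "3 / 8 * exp (s\<^sup>2 / 2)" "3 / 4 * exp (s\<^sup>2 / 2) - exp (s\<^sup>2 / 4)" "2 * q"] by linarith
  moreover have "2 * q * (3 / 8 * exp (s\<^sup>2 / 2)) = 3 / 8 * exp (- (4 * real p))"
    unfolding q_def using s2 by (simp add: exp_add[symmetric])
  ultimately have PA: "3 / 8 * exp (- (4 * real p)) \<le> measure (gauss N) A" by simp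
  have "ennreal ((sqrt p * V / 1024) ^ p) \<le> ennreal ((s * \<sigma> / 4) ^ p * measure (gauss N) A)"
  proof (rule ennreal_leI)
    have "exp (4::real) \<le> 3 ^ 4"
    proof -
      have "exp (4::real) = exp 1 ^ 4" by (simp add: exp_of_nat_mult[symmetric])
      also have "\<dots> \<le> 3 ^ 4" using exp_le by (intro power_mono) auto
      finally show ?thesis .
    qed
    then have "exp (4::real) \<le> 81" by simp
    have "(3/8 :: real) ^ p \<le> 3 / 8" using power_decreasing[of 1 p "3/8::real"] p by simp
    have sq: "sqrt 2 \<le> (1.42::real)" by (rule real_le_lsqrt) (auto simp: power2_eq_square)
    have ex: "1 / 81 \<le> exp (- 4::real)" using \<open>exp (4::real) \<le> 81\<close> by (simp add: exp_minus field_simps)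
    have "sqrt p * V / 1024 \<le> sqrt p * V * (1 / (2 * 1.42) * (1 / 81) * (3 / 8))"
      using V by (simp add: field_simps)
    also have "\<dots> \<le> sqrt p * V * (1 / (2 * sqrt 2) * exp (- 4) * (3 / 8))"
    proof (rule mult_left_mono)
      show "1 / (2 * 1.42) * (1 / 81) * (3 / 8) \<le> 1 / (2 * sqrt 2) * exp (- 4) * (3 / 8 :: real)"
        using sq ex by (intro mult_right_mono mult_mono divide_left_mono) auto
    qed (use V in simp)
    also have "\<dots> = s * \<sigma> / 4 * (exp (- 4) * (3 / 8))" unfolding s_def \<sigma>_def by (simp add: field_simps)
    finally have "(sqrt p * V / 1024) ^ p \<le> (s * \<sigma> / 4 * (exp (- 4) * (3 / 8))) ^ p"
      using V by (intro power_mono) auto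
    also have "\<dots> = (s * \<sigma> / 4) ^ p * (exp (- (4 * real p)) * (3 / 8) ^ p)"
    proof -
      have "exp (- (4 * real p)) = exp (- 4) ^ p" by (simp add: exp_of_nat_mult[symmetric])
      then show ?thesis by (simp only: power_mult_distrib)
    qed
    also have "\<dots> \<le> (s * \<sigma> / 4) ^ p * (exp (- (4 * real p)) * (3 / 8))"
      using \<open>(3/8 :: real) ^ p \<le> 3 / 8\<close> s s_def by (intro mult_left_mono) auto
    also have "\<dots> \<le> (s * \<sigma> / 4) ^ p * measure (gauss N) A"
      using PA s s_def by (intro mult_left_mono) (auto simp: mult_ac)
    finally show "(sqrt p * V / 1024) ^ p \<le> (s * \<sigma> / 4) ^ p * measure (gauss N) A" .
  qed
  also have "\<dots> = (\<integral>\<^sup>+x. ennreal ((s * \<sigma> / 4) ^ p) * indicator A x \<partial>gauss N)"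
    using s s_def by (subst nn_integral_cmult_indicator) (auto simp: G.emeasure_eq_measure ennreal_mult)
  also have "\<dots> \<le> (\<integral>\<^sup>+x. ennreal (cmod (cvec_inner N x v) ^ p) \<partial>gauss N)"
  proof (intro nn_integral_mono)
    fix x
    show "ennreal ((s * \<sigma> / 4) ^ p) * indicator A x \<le> ennreal (cmod (cvec_inner N x v) ^ p)"
    proof (cases "x \<in> A")
      case True
      then have "s * \<sigma> / 4 \<le> cmod (cvec_inner N x v)"
        unfolding A_def Z_def using complex_Re_le_cmod[of "cvec_inner N x v"] by auto
      then show ?thesis using True s s_def by (auto intro!: ennreal_leI power_mono)
    qed simp
  qed
  finally show ?thesis unfolding V_def .
qed

section \<open>The mean norm of a Gaussian vector is of order sqrt N\<close>

definition gauss_mean_norm :: "nat \<Rightarrow> real" where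
  "gauss_mean_norm N = (LINT x|gauss N. cvec_norm N x)"

lemma gauss_lipschitz_cvec_norm: "gauss_lipschitz N 1 (cvec_norm N)"
  unfolding gauss_lipschitz_def
proof (intro conjI allI)
  fix x y
  show "cvec_norm N x - cvec_norm N y \<le> 1 * cvec_norm N (\<lambda>j. x j - y j)"
    using cvec_norm_triangle[of N "\<lambda>j. x j - y j" y] by simp
qed auto

lemma cvec_inner_unit: "j < N \<Longrightarrow> cvec_inner N x (\<lambda>i. if i = j then 1 else 0) = x j"
proof -
  assume "j < N"
  have "cvec_inner N x (\<lambda>i. if i = j then 1 else 0) = (\<Sum>i<N. if i = j then x j else 0)"
    unfolding cvec_inner_def by (intro sum.cong) auto
  then show ?thesis using \<open>j < N\<close> by simp
qed

lemma cvec_norm_unit: "j < N \<Longrightarrow> cvec_norm N (\<lambda>i. if i = j then 1 else 0) = 1"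
proof -
  assume "j < N"
  then have "(\<Sum>i<N. (cmod (if i = j then 1 else 0))\<^sup>2) = (\<Sum>i<N. if i = j then 1 else 0)" by (intro sum.cong) auto
  also have "\<dots> = 1" using \<open>j < N\<close> by simp
  finally show ?thesis unfolding cvec_norm_def by simp
qed

text \<open>By Cauchy-Schwarz the sum of the moduli of the coordinates is at most sqrt N times the
  norm, and each modulus has mean at least 1/1024.\<close>

lemma gauss_mean_norm_lower: "sqrt N / 1024 \<le> gauss_mean_norm N"
proof (cases "N = 0")
  case True then show ?thesis by (simp add: gauss_mean_norm_def)
next
  case False
  have int: "integrable (gauss N) (cvec_norm N)" by (rule gauss_lipschitz_integrable[OF gauss_lipschitz_cvec_norm])
  have "ennreal (real N / 1024) = (\<Sum>j<N. ennreal ((sqrt 1 * 1 / 1024) ^ 1))"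
    by (simp add: ennreal_of_nat_eq_real_of_nat ennreal_mult[symmetric])
  also have "\<dots> \<le> (\<Sum>j<N. \<integral>\<^sup>+x. ennreal (cmod (x j)) \<partial>gauss N)"
  proof (rule sum_mono)
    fix j assume "j \<in> {..<N}"
    then show "ennreal ((sqrt 1 * 1 / 1024) ^ 1) \<le> (\<integral>\<^sup>+x. ennreal (cmod (x j)) \<partial>gauss N)"
      using gauss_inner_moment_lower[of 1 N "\<lambda>i. if i = j then 1 else 0"]
      by (simp add: cvec_inner_unit cvec_norm_unit)
  qed
  also have "\<dots> = (\<integral>\<^sup>+x. (\<Sum>j<N. ennreal (cmod (x j))) \<partial>gauss N)"
    by (rule nn_integral_sum[symmetric])
      (auto intro!: borel_measurable_norm measurable_compose[OF _ measurable_ennreal])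
  also have "\<dots> \<le> (\<integral>\<^sup>+x. ennreal (sqrt N * cvec_norm N x) \<partial>gauss N)"
  proof (intro nn_integral_mono)
    fix x :: "nat \<Rightarrow> complex"
    have "(\<Sum>j<N. \<bar>1\<bar> * \<bar>cmod (x j)\<bar>) \<le> L2_set (\<lambda>_. 1) {..<N} * L2_set (\<lambda>j. cmod (x j)) {..<N}"
      by (rule L2_set_mult_ineq)
    then have "(\<Sum>j<N. cmod (x j)) \<le> sqrt N * cvec_norm N x"
      unfolding cvec_norm_eq_L2 by (simp add: L2_set_def)
    then show "(\<Sum>j<N. ennreal (cmod (x j))) \<le> ennreal (sqrt N * cvec_norm N x)"
      by (simp add: sum_ennreal ennreal_leI)
  qed
  also have "\<dots> = ennreal (sqrt N * gauss_mean_norm N)"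
    unfolding gauss_mean_norm_def using int by (subst nn_integral_eq_integral) auto
  finally have "real N / 1024 \<le> sqrt N * gauss_mean_norm N"
    by (subst (asm) ennreal_le_iff) (auto simp: gauss_mean_norm_def)
  then have "sqrt N * (sqrt N / 1024) \<le> sqrt N * gauss_mean_norm N" by simp
  then show ?thesis by (rule mult_left_le_imp_le) (use False in simp)
qed

text \<open>Each coordinate has mean square at most (16 sqrt 2)^2 = 512. The inequality |x| <= |x|^2
  / (2 sqrt N) + sqrt N / 2 takes the place of Jensen's.\<close>

lemma gauss_mean_norm_upper: "gauss_mean_norm N \<le> 512 * sqrt N"
proof (cases "N = 0")
  case True then show ?thesis by (simp add: gauss_mean_norm_def cvec_norm_def)
next
  case False
  have int: "integrable (gauss N) (cvec_norm N)" by (rule gauss_lipschitz_integrable[OF gauss_lipschitz_cvec_norm])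
  have sq: "(\<integral>\<^sup>+x. ennreal ((cvec_norm N x)\<^sup>2) \<partial>gauss N) \<le> ennreal (512 * real N)"
  proof -
    have "(\<integral>\<^sup>+x. ennreal ((cvec_norm N x)\<^sup>2) \<partial>gauss N) = (\<integral>\<^sup>+x. (\<Sum>j<N. ennreal ((cmod (x j))\<^sup>2)) \<partial>gauss N)"
      by (intro nn_integral_cong) (simp add: cvec_norm_sq sum_ennreal)
    also have "\<dots> = (\<Sum>j<N. \<integral>\<^sup>+x. ennreal ((cmod (x j))\<^sup>2) \<partial>gauss N)"
      by (rule nn_integral_sum)
        (auto intro!: borel_measurable_power borel_measurable_norm measurable_compose[OF _ measurable_ennreal])
    also have "\<dots> \<le> (\<Sum>j<N. ennreal ((16 * sqrt 2 * 1)\<^sup>2))"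
    proof (rule sum_mono)
      fix j assume "j \<in> {..<N}"
      then show "(\<integral>\<^sup>+x. ennreal ((cmod (x j))\<^sup>2) \<partial>gauss N) \<le> ennreal ((16 * sqrt 2 * 1)\<^sup>2)"
        using gauss_inner_moment_upper[of 2 N "\<lambda>i. if i = j then 1 else 0"]
        by (simp add: cvec_inner_unit cvec_norm_unit)
    qed
    also have "\<dots> = ennreal (512 * real N)"
      by (simp add: power_mult_distrib ennreal_of_nat_eq_real_of_nat ennreal_mult mult.commute)
    finally show ?thesis .
  qed
  have "ennreal (gauss_mean_norm N) = (\<integral>\<^sup>+x. ennreal (cvec_norm N x) \<partial>gauss N)"
    unfolding gauss_mean_norm_def using int by (subst nn_integral_eq_integral) auto
  also have "\<dots> \<le> (\<integral>\<^sup>+x. ennreal (1 / (2 * sqrt N)) * ennreal ((cvec_norm N x)\<^sup>2) + ennreal (sqrt N / 2) \<partial>gauss N)"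
  proof (intro nn_integral_mono)
    fix x :: "nat \<Rightarrow> complex"
    have "0 \<le> (cvec_norm N x - sqrt N)\<^sup>2" by simp
    then have "2 * sqrt N * cvec_norm N x \<le> (cvec_norm N x)\<^sup>2 + real N" by (simp add: power2_diff algebra_simps)
    then have "cvec_norm N x \<le> ((cvec_norm N x)\<^sup>2 + real N) / (2 * sqrt N)"
      using False by (subst pos_le_divide_eq) (auto simp: mult_ac)
    also have "\<dots> = 1 / (2 * sqrt N) * (cvec_norm N x)\<^sup>2 + sqrt N / 2"
      using False by (simp add: add_divide_distrib real_div_sqrt)
    finally have "ennreal (cvec_norm N x) \<le> ennreal (1 / (2 * sqrt N) * (cvec_norm N x)\<^sup>2 + sqrt N / 2)"
      by (rule ennreal_leI)
    then show "ennreal (cvec_norm N x) \<le> ennreal (1 / (2 * sqrt N)) * ennreal ((cvec_norm N x)\<^sup>2) + ennreal (sqrt N / 2)"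
      by (simp add: ennreal_plus[symmetric] ennreal_mult[symmetric] del: ennreal_plus)
  qed
  also have "\<dots> = ennreal (1 / (2 * sqrt N)) * (\<integral>\<^sup>+x. ennreal ((cvec_norm N x)\<^sup>2) \<partial>gauss N) + ennreal (sqrt N / 2)"
    using prob_space.emeasure_space_1[OF prob_space_gauss]
    by (subst nn_integral_add) (auto simp: nn_integral_cmult)
  also have "\<dots> \<le> ennreal (1 / (2 * sqrt N)) * ennreal (512 * real N) + ennreal (sqrt N / 2)"
    by (intro add_mono mult_left_mono sq) auto
  also have "\<dots> = ennreal (1 / (2 * sqrt N) * (512 * real N) + sqrt N / 2)"
    by (simp add: ennreal_plus[symmetric] ennreal_mult[symmetric] del: ennreal_plus)
  finally have "gauss_mean_norm N \<le> 1 / (2 * sqrt N) * (512 * real N) + sqrt N / 2"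
    by (subst (asm) ennreal_le_iff) auto
  also have "\<dots> = 256 * sqrt N + sqrt N / 2" using False by (simp add: real_div_sqrt field_simps)
  also have "\<dots> \<le> 512 * sqrt N" by simp
  finally show ?thesis .
qed

lemma gauss_mean_norm_pos: "N \<ge> 1 \<Longrightarrow> 0 < gauss_mean_norm N"
  using gauss_mean_norm_lower[of N] by (smt (verit) divide_pos_pos of_nat_0_less_iff real_sqrt_gt_0_iff less_le_trans zero_less_numeral zero_less_one less_eq_Suc_le One_nat_def)

section \<open>Dilations of Lebesgue measure\<close>

lemma nn_integral_complex_scale:
  assumes [measurable]: "f \<in> borel_measurable borel" and c: "c > 0"
  shows "(\<integral>\<^sup>+z. f z \<partial>lborel) = ennreal (c\<^sup>2) * (\<integral>\<^sup>+z. f (complex_of_real c * z) \<partial>lborel)"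
  using c by (subst lborel_affine[of c "0::complex"])
    (auto simp: nn_integral_density nn_integral_distr nn_integral_cmult scaleR_conv_of_real DIM_complex)

lemma nn_integral_PiM_complex_scale:
  assumes "finite I" "f \<in> borel_measurable (Pi\<^sub>M I (\<lambda>_. borel))" and c: "c > 0"
  shows "(\<integral>\<^sup>+x. f x \<partial>Pi\<^sub>M I (\<lambda>_. lborel)) =
    ennreal (c ^ (2 * card I)) * (\<integral>\<^sup>+x. f (\<lambda>i\<in>I. complex_of_real c * x i) \<partial>Pi\<^sub>M I (\<lambda>_. lborel))"
  using assms(1,2)
proof (induction I arbitrary: f)
  case empty
  show ?case by (simp add: PiM_empty nn_integral_count_space_finite restrict_def)
next
  case (insert i I)
  interpret product_sigma_finite "\<lambda>_. lborel :: complex measure" by standard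
  have bm: "borel_measurable (Pi\<^sub>M J (\<lambda>_. lborel :: complex measure)) = borel_measurable (Pi\<^sub>M J (\<lambda>_. borel :: complex measure))" for J
    by (rule measurable_cong_sets) (auto intro!: sets_PiM_cong)
  have f[measurable]: "f \<in> borel_measurable (Pi\<^sub>M (insert i I) (\<lambda>_. lborel))" using insert.prems by (simp add: bm)
  have f': "(\<lambda>x. f (\<lambda>j\<in>insert i I. complex_of_real c * x j)) \<in> borel_measurable (Pi\<^sub>M (insert i I) (\<lambda>_. lborel))"
    by (rule measurable_compose[OF _ f]) measurable
  have upd: "(\<lambda>j\<in>insert i I. complex_of_real c * (x(i := y)) j) = (\<lambda>j\<in>I. complex_of_real c * x j)(i := complex_of_real c * y)" for x y
    using insert.hyps by (auto simp: fun_eq_iff)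
  have mu: "(\<lambda>y. f (x(i := y))) \<in> borel_measurable borel" if "x \<in> space (Pi\<^sub>M I (\<lambda>_. lborel))" for x
    using measurable_comp[OF measurable_component_update f, OF that insert.hyps(2)]
    unfolding comp_def by simp
  have "(\<integral>\<^sup>+x. f x \<partial>Pi\<^sub>M (insert i I) (\<lambda>_. lborel)) = (\<integral>\<^sup>+x. \<integral>\<^sup>+y. f (x(i := y)) \<partial>lborel \<partial>Pi\<^sub>M I (\<lambda>_. lborel))"
    by (rule product_nn_integral_insert[OF insert.hyps f])
  also have "\<dots> = (\<integral>\<^sup>+x. ennreal (c\<^sup>2) * (\<integral>\<^sup>+y. f (x(i := complex_of_real c * y)) \<partial>lborel) \<partial>Pi\<^sub>M I (\<lambda>_. lborel))"
    by (intro nn_integral_cong nn_integral_complex_scale mu c)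
  also have "\<dots> = ennreal (c ^ (2 * card I)) * (\<integral>\<^sup>+x. ennreal (c\<^sup>2) * (\<integral>\<^sup>+y. f ((\<lambda>j\<in>I. complex_of_real c * x j)(i := complex_of_real c * y)) \<partial>lborel) \<partial>Pi\<^sub>M I (\<lambda>_. lborel))"
    by (subst insert.IH) (simp_all flip: bm)
  also have "\<dots> = ennreal (c ^ (2 * card I)) * (ennreal (c\<^sup>2) * (\<integral>\<^sup>+x. \<integral>\<^sup>+y. f ((\<lambda>j\<in>I. complex_of_real c * x j)(i := complex_of_real c * y)) \<partial>lborel \<partial>Pi\<^sub>M I (\<lambda>_. lborel)))"
    by (subst nn_integral_cmult) auto
  also have "(\<integral>\<^sup>+x. \<integral>\<^sup>+y. f ((\<lambda>j\<in>I. complex_of_real c * x j)(i := complex_of_real c * y)) \<partial>lborel \<partial>Pi\<^sub>M I (\<lambda>_. lborel)) =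
     (\<integral>\<^sup>+x. f (\<lambda>j\<in>insert i I. complex_of_real c * x j) \<partial>Pi\<^sub>M (insert i I) (\<lambda>_. lborel))"
    by (subst product_nn_integral_insert[OF insert.hyps f']) (simp only: upd)
  also have "ennreal (c ^ (2 * card I)) * (ennreal (c\<^sup>2) * X) = ennreal (c ^ (2 * card (insert i I))) * X" for X
  proof -
    have "ennreal (c ^ (2 * card I)) * ennreal (c\<^sup>2) = ennreal (c ^ (2 * card I) * c\<^sup>2)"
      using c by (intro ennreal_mult[symmetric]) auto
    also have "c ^ (2 * card I) * c\<^sup>2 = c ^ (2 * card (insert i I))"
      using insert.hyps by (simp add: power2_eq_square)
    finally show ?thesis by (simp add: mult.assoc[symmetric])
  qed
  finally show ?case .
qed

section \<open>The uniform distribution on the sphere\<close>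

text \<open>Division by 0 gives a vector of norm 0 the direction 0, so the map is total.\<close>

definition direction :: "nat \<Rightarrow> (nat \<Rightarrow> complex) \<Rightarrow> nat \<Rightarrow> complex" where
  "direction N a = (\<lambda>j\<in>{..<N}. a j / complex_of_real (cvec_norm N a))"

lemma measurable_direction [measurable]:
  "direction N \<in> Pi\<^sub>M {..<N} (\<lambda>_. borel) \<rightarrow>\<^sub>M Pi\<^sub>M {..<N} (\<lambda>_. borel)"
  unfolding direction_def by measurable

lemma cvec_norm_restrict_scale: "cvec_norm N (\<lambda>i\<in>{..<N}. c * x i) = cmod c * cvec_norm N x"
  unfolding cvec_norm_scale[symmetric] by (simp add: cvec_norm_def)

lemma direction_scale:
  assumes "c > 0"
  shows "direction N (\<lambda>i\<in>{..<N}. complex_of_real c * x i) = direction N x"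
  unfolding direction_def cvec_norm_restrict_scale using assms by (auto simp: fun_eq_iff)

lemma nn_integral_exp_atLeast:
  "(\<integral>\<^sup>+t. ennreal (exp (- t)) * indicator {s..} t \<partial>lborel) = ennreal (exp (- s))"
proof -
  have "((\<lambda>t. - exp (- t)) \<longlongrightarrow> (0::real)) at_top" by real_asymp
  then have "(\<integral>\<^sup>+t. ennreal (exp (- t)) * indicator {s..} t \<partial>lborel) = ennreal (0 - (- exp (- s)))"
    by (intro nn_integral_FTC_atLeast[where F = "\<lambda>t. - exp (- t)"]) (auto intro!: derivative_eq_intros)
  then show ?thesis by simp
qed

text \<open>
  The Gaussian weight is a mixture of uniform weights on balls, and the balls are dilates of each other.
\<close>

lemma emeasure_gauss_cone:
  assumes N: "N \<ge> 1"
  shows "\<exists>\<kappa>. \<forall>S\<in>sets (Pi\<^sub>M {..<N} (\<lambda>_. borel)).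
    emeasure (gauss N) (direction N -` S \<inter> space (gauss N)) =
    \<kappa> * emeasure (Pi\<^sub>M {..<N} (\<lambda>_. lborel))
      ({a \<in> {..<N} \<rightarrow>\<^sub>E UNIV. 0 < cvec_norm N a \<and> cvec_norm N a \<le> 1} \<inter> direction N -` S)"
proof (intro exI ballI)
  let ?L = "Pi\<^sub>M {..<N} (\<lambda>_. lborel :: complex measure)"
  let ?B = "Pi\<^sub>M {..<N} (\<lambda>_. borel :: complex measure)"
  fix S assume S[measurable]: "S \<in> sets ?B"
  have spL: "space ?L = {..<N} \<rightarrow>\<^sub>E UNIV" by (simp add: space_PiM)
  have spB: "space ?B = {..<N} \<rightarrow>\<^sub>E UNIV" by (simp add: space_PiM)
  note [measurable_cong] = sets_PiM_lborel
  interpret product_sigma_finite "\<lambda>_::nat. lborel :: complex measure" by standard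
  interpret fp: finite_product_sigma_finite "\<lambda>_. lborel :: complex measure" "{..<N}" by standard auto
  define T where "T = {a \<in> space ?B. 0 < cvec_norm N a \<and> direction N a \<in> S}"
  have T[measurable]: "T \<in> sets ?B" unfolding T_def by measurable
  define k where "k = ennreal (1 / pi ^ N)"
  define U where "U = {a \<in> {..<N} \<rightarrow>\<^sub>E UNIV. 0 < cvec_norm N a \<and> cvec_norm N a \<le> 1} \<inter> direction N -` S"
  have U: "U = {a \<in> space ?B. a \<in> T \<and> cvec_norm N a \<le> 1}" unfolding U_def T_def spB by auto
  have [measurable]: "U \<in> sets ?B" unfolding U by measurable
  have null: "{x \<in> space ?L. cvec_norm N x = 0} \<in> null_sets ?L"
  proof -
    have "{x \<in> space ?L. cvec_norm N x = 0} \<subseteq> (\<Pi>\<^sub>E j\<in>{..<N}. {0})"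
      unfolding spL by (auto simp: cvec_norm_def sum_nonneg_eq_0_iff PiE_def extensional_def fun_eq_iff)
    moreover have "(\<Pi>\<^sub>E j\<in>{..<N}. {0}) \<in> null_sets ?L"
    proof (rule null_setsI)
      have "emeasure ?L (\<Pi>\<^sub>E j\<in>{..<N}. {0}) = (\<Prod>j<N. emeasure lborel {0::complex})"
        by (rule emeasure_PiM) auto
      also have "\<dots> = 0" using N by (simp add: power_0_left)
      finally show "emeasure ?L (\<Pi>\<^sub>E j\<in>{..<N}. {0}) = 0" .
      show "(\<Pi>\<^sub>E j\<in>{..<N}. {0}) \<in> sets ?L" by (rule sets_PiM_I_finite) auto
    qed
    moreover have "{x \<in> space ?L. cvec_norm N x = 0} \<in> sets ?L"
    proof -
      have "cvec_norm N -` {0} \<inter> space ?B \<in> sets ?B" by (rule measurable_sets[OF cvec_norm_measurable]) simp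
      moreover have "{x \<in> space ?L. cvec_norm N x = 0} = cvec_norm N -` {0} \<inter> space ?B" by (auto simp: spL spB)
      ultimately show ?thesis by (simp add: sets_PiM_lborel)
    qed
    ultimately show ?thesis by (rule null_sets_subset[rotated 2])
  qed
  have scale: "indicator T (\<lambda>i\<in>{..<N}. complex_of_real c * x i) = (indicator T x :: ennreal)"
    if "x \<in> space ?L" "c > 0" for c x
  proof -
    have "(\<lambda>i\<in>{..<N}. complex_of_real c * x i) \<in> space ?B" "x \<in> space ?B" using that by (auto simp: spB spL)
    then have "(\<lambda>i\<in>{..<N}. complex_of_real c * x i) \<in> T \<longleftrightarrow> x \<in> T"
      using that unfolding T_def by (simp add: direction_scale cvec_norm_restrict_scale zero_less_mult_iff)
    then show ?thesis by (simp add: indicator_def)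
  qed
  have "emeasure (gauss N) (direction N -` S \<inter> space (gauss N)) =
     (\<integral>\<^sup>+x. indicator (direction N -` S \<inter> space ?B) x \<partial>gauss N)"
    using measurable_sets[OF measurable_direction S] by (simp add: space_gauss spB sets_gauss)
  also have "\<dots> = (\<integral>\<^sup>+x. ennreal (exp (- (cvec_norm N x)\<^sup>2) / pi ^ N) * indicator (direction N -` S \<inter> space ?B) x \<partial>?L)"
    using measurable_sets[OF measurable_direction S] by (intro nn_integral_gauss) auto
  \<comment> \<open>exp (- r) is the integral of exp (- t) over t >= r. The integrands can differ
    only at the origin, a null set because N >= 1.\<close>
  also have "\<dots> = (\<integral>\<^sup>+x. k * (\<integral>\<^sup>+t. ennreal (exp (- t)) * indicator {(cvec_norm N x)\<^sup>2..} t * indicator T x \<partial>lborel) \<partial>?L)"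
  proof (rule nn_integral_cong_AE, rule AE_I'[OF null], rule subsetI)
    fix x
    assume x: "x \<in> {x \<in> space ?L. \<not> (ennreal (exp (- (cvec_norm N x)\<^sup>2) / pi ^ N) * indicator (direction N -` S \<inter> space ?B) x =
       k * (\<integral>\<^sup>+t. ennreal (exp (- t)) * indicator {(cvec_norm N x)\<^sup>2..} t * indicator T x \<partial>lborel))}"
    show "x \<in> {x \<in> space ?L. cvec_norm N x = 0}"
    proof (rule ccontr)
      assume "\<not> ?thesis"
      with x have pos: "cvec_norm N x > 0" and sp: "x \<in> space ?B" using cvec_norm_nonneg[of N x] by (auto simp: spL spB less_le)
      then have "indicator (direction N -` S \<inter> space ?B) x = (indicator T x :: ennreal)"
        unfolding T_def by (auto simp: indicator_def)
      moreover have "k * (\<integral>\<^sup>+t. ennreal (exp (- t)) * indicator {(cvec_norm N x)\<^sup>2..} t * indicator T x \<partial>lborel)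
          = k * (ennreal (exp (- (cvec_norm N x)\<^sup>2)) * indicator T x)"
        by (simp add: nn_integral_multc nn_integral_exp_atLeast)
      moreover have "ennreal (exp (- (cvec_norm N x)\<^sup>2) / pi ^ N) = k * ennreal (exp (- (cvec_norm N x)\<^sup>2))"
        unfolding k_def by (simp add: ennreal_mult[symmetric])
      ultimately show False using x by (simp add: mult.assoc)
    qed
  qed
  also have "\<dots> = k * (\<integral>\<^sup>+x. (\<integral>\<^sup>+t. ennreal (exp (- t)) * indicator {p. (cvec_norm N (fst p))\<^sup>2 \<le> snd p} (x, t) * indicator T x \<partial>lborel) \<partial>?L)"
    by (subst nn_integral_cmult[symmetric])
      (auto intro!: nn_integral_cong simp: indicator_def lborel.borel_measurable_nn_integral_fst[unfolded case_prod_beta fst_conv snd_conv])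
  also have "(\<integral>\<^sup>+x. (\<integral>\<^sup>+t. ennreal (exp (- t)) * indicator {p. (cvec_norm N (fst p))\<^sup>2 \<le> snd p} (x, t) * indicator T x \<partial>lborel) \<partial>?L) =
     (\<integral>\<^sup>+t. (\<integral>\<^sup>+x. ennreal (exp (- t)) * indicator {p. (cvec_norm N (fst p))\<^sup>2 \<le> snd p} (x, t) * indicator T x \<partial>?L) \<partial>lborel)"
    by (rule pair_sigma_finite.Fubini'[symmetric])
      (auto simp: pair_sigma_finite_def fp.sigma_finite_measure_axioms sigma_finite_lborel)
  \<comment> \<open>For t > 0 the part of the cone with |x|^2 <= t is the dilate by sqrt t of the
    part in the unit ball, and the real dimension 2 N gives the factor t ^ N. For t <= 0 it is empty
    because \<open>T\<close> omits the origin.\<close>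
  also have "\<dots> = (\<integral>\<^sup>+t. (ennreal (exp (- t)) * ennreal (t ^ N) * indicator {0<..} t) * emeasure ?L U \<partial>lborel)"
  proof (rule nn_integral_cong)
    fix t :: real
    show "(\<integral>\<^sup>+x. ennreal (exp (- t)) * indicator {p. (cvec_norm N (fst p))\<^sup>2 \<le> snd p} (x, t) * indicator T x \<partial>?L) =
       (ennreal (exp (- t)) * ennreal (t ^ N) * indicator {0<..} t) * emeasure ?L U"
    proof (cases "t > 0")
      case False
      have "indicator {p. (cvec_norm N (fst p))\<^sup>2 \<le> snd p} (x, t) * indicator T x = (0 :: ennreal)" for x
      proof (cases "x \<in> T")
        case True
        then have "0 < (cvec_norm N x)\<^sup>2" unfolding T_def by auto
        then have "\<not> (cvec_norm N x)\<^sup>2 \<le> t" using False by linarith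
        then show ?thesis by simp
      qed simp
      then have "(\<integral>\<^sup>+x. ennreal (exp (- t)) * indicator {p. (cvec_norm N (fst p))\<^sup>2 \<le> snd p} (x, t) * indicator T x \<partial>?L) = (\<integral>\<^sup>+x. 0 \<partial>?L)"
        by (intro nn_integral_cong) (simp only: mult.assoc mult_zero_right)
      then show ?thesis using False by simp
    next
      case True
      define c where "c = sqrt t"
      have c: "c > 0" "c\<^sup>2 = t" unfolding c_def using True by auto
      have "(\<integral>\<^sup>+x. indicator {p. (cvec_norm N (fst p))\<^sup>2 \<le> snd p} (x, t) * indicator T x \<partial>?L) =
         ennreal (c ^ (2 * card {..<N})) * (\<integral>\<^sup>+x. indicator {p. (cvec_norm N (fst p))\<^sup>2 \<le> snd p} (\<lambda>i\<in>{..<N}. complex_of_real c * x i, t)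
            * indicator T (\<lambda>i\<in>{..<N}. complex_of_real c * x i) \<partial>?L)"
        by (rule nn_integral_PiM_complex_scale) (use c in auto)
      also have "c ^ (2 * card {..<N}) = t ^ N" using c by (simp add: power_mult)
      also have "(\<integral>\<^sup>+x. indicator {p. (cvec_norm N (fst p))\<^sup>2 \<le> snd p} (\<lambda>i\<in>{..<N}. complex_of_real c * x i, t)
            * indicator T (\<lambda>i\<in>{..<N}. complex_of_real c * x i) \<partial>?L) = (\<integral>\<^sup>+x. indicator U x \<partial>?L)"
      proof (intro nn_integral_cong)
        fix x assume x: "x \<in> space ?L"
        have "(cvec_norm N (\<lambda>i\<in>{..<N}. complex_of_real c * x i))\<^sup>2 \<le> t \<longleftrightarrow> cvec_norm N x \<le> 1"
        proof -
          have "(cvec_norm N (\<lambda>i\<in>{..<N}. complex_of_real c * x i))\<^sup>2 = t * (cvec_norm N x)\<^sup>2"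
            unfolding cvec_norm_restrict_scale using c by (simp add: power_mult_distrib)
          also have "\<dots> \<le> t \<longleftrightarrow> (cvec_norm N x)\<^sup>2 \<le> 1" using True by simp
          finally show ?thesis by (simp add: abs_square_le_1)
        qed
        then show "indicator {p. (cvec_norm N (fst p))\<^sup>2 \<le> snd p} (\<lambda>i\<in>{..<N}. complex_of_real c * x i, t)
            * indicator T (\<lambda>i\<in>{..<N}. complex_of_real c * x i) = (indicator U x :: ennreal)"
          unfolding scale[OF x c(1)] using x by (auto simp: U indicator_def spB spL)
      qed
      also have "\<dots> = emeasure ?L U" by simp
      finally show ?thesis using True by (subst mult.assoc, subst nn_integral_cmult) (auto simp: mult.assoc)
    qed
  qed
  also have "\<dots> = (\<integral>\<^sup>+t. ennreal (exp (- t)) * ennreal (t ^ N) * indicator {0<..} t \<partial>lborel) * emeasure ?L U"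
    by (rule nn_integral_multc) measurable
  finally show "emeasure (gauss N) (direction N -` S \<inter> space (gauss N)) =
    (ennreal (1 / pi ^ N) * (\<integral>\<^sup>+t. ennreal (exp (- t)) * ennreal (t ^ N) * indicator {0<..} t \<partial>lborel)) * emeasure ?L
      ({a \<in> {..<N} \<rightarrow>\<^sub>E UNIV. 0 < cvec_norm N a \<and> cvec_norm N a \<le> 1} \<inter> direction N -` S)"
    unfolding U_def k_def by (simp add: mult.assoc)
qed

lemma uniform_sphere_eq_gauss_direction:
  assumes N: "N \<ge> 1"
  shows "uniform_sphere N = distr (gauss N) (Pi\<^sub>M {..<N} (\<lambda>_. borel)) (direction N)"
proof (rule measure_eqI)
  let ?L = "Pi\<^sub>M {..<N} (\<lambda>_. lborel :: complex measure)"
  let ?B = "Pi\<^sub>M {..<N} (\<lambda>_. borel :: complex measure)"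
  let ?A = "{a \<in> {..<N} \<rightarrow>\<^sub>E UNIV. 0 < cvec_norm N a \<and> cvec_norm N a \<le> 1}"
  note [measurable_cong] = sets_PiM_lborel
  show "sets (uniform_sphere N) = sets (distr (gauss N) ?B (direction N))"
    unfolding uniform_sphere_def by simp
  fix S assume "S \<in> sets (uniform_sphere N)"
  then have S[measurable]: "S \<in> sets ?B" unfolding uniform_sphere_def by simp
  obtain \<kappa> where \<kappa>: "\<And>S. S \<in> sets ?B \<Longrightarrow> emeasure (gauss N) (direction N -` S \<inter> space (gauss N)) = \<kappa> * emeasure ?L (?A \<inter> direction N -` S)"
    using emeasure_gauss_cone[OF N] by blast
  have "1 = emeasure (gauss N) (direction N -` space ?B \<inter> space (gauss N))"
  proof -
    have "direction N -` space ?B \<inter> space (gauss N) = space (gauss N)"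
      by (auto simp: direction_def space_PiM space_gauss)
    then show ?thesis using prob_space.emeasure_space_1[OF prob_space_gauss] by simp
  qed
  also have "\<dots> = \<kappa> * emeasure ?L (?A \<inter> direction N -` space ?B)" by (rule \<kappa>) simp
  also have "?A \<inter> direction N -` space ?B = ?A" by (auto simp: direction_def space_PiM)
  \<comment> \<open>The whole space as S fixes the constant, so the integral over t that defines it
    is never evaluated.\<close>
  finally have one: "\<kappa> * emeasure ?L ?A = 1" by simp
  have A: "?A = {a \<in> space ?B. 0 < cvec_norm N a \<and> cvec_norm N a \<le> 1}" by (simp add: space_PiM)
  have [measurable]: "?A \<in> sets ?B" unfolding A by measurable
  have "emeasure ?L ?A \<noteq> 0" "emeasure ?L ?A \<noteq> \<top>" "\<kappa> \<noteq> \<top>" using one by (auto simp: ennreal_top_mult ennreal_mult_top split: if_splits)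
  have dirm: "direction N -` S \<inter> space ?B \<in> sets ?B" using measurable_direction S by (rule measurable_sets)
  have "emeasure (uniform_sphere N) S = emeasure (uniform_measure ?L ?A) (direction N -` S \<inter> space ?B)"
    unfolding uniform_sphere_def direction_def[symmetric, abs_def]
    by (subst emeasure_distr) (auto simp: space_PiM)
  also have "\<dots> = emeasure ?L (?A \<inter> (direction N -` S \<inter> space ?B)) / emeasure ?L ?A"
    using dirm by (subst emeasure_uniform_measure) (auto simp: sets_PiM_lborel)
  also have "?A \<inter> (direction N -` S \<inter> space ?B) = ?A \<inter> direction N -` S" by (auto simp: space_PiM)
  also have "emeasure ?L (?A \<inter> direction N -` S) / emeasure ?L ?A = (\<kappa> * emeasure ?L (?A \<inter> direction N -` S) * emeasure ?L ?A) / emeasure ?L ?A"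
  proof -
    have "\<kappa> * emeasure ?L (?A \<inter> direction N -` S) * emeasure ?L ?A = (\<kappa> * emeasure ?L ?A) * emeasure ?L (?A \<inter> direction N -` S)"
      by (simp only: mult_ac)
    then show ?thesis unfolding one by simp
  qed
  also have "\<dots> = \<kappa> * emeasure ?L (?A \<inter> direction N -` S)"
    using \<open>emeasure ?L ?A \<noteq> 0\<close> \<open>emeasure ?L ?A \<noteq> \<top>\<close> by (simp add: ennreal_mult_divide_eq)
  also have "\<dots> = emeasure (gauss N) (direction N -` S \<inter> space (gauss N))" by (rule \<kappa>[OF S, symmetric])
  also have "\<dots> = emeasure (distr (gauss N) ?B (direction N)) S" by (rule emeasure_distr[symmetric]) auto
  finally show "emeasure (uniform_sphere N) S = emeasure (distr (gauss N) ?B (direction N)) S" .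
qed

lemma prob_space_uniform_sphere: "N \<ge> 1 \<Longrightarrow> prob_space (uniform_sphere N)"
  unfolding uniform_sphere_eq_gauss_direction
  by (intro prob_space.prob_space_distr prob_space_gauss) measurable

section \<open>Transfer of concentration from Gaussian vectors to the sphere\<close>

lemma gauss_lipschitz_restrict:
  assumes "gauss_lipschitz N L F"
  shows "F (restrict x {..<N}) = F x"
proof -
  have FL: "F x - F y \<le> L * cvec_norm N (\<lambda>j. x j - y j)" for x y using assms unfolding gauss_lipschitz_def by blast
  have "cvec_norm N (\<lambda>j. restrict x {..<N} j - x j) = 0" "cvec_norm N (\<lambda>j. x j - restrict x {..<N} j) = 0"
    by (auto simp: cvec_norm_def)
  then show ?thesis using FL[of "restrict x {..<N}" x] FL[of x "restrict x {..<N}"] by simp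
qed

text \<open>Homogeneity gives F x = |x| F (x / |x|), which reads the values on the sphere off a
  Gaussian vector. The intended F is the supremum over a compact set.\<close>

locale sphere_functional =
  fixes N :: nat and L :: real and F :: "(nat \<Rightarrow> complex) \<Rightarrow> real"
  assumes N: "N \<ge> 1" and L: "L > 0" and F: "gauss_lipschitz N L F"
    and hom: "\<And>c x. c > 0 \<Longrightarrow> F (\<lambda>j. complex_of_real c * x j) = c * F x"
begin

interpretation G: prob_space "gauss N" by (rule prob_space_gauss)
interpretation S: prob_space "uniform_sphere N" by (rule prob_space_uniform_sphere[OF N])

text \<open>An intermediary: the expectation and every median on the sphere are shown to be close to
  this quotient of Gaussian means.\<close>

definition center :: real where "center = (LINT x|gauss N. F x) / gauss_mean_norm N"

text \<open>The size of the fluctuations of F on the sphere, of order L / sqrt N.\<close>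

definition scale :: real where "scale = L / gauss_mean_norm N"

lemma mean_norm_pos: "gauss_mean_norm N > 0" by (rule gauss_mean_norm_pos[OF N])

lemma scale_pos: "scale > 0" unfolding scale_def using L mean_norm_pos by simp

lemma F_zero: "F (\<lambda>_. 0) = 0" using hom[of 2 "\<lambda>_. 0"] by simp

lemma abs_F_le: "\<bar>F x\<bar> \<le> L * cvec_norm N x"
proof -
  have FL: "F x - F y \<le> L * cvec_norm N (\<lambda>j. x j - y j)" for x y using F unfolding gauss_lipschitz_def by blast
  have "cvec_norm N (\<lambda>j. - x j) = cvec_norm N x" by (simp add: cvec_norm_def)
  then show ?thesis using FL[of x "\<lambda>_. 0"] FL[of "\<lambda>_. 0" x] by (simp add: F_zero abs_le_iff)
qed

lemma F_direction: "F (direction N x) * cvec_norm N x = F x"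
proof (cases "cvec_norm N x = 0")
  case True
  then show ?thesis using abs_F_le[of x] by simp
next
  case False
  then have p: "cvec_norm N x > 0" using cvec_norm_nonneg[of N x] by linarith
  have "F (direction N x) = F (\<lambda>j. complex_of_real (1 / cvec_norm N x) * x j)"
    unfolding direction_def using gauss_lipschitz_restrict[OF F, of "\<lambda>j. x j / complex_of_real (cvec_norm N x)"]
    by simp
  also have "\<dots> = 1 / cvec_norm N x * F x" by (rule hom) (use p in simp)
  finally show ?thesis using p by simp
qed

lemma abs_F_direction_le: "\<bar>F (direction N x)\<bar> \<le> L"
proof (cases "cvec_norm N x = 0")
  case True
  then have "cvec_norm N (direction N x) = 0" by (simp add: direction_def cvec_norm_def)
  then show ?thesis using abs_F_le[of "direction N x"] L by simp
next
  case False
  then have p: "cvec_norm N x > 0" using cvec_norm_nonneg[of N x] by linarith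
  have "\<bar>F (direction N x)\<bar> * cvec_norm N x = \<bar>F x\<bar>" using F_direction[of x] p abs_mult[of "F (direction N x)" "cvec_norm N x"] by simp
  also have "\<dots> \<le> L * cvec_norm N x" by (rule abs_F_le)
  finally show ?thesis using p by simp
qed

lemma F_measurable [measurable]: "F \<in> borel_measurable (Pi\<^sub>M {..<N} (\<lambda>_. borel))"
  using F unfolding gauss_lipschitz_def by blast

lemma sets_uniform_sphere [measurable_cong]: "sets (uniform_sphere N) = sets (Pi\<^sub>M {..<N} (\<lambda>_. borel))"
  unfolding uniform_sphere_def by simp

text \<open>With u the direction of x, r the mean norm and m the Gaussian mean of F, (F u - center)
  r = (F x - m) - F u (|x| - r), and |F u| <= L.\<close>

lemma deviation_le:
  "\<bar>F (direction N x) - center\<bar> \<le>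
     (\<bar>F x - (LINT x|gauss N. F x)\<bar> + L * \<bar>cvec_norm N x - gauss_mean_norm N\<bar>) / gauss_mean_norm N"
proof -
  let ?r = "gauss_mean_norm N"
  let ?m = "LINT x|gauss N. F x"
  have r: "?r > 0" by (rule mean_norm_pos)
  have "(F (direction N x) - center) * ?r = F (direction N x) * ?r - ?m" unfolding center_def using r by (simp add: field_simps)
  also have "\<dots> = (F x - ?m) - F (direction N x) * (cvec_norm N x - ?r)" using F_direction[of x] by (simp add: algebra_simps)
  finally have "\<bar>F (direction N x) - center\<bar> * ?r = \<bar>(F x - ?m) - F (direction N x) * (cvec_norm N x - ?r)\<bar>"
    using r abs_mult[of "F (direction N x) - center" ?r] by simp
  also have "\<dots> \<le> \<bar>F x - ?m\<bar> + \<bar>F (direction N x) * (cvec_norm N x - ?r)\<bar>" by (rule abs_triangle_ineq4)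
  also have "\<dots> \<le> \<bar>F x - ?m\<bar> + L * \<bar>cvec_norm N x - ?r\<bar>"
    unfolding abs_mult by (intro add_left_mono mult_right_mono abs_F_direction_le) auto
  finally show ?thesis using r by (simp add: pos_le_divide_eq)
qed

lemma integrable_sphere: "integrable (uniform_sphere N) F"
  unfolding uniform_sphere_eq_gauss_direction[OF N]
  by (subst integrable_distr_eq) (auto intro!: G.integrable_const_bound[where B = L] simp: abs_F_direction_le)

lemma integral_sphere: "(LINT a|uniform_sphere N. F a) = (LINT x|gauss N. F (direction N x))"
  unfolding uniform_sphere_eq_gauss_direction[OF N] by (subst integral_distr) auto

lemma expectation_center: "\<bar>(LINT a|uniform_sphere N. F a) - center\<bar> \<le> 8 * scale"
proof -
  let ?r = "gauss_mean_norm N"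
  let ?m = "LINT x|gauss N. F x"
  have r: "?r > 0" by (rule mean_norm_pos)
  note m1 = gauss_lipschitz_moment[OF F L, of 1, simplified]
  note m2 = gauss_lipschitz_moment[OF gauss_lipschitz_cvec_norm, of 1, simplified, folded gauss_mean_norm_def]
  have i1: "integrable (gauss N) (\<lambda>x. F (direction N x))"
    by (auto intro!: G.integrable_const_bound[where B = L] simp: abs_F_direction_le)
  have "\<bar>(LINT a|uniform_sphere N. F a) - center\<bar> = \<bar>LINT x|gauss N. F (direction N x) - center\<bar>"
    unfolding integral_sphere using i1 by (simp add: G.prob_space)
  also have "\<dots> \<le> (LINT x|gauss N. \<bar>F (direction N x) - center\<bar>)" by (rule integral_abs_bound)
  also have "\<dots> \<le> (LINT x|gauss N. (\<bar>F x - ?m\<bar> + L * \<bar>cvec_norm N x - ?r\<bar>) / ?r)"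
    using i1 m1(1) m2(1) by (intro integral_mono deviation_le) auto
  also have "\<dots> = ((LINT x|gauss N. \<bar>F x - ?m\<bar>) + L * (LINT x|gauss N. \<bar>cvec_norm N x - ?r\<bar>)) / ?r"
    using m1(1) m2(1) by simp
  also have "\<dots> \<le> (4 * L + L * 4) / ?r"
    using m1(2) m2(2) L r by (intro divide_right_mono add_mono mult_left_mono) auto
  also have "\<dots> = 8 * scale" unfolding scale_def by simp
  finally show ?thesis .
qed

text \<open>A deviation above t forces one of the two terms in \<open>deviation_le\<close> to supply
  at least half of r t, with r the mean norm. Both events have the same Gaussian bound because L t /
  (2 scale) = r t / 2.\<close>

lemma tail_center:
  assumes t: "t \<ge> 0"
  shows "measure (uniform_sphere N) {a \<in> space (uniform_sphere N). t < \<bar>F a - center\<bar>} \<le> 4 * exp (- t\<^sup>2 / (8 * scale\<^sup>2))"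
proof -
  let ?r = "gauss_mean_norm N"
  let ?m = "LINT x|gauss N. F x"
  have r: "?r > 0" by (rule mean_norm_pos)
  let ?E1 = "{x \<in> space (gauss N). ?r * t / 2 \<le> \<bar>F x - ?m\<bar>}"
  let ?E2 = "{x \<in> space (gauss N). t / (2 * scale) \<le> \<bar>cvec_norm N x - ?r\<bar>}"
  have "measure (uniform_sphere N) {a \<in> space (uniform_sphere N). t < \<bar>F a - center\<bar>} =
      measure (gauss N) (direction N -` {a \<in> space (uniform_sphere N). t < \<bar>F a - center\<bar>} \<inter> space (gauss N))"
    unfolding uniform_sphere_eq_gauss_direction[OF N] by (rule measure_distr) auto
  also have "\<dots> \<le> measure (gauss N) (?E1 \<union> ?E2)"
  proof (rule G.finite_measure_mono)
    show "direction N -` {a \<in> space (uniform_sphere N). t < \<bar>F a - center\<bar>} \<inter> space (gauss N) \<subseteq> ?E1 \<union> ?E2"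
    proof
      fix x assume x: "x \<in> direction N -` {a \<in> space (uniform_sphere N). t < \<bar>F a - center\<bar>} \<inter> space (gauss N)"
      then have "t < (\<bar>F x - ?m\<bar> + L * \<bar>cvec_norm N x - ?r\<bar>) / ?r" using deviation_le[of x] by auto
      then have *: "?r * t < \<bar>F x - ?m\<bar> + L * \<bar>cvec_norm N x - ?r\<bar>" using r by (simp add: pos_less_divide_eq mult.commute)
      show "x \<in> ?E1 \<union> ?E2"
      proof (rule ccontr)
        assume n: "x \<notin> ?E1 \<union> ?E2"
        then have a: "\<bar>F x - ?m\<bar> < ?r * t / 2" and b: "\<bar>cvec_norm N x - ?r\<bar> < t / (2 * scale)" using x by auto
        have "L * \<bar>cvec_norm N x - ?r\<bar> < L * (t / (2 * scale))" using b L by (rule mult_strict_left_mono)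
        also have "\<dots> = ?r * t / 2" unfolding scale_def using L r by (simp add: field_simps)
        finally show False using a * by linarith
      qed
    qed
  qed measurable
  also have "\<dots> \<le> measure (gauss N) ?E1 + measure (gauss N) ?E2"
    by (rule measure_Un_le; measurable)
  also have "\<dots> \<le> 2 * exp (- t\<^sup>2 / (8 * scale\<^sup>2)) + 2 * exp (- t\<^sup>2 / (8 * scale\<^sup>2))"
  proof (rule add_mono)
    have "measure (gauss N) ?E1 \<le> 2 * exp (- (?r * t / 2)\<^sup>2 / (2 * L\<^sup>2))"
      by (rule gauss_lipschitz_tail[OF F L]) (use r t in simp)
    also have "- (?r * t / 2)\<^sup>2 / (2 * L\<^sup>2) = - t\<^sup>2 / (8 * scale\<^sup>2)"
      unfolding scale_def using L r by (simp add: field_simps power2_eq_square)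
    finally show "measure (gauss N) ?E1 \<le> 2 * exp (- t\<^sup>2 / (8 * scale\<^sup>2))" .
    have "measure (gauss N) ?E2 \<le> 2 * exp (- (t / (2 * scale))\<^sup>2 / (2 * 1\<^sup>2))"
      unfolding gauss_mean_norm_def
      by (rule gauss_lipschitz_tail[OF gauss_lipschitz_cvec_norm]) (use scale_pos t in simp_all)
    also have "- (t / (2 * scale))\<^sup>2 / (2 * 1\<^sup>2) = - t\<^sup>2 / (8 * scale\<^sup>2)"
      using scale_pos by (simp add: field_simps power2_eq_square)
    finally show "measure (gauss N) ?E2 \<le> 2 * exp (- t\<^sup>2 / (8 * scale\<^sup>2))" .
  qed
  finally show ?thesis by simp
qed

text \<open>At distance 5 scale the tail is at most 4 exp (- 25/8) < 1/2, so no median lies farther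
  out.\<close>

lemma median_center:
  assumes med: "is_median (uniform_sphere N) F \<mu>"
  shows "\<bar>\<mu> - center\<bar> \<le> 5 * scale"
proof (rule ccontr)
  assume n: "\<not> ?thesis"
  let ?S = "uniform_sphere N"
  have "4 * exp (- (5 * scale)\<^sup>2 / (8 * scale\<^sup>2)) < 1 / 2"
  proof -
    have "- (5 * scale)\<^sup>2 / (8 * scale\<^sup>2) = - (25 / 8)" using scale_pos by (simp add: power_mult_distrib field_simps)
    moreover have "exp (- (25 / 8)) < 1 / (8 :: real)"
    proof -
      have "(8::real) = 2 ^ 3" by simp
      also have "\<dots> \<le> exp 1 ^ 3" using exp_ge_add_one_self[of "1::real"] by (intro power_mono) auto
      also have "\<dots> = exp 3" by (simp add: exp_of_nat_mult[symmetric])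
      also have "\<dots> < exp (25 / 8)" by simp
      finally show ?thesis by (simp add: exp_minus field_simps)
    qed
    ultimately show ?thesis using scale_pos by simp
  qed
  then have small: "measure ?S {a \<in> space ?S. 5 * scale < \<bar>F a - center\<bar>} < 1 / 2"
    using tail_center[of "5 * scale"] scale_pos by linarith
  have h: "measure ?S {a \<in> space ?S. F a \<le> \<mu>} \<ge> 1 / 2" "measure ?S {a \<in> space ?S. F a \<ge> \<mu>} \<ge> 1 / 2"
    using med unfolding is_median_def by auto
  consider "\<mu> > center + 5 * scale" | "\<mu> < center - 5 * scale" using n by linarith
  then show False
  proof cases
    case 1
    then have "measure ?S {a \<in> space ?S. F a \<ge> \<mu>} \<le> measure ?S {a \<in> space ?S. 5 * scale < \<bar>F a - center\<bar>}"
      by (intro S.finite_measure_mono) auto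
    then show False using h small by linarith
  next
    case 2
    then have "measure ?S {a \<in> space ?S. F a \<le> \<mu>} \<le> measure ?S {a \<in> space ?S. 5 * scale < \<bar>F a - center\<bar>}"
      by (intro S.finite_measure_mono) auto
    then show False using h small by linarith
  qed
qed

lemma median_expectation:
  assumes med: "is_median (uniform_sphere N) F \<mu>"
  shows "\<bar>\<mu> - (LINT a|uniform_sphere N. F a)\<bar> \<le> 13 * scale"
  using median_center[OF med] expectation_center by linarith

text \<open>For t <= 10 scale the bound is trivial, since 2 exp (- 1/2) >= 1. Beyond that the step
  from the median to the center costs at most 5 scale < t / 2, and the gap between the rates 1/32
  and 1/200 turns the factor 4 into 2. The bound \<open>A\<close> for the scale makes the rate
  uniform over the weights.\<close>

lemma tail_median:
  assumes med: "is_median (uniform_sphere N) F \<mu>" and t: "t > 0" and A: "scale \<le> A"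
  shows "measure (uniform_sphere N) {a \<in> space (uniform_sphere N). \<bar>F a - \<mu>\<bar> > t} \<le> 2 * exp (- (1 / (200 * A\<^sup>2)) * t\<^sup>2)"
proof -
  let ?S = "uniform_sphere N"
  have "measure ?S {a \<in> space ?S. \<bar>F a - \<mu>\<bar> > t} \<le> 2 * exp (- (1 / (200 * scale\<^sup>2)) * t\<^sup>2)"
  proof (cases "t \<le> 10 * scale")
    case True
    have "measure ?S {a \<in> space ?S. \<bar>F a - \<mu>\<bar> > t} \<le> 1" by (rule S.prob_le_1)
    also have "1 \<le> 2 * exp (- (1 / (200 * scale\<^sup>2)) * t\<^sup>2)"
    proof -
      have "t\<^sup>2 \<le> (10 * scale)\<^sup>2" using True t by (intro power_mono) auto
      then have "- (1 / 2) \<le> - (1 / (200 * scale\<^sup>2)) * t\<^sup>2"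
        using scale_pos by (simp add: field_simps)
      then have "exp (- (1 / 2)) \<le> exp (- (1 / (200 * scale\<^sup>2)) * t\<^sup>2)" by (simp only: exp_le_cancel_iff)
      moreover have "1 / 2 \<le> exp (- (1 / 2) :: real)" using exp_ge_add_one_self[of "- (1/2)::real"] by simp
      ultimately have "1 / 2 \<le> exp (- (1 / (200 * scale\<^sup>2)) * t\<^sup>2)" by linarith
      then show ?thesis by simp
    qed
    finally show ?thesis .
  next
    case False
    have "measure ?S {a \<in> space ?S. \<bar>F a - \<mu>\<bar> > t} \<le> measure ?S {a \<in> space ?S. t / 2 < \<bar>F a - center\<bar>}"
    proof (rule S.finite_measure_mono)
      have "t / 2 < \<bar>F a - center\<bar>" if "\<bar>F a - \<mu>\<bar> > t" for a
        using median_center[OF med] False that by linarith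
      then show "{a \<in> space ?S. \<bar>F a - \<mu>\<bar> > t} \<subseteq> {a \<in> space ?S. t / 2 < \<bar>F a - center\<bar>}" by auto
    qed measurable
    also have "\<dots> \<le> 4 * exp (- (t / 2)\<^sup>2 / (8 * scale\<^sup>2))" by (rule tail_center) (use t in simp)
    also have "\<dots> \<le> 2 * exp (- (1 / (200 * scale\<^sup>2)) * t\<^sup>2)"
    proof -
      have "(10 * scale)\<^sup>2 \<le> t\<^sup>2" using False scale_pos by (intro power_mono) auto
      then have b: "100 \<le> t\<^sup>2 / scale\<^sup>2" using scale_pos by (simp add: field_simps)
      define u where "u = t\<^sup>2 / scale\<^sup>2"
      have e1: "- (t / 2)\<^sup>2 / (8 * scale\<^sup>2) = - (u / 32)"
      proof -
        have "2\<^sup>2 * (8 * s) = s * 32" for s :: real by simp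
        then show ?thesis by (simp only: u_def power_divide minus_divide_left[symmetric] divide_divide_eq_left)
      qed
      have e2: "- (1 / (200 * scale\<^sup>2)) * t\<^sup>2 = - (u / 200)"
      proof -
        have "1 / (200 * s) * q = q / s / 200" for s q :: real by (cases "s = 0") (auto simp: field_simps)
        then show ?thesis by (simp only: u_def mult_minus_left)
      qed
      have "100 \<le> u" using b by (simp only: u_def)
      then have "2 \<le> 1 + (u / 32 - u / 200)" by linarith
      also have "\<dots> \<le> exp (u / 32 - u / 200)" by (rule exp_ge_add_one_self)
      finally have "2 * exp (- (u / 32)) \<le> exp (u / 32 - u / 200) * exp (- (u / 32))" by (intro mult_right_mono) auto
      also have "\<dots> = exp (- (u / 200))" by (simp add: exp_add[symmetric])
      finally show ?thesis unfolding e1 e2 by simp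
    qed
    finally show ?thesis .
  qed
  also have "\<dots> \<le> 2 * exp (- (1 / (200 * A\<^sup>2)) * t\<^sup>2)"
  proof -
    have "scale\<^sup>2 \<le> A\<^sup>2" using A scale_pos by (intro power_mono) auto
    moreover have "0 < A" using A scale_pos by linarith
    ultimately have "1 / (200 * A\<^sup>2) \<le> 1 / (200 * scale\<^sup>2)" using scale_pos by (intro divide_left_mono) auto
    then have "1 / (200 * A\<^sup>2) * t\<^sup>2 \<le> 1 / (200 * scale\<^sup>2) * t\<^sup>2" by (rule mult_right_mono) simp
    then show ?thesis by simp
  qed
  finally show ?thesis .
qed

end

section \<open>Mean values over squares\<close>

text \<open>Squares instead of discs, so that Cauchy's formula runs over straight sides and Fubini
  applies in Cartesian coordinates.\<close>

definition square :: "complex \<Rightarrow> real \<Rightarrow> complex set" where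
  "square z \<rho> = {w. \<bar>Re w - Re z\<bar> \<le> \<rho> \<and> \<bar>Im w - Im z\<bar> \<le> \<rho>}"

lemma square_closed [simp]: "closed (square z \<rho>)"
  unfolding square_def by (intro closed_Collect_conj closed_Collect_le continuous_intros)

lemma square_measurable [measurable]: "square z \<rho> \<in> sets borel"
  by (rule borel_closed) simp

lemma norm_contour_integral_linepath_le:
  assumes h: "continuous_on (closed_segment p q) h"
  shows "ennreal (cmod (contour_integral (linepath p q) h)) \<le>
    (\<integral>\<^sup>+t. ennreal (cmod (h (linepath p q t)) * cmod (q - p)) * indicator {0..1} t \<partial>lborel)"
proof -
  have c: "continuous_on {0..1} (\<lambda>t. h (linepath p q t) * (q - p))"
    by (intro continuous_intros continuous_on_compose2[OF h]) (auto simp: linepath_in_path)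
  have i: "set_integrable lborel {0..1} (\<lambda>t. h (linepath p q t) * (q - p))"
    by (rule borel_integrable_atLeastAtMost'[OF c])
  have "contour_integral (linepath p q) h = integral {0..1} (\<lambda>t. h (linepath p q t) * (q - p))"
    by (simp add: contour_integral_integral)
  also have "\<dots> = (LINT t:{0..1}|lborel. h (linepath p q t) * (q - p))"
    by (rule set_borel_integral_eq_integral(2)[OF i, symmetric])
  finally have "ennreal (cmod (contour_integral (linepath p q) h)) \<le> (\<integral>\<^sup>+t. ennreal (cmod (indicator {0..1} t *\<^sub>R (h (linepath p q t) * (q - p)))) \<partial>lborel)"
    unfolding set_lebesgue_integral_def
    using i by (simp only:) (rule integral_norm_bound_ennreal, simp add: set_integrable_def)
  also have "\<dots> = (\<integral>\<^sup>+t. ennreal (cmod (h (linepath p q t)) * cmod (q - p)) * indicator {0..1} t \<partial>lborel)"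
    by (intro nn_integral_cong) (auto simp: norm_mult split: split_indicator)
  finally show ?thesis .
qed

text \<open>
  Averaging Cauchy's formula over squares of varying size turns line integrals into area integrals;
  each side of the squares is treated separately.
\<close>

lemma nn_integral_sweep_side:
  fixes G :: "real \<Rightarrow> real \<Rightarrow> ennreal"
  assumes [measurable]: "case_prod G \<in> borel_measurable (borel \<Otimes>\<^sub>M borel)"
    and \<rho>: "\<rho> > 0" and \<sigma>: "\<sigma> = 1 \<or> \<sigma> = -1" and \<epsilon>: "\<epsilon> = 1 \<or> \<epsilon> = -1"
  shows "(\<integral>\<^sup>+s. (\<integral>\<^sup>+t. G (\<sigma> * s) (\<epsilon> * (s * (2 * t - 1))) * indicator {0..1} t \<partial>lborel) * indicator {\<rho>/2..\<rho>} s \<partial>lborel)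
    \<le> ennreal (1 / \<rho>) * (\<integral>\<^sup>+x. \<integral>\<^sup>+y. G x y * indicator {-\<rho>..\<rho>} x * indicator {-\<rho>..\<rho>} y \<partial>lborel \<partial>lborel)"
proof -
  have inner: "(\<integral>\<^sup>+t. G (\<sigma> * s) (\<epsilon> * (s * (2 * t - 1))) * indicator {0..1} t \<partial>lborel) \<le>
      ennreal (1 / \<rho>) * (\<integral>\<^sup>+y. G (\<sigma> * s) y * indicator {-\<rho>..\<rho>} y \<partial>lborel)" if s: "s \<in> {\<rho>/2..\<rho>}" for s
  proof -
    have sp: "s > 0" "\<rho> \<le> 2 * s" "s \<le> \<rho>" using s \<rho> by auto
    have aff: "(\<integral>\<^sup>+y. G (\<sigma> * s) y * indicator {-\<rho>..\<rho>} y \<partial>lborel) =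
        ennreal \<bar>\<epsilon> * (2 * s)\<bar> * (\<integral>\<^sup>+t. G (\<sigma> * s) (- \<epsilon> * s + (\<epsilon> * (2 * s)) * t) * indicator {-\<rho>..\<rho>} (- \<epsilon> * s + (\<epsilon> * (2 * s)) * t) \<partial>lborel)"
      using sp \<epsilon> by (intro nn_integral_real_affine) auto
    have "(\<integral>\<^sup>+t. G (\<sigma> * s) (\<epsilon> * (s * (2 * t - 1))) * indicator {0..1} t \<partial>lborel) \<le>
       (\<integral>\<^sup>+t. G (\<sigma> * s) (- \<epsilon> * s + (\<epsilon> * (2 * s)) * t) * indicator {-\<rho>..\<rho>} (- \<epsilon> * s + (\<epsilon> * (2 * s)) * t) \<partial>lborel)"
    proof (rule nn_integral_mono)
      fix t
      have eq: "- \<epsilon> * s + (\<epsilon> * (2 * s)) * t = \<epsilon> * (s * (2 * t - 1))" by (simp add: algebra_simps)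
      have "\<bar>\<epsilon> * (s * (2 * t - 1))\<bar> \<le> \<rho>" if "t \<in> {0..1}"
      proof -
        have "\<bar>2 * t - 1\<bar> \<le> 1" using that by auto
        then have "s * \<bar>2 * t - 1\<bar> \<le> s * 1" using sp by (intro mult_left_mono) auto
        then have "s * \<bar>2 * t - 1\<bar> \<le> \<rho>" using sp by linarith
        then show ?thesis using sp \<epsilon> by (auto simp: abs_mult)
      qed
      then show "G (\<sigma> * s) (\<epsilon> * (s * (2 * t - 1))) * indicator {0..1} t \<le>
          G (\<sigma> * s) (- \<epsilon> * s + (\<epsilon> * (2 * s)) * t) * indicator {-\<rho>..\<rho>} (- \<epsilon> * s + (\<epsilon> * (2 * s)) * t)"
        unfolding eq by (auto split: split_indicator simp: abs_le_iff)
    qed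
    also have "\<dots> = ennreal (1 / (2 * s)) * (\<integral>\<^sup>+y. G (\<sigma> * s) y * indicator {-\<rho>..\<rho>} y \<partial>lborel)"
    proof -
      have "ennreal (1 / (2 * s)) * ennreal \<bar>\<epsilon> * (2 * s)\<bar> = 1" using sp \<epsilon> by (auto simp: ennreal_mult[symmetric])
      then show ?thesis unfolding aff by (simp only: mult.assoc[symmetric] mult_1)
    qed
    \<comment> \<open>Here s >= \<rho> / 2 is used.\<close>
    also have "\<dots> \<le> ennreal (1 / \<rho>) * (\<integral>\<^sup>+y. G (\<sigma> * s) y * indicator {-\<rho>..\<rho>} y \<partial>lborel)"
      using sp \<rho> by (intro mult_right_mono ennreal_leI divide_left_mono) auto
    finally show ?thesis .
  qed
  have "(\<integral>\<^sup>+s. (\<integral>\<^sup>+t. G (\<sigma> * s) (\<epsilon> * (s * (2 * t - 1))) * indicator {0..1} t \<partial>lborel) * indicator {\<rho>/2..\<rho>} s \<partial>lborel)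
     \<le> (\<integral>\<^sup>+s. ennreal (1 / \<rho>) * ((\<integral>\<^sup>+y. G (\<sigma> * s) y * indicator {-\<rho>..\<rho>} y \<partial>lborel) * indicator {-\<rho>..\<rho>} (\<sigma> * s)) \<partial>lborel)"
  proof (rule nn_integral_mono)
    fix s :: real
    show "(\<integral>\<^sup>+t. G (\<sigma> * s) (\<epsilon> * (s * (2 * t - 1))) * indicator {0..1} t \<partial>lborel) * indicator {\<rho>/2..\<rho>} s
       \<le> ennreal (1 / \<rho>) * ((\<integral>\<^sup>+y. G (\<sigma> * s) y * indicator {-\<rho>..\<rho>} y \<partial>lborel) * indicator {-\<rho>..\<rho>} (\<sigma> * s))"
    proof (cases "s \<in> {\<rho>/2..\<rho>}")
      case True
      then have "\<sigma> * s \<in> {-\<rho>..\<rho>}" using \<rho> \<sigma> by auto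
      then show ?thesis using inner[OF True] True by simp
    qed simp
  qed
  also have "\<dots> = ennreal (1 / \<rho>) * (\<integral>\<^sup>+s. (\<integral>\<^sup>+y. G (\<sigma> * s) y * indicator {-\<rho>..\<rho>} y \<partial>lborel) * indicator {-\<rho>..\<rho>} (\<sigma> * s) \<partial>lborel)"
    by (rule nn_integral_cmult) measurable
  also have "(\<integral>\<^sup>+s. (\<integral>\<^sup>+y. G (\<sigma> * s) y * indicator {-\<rho>..\<rho>} y \<partial>lborel) * indicator {-\<rho>..\<rho>} (\<sigma> * s) \<partial>lborel) =
     (\<integral>\<^sup>+x. (\<integral>\<^sup>+y. G x y * indicator {-\<rho>..\<rho>} y \<partial>lborel) * indicator {-\<rho>..\<rho>} x \<partial>lborel)"
    using nn_integral_real_affine[of "\<lambda>x. (\<integral>\<^sup>+y. G x y * indicator {-\<rho>..\<rho>} y \<partial>lborel) * indicator {-\<rho>..\<rho>} x" \<sigma> 0] \<sigma>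
    by auto
  also have "\<dots> = (\<integral>\<^sup>+x. \<integral>\<^sup>+y. G x y * indicator {-\<rho>..\<rho>} x * indicator {-\<rho>..\<rho>} y \<partial>lborel \<partial>lborel)"
    by (intro nn_integral_cong, subst nn_integral_multc[symmetric]) (auto simp: mult_ac)
  finally show ?thesis .
qed

lemma Cauchy_square_mean:
  assumes g: "g holomorphic_on S" "convex S" "open S" and sub: "square z \<rho> \<subseteq> S" and \<rho>: "\<rho> > 0"
  shows "ennreal (cmod (g z)) \<le> ennreal (8 / \<rho>\<^sup>2) * (\<integral>\<^sup>+w. ennreal (cmod (g w)) * indicator (square z \<rho>) w \<partial>lborel)"
proof -
  define u where "u w = ennreal (indicator (square z \<rho>) w *\<^sub>R cmod (g w))" for w
  have um[measurable]: "u \<in> borel_measurable borel"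
  proof -
    have "continuous_on (square z \<rho>) (\<lambda>w. cmod (g w))"
      using holomorphic_on_imp_continuous_on[OF g(1)] sub by (intro continuous_intros) (rule continuous_on_subset)
    then have "(\<lambda>w. indicator (square z \<rho>) w *\<^sub>R cmod (g w)) \<in> borel_measurable borel"
      by (intro borel_measurable_continuous_on_indicator) auto
    then show ?thesis unfolding u_def by measurable
  qed
  have u: "u w = ennreal (cmod (g w))" if "w \<in> square z \<rho>" for w using that by (simp add: u_def)
  define I where "I = (\<integral>\<^sup>+w. u w \<partial>lborel)"
  define G where "G x y = u (z + Complex x y)" for x y
  have Gm[measurable]: "case_prod G \<in> borel_measurable (borel \<Otimes>\<^sub>M borel)"
    unfolding G_def[abs_def] Complex_eq by measurable
  have Gm'[measurable]: "(\<lambda>(x, y). G y x) \<in> borel_measurable (borel \<Otimes>\<^sub>M borel)"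
    by measurable
  have Iyx: "(\<integral>\<^sup>+y. \<integral>\<^sup>+x. G x y \<partial>lborel \<partial>lborel) = I"
  proof -
    have "I = (\<integral>\<^sup>+w. u (z + w) \<partial>lborel)"
      unfolding I_def by (subst lborel_distr_plus[of z, symmetric]) (simp add: nn_integral_distr)
    also have "\<dots> = (\<integral>\<^sup>+y. \<integral>\<^sup>+x. G x y \<partial>lborel \<partial>lborel)"
      unfolding G_def by (rule borel_measurable_nn_integral_Complex) measurable
    finally show ?thesis ..
  qed
  have Ixy: "(\<integral>\<^sup>+x. \<integral>\<^sup>+y. G x y \<partial>lborel \<partial>lborel) = I"
    unfolding Iyx[symmetric] by (rule lborel_pair.Fubini') (simp add: case_prod_beta)
  have le: "(\<integral>\<^sup>+x. \<integral>\<^sup>+y. G' x y * indicator {-\<rho>..\<rho>} x * indicator {-\<rho>..\<rho>} y \<partial>lborel \<partial>lborel) \<le> (\<integral>\<^sup>+x. \<integral>\<^sup>+y. G' x y \<partial>lborel \<partial>lborel)" for G' :: "real \<Rightarrow> real \<Rightarrow> ennreal"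
    by (intro nn_integral_mono) (auto split: split_indicator)
  \<comment> \<open>\<open>X\<close> averages |g| over a vertical side and \<open>Y\<close> over a
    horizontal side of the square of half side s. The sign \<sigma> selects the side, \<epsilon> the
    direction in which it is traversed.\<close>
  define X where "X \<sigma> \<epsilon> s = (\<integral>\<^sup>+t. G (\<sigma> * s) (\<epsilon> * (s * (2 * t - 1))) * indicator {0..1} t \<partial>lborel)" for \<sigma> \<epsilon> s :: real
  define Y where "Y \<sigma> \<epsilon> s = (\<integral>\<^sup>+t. G (\<epsilon> * (s * (2 * t - 1))) (\<sigma> * s) * indicator {0..1} t \<partial>lborel)" for \<sigma> \<epsilon> s :: real
  have X: "(\<integral>\<^sup>+s. X \<sigma> \<epsilon> s * indicator {\<rho>/2..\<rho>} s \<partial>lborel) \<le> ennreal (1 / \<rho>) * I"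
    if "\<sigma> = 1 \<or> \<sigma> = -1" "\<epsilon> = 1 \<or> \<epsilon> = -1" for \<sigma> \<epsilon>
    unfolding X_def by (rule order_trans[OF nn_integral_sweep_side[OF Gm \<rho> that]])
      (intro mult_left_mono, simp_all add: order_trans[OF le] Ixy)
  have Y: "(\<integral>\<^sup>+s. Y \<sigma> \<epsilon> s * indicator {\<rho>/2..\<rho>} s \<partial>lborel) \<le> ennreal (1 / \<rho>) * I"
    if "\<sigma> = 1 \<or> \<sigma> = -1" "\<epsilon> = 1 \<or> \<epsilon> = -1" for \<sigma> \<epsilon>
    unfolding Y_def by (rule order_trans[OF nn_integral_sweep_side[OF Gm' \<rho> that]])
      (intro mult_left_mono, simp_all add: order_trans[OF le] Iyx)
  have [measurable]: "X \<sigma> \<epsilon> \<in> borel_measurable borel" "Y \<sigma> \<epsilon> \<in> borel_measurable borel" for \<sigma> \<epsilon>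
    unfolding X_def[abs_def] Y_def[abs_def] G_def Complex_eq by measurable
  \<comment> \<open>Cauchy's formula on the square of half side s: a side has length 2 s and
    distance s from z, so it contributes at most twice the average of |g| over it.\<close>
  have main: "ennreal (2 * pi * cmod (g z)) \<le> 2 * (Y (-1) 1 s + X 1 1 s + Y 1 (-1) s + X (-1) (-1) s)"
    if s: "s \<in> {\<rho>/2..\<rho>}" for s
  proof -
    have sp: "s > 0" "s \<le> \<rho>" using s \<rho> by auto
    define a where "a = z + Complex (- s) (- s)"
    define b where "b = z + Complex s s"
    define h where "h w = g w / (w - z)" for w
    have zbox: "z \<in> box a b" unfolding a_def b_def using sp by (auto simp: box_def Basis_complex_def)
    have cb: "cbox a b \<subseteq> square z \<rho>" unfolding a_def b_def square_def using sp by (auto simp: in_cbox_complex_iff)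
    have img: "path_image (rectpath a b) \<subseteq> cbox a b - {z}"
    proof -
      have "path_image (rectpath a b) = cbox a b - box a b"
        by (rule path_image_rectpath_cbox_minus_box) (use sp in \<open>auto simp: a_def b_def\<close>)
      then show ?thesis using zbox by auto
    qed
    have zS: "z \<in> interior S" using sub \<rho> g(3) by (auto simp: interior_open square_def)
    have ci: "(h has_contour_integral (2 * pi * \<i> * winding_number (rectpath a b) z * g z)) (rectpath a b)"
      unfolding h_def
      by (rule Cauchy_integral_formula_convex_simple[OF g(2,1) zS]) (use img cb sub in auto)
    have w1: "winding_number (rectpath a b) z = 1" by (rule winding_number_rectpath[OF zbox])
    let ?p2 = "Complex (Re b) (Im a)" and ?p4 = "Complex (Re a) (Im b)"
    have imgs: "closed_segment a ?p2 \<subseteq> path_image (rectpath a b)" "closed_segment ?p2 b \<subseteq> path_image (rectpath a b)"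
       "closed_segment b ?p4 \<subseteq> path_image (rectpath a b)" "closed_segment ?p4 a \<subseteq> path_image (rectpath a b)"
      unfolding rectpath_def Let_def by (auto simp: path_image_join)
    have hc: "continuous_on (closed_segment p q) h" if "closed_segment p q \<subseteq> path_image (rectpath a b)" for p q
      unfolding h_def
    proof (intro continuous_intros)
      show "continuous_on (closed_segment p q) g"
        using holomorphic_on_imp_continuous_on[OF g(1)] that img cb sub by (meson Diff_subset continuous_on_subset order_trans)
    qed (use that img in auto)
    have ii: "h contour_integrable_on (linepath p q)" if "closed_segment p q \<subseteq> path_image (rectpath a b)" for p q
      by (rule contour_integrable_continuous_linepath[OF hc[OF that]])
    have "contour_integral (rectpath a b) h = contour_integral (linepath a ?p2) h + (contour_integral (linepath ?p2 b) h
        + (contour_integral (linepath b ?p4) h + contour_integral (linepath ?p4 a) h))"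
      unfolding rectpath_def Let_def using imgs
      by (subst contour_integral_join; (intro valid_path_join contour_integrable_joinI ii valid_path_linepath)?; simp)+
    then have "cmod (2 * pi * \<i> * g z) \<le> cmod (contour_integral (linepath a ?p2) h) + cmod (contour_integral (linepath ?p2 b) h)
        + cmod (contour_integral (linepath b ?p4) h) + cmod (contour_integral (linepath ?p4 a) h)"
      using contour_integral_unique[OF ci] unfolding w1
      by (simp only: mult_1_right) (smt (verit) norm_triangle_ineq)
    then have "ennreal (2 * pi * cmod (g z)) \<le> ennreal (cmod (contour_integral (linepath a ?p2) h)) + ennreal (cmod (contour_integral (linepath ?p2 b) h))
        + ennreal (cmod (contour_integral (linepath b ?p4) h)) + ennreal (cmod (contour_integral (linepath ?p4 a) h))"
      by (simp add: norm_mult ennreal_plus[symmetric] ennreal_leI del: ennreal_plus)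
    also have "\<dots> \<le> 2 * Y (-1) 1 s + 2 * X 1 1 s + 2 * Y 1 (-1) s + 2 * X (-1) (-1) s"
    proof -
      have side: "ennreal (cmod (contour_integral (linepath p q) h)) \<le> 2 * (\<integral>\<^sup>+t. Z t * indicator {0..1} t \<partial>lborel)"
        if pq: "closed_segment p q \<subseteq> path_image (rectpath a b)" "cmod (q - p) = 2 * s"
          and Z: "\<And>t. t \<in> {0..1} \<Longrightarrow> Z t = u (linepath p q t)" and d: "\<And>t. t \<in> {0..1} \<Longrightarrow> s \<le> cmod (linepath p q t - z)"
          and Zm: "Z \<in> borel_measurable borel"
        for p q Z
      proof -
        have "ennreal (cmod (contour_integral (linepath p q) h)) \<le> (\<integral>\<^sup>+t. ennreal (cmod (h (linepath p q t)) * cmod (q - p)) * indicator {0..1} t \<partial>lborel)"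
          by (rule norm_contour_integral_linepath_le[OF hc[OF pq(1)]])
        also have "\<dots> \<le> (\<integral>\<^sup>+t. 2 * (Z t * indicator {0..1} t) \<partial>lborel)"
        proof (rule nn_integral_mono)
          fix t :: real
          show "ennreal (cmod (h (linepath p q t)) * cmod (q - p)) * indicator {0..1} t \<le> 2 * (Z t * indicator {0..1} t)"
          proof (cases "t \<in> {0..1}")
            case True
            let ?w = "linepath p q t"
            have "?w \<in> closed_segment p q" using True by (simp add: linepath_in_path)
            then have sq: "?w \<in> square z \<rho>" using pq(1) img cb by auto
            have "cmod (h ?w) * cmod (q - p) = cmod (g ?w) * (2 * s) / cmod (?w - z)"
              unfolding h_def pq(2) by (simp add: norm_divide)
            also have "\<dots> \<le> cmod (g ?w) * (2 * s) / s"
              using d[OF True] sp by (intro divide_left_mono mult_nonneg_nonneg mult_pos_pos) auto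
            also have "\<dots> = 2 * cmod (g ?w)" using sp by simp
            finally have "ennreal (cmod (h ?w) * cmod (q - p)) \<le> ennreal (2 * cmod (g ?w))" by (rule ennreal_leI)
            then show ?thesis using True by (simp add: Z[OF True] u[OF sq] ennreal_mult')
          qed simp
        qed
        also have "\<dots> = 2 * (\<integral>\<^sup>+t. Z t * indicator {0..1} t \<partial>lborel)"
          using Zm by (intro nn_integral_cmult) simp
        finally show ?thesis .
      qed
      have lp: "linepath a ?p2 t = z + Complex (s * (2 * t - 1)) (- s)" "linepath ?p2 b t = z + Complex s (s * (2 * t - 1))"
        "linepath b ?p4 t = z + Complex (- (s * (2 * t - 1))) s" "linepath ?p4 a t = z + Complex (- s) (- (s * (2 * t - 1)))" for t
        unfolding linepath_def a_def b_def by (auto simp: complex_eq_iff algebra_simps)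
      have cR: "s \<le> cmod (Complex x y)" if "\<bar>x\<bar> = s \<or> \<bar>y\<bar> = s" for x y
        using that abs_Re_le_cmod[of "Complex x y"] abs_Im_le_cmod[of "Complex x y"] by auto
      have len: "cmod (?p2 - a) = 2 * s" "cmod (b - ?p2) = 2 * s" "cmod (?p4 - b) = 2 * s" "cmod (a - ?p4) = 2 * s"
        using sp by (auto simp: a_def b_def cmod_def real_sqrt_mult)
      have m1: "(\<lambda>t. G (c * (s * (2 * t - 1))) d) \<in> borel_measurable borel" "(\<lambda>t. G d (c * (s * (2 * t - 1)))) \<in> borel_measurable borel" for c d
        unfolding G_def Complex_eq by measurable
      show ?thesis unfolding X_def Y_def using sp
        by (intro add_mono side imgs len m1) (auto simp: lp G_def intro!: cR)
    qed
    finally show ?thesis by (simp add: distrib_left)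
  qed
  \<comment> \<open>Integration over s in [\<rho>/2, \<rho>] turns each of the four averages into at
    most I / \<rho>, which gives pi \<rho> |g z| <= 8 I / \<rho>.\<close>
  have "ennreal (2 * pi * cmod (g z)) * ennreal (\<rho> / 2) = (\<integral>\<^sup>+s. ennreal (2 * pi * cmod (g z)) * indicator {\<rho>/2..\<rho>} s \<partial>lborel)"
    using \<rho> by (simp add: nn_integral_cmult)
  also have "\<dots> \<le> (\<integral>\<^sup>+s. 2 * (Y (-1) 1 s * indicator {\<rho>/2..\<rho>} s + X 1 1 s * indicator {\<rho>/2..\<rho>} s + Y 1 (-1) s * indicator {\<rho>/2..\<rho>} s + X (-1) (-1) s * indicator {\<rho>/2..\<rho>} s) \<partial>lborel)"
    by (intro nn_integral_mono) (use main in \<open>auto split: split_indicator\<close>)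
  also have "\<dots> = 2 * ((\<integral>\<^sup>+s. Y (-1) 1 s * indicator {\<rho>/2..\<rho>} s \<partial>lborel) + (\<integral>\<^sup>+s. X 1 1 s * indicator {\<rho>/2..\<rho>} s \<partial>lborel)
      + (\<integral>\<^sup>+s. Y 1 (-1) s * indicator {\<rho>/2..\<rho>} s \<partial>lborel) + (\<integral>\<^sup>+s. X (-1) (-1) s * indicator {\<rho>/2..\<rho>} s \<partial>lborel))"
    by (simp add: nn_integral_cmult nn_integral_add)
  also have "\<dots> \<le> 2 * (ennreal (1 / \<rho>) * I + ennreal (1 / \<rho>) * I + ennreal (1 / \<rho>) * I + ennreal (1 / \<rho>) * I)"
    by (intro mult_left_mono add_mono X Y) auto
  also have "\<dots> = ennreal (8 / \<rho>) * I"
  proof -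
    have "2 * (x + x + x + x) = 8 * x" for x :: ennreal
    proof -
      have "(8::ennreal) = 2 * (1 + 1 + 1 + 1)" by simp
      then show ?thesis by (simp only: mult.assoc distrib_right mult_1)
    qed
    moreover have "8 * (ennreal (1 / \<rho>) * I) = ennreal (8 / \<rho>) * I"
    proof -
      have "ennreal (8 / \<rho>) = ennreal 8 * ennreal (1 / \<rho>)" using \<rho> by (subst ennreal_mult[symmetric]) auto
      then show ?thesis by (simp add: mult.assoc)
    qed
    ultimately show ?thesis by simp
  qed
  finally have fin: "ennreal (pi * \<rho> * cmod (g z)) \<le> ennreal (8 / \<rho>) * I"
    using \<rho> by (simp add: ennreal_mult[symmetric] mult_ac)
  have "ennreal (cmod (g z)) \<le> ennreal (1 / \<rho> * (pi * \<rho> * cmod (g z)))"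
  proof (rule ennreal_leI)
    have "1 * cmod (g z) \<le> pi * cmod (g z)" using pi_gt3 by (intro mult_right_mono) auto
    then show "cmod (g z) \<le> 1 / \<rho> * (pi * \<rho> * cmod (g z))" using \<rho> by simp
  qed
  also have "\<dots> = ennreal (1 / \<rho>) * ennreal (pi * \<rho> * cmod (g z))" using \<rho> by (intro ennreal_mult) auto
  also have "\<dots> \<le> ennreal (1 / \<rho>) * (ennreal (8 / \<rho>) * I)" by (intro mult_left_mono fin) simp
  also have "\<dots> = ennreal (8 / \<rho>\<^sup>2) * I"
    using \<rho> by (simp add: mult.assoc[symmetric] ennreal_mult[symmetric] power2_eq_square)
  also have "I = (\<integral>\<^sup>+w. ennreal (cmod (g w)) * indicator (square z \<rho>) w \<partial>lborel)"
    unfolding I_def u_def by (intro nn_integral_cong) (auto split: split_indicator)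
  finally show ?thesis .
qed

text \<open>The logarithms of the two powers differ by at most 2 l v^2 <= 1/8. This is what limits
  the half side in \<open>weighted_square_mean\<close> to Im z / (4 sqrt l).\<close>

lemma exp_le_one_plus_power:
  fixes v :: real
  assumes l: "l \<ge> 1" and v: "\<bar>v\<bar> \<le> 1 / (4 * sqrt (real l))"
  shows "exp (real l * v) \<le> 2 * (1 + v) ^ l"
proof -
  have sl: "sqrt (real l) \<ge> 1" using l by simp
  then have "1 / (4 * sqrt (real l)) \<le> 1 / 4" by (simp add: field_simps)
  then have v4: "\<bar>v\<bar> \<le> 1 / 4" using v by linarith
  have "\<bar>ln (1 + v) - v\<bar> \<le> 2 * v\<^sup>2" by (rule abs_ln_one_plus_x_minus_x_bound) (use v4 in simp)
  then have "v \<le> ln (1 + v) + 2 * v\<^sup>2" by linarith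
  then have "real l * v \<le> real l * (ln (1 + v) + 2 * v\<^sup>2)" by (intro mult_left_mono) auto
  also have "\<dots> = real l * ln (1 + v) + 2 * (real l * v\<^sup>2)" by (simp add: algebra_simps)
  also have "real l * v\<^sup>2 \<le> 1 / 16"
  proof -
    have "\<bar>v\<bar>\<^sup>2 \<le> (1 / (4 * sqrt (real l)))\<^sup>2" by (rule power_mono[OF v]) simp
    also have "\<dots> = 1 / (16 * real l)" by (simp add: power_divide power_mult_distrib)
    finally have "v\<^sup>2 \<le> 1 / (16 * real l)" by simp
    then have "real l * v\<^sup>2 \<le> real l * (1 / (16 * real l))" by (intro mult_left_mono) auto
    also have "\<dots> = 1 / 16" using l by simp
    finally show ?thesis .
  qed
  finally have "exp (real l * v) \<le> exp (real l * ln (1 + v) + 1 / 8)" by simp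
  also have "\<dots> = exp (1 / 8) * (1 + v) ^ l"
    using v4 by (simp add: exp_add exp_of_nat_mult mult.commute)
  also have "\<dots> \<le> 2 * (1 + v) ^ l"
  proof (rule mult_right_mono)
    have "exp (1 / 8 :: real) \<le> 1 + 1/8 + (1/8)\<^sup>2" by (rule exp_bound) auto
    then show "exp (1 / 8 :: real) \<le> 2" by (simp add: power2_eq_square)
  qed (use v4 in simp)
  finally show ?thesis .
qed

section \<open>Hyperbolic area and a mean value inequality with weight\<close>

lemma upper_half_plane_open [simp]: "open upper_half_plane"
  unfolding upper_half_plane_def by (rule open_halfspace_Im_gt)

lemma upper_half_plane_convex [simp]: "convex upper_half_plane"
  unfolding upper_half_plane_def by (rule convex_halfspace_Im_gt)

lemma upper_half_plane_measurable [measurable]: "upper_half_plane \<in> sets borel"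
  by (rule borel_open) simp

lemma sets_hyp_area [measurable_cong]: "sets hyp_area = sets borel"
  unfolding hyp_area_def by simp

lemma space_hyp_area [simp]: "space hyp_area = UNIV"
  unfolding hyp_area_def by simp

lemma nn_integral_hyp_area:
  assumes [measurable]: "u \<in> borel_measurable borel"
  shows "(\<integral>\<^sup>+w. u w \<partial>hyp_area) = (\<integral>\<^sup>+w. indicator upper_half_plane w * ennreal (1 / (Im w)\<^sup>2) * u w \<partial>lborel)"
  unfolding hyp_area_def by (subst nn_integral_density) auto

text \<open>
  The weight \<open>(Im w) ^ l\<close> varies too fast on the square; the factor \<open>exp (- i l (w - z) / (2 Im z))\<close> cancels
  its logarithmic derivative at the centre.
\<close>

lemma weighted_square_mean:
  assumes h: "h holomorphic_on upper_half_plane" and z: "Im z > 0" and l: "l \<ge> 1"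
    and hm: "(\<lambda>w. ennreal ((cmod (h w))\<^sup>2 * Im w ^ l)) \<in> borel_measurable borel"
  shows "ennreal ((cmod (h z))\<^sup>2 * Im z ^ l) \<le> ennreal (512 * real l) *
    (\<integral>\<^sup>+w. ennreal ((cmod (h w))\<^sup>2 * Im w ^ l) * indicator (square z (Im z / (4 * sqrt (real l)))) w \<partial>hyp_area)"
proof -
  define y where "y = Im z"
  define \<rho> where "\<rho> = y / (4 * sqrt (real l))"
  have y: "y > 0" unfolding y_def using z .
  have sl: "sqrt (real l) \<ge> 1" using l by simp
  have \<rho>: "\<rho> > 0" unfolding \<rho>_def using y l by simp
  have \<rho>y: "\<rho> \<le> y / 4" unfolding \<rho>_def using sl y by (intro divide_left_mono) auto
  define g where "g w = (h w)\<^sup>2 * exp (- \<i> * of_nat l * (w - z) / of_real y)" for w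
  have g: "g holomorphic_on upper_half_plane"
    unfolding g_def using y by (intro holomorphic_intros h) auto
  have sq: "Im w \<ge> 3 / 4 * y" "Im w \<le> 5 / 4 * y" if "w \<in> square z \<rho>" for w
    using that \<rho>y unfolding square_def y_def by auto
  have sub: "square z \<rho> \<subseteq> upper_half_plane"
    unfolding upper_half_plane_def using sq(1) y by fastforce
  have gn: "cmod (g w) = (cmod (h w))\<^sup>2 * exp (real l * ((Im w - y) / y))" for w
    unfolding g_def y_def by (simp add: norm_mult norm_power)
  have gz: "cmod (g z) = (cmod (h z))\<^sup>2" unfolding gn y_def by simp
  \<comment> \<open>One factor 2 comes from \<open>exp_le_one_plus_power\<close>, the other from (Im
    w)^2 <= 2 y^2.\<close>
  have pt: "ennreal (cmod (g w)) * ennreal (y ^ l) * indicator (square z \<rho>) w \<le>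
     ennreal (4 * y\<^sup>2) * (indicator upper_half_plane w * ennreal (1 / (Im w)\<^sup>2) * (ennreal ((cmod (h w))\<^sup>2 * Im w ^ l) * indicator (square z \<rho>) w))" for w
  proof (cases "w \<in> square z \<rho>")
    case True
    define v where "v = (Im w - y) / y"
    have "\<bar>Im w - y\<bar> \<le> \<rho>" using True unfolding square_def y_def by auto
    then have "\<bar>v\<bar> \<le> \<rho> / y" unfolding v_def using y by (simp add: divide_right_mono)
    also have "\<rho> / y = 1 / (4 * sqrt (real l))" unfolding \<rho>_def using y by simp
    finally have "exp (real l * v) \<le> 2 * (1 + v) ^ l" by (rule exp_le_one_plus_power[OF l])
    then have "exp (real l * v) * y ^ l \<le> 2 * (1 + v) ^ l * y ^ l" using y by (intro mult_right_mono) auto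
    also have "\<dots> = 2 * ((1 + v) * y) ^ l" by (simp add: power_mult_distrib)
    also have "(1 + v) * y = Im w" unfolding v_def using y by (simp add: field_simps)
    finally have 1: "exp (real l * v) * y ^ l \<le> 2 * Im w ^ l" .
    have Iw: "Im w > 0" using sq(1)[OF True] y by linarith
    have "(Im w)\<^sup>2 \<le> (5 / 4 * y)\<^sup>2" using sq(2)[OF True] Iw by (intro power_mono) auto
    also have "\<dots> \<le> 2 * y\<^sup>2" by (simp add: power_mult_distrib power_divide)
    finally have 2: "1 \<le> 2 * y\<^sup>2 * (1 / (Im w)\<^sup>2)" using Iw by simp
    have "cmod (g w) * y ^ l = (cmod (h w))\<^sup>2 * (exp (real l * v) * y ^ l)" unfolding gn v_def by simp
    also have "\<dots> \<le> (cmod (h w))\<^sup>2 * (2 * Im w ^ l)" by (intro mult_left_mono 1) auto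
    also have "\<dots> = (cmod (h w))\<^sup>2 * (2 * Im w ^ l) * 1" by simp
    also have "\<dots> \<le> (cmod (h w))\<^sup>2 * (2 * Im w ^ l) * (2 * y\<^sup>2 * (1 / (Im w)\<^sup>2))"
      using Iw by (intro mult_left_mono 2) auto
    also have "\<dots> = 4 * y\<^sup>2 * (1 / (Im w)\<^sup>2 * ((cmod (h w))\<^sup>2 * Im w ^ l))" by (simp add: mult_ac)
    finally have "ennreal (cmod (g w) * y ^ l) \<le> ennreal (4 * y\<^sup>2 * (1 / (Im w)\<^sup>2 * ((cmod (h w))\<^sup>2 * Im w ^ l)))"
      by (rule ennreal_leI)
    moreover have e3: "ennreal (a * (b * c)) = ennreal a * (ennreal b * ennreal c)" if "0 \<le> a" "0 \<le> b" "0 \<le> c" for a b c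
      using that by (simp add: ennreal_mult)
    have "ennreal (4 * y\<^sup>2 * (1 / (Im w)\<^sup>2 * ((cmod (h w))\<^sup>2 * Im w ^ l))) =
        ennreal (4 * y\<^sup>2) * (ennreal (1 / (Im w)\<^sup>2) * ennreal ((cmod (h w))\<^sup>2 * Im w ^ l))"
      by (rule e3) (use Iw in auto)
    moreover have "ennreal (cmod (g w) * y ^ l) = ennreal (cmod (g w)) * ennreal (y ^ l)"
      using y by (simp add: ennreal_mult)
    moreover have hw: "w \<in> upper_half_plane" using True sub by auto
    ultimately show ?thesis
      unfolding indicator_simps(1)[OF True] indicator_simps(1)[OF hw] mult_1_left mult_1_right by (simp only:)
  qed simp
  have "ennreal ((cmod (h z))\<^sup>2 * Im z ^ l) = ennreal (y ^ l) * ennreal (cmod (g z))"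
    unfolding gz y_def using z by (subst ennreal_mult[symmetric]) (auto simp: mult.commute)
  also have "\<dots> \<le> ennreal (y ^ l) * (ennreal (8 / \<rho>\<^sup>2) * (\<integral>\<^sup>+w. ennreal (cmod (g w)) * indicator (square z \<rho>) w \<partial>lborel))"
    by (intro mult_left_mono Cauchy_square_mean[OF g _ _ sub \<rho>]) auto
  also have "\<dots> = ennreal (8 / \<rho>\<^sup>2) * (ennreal (y ^ l) * (\<integral>\<^sup>+w. ennreal (cmod (g w)) * indicator (square z \<rho>) w \<partial>lborel))"
    by (simp only: mult_ac)
  also have "ennreal (y ^ l) * (\<integral>\<^sup>+w. ennreal (cmod (g w)) * indicator (square z \<rho>) w \<partial>lborel) =
     (\<integral>\<^sup>+w. ennreal (cmod (g w)) * ennreal (y ^ l) * indicator (square z \<rho>) w \<partial>lborel)"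
  proof -
    have "continuous_on (square z \<rho>) (\<lambda>w. cmod (g w))"
      using holomorphic_on_imp_continuous_on[OF g] sub by (intro continuous_intros) (rule continuous_on_subset)
    then have "(\<lambda>w. indicator (square z \<rho>) w *\<^sub>R cmod (g w)) \<in> borel_measurable borel"
      by (intro borel_measurable_continuous_on_indicator) auto
    then have "(\<lambda>w. ennreal (indicator (square z \<rho>) w *\<^sub>R cmod (g w))) \<in> borel_measurable borel" by measurable
    also have "(\<lambda>w. ennreal (indicator (square z \<rho>) w *\<^sub>R cmod (g w))) = (\<lambda>w. ennreal (cmod (g w)) * indicator (square z \<rho>) w)"
      by (auto split: split_indicator)
    finally show ?thesis
      by (subst nn_integral_cmult[symmetric]) (auto simp: mult_ac)
  qed
  also have "\<dots> \<le> (\<integral>\<^sup>+w. ennreal (4 * y\<^sup>2) * (indicator upper_half_plane w * ennreal (1 / (Im w)\<^sup>2) * (ennreal ((cmod (h w))\<^sup>2 * Im w ^ l) * indicator (square z \<rho>) w)) \<partial>lborel)"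
    by (intro nn_integral_mono pt)
  also have "\<dots> = ennreal (4 * y\<^sup>2) * (\<integral>\<^sup>+w. ennreal ((cmod (h w))\<^sup>2 * Im w ^ l) * indicator (square z \<rho>) w \<partial>hyp_area)"
    using hm by (subst nn_integral_cmult) (auto simp: nn_integral_hyp_area)
  also have "ennreal (8 / \<rho>\<^sup>2) * (ennreal (4 * y\<^sup>2) * I) = ennreal (512 * real l) * I" for I
  proof -
    have "8 / \<rho>\<^sup>2 * (4 * y\<^sup>2) = 512 * real l"
      unfolding \<rho>_def using y l by (simp add: power_divide power_mult_distrib)
    then have "ennreal (8 / \<rho>\<^sup>2) * ennreal (4 * y\<^sup>2) = ennreal (512 * real l)"
      by (subst ennreal_mult[symmetric]) auto
    then show ?thesis by (simp add: mult.assoc[symmetric])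
  qed
  finally show ?thesis unfolding \<rho>_def y_def by (simp add: mult_left_mono)
qed

section \<open>The modular group\<close>

text \<open>A matrix is listed row by row. A matrix and its negative are kept apart, so every
  transformation occurs twice.\<close>

definition SL2Z :: "(int \<times> int \<times> int \<times> int) set" where
  "SL2Z = {(a, b, c, d). a * d - b * c = 1}"

fun moebius_den :: "int \<times> int \<times> int \<times> int \<Rightarrow> complex \<Rightarrow> complex" where
  "moebius_den (a, b, c, d) w = of_int c * w + of_int d"

fun moebius_num :: "int \<times> int \<times> int \<times> int \<Rightarrow> complex \<Rightarrow> complex" where
  "moebius_num (a, b, c, d) w = of_int a * w + of_int b"

definition moebius :: "int \<times> int \<times> int \<times> int \<Rightarrow> complex \<Rightarrow> complex" where
  "moebius \<gamma> w = moebius_num \<gamma> w / moebius_den \<gamma> w"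

lemma den_nonzero:
  assumes "Im w > 0" "(c, d) \<noteq> (0, 0)"
  shows "of_int c * w + of_int d \<noteq> 0"
proof
  assume "of_int c * w + of_int d = 0"
  then have "Im (of_int c * w + of_int d) = 0" "Re (of_int c * w + of_int d) = 0" by simp_all
  then show False using assms by auto
qed

lemma Im_moebius:
  assumes det: "a * d - b * c = 1" and w: "Im w > 0"
  shows "Im ((of_int a * w + of_int b) / (of_int c * w + of_int d)) = Im w / (cmod (of_int c * w + of_int d))\<^sup>2"
proof -
  have "real_of_int a * real_of_int d - real_of_int b * real_of_int c = 1"
    using det by (metis of_int_1 of_int_diff of_int_mult)
  then have "Im w * (real_of_int a * real_of_int d - real_of_int b * real_of_int c) = Im w" by simp
  then have "Im (of_int a * w + of_int b) * Re (of_int c * w + of_int d) - Re (of_int a * w + of_int b) * Im (of_int c * w + of_int d) = Im w"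
    by (simp add: algebra_simps)
  then show ?thesis by (simp add: Im_divide cmod_power2)
qed

lemma SL2Z_cd_nonzero: "(a, b, c, d) \<in> SL2Z \<Longrightarrow> (c, d) \<noteq> (0, 0)"
  unfolding SL2Z_def by auto

lemma moebius_in_upper:
  assumes "\<gamma> \<in> SL2Z" "Im w > 0"
  shows "Im (moebius \<gamma> w) = Im w / (cmod (moebius_den \<gamma> w))\<^sup>2" "Im (moebius \<gamma> w) > 0" "moebius_den \<gamma> w \<noteq> 0"
proof -
  obtain a b c d where g: "\<gamma> = (a, b, c, d)" by (cases \<gamma>)
  have det: "a * d - b * c = 1" using assms(1) unfolding g SL2Z_def by simp
  show 1: "Im (moebius \<gamma> w) = Im w / (cmod (moebius_den \<gamma> w))\<^sup>2"
    unfolding g moebius_def using Im_moebius[OF det assms(2)] by simp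
  show 2: "moebius_den \<gamma> w \<noteq> 0"
    unfolding g using den_nonzero[OF assms(2)] SL2Z_cd_nonzero[of a b c d] assms(1) g by auto
  show "Im (moebius \<gamma> w) > 0" unfolding 1 using assms(2) 2 by simp
qed

section \<open>Reduction to the fundamental domain\<close>

lemma finite_bounded_den:
  assumes w: "Im w > 0"
  shows "finite {(c :: int, d :: int). cmod (of_int c * w + of_int d) \<le> M}"
proof -
  define B where "B = \<lceil>M / Im w\<rceil> + \<lceil>M + (M / Im w) * cmod w\<rceil>"
  have "{(c :: int, d :: int). cmod (of_int c * w + of_int d) \<le> M} \<subseteq>
     {- \<lceil>M / Im w\<rceil>..\<lceil>M / Im w\<rceil>} \<times> {- \<lceil>M + (M / Im w) * cmod w\<rceil>..\<lceil>M + (M / Im w) * cmod w\<rceil>}"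
  proof clarify
    fix c d :: int assume le: "cmod (of_int c * w + of_int d) \<le> M"
    have "\<bar>real_of_int c\<bar> * Im w = \<bar>Im (of_int c * w + of_int d)\<bar>" using w by (simp add: abs_mult)
    also have "\<dots> \<le> M" using abs_Im_le_cmod le order_trans by blast
    finally have c: "\<bar>real_of_int c\<bar> \<le> M / Im w" using w by (simp add: pos_le_divide_eq)
    have "\<bar>real_of_int d\<bar> = cmod ((of_int c * w + of_int d) - of_int c * w)" by simp
    also have "\<dots> \<le> cmod (of_int c * w + of_int d) + cmod (of_int c * w)" by (rule norm_triangle_ineq4)
    also have "\<dots> \<le> M + (M / Im w) * cmod w"
    proof (rule add_mono[OF le])
      show "cmod (of_int c * w) \<le> (M / Im w) * cmod w"
        unfolding norm_mult norm_of_int by (rule mult_right_mono[OF c]) simp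
    qed
    finally have d: "\<bar>real_of_int d\<bar> \<le> M + (M / Im w) * cmod w" .
    have "\<bar>c\<bar> \<le> \<lceil>M / Im w\<rceil>" "\<bar>d\<bar> \<le> \<lceil>M + (M / Im w) * cmod w\<rceil>"
      using c d by (simp_all add: le_ceiling_iff)
    then show "c \<in> {- \<lceil>M / Im w\<rceil>..\<lceil>M / Im w\<rceil>} \<and> d \<in> {- \<lceil>M + (M / Im w) * cmod w\<rceil>..\<lceil>M + (M / Im w) * cmod w\<rceil>}"
      by auto
  qed
  then show ?thesis by (rule finite_subset) auto
qed

text \<open>Choose a coprime pair with |c w + d| minimal, complete it to a matrix and translate the
  image into |Re| <= 1/2. The numerator a w + b also belongs to a coprime pair, so minimality gives
  |a w + b| >= |c w + d|, and the image has modulus at least 1.\<close>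

lemma moebius_to_fund_domain:
  assumes w: "Im w > 0"
  shows "\<exists>\<gamma>\<in>SL2Z. moebius \<gamma> w \<in> fund_domain"
proof -
  let ?m = "\<lambda>(c, d). cmod (of_int c * w + of_int d)"
  define P where "P = {(c :: int, d :: int). coprime c d \<and> cmod (of_int c * w + of_int d) \<le> 1}"
  have finP: "finite P" by (rule finite_subset[OF _ finite_bounded_den[OF w, of 1]]) (auto simp: P_def)
  have "(0, 1) \<in> P" by (simp add: P_def)
  then have neP: "P \<noteq> {}" by blast
  obtain p where p: "p \<in> P" "\<And>q. q \<in> P \<Longrightarrow> ?m p \<le> ?m q"
    using ex_min_if_finite[OF finite_imageI[OF finP, of ?m]] neP by (metis (no_types, lifting) image_iff imageI image_is_empty linorder_not_less)
  obtain c d where cd: "p = (c, d)" by (cases p)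
  have cop: "coprime c d" and m1: "cmod (of_int c * w + of_int d) \<le> 1" using p(1) unfolding cd P_def by auto
  have min: "cmod (of_int c * w + of_int d) \<le> cmod (of_int c' * w + of_int d')" if "coprime c' d'" for c' d'
  proof (cases "cmod (of_int c' * w + of_int d') \<le> 1")
    case True
    then have "(c', d') \<in> P" using that by (simp add: P_def)
    then show ?thesis using p(2) unfolding cd by fastforce
  qed (use m1 in auto)
  obtain u v where uv: "u * c + v * d = 1" using cop by (metis bezout_int coprime_iff_gcd_eq_1)
  define a0 where "a0 = v"
  define b0 where "b0 = - u"
  have det0: "a0 * d - b0 * c = 1" unfolding a0_def b0_def using uv by (simp add: algebra_simps)
  define v0 where "v0 = (of_int a0 * w + of_int b0) / (of_int c * w + of_int d)"
  define n where "n = - round (Re v0)"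
  define a where "a = a0 + n * c"
  define b where "b = b0 + n * d"
  have det: "a * d - b * c = 1" using det0 unfolding a_def b_def by (simp add: algebra_simps)
  have g: "(a, b, c, d) \<in> SL2Z" using det by (simp add: SL2Z_def)
  have nz: "of_int c * w + of_int d \<noteq> 0" using den_nonzero[OF w] SL2Z_cd_nonzero[OF g] by auto
  have mv: "moebius (a, b, c, d) w = v0 + of_int n"
    unfolding moebius_def v0_def a_def b_def using nz by (simp add: field_simps)
  have "\<bar>Re (v0 + of_int n)\<bar> \<le> 1 / 2" unfolding n_def using of_int_round_abs_le[of "Re v0"] by (simp add: abs_minus_commute)
  moreover have "cmod (moebius (a, b, c, d) w) \<ge> 1"
  proof -
    have "coprime a b"
    proof (rule coprimeI)
      fix e assume "e dvd a" "e dvd b"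
      then have "e dvd a * d - b * c" by (intro dvd_diff dvd_mult2)
      then show "is_unit e" using det by simp
    qed
    then have "cmod (of_int c * w + of_int d) \<le> cmod (of_int a * w + of_int b)" by (rule min)
    then show ?thesis unfolding moebius_def using nz by (simp add: norm_divide)
  qed
  ultimately have "moebius (a, b, c, d) w \<in> fund_domain"
    using moebius_in_upper(2)[OF g w] unfolding fund_domain_def upper_half_plane_def mv by auto
  then show ?thesis using g by blast
qed

definition box_region :: "real \<Rightarrow> complex set" where
  "box_region R = {w. \<bar>Re w\<bar> \<le> R \<and> 1 / R \<le> Im w \<and> Im w \<le> R}"

lemma fund_domain_Im: "w \<in> fund_domain \<Longrightarrow> 3 / 4 \<le> (Im w)\<^sup>2"
proof -
  assume w: "w \<in> fund_domain"
  then have "1 \<le> (cmod w)\<^sup>2" unfolding fund_domain_def by (auto simp: power2_eq_square intro: mult_ge1_I)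
  moreover have "(Re w)\<^sup>2 \<le> (1 / 2)\<^sup>2" using w unfolding fund_domain_def by (auto simp: abs_le_square_iff[symmetric])
  ultimately show ?thesis unfolding cmod_power2 by (simp add: power2_eq_square)
qed

lemma fund_domain_Im_ge: "w \<in> fund_domain \<Longrightarrow> 1 / 2 \<le> Im w"
proof -
  assume w: "w \<in> fund_domain"
  have "(1 / 2)\<^sup>2 \<le> (Im w)\<^sup>2" using fund_domain_Im[OF w] by (simp add: power2_eq_square)
  then show ?thesis using w unfolding fund_domain_def upper_half_plane_def by (auto intro: power2_le_imp_le)
qed

text \<open>An image in the fundamental domain has height at least 1/2, which bounds |c w + d| from
  above; with |c w + d| >= 1 / R this bounds |a w + b| as well. On the box, a bound for |p w + q|
  bounds the integers p and q.\<close>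

lemma box_region_finite_cover:
  assumes R: "R \<ge> 1"
  shows "\<exists>G. finite G \<and> G \<subseteq> SL2Z \<and> (\<forall>w\<in>box_region R. \<exists>\<gamma>\<in>G. moebius \<gamma> w \<in> fund_domain)"
proof -
  define M where "M = 2 * R + R\<^sup>2 + 1"
  define B where "B = \<lceil>R * M + M + M * (2 * R) * R\<rceil>"
  define G where "G = SL2Z \<inter> ({-B..B} \<times> {-B..B} \<times> {-B..B} \<times> {-B..B})"
  have coef: "\<bar>p\<bar> \<le> B \<and> \<bar>q\<bar> \<le> B" if w: "w \<in> box_region R" and le: "cmod (of_int p * w + of_int q) \<le> M" for p q w
  proof -
    have Iw: "1 / R \<le> Im w" "Im w \<le> R" "\<bar>Re w\<bar> \<le> R" using w by (auto simp: box_region_def)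
    have "0 < 1 / R" using R by simp
    then have Ip: "Im w > 0" using Iw by linarith
    have M0: "M \<ge> 0" unfolding M_def using R by simp
    have "\<bar>real_of_int p\<bar> * Im w = \<bar>Im (of_int p * w + of_int q)\<bar>" using Ip by (simp add: abs_mult)
    also have "\<dots> \<le> M" using abs_Im_le_cmod le order_trans by blast
    finally have "\<bar>real_of_int p\<bar> * (1 / R) \<le> M" using Iw(1) by (meson abs_ge_zero mult_left_mono order_trans)
    then have p: "\<bar>real_of_int p\<bar> \<le> R * M" using R by (simp add: field_simps)
    have "cmod w \<le> 2 * R" using cmod_le[of w] Iw Ip by linarith
    have "\<bar>real_of_int q\<bar> = cmod ((of_int p * w + of_int q) - of_int p * w)" by simp
    also have "\<dots> \<le> cmod (of_int p * w + of_int q) + cmod (of_int p * w)" by (rule norm_triangle_ineq4)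
    also have "\<dots> \<le> M + (R * M) * (2 * R)"
      using le p \<open>cmod w \<le> 2 * R\<close> R M0 by (auto simp: norm_mult intro!: add_mono mult_mono)
    finally have q: "\<bar>real_of_int q\<bar> \<le> M + (R * M) * (2 * R)" .
    have X: "0 \<le> R * M" "0 \<le> M * (2 * R) * R" using R M0 by auto
    have "\<bar>real_of_int p\<bar> \<le> R * M + M + M * (2 * R) * R" "\<bar>real_of_int q\<bar> \<le> R * M + M + M * (2 * R) * R"
      using p q X M0 by (simp_all add: mult_ac)
    then show ?thesis unfolding B_def by (simp add: le_ceiling_iff)
  qed
  show ?thesis
  proof (intro exI[of _ G] conjI ballI)
    show "finite G" unfolding G_def by auto
    show "G \<subseteq> SL2Z" unfolding G_def by auto
    fix w assume w: "w \<in> box_region R"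
    have Iw: "1 / R \<le> Im w" "Im w \<le> R" using w by (auto simp: box_region_def)
    have "0 < 1 / R" using R by simp
    then have Ip: "Im w > 0" using Iw by linarith
    obtain \<gamma> where g: "\<gamma> \<in> SL2Z" "moebius \<gamma> w \<in> fund_domain" using moebius_to_fund_domain[OF Ip] by blast
    obtain a b c d where abcd: "\<gamma> = (a, b, c, d)" by (cases \<gamma>)
    define D where "D = cmod (of_int c * w + of_int d)"
    define v where "v = moebius \<gamma> w"
    have Dp: "D > 0" unfolding D_def using moebius_in_upper(3)[OF g(1) Ip] unfolding abcd by simp
    have Iv: "Im v = Im w / D\<^sup>2" unfolding v_def D_def using moebius_in_upper(1)[OF g(1) Ip] unfolding abcd by simp
    have Iv2: "1 / 2 \<le> Im v" unfolding v_def by (rule fund_domain_Im_ge[OF g(2)])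
    then have "D\<^sup>2 \<le> 2 * Im w" unfolding Iv using Dp by (simp add: field_simps)
    then have D2: "D\<^sup>2 \<le> 2 * R" using Iw by linarith
    have DM: "D \<le> 2 * R"
    proof (rule power2_le_imp_le)
      have "2 * R \<le> (2 * R)\<^sup>2" using R by (simp add: power2_eq_square)
      then show "D\<^sup>2 \<le> (2 * R)\<^sup>2" using D2 by linarith
    qed (use R in simp)
    have Dlow: "1 / R \<le> D"
    proof (cases "c = 0")
      case True
      then have "d \<noteq> 0" using SL2Z_cd_nonzero[of a b c d] g(1) abcd by auto
      then have "1 \<le> \<bar>real_of_int d\<bar>" by linarith
      then have "1 \<le> D" unfolding D_def using True by simp
      moreover have "1 / R \<le> 1" using R by simp
      ultimately show ?thesis by linarith
    next
      case False
      then have "1 \<le> \<bar>real_of_int c\<bar>" by linarith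
      then have "1 * Im w \<le> \<bar>real_of_int c\<bar> * Im w" using Ip by (intro mult_right_mono) auto
      also have "\<dots> = \<bar>Im (of_int c * w + of_int d)\<bar>" using Ip by (simp add: abs_mult)
      also have "\<dots> \<le> D" unfolding D_def by (rule abs_Im_le_cmod)
      finally show ?thesis using Iw by linarith
    qed
    have "cmod (of_int a * w + of_int b) = cmod v * D"
      unfolding v_def D_def abcd moebius_def using Dp unfolding D_def by (simp add: norm_divide)
    also have "\<dots> \<le> (1 / 2 + Im v) * D"
      using cmod_le[of v] g(2) Iv2 Dp unfolding v_def[symmetric] fund_domain_def by (intro mult_right_mono) auto
    also have "\<dots> = D / 2 + Im w / D" unfolding Iv using Dp by (simp add: field_simps power2_eq_square)
    also have "\<dots> \<le> R + R * R"
    proof (intro add_mono)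
      have "1 / D \<le> R" using Dlow Dp R by (simp add: field_simps)
      then have "Im w * (1 / D) \<le> R * R" using Iw Ip Dp R by (intro mult_mono) auto
      then show "Im w / D \<le> R * R" by simp
    qed (use DM in simp)
    also have "\<dots> \<le> M" unfolding M_def using R by (simp add: power2_eq_square)
    finally have num: "cmod (of_int a * w + of_int b) \<le> M" .
    have "cmod (of_int c * w + of_int d) \<le> M" using DM unfolding D_def M_def using R by (smt (verit) zero_le_power2)
    then have "\<gamma> \<in> G" using coef[OF w num] coef[OF w, of c d] g(1) unfolding G_def abcd by (auto simp: abs_le_iff)
    then show "\<exists>\<gamma>\<in>G. moebius \<gamma> w \<in> fund_domain" using g(2) by blast
  qed
qed

section \<open>Invariance of the hyperbolic area under the modular group\<close>

lemma nn_integral_exp_substitution: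
  fixes v :: "real \<Rightarrow> ennreal"
  assumes [measurable]: "v \<in> borel_measurable borel"
  shows "(\<integral>\<^sup>+y. v y * ennreal (1 / y) * indicator {0<..} y \<partial>lborel) = (\<integral>\<^sup>+u. v (exp u) \<partial>lborel)"
proof -
  have step: "(\<integral>\<^sup>+y. v y * ennreal (1 / y) * indicator {exp (- real n)..exp (real n)} y \<partial>lborel) =
     (\<integral>\<^sup>+u. v (exp u) * indicator {- real n..real n} u \<partial>lborel)" if "n > 0" for n
  proof -
    have "(\<integral>\<^sup>+y. v y * ennreal (1 / y) * indicator {exp (- real n)..exp (real n)} y \<partial>lborel) =
       (\<integral>\<^sup>+u. (v (exp u) * ennreal (1 / exp u)) * ennreal (exp u) * indicator {- real n..real n} u \<partial>lborel)"
      by (rule nn_integral_substitution_aux[where g = exp and g' = exp])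
        (use that in \<open>auto intro!: derivative_eq_intros continuous_intros\<close>)
    also have "\<dots> = (\<integral>\<^sup>+u. v (exp u) * indicator {- real n..real n} u \<partial>lborel)"
    proof (intro nn_integral_cong)
      fix u :: real
      have "ennreal (1 / exp u) * ennreal (exp u) = 1" by (simp add: ennreal_mult[symmetric])
      then show "(v (exp u) * ennreal (1 / exp u)) * ennreal (exp u) * indicator {- real n..real n} u = v (exp u) * indicator {- real n..real n} u"
        by (simp add: mult.assoc)
    qed
    finally show ?thesis .
  qed
  have un1: "indicator {0<..} y = (SUP n. indicator {exp (- real (Suc n))..exp (real (Suc n))} y :: ennreal)" for y :: real
  proof (cases "y > 0")
    case True
    obtain n :: nat where n: "\<bar>ln y\<bar> \<le> real n" using real_arch_simple by blast
    have "ln y \<le> real (Suc n)" "- real (Suc n) \<le> ln y" using n by auto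
    then have "exp (- real (Suc n)) \<le> y" "y \<le> exp (real (Suc n))" using True by (metis exp_le_cancel_iff exp_ln)+
    then have "(1 :: ennreal) \<le> (SUP n. indicator {exp (- real (Suc n))..exp (real (Suc n))} y)"
      by (intro SUP_upper2[of n]) auto
    moreover have "(SUP n. indicator {exp (- real (Suc n))..exp (real (Suc n))} y :: ennreal) \<le> 1"
      by (intro SUP_least) (auto split: split_indicator)
    ultimately show ?thesis using True by (auto intro: antisym)
  next
    case False
    have "indicator {exp (- real (Suc n))..exp (real (Suc n))} y = (0 :: ennreal)" for n
      using False exp_gt_zero[of "- real (Suc n)"] by (auto split: split_indicator simp del: exp_gt_zero)
    then show ?thesis using False by simp
  qed
  have un2: "(1 :: ennreal) = (SUP n. indicator {- real (Suc n)..real (Suc n)} u)" for u :: real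
  proof -
    obtain n :: nat where n: "\<bar>u\<bar> \<le> real n" using real_arch_simple by blast
    then have "u \<in> {- real (Suc n)..real (Suc n)}" by auto
    then have "(1 :: ennreal) \<le> (SUP n. indicator {- real (Suc n)..real (Suc n)} u)"
      by (intro SUP_upper2[of n]) (simp_all only: indicator_simps(1) UNIV_I order_refl)
    moreover have "(SUP n. indicator {- real (Suc n)..real (Suc n)} u :: ennreal) \<le> 1"
      by (intro SUP_least) (auto split: split_indicator)
    ultimately show ?thesis by (rule antisym)
  qed
  have "(\<integral>\<^sup>+y. v y * ennreal (1 / y) * indicator {0<..} y \<partial>lborel) =
     (\<integral>\<^sup>+y. (SUP n. v y * ennreal (1 / y) * indicator {exp (- real (Suc n))..exp (real (Suc n))} y) \<partial>lborel)"
    by (simp only: un1 SUP_mult_left_ennreal)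
  also have "\<dots> = (SUP n. \<integral>\<^sup>+y. v y * ennreal (1 / y) * indicator {exp (- real (Suc n))..exp (real (Suc n))} y \<partial>lborel)"
  proof (rule nn_integral_monotone_convergence_SUP)
    have sub: "{exp (- real (Suc m))..exp (real (Suc m))} \<subseteq> {exp (- real (Suc n))..exp (real (Suc n))}" if "m \<le> n" for m n
      using that by (intro atLeastatMost_subset_iff[THEN iffD2]) simp
    have im: "indicator A y \<le> (indicator B y :: ennreal)" if "A \<subseteq> B" for A B and y :: real
      using that by (auto simp: indicator_def)
    show "incseq (\<lambda>n y. v y * ennreal (1 / y) * indicator {exp (- real (Suc n))..exp (real (Suc n))} y)"
      unfolding incseq_def le_fun_def
    proof (intro allI impI)
      fix m n :: nat and y :: real
      assume "m \<le> n"
      show "v y * ennreal (1 / y) * indicator {exp (- real (Suc m))..exp (real (Suc m))} y \<le>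
          v y * ennreal (1 / y) * indicator {exp (- real (Suc n))..exp (real (Suc n))} y"
        by (rule mult_left_mono[OF im[OF sub[OF \<open>m \<le> n\<close>]]]) simp
    qed
  qed measurable
  also have "\<dots> = (SUP n. \<integral>\<^sup>+u. v (exp u) * indicator {- real (Suc n)..real (Suc n)} u \<partial>lborel)"
    by (intro SUP_cong refl step) simp
  also have "\<dots> = (\<integral>\<^sup>+u. (SUP n. v (exp u) * indicator {- real (Suc n)..real (Suc n)} u) \<partial>lborel)"
    by (rule nn_integral_monotone_convergence_SUP[symmetric])
      (auto simp: incseq_def le_fun_def split: split_indicator)
  also have "\<dots> = (\<integral>\<^sup>+u. v (exp u) \<partial>lborel)"
    by (simp only: SUP_mult_left_ennreal[symmetric] un2[symmetric] mult_1_right)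
  finally show ?thesis .
qed

text \<open>In the coordinate u = ln y the map from y to 1 / (c y) is the reflection from u to - ln
  c - u.\<close>

lemma nn_integral_inversion:
  fixes v :: "real \<Rightarrow> ennreal"
  assumes [measurable]: "v \<in> borel_measurable borel" and c: "c > 0"
  shows "(\<integral>\<^sup>+y. v (1 / (c * y)) * ennreal (1 / y) * indicator {0<..} y \<partial>lborel) =
    (\<integral>\<^sup>+y. v y * ennreal (1 / y) * indicator {0<..} y \<partial>lborel)"
proof -
  have "(\<integral>\<^sup>+y. v (1 / (c * y)) * ennreal (1 / y) * indicator {0<..} y \<partial>lborel) = (\<integral>\<^sup>+u. v (1 / (c * exp u)) \<partial>lborel)"
    by (rule nn_integral_exp_substitution) measurable
  also have "\<dots> = (\<integral>\<^sup>+u. v (exp (- ln c + (-1) * u)) \<partial>lborel)"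
  proof (intro nn_integral_cong arg_cong[where f = v])
    fix u
    have "exp (- ln c + (-1) * u) = exp (- ln c) * exp (- u)" by (simp add: exp_add[symmetric])
    also have "\<dots> = 1 / (c * exp u)" using c by (simp add: exp_minus inverse_eq_divide)
    finally show "1 / (c * exp u) = exp (- ln c + (-1) * u)" ..
  qed
  also have "\<dots> = (\<integral>\<^sup>+u. v (exp u) \<partial>lborel)"
    using nn_integral_real_affine[of "\<lambda>u. v (exp u)" "-1" "- ln c"] by simp
  also have "\<dots> = (\<integral>\<^sup>+y. v y * ennreal (1 / y) * indicator {0<..} y \<partial>lborel)"
    by (rule nn_integral_exp_substitution[symmetric]) simp
  finally show ?thesis .
qed

text \<open>The coordinates are the height y and the slope t = x / y, in which the area element is
  dt dy / y. In them - 1 / w has slope - t and height 1 / ((1 + t^2) y), so for each t the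
  invariance under inversion becomes \<open>nn_integral_inversion\<close>.\<close>

lemma nn_integral_hyp_area_polar:
  assumes [measurable]: "u \<in> borel_measurable borel"
  shows "(\<integral>\<^sup>+w. u w \<partial>hyp_area) =
    (\<integral>\<^sup>+t. \<integral>\<^sup>+y. u (Complex (y * t) y) * ennreal (1 / y) * indicator {0<..} y \<partial>lborel \<partial>lborel)"
proof -
  have "(\<integral>\<^sup>+w. u w \<partial>hyp_area) = (\<integral>\<^sup>+y. \<integral>\<^sup>+x. indicator upper_half_plane (Complex x y) * ennreal (1 / y\<^sup>2) * u (Complex x y) \<partial>lborel \<partial>lborel)"
    by (subst nn_integral_hyp_area, simp, subst borel_measurable_nn_integral_Complex) auto
  also have "\<dots> = (\<integral>\<^sup>+y. \<integral>\<^sup>+t. u (Complex (y * t) y) * ennreal (1 / y) * indicator {0<..} y \<partial>lborel \<partial>lborel)"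
  proof (rule nn_integral_cong)
    fix y :: real
    show "(\<integral>\<^sup>+x. indicator upper_half_plane (Complex x y) * ennreal (1 / y\<^sup>2) * u (Complex x y) \<partial>lborel) =
       (\<integral>\<^sup>+t. u (Complex (y * t) y) * ennreal (1 / y) * indicator {0<..} y \<partial>lborel)"
    proof (cases "y > 0")
      case True
      have [measurable]: "(\<lambda>x. u (Complex x y)) \<in> borel_measurable borel" unfolding Complex_eq by measurable
      have "(\<integral>\<^sup>+x. indicator upper_half_plane (Complex x y) * ennreal (1 / y\<^sup>2) * u (Complex x y) \<partial>lborel) =
          (\<integral>\<^sup>+x. ennreal (1 / y\<^sup>2) * u (Complex x y) \<partial>lborel)"
        using True by (intro nn_integral_cong) (simp add: upper_half_plane_def)
      also have "\<dots> = ennreal \<bar>y\<bar> * (\<integral>\<^sup>+t. ennreal (1 / y\<^sup>2) * u (Complex (0 + y * t) y) \<partial>lborel)"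
        using True by (intro nn_integral_real_affine) auto
      also have "\<dots> = (\<integral>\<^sup>+t. ennreal \<bar>y\<bar> * (ennreal (1 / y\<^sup>2) * u (Complex (0 + y * t) y)) \<partial>lborel)"
        by (rule nn_integral_cmult[symmetric]) (simp add: Complex_eq)
      also have "\<dots> = (\<integral>\<^sup>+t. u (Complex (y * t) y) * ennreal (1 / y) * indicator {0<..} y \<partial>lborel)"
      proof (intro nn_integral_cong)
        fix t
        have "ennreal \<bar>y\<bar> * ennreal (1 / y\<^sup>2) = ennreal (1 / y)"
          using True by (subst ennreal_mult[symmetric]) (auto simp: power2_eq_square)
        then show "ennreal \<bar>y\<bar> * (ennreal (1 / y\<^sup>2) * u (Complex (0 + y * t) y)) = u (Complex (y * t) y) * ennreal (1 / y) * indicator {0<..} y"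
          using True by (simp add: mult.assoc[symmetric] mult.commute)
      qed
      finally show ?thesis .
    qed (simp add: upper_half_plane_def)
  qed
  also have "\<dots> = (\<integral>\<^sup>+t. \<integral>\<^sup>+y. u (Complex (y * t) y) * ennreal (1 / y) * indicator {0<..} y \<partial>lborel \<partial>lborel)"
    by (rule lborel_pair.Fubini') (simp add: case_prod_beta Complex_eq)
  finally show ?thesis .
qed

lemma nn_integral_hyp_area_inversion:
  assumes [measurable]: "u \<in> borel_measurable borel"
  shows "(\<integral>\<^sup>+w. u (- 1 / w) \<partial>hyp_area) = (\<integral>\<^sup>+w. u w \<partial>hyp_area)"
proof -
  have um: "(\<lambda>y. u (Complex (y * t) y)) \<in> borel_measurable borel" for t unfolding Complex_eq by measurable
  have "(\<integral>\<^sup>+w. u (- 1 / w) \<partial>hyp_area) =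
     (\<integral>\<^sup>+t. \<integral>\<^sup>+y. u (- 1 / Complex (y * t) y) * ennreal (1 / y) * indicator {0<..} y \<partial>lborel \<partial>lborel)"
    by (rule nn_integral_hyp_area_polar) measurable
  also have "\<dots> = (\<integral>\<^sup>+t. \<integral>\<^sup>+y. u (Complex (1 / ((1 + t\<^sup>2) * y) * (- t)) (1 / ((1 + t\<^sup>2) * y))) * ennreal (1 / y) * indicator {0<..} y \<partial>lborel \<partial>lborel)"
  proof (intro nn_integral_cong)
    fix t y :: real
    have "- 1 / Complex (y * t) y = Complex (1 / ((1 + t\<^sup>2) * y) * (- t)) (1 / ((1 + t\<^sup>2) * y))" if "y > 0"
    proof -
      have nz: "Complex (y * t) y \<noteq> 0" using that by (simp add: complex_eq_iff)
      have p: "1 + t\<^sup>2 > 0" by (simp add: add_pos_nonneg)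
      have "Complex (1 / ((1 + t\<^sup>2) * y) * (- t)) (1 / ((1 + t\<^sup>2) * y)) * Complex (y * t) y = - 1"
      proof -
        define q where "q = 1 / ((1 + t\<^sup>2) * y)"
        have "q * (y * (1 + t\<^sup>2)) = 1" unfolding q_def using p that by simp
        then show ?thesis unfolding q_def[symmetric]
          by (simp add: complex_eq_iff power2_eq_square algebra_simps)
      qed
      then show ?thesis using nz by (metis nonzero_eq_divide_eq)
    qed
    then show "u (- 1 / Complex (y * t) y) * ennreal (1 / y) * indicator {0<..} y =
        u (Complex (1 / ((1 + t\<^sup>2) * y) * (- t)) (1 / ((1 + t\<^sup>2) * y))) * ennreal (1 / y) * indicator {0<..} y"
      by (cases "y > 0") auto
  qed
  also have "\<dots> = (\<integral>\<^sup>+t. \<integral>\<^sup>+y. u (Complex (y * (- t)) y) * ennreal (1 / y) * indicator {0<..} y \<partial>lborel \<partial>lborel)"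
  proof (rule nn_integral_cong)
    fix t :: real
    show "(\<integral>\<^sup>+y. u (Complex (1 / ((1 + t\<^sup>2) * y) * (- t)) (1 / ((1 + t\<^sup>2) * y))) * ennreal (1 / y) * indicator {0<..} y \<partial>lborel) =
        (\<integral>\<^sup>+y. u (Complex (y * (- t)) y) * ennreal (1 / y) * indicator {0<..} y \<partial>lborel)"
      by (rule nn_integral_inversion[where v = "\<lambda>y. u (Complex (y * (- t)) y)"]) (rule um, simp add: add_pos_nonneg)
  qed
  also have "\<dots> = (\<integral>\<^sup>+t. \<integral>\<^sup>+y. u (Complex (y * t) y) * ennreal (1 / y) * indicator {0<..} y \<partial>lborel \<partial>lborel)"
  proof -
    have "(\<lambda>t. \<integral>\<^sup>+y. u (Complex (y * t) y) * ennreal (1 / y) * indicator {0<..} y \<partial>lborel) \<in> borel_measurable borel"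
      unfolding Complex_eq by measurable
    from nn_integral_real_affine[OF this, of "-1" 0] show ?thesis by simp
  qed
  also have "\<dots> = (\<integral>\<^sup>+w. u w \<partial>hyp_area)"
    by (rule nn_integral_hyp_area_polar[symmetric]) simp
  finally show ?thesis .
qed

lemma nn_integral_hyp_area_affine:
  assumes [measurable]: "u \<in> borel_measurable borel" and r: "r > 0"
  shows "(\<integral>\<^sup>+w. u (of_real r * w + of_real s) \<partial>hyp_area) = (\<integral>\<^sup>+w. u w \<partial>hyp_area)"
proof -
  define f where "f w = indicator upper_half_plane w * ennreal (1 / (Im w)\<^sup>2) * u w" for w
  have [measurable]: "f \<in> borel_measurable borel" unfolding f_def by measurable
  have "(\<integral>\<^sup>+w. u w \<partial>hyp_area) = (\<integral>\<^sup>+w. f w \<partial>lborel)" unfolding f_def by (rule nn_integral_hyp_area) simp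
  also have "\<dots> = (\<integral>\<^sup>+w. ennreal (r\<^sup>2) * f (of_real s + of_real r * w) \<partial>lborel)"
    using r by (subst lborel_affine[of r "of_real s :: complex"])
      (auto simp: nn_integral_density nn_integral_distr scaleR_conv_of_real DIM_complex)
  also have "\<dots> = (\<integral>\<^sup>+w. indicator upper_half_plane w * ennreal (1 / (Im w)\<^sup>2) * u (of_real r * w + of_real s) \<partial>lborel)"
  proof (intro nn_integral_cong)
    fix w :: complex
    show "ennreal (r\<^sup>2) * f (of_real s + of_real r * w) = indicator upper_half_plane w * ennreal (1 / (Im w)\<^sup>2) * u (of_real r * w + of_real s)"
    proof (cases "Im w > 0")
      case True
      have "ennreal (r\<^sup>2) * ennreal (1 / (r * Im w)\<^sup>2) = ennreal (1 / (Im w)\<^sup>2)"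
        using r by (subst ennreal_mult[symmetric]) (auto simp: power_mult_distrib)
      then show ?thesis using True r unfolding f_def upper_half_plane_def
        by (simp add: mult.assoc[symmetric] add.commute)
    next
      case False
      then have "\<not> 0 < r * Im w" using r by (simp add: zero_less_mult_iff)
      then show ?thesis using False unfolding f_def upper_half_plane_def by simp
    qed
  qed
  also have "\<dots> = (\<integral>\<^sup>+w. u (of_real r * w + of_real s) \<partial>hyp_area)"
    by (rule nn_integral_hyp_area[symmetric]) measurable
  finally show ?thesis ..
qed

lemma nn_integral_hyp_area_cong:
  assumes "\<And>w. Im w > 0 \<Longrightarrow> f w = g w" and [measurable]: "f \<in> borel_measurable borel" "g \<in> borel_measurable borel"
  shows "(\<integral>\<^sup>+w. f w \<partial>hyp_area) = (\<integral>\<^sup>+w. g w \<partial>hyp_area)"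
  by (subst (1 2) nn_integral_hyp_area) (auto intro!: nn_integral_cong simp: upper_half_plane_def assms(1) split: split_indicator)

lemma moebius_measurable [measurable]: "moebius \<gamma> \<in> borel_measurable borel"
  by (cases \<gamma>) (simp add: moebius_def[abs_def])

lemma nn_integral_hyp_area_moebius:
  assumes [measurable]: "u \<in> borel_measurable borel" and g: "\<gamma> \<in> SL2Z"
  shows "(\<integral>\<^sup>+w. u (moebius \<gamma> w) \<partial>hyp_area) = (\<integral>\<^sup>+w. u w \<partial>hyp_area)"
proof -
  obtain a b c d where abcd: "\<gamma> = (a, b, c, d)" by (cases \<gamma>)
  have det: "a * d - b * c = 1" using g unfolding abcd SL2Z_def by simp
  have detc: "of_int a * of_int d - of_int b * of_int c = (1 :: complex)"
    using det by (metis of_int_1 of_int_diff of_int_mult)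
  show ?thesis
  proof (cases "c = 0")
    case True
    then have "a * d = 1" using det by simp
    then have "(a = 1 \<and> d = 1) \<or> (a = -1 \<and> d = -1)" by (simp add: zmult_eq_1_iff)
    then have "moebius \<gamma> w = of_real 1 * w + of_real (of_int (a * b))" for w
      unfolding abcd moebius_def using True by (auto simp: field_simps)
    then show ?thesis using nn_integral_hyp_area_affine[of u 1 "of_int (a * b)"] by simp
  next
    case False
    define s where "s = real_of_int a / real_of_int c"
    \<comment> \<open>The Bruhat decomposition for c not 0: the image of w is a / c - 1 / (c^2 w + c
      d).\<close>
    have eq: "moebius \<gamma> w = of_real 1 * (- 1 / (of_real ((real_of_int c)\<^sup>2) * w + of_real (real_of_int (c * d)))) + of_real s" if "Im w > 0" for w
    proof -
      have nz: "of_int c * w + of_int d \<noteq> 0" using den_nonzero[OF that] False by auto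
      have c0: "(of_int c :: complex) \<noteq> 0" using False by simp
      have den: "of_real ((real_of_int c)\<^sup>2) * w + of_real (real_of_int (c * d)) = of_int c * (of_int c * w + of_int d)"
        by (simp add: power2_eq_square algebra_simps)
      have "of_int c * (of_int a * w + of_int b) = of_int a * (of_int c * w + of_int d) - 1"
        using detc by (simp add: algebra_simps)
      then have "of_int a * w + of_int b = (of_int a * (of_int c * w + of_int d) - 1) / of_int c"
        using c0 by (simp add: field_simps)
      then show ?thesis unfolding abcd moebius_def den s_def using nz c0
        by (simp add: divide_simps) 
    qed
    have "(\<integral>\<^sup>+w. u (moebius \<gamma> w) \<partial>hyp_area) =
       (\<integral>\<^sup>+w. u (of_real 1 * (- 1 / (of_real ((real_of_int c)\<^sup>2) * w + of_real (real_of_int (c * d)))) + of_real s) \<partial>hyp_area)"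
      by (rule nn_integral_hyp_area_cong) (simp only: eq, measurable)
    also have "\<dots> = (\<integral>\<^sup>+w. u (of_real 1 * (- 1 / w) + of_real s) \<partial>hyp_area)"
      by (rule nn_integral_hyp_area_affine[where u = "\<lambda>w. u (of_real 1 * (- 1 / w) + of_real s)"]) (use False in auto)
    also have "\<dots> = (\<integral>\<^sup>+w. u (of_real 1 * w + of_real s) \<partial>hyp_area)"
      by (rule nn_integral_hyp_area_inversion[where u = "\<lambda>w. u (of_real 1 * w + of_real s)"]) measurable
    also have "\<dots> = (\<integral>\<^sup>+w. u w \<partial>hyp_area)"
      by (rule nn_integral_hyp_area_affine) auto
    finally show ?thesis .
  qed
qed

section \<open>The invariant density of a cusp form and its pointwise bound\<close>

definition form_weight :: "nat \<Rightarrow> (complex \<Rightarrow> complex) \<Rightarrow> complex \<Rightarrow> real" where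
  "form_weight k f w = (cmod (f w))\<^sup>2 * Im w ^ k"

lemma cusp_formsD:
  assumes "f \<in> cusp_forms k"
  shows "f holomorphic_on upper_half_plane" "\<And>w. \<not> Im w > 0 \<Longrightarrow> f w = 0"
    "\<And>\<gamma> w. \<gamma> \<in> SL2Z \<Longrightarrow> Im w > 0 \<Longrightarrow> f (moebius \<gamma> w) = moebius_den \<gamma> w ^ k * f w"
    "filterlim f (nhds 0) (filtercomap Im at_top)"
proof -
  have *: "\<forall>a b c d :: int. a * d - b * c = 1 \<longrightarrow>
        (\<forall>z \<in> upper_half_plane.
           f ((of_int a * z + of_int b) / (of_int c * z + of_int d)) =
             (of_int c * z + of_int d) ^ k * f z)"
    using assms unfolding cusp_forms_def by blast
  show "f (moebius \<gamma> w) = moebius_den \<gamma> w ^ k * f w" if "\<gamma> \<in> SL2Z" "Im w > 0" for \<gamma> w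
    using * that by (cases \<gamma>) (auto simp: SL2Z_def moebius_def upper_half_plane_def)
  show "f holomorphic_on upper_half_plane" "\<And>w. \<not> Im w > 0 \<Longrightarrow> f w = 0" "filterlim f (nhds 0) (filtercomap Im at_top)"
    using assms unfolding cusp_forms_def upper_half_plane_def by auto
qed

lemma cusp_form_measurable:
  assumes "f \<in> cusp_forms k"
  shows "f \<in> borel_measurable borel"
proof -
  have "(\<lambda>w. indicator upper_half_plane w *\<^sub>R f w) \<in> borel_measurable borel"
    by (rule borel_measurable_continuous_on_indicator)
      (auto intro: holomorphic_on_imp_continuous_on cusp_formsD(1)[OF assms])
  also have "(\<lambda>w. indicator upper_half_plane w *\<^sub>R f w) = f"
    using cusp_formsD(2)[OF assms] by (auto simp: fun_eq_iff upper_half_plane_def indicator_def)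
  finally show ?thesis .
qed

lemma form_weight_moebius:
  assumes f: "f \<in> cusp_forms k" and g: "\<gamma> \<in> SL2Z" and w: "Im w > 0"
  shows "form_weight k f (moebius \<gamma> w) = form_weight k f w"
proof -
  have nz: "cmod (moebius_den \<gamma> w) > 0" using moebius_in_upper(3)[OF g w] by simp
  have "form_weight k f (moebius \<gamma> w) = (cmod (moebius_den \<gamma> w)) ^ (2 * k) * (cmod (f w))\<^sup>2 * (Im w / (cmod (moebius_den \<gamma> w))\<^sup>2) ^ k"
    unfolding form_weight_def moebius_in_upper(1)[OF g w] cusp_formsD(3)[OF f g w]
    by (simp add: norm_mult norm_power power_mult_distrib power_mult[symmetric] mult.commute)
  also have "\<dots> = (cmod (f w))\<^sup>2 * Im w ^ k"
    using nz by (simp add: power_divide power_mult)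
  finally show ?thesis unfolding form_weight_def .
qed

lemma fund_domain_measurable [measurable]: "fund_domain \<in> sets borel"
proof -
  have "fund_domain = upper_half_plane \<inter> {z. \<bar>Re z\<bar> \<le> 1 / 2} \<inter> {z. 1 \<le> cmod z}" unfolding fund_domain_def by auto
  also have "\<dots> \<in> sets borel" by measurable
  finally show ?thesis .
qed

lemma box_region_Im_pos:
  assumes "R > 0" "w \<in> box_region R"
  shows "Im w > 0"
proof -
  have "0 < 1 / R" using assms by simp
  then show ?thesis using assms(2) unfolding box_region_def mem_Collect_eq by linarith
qed

lemma square_subset_box_region:
  assumes R: "R \<ge> 1" and z: "z \<in> box_region R" and l: "l \<ge> 1"
  shows "square z (Im z / (4 * sqrt (real l))) \<subseteq> box_region (2 * R)"
proof
  fix w assume w: "w \<in> square z (Im z / (4 * sqrt (real l)))"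
  have zz: "\<bar>Re z\<bar> \<le> R" "1 / R \<le> Im z" "Im z \<le> R" using z by (auto simp: box_region_def)
  have "0 < 1 / R" using R by simp
  then have Iz: "Im z > 0" using zz by linarith
  have "sqrt (real l) \<ge> 1" using l by simp
  then have le: "Im z / (4 * sqrt (real l)) \<le> Im z / 4" using Iz by (intro divide_left_mono) auto
  have "\<bar>Re w - Re z\<bar> \<le> Im z / 4" "\<bar>Im w - Im z\<bar> \<le> Im z / 4" using w le unfolding square_def by auto
  moreover have "1 / (2 * R) = (1 / R) / 2" by simp
  ultimately have "\<bar>Re w\<bar> \<le> 2 * R" "1 / (2 * R) \<le> Im w" "Im w \<le> 2 * R" using zz Iz R by linarith+
  then show "w \<in> box_region (2 * R)" unfolding box_region_def by blast
qed

text \<open>Finitely many group elements, depending on R alone, carry the squares around points of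
  the box into the fundamental domain. Density and area are invariant, so each element contributes
  at most one integral over that domain. The factor k reflects that the squares have area of order 1
  / k.\<close>

lemma cusp_form_pointwise_bound:
  assumes R: "R \<ge> 1"
  shows "\<exists>C>0. \<forall>k\<ge>1. \<forall>f\<in>cusp_forms k. \<forall>z\<in>box_region R.
    ennreal (form_weight k f z) \<le> ennreal (C * real k) * (\<integral>\<^sup>+w. ennreal (form_weight k f w) * indicator fund_domain w \<partial>hyp_area)"
proof -
  have R2: "2 * R \<ge> 1" using R by simp
  obtain G where G: "finite G" "G \<subseteq> SL2Z" "\<And>w. w \<in> box_region (2 * R) \<Longrightarrow> \<exists>\<gamma>\<in>G. moebius \<gamma> w \<in> fund_domain"
    using box_region_finite_cover[OF R2] by blast
  define C where "C = 512 * (real (card G) + 1)"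
  show ?thesis
  proof (intro exI[of _ C] conjI allI impI ballI)
    show "C > 0" unfolding C_def by simp
    fix k f z assume k: "k \<ge> (1::nat)" and f: "f \<in> cusp_forms k" and z: "z \<in> box_region R"
    have [measurable]: "f \<in> borel_measurable borel" by (rule cusp_form_measurable[OF f])
    have [measurable]: "form_weight k f \<in> borel_measurable borel" unfolding form_weight_def[abs_def] by measurable
    have Iz: "Im z > 0" by (rule box_region_Im_pos[OF _ z]) (use R in simp)
    let ?I = "\<integral>\<^sup>+w. ennreal (form_weight k f w) * indicator fund_domain w \<partial>hyp_area"
    have nn: "0 \<le> form_weight k f w" if "Im w > 0" for w using that by (simp add: form_weight_def)
    have "ennreal (form_weight k f z) \<le> ennreal (512 * real k) *
        (\<integral>\<^sup>+w. ennreal (form_weight k f w) * indicator (square z (Im z / (4 * sqrt (real k)))) w \<partial>hyp_area)"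
      unfolding form_weight_def by (rule weighted_square_mean[OF cusp_formsD(1)[OF f] Iz k]) measurable
    also have "\<dots> \<le> ennreal (512 * real k) * (\<integral>\<^sup>+w. (\<Sum>\<gamma>\<in>G. ennreal (form_weight k f (moebius \<gamma> w)) * indicator fund_domain (moebius \<gamma> w)) \<partial>hyp_area)"
    proof (rule mult_left_mono)
      have "(\<integral>\<^sup>+w. ennreal (form_weight k f w) * indicator (square z (Im z / (4 * sqrt (real k)))) w \<partial>hyp_area) =
         (\<integral>\<^sup>+w. indicator upper_half_plane w * ennreal (1 / (Im w)\<^sup>2) * (ennreal (form_weight k f w) * indicator (square z (Im z / (4 * sqrt (real k)))) w) \<partial>lborel)"
        by (rule nn_integral_hyp_area) measurable
      also have "\<dots> \<le> (\<integral>\<^sup>+w. indicator upper_half_plane w * ennreal (1 / (Im w)\<^sup>2) * (\<Sum>\<gamma>\<in>G. ennreal (form_weight k f (moebius \<gamma> w)) * indicator fund_domain (moebius \<gamma> w)) \<partial>lborel)"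
      proof (intro nn_integral_mono mult_left_mono)
        fix w
        show "ennreal (form_weight k f w) * indicator (square z (Im z / (4 * sqrt (real k)))) w \<le>
            (\<Sum>\<gamma>\<in>G. ennreal (form_weight k f (moebius \<gamma> w)) * indicator fund_domain (moebius \<gamma> w))"
        proof (cases "w \<in> square z (Im z / (4 * sqrt (real k)))")
          case True
          then have w: "w \<in> box_region (2 * R)" using square_subset_box_region[OF R z k] by auto
          have Iw: "Im w > 0" by (rule box_region_Im_pos[OF _ w]) (use R in simp)
          obtain \<gamma> where g: "\<gamma> \<in> G" "moebius \<gamma> w \<in> fund_domain" using G(3)[OF w] by blast
          have "ennreal (form_weight k f w) = ennreal (form_weight k f (moebius \<gamma> w)) * indicator fund_domain (moebius \<gamma> w)"
            using form_weight_moebius[OF f subsetD[OF G(2) g(1)] Iw] g(2) by simp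
          also have "\<dots> \<le> (\<Sum>\<gamma>\<in>G. ennreal (form_weight k f (moebius \<gamma> w)) * indicator fund_domain (moebius \<gamma> w))"
            using G(1) g(1) by (intro member_le_sum) auto
          finally show ?thesis using True by simp
        qed simp
      qed simp
      also have "\<dots> = (\<integral>\<^sup>+w. (\<Sum>\<gamma>\<in>G. ennreal (form_weight k f (moebius \<gamma> w)) * indicator fund_domain (moebius \<gamma> w)) \<partial>hyp_area)"
        by (rule nn_integral_hyp_area[symmetric]) measurable
      finally show "(\<integral>\<^sup>+w. ennreal (form_weight k f w) * indicator (square z (Im z / (4 * sqrt (real k)))) w \<partial>hyp_area) \<le>
        (\<integral>\<^sup>+w. (\<Sum>\<gamma>\<in>G. ennreal (form_weight k f (moebius \<gamma> w)) * indicator fund_domain (moebius \<gamma> w)) \<partial>hyp_area)" .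
    qed simp
    also have "(\<integral>\<^sup>+w. (\<Sum>\<gamma>\<in>G. ennreal (form_weight k f (moebius \<gamma> w)) * indicator fund_domain (moebius \<gamma> w)) \<partial>hyp_area) =
       (\<Sum>\<gamma>\<in>G. \<integral>\<^sup>+w. ennreal (form_weight k f (moebius \<gamma> w)) * indicator fund_domain (moebius \<gamma> w) \<partial>hyp_area)"
      by (rule nn_integral_sum) measurable
    also have "\<dots> = (\<Sum>\<gamma>\<in>G. ?I)"
      using G(2) by (intro sum.cong refl nn_integral_hyp_area_moebius[where u = "\<lambda>w. ennreal (form_weight k f w) * indicator fund_domain w"]) auto
    also have "\<dots> = ennreal (real (card G)) * ?I" by (simp add: ennreal_of_nat_eq_real_of_nat)
    also have "ennreal (512 * real k) * (ennreal (real (card G)) * ?I) = ennreal (512 * real k * real (card G)) * ?I"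
      by (simp add: ennreal_mult mult.assoc)
    also have "\<dots> \<le> ennreal (C * real k) * ?I"
      unfolding C_def by (intro mult_right_mono ennreal_leI) (auto simp: algebra_simps)
    finally show "ennreal (form_weight k f z) \<le> ennreal (C * real k) * ?I" .
  qed
qed

section \<open>Cusp forms with a peak\<close>

text \<open>The squared Euclidean norm of the matrix, used to measure convergence of series over the
  group.\<close>

fun gsize :: "int \<times> int \<times> int \<times> int \<Rightarrow> real" where
  "gsize (a, b, c, d) = (real_of_int a)\<^sup>2 + (real_of_int b)\<^sup>2 + (real_of_int c)\<^sup>2 + (real_of_int d)\<^sup>2"

declare gsize.simps [simp del]

text \<open>This is (c w + d) times the difference of the image of w and \<open>cnj z\<close>, the
  denominator that occurs in the reproducing kernel.\<close>

definition kernel_den :: "complex \<Rightarrow> int \<times> int \<times> int \<times> int \<Rightarrow> complex \<Rightarrow> complex" where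
  "kernel_den z \<gamma> w = moebius_num \<gamma> w - cnj z * moebius_den \<gamma> w"

text \<open>The determinant turns the mixed terms into 2 Im z Im w. In this form every summand is
  nonnegative for z and w in the upper half-plane.\<close>

lemma kernel_den_sq:
  assumes g: "(a, b, c, d) \<in> SL2Z"
  shows "(cmod (kernel_den z (a, b, c, d) w))\<^sup>2 =
    ((a - Re z * c) * Re w + (b - Re z * d))\<^sup>2 + ((a - Re z * c) * Im w)\<^sup>2
    + (Im z)\<^sup>2 * ((c * Re w + d)\<^sup>2 + (c * Im w)\<^sup>2) + 2 * Im z * Im w"
proof -
  have det: "real_of_int a * real_of_int d - real_of_int b * real_of_int c = 1"
    using g unfolding SL2Z_def by (metis (mono_tags, lifting) case_prodD mem_Collect_eq of_int_1 of_int_diff of_int_mult)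
  define A where "A = real_of_int a - Re z * real_of_int c"
  define B where "B = real_of_int b - Re z * real_of_int d"
  have AB: "A * d - B * c = 1" unfolding A_def B_def using det by (simp add: algebra_simps)
  have re: "Re (kernel_den z (a, b, c, d) w) = (A * Re w + B) - Im z * (c * Im w)"
    unfolding kernel_den_def A_def B_def by (simp add: algebra_simps)
  have im: "Im (kernel_den z (a, b, c, d) w) = A * Im w + Im z * (c * Re w + d)"
    unfolding kernel_den_def A_def B_def by (simp add: algebra_simps)
  have "(cmod (kernel_den z (a, b, c, d) w))\<^sup>2 = (A * Re w + B)\<^sup>2 + (A * Im w)\<^sup>2
     + (Im z)\<^sup>2 * ((c * Re w + d)\<^sup>2 + (c * Im w)\<^sup>2) + 2 * Im z * (Im w * (A * d - B * c))"
    unfolding cmod_power2 re im by (simp add: power2_eq_square algebra_simps)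
  then have "(cmod (kernel_den z (a, b, c, d) w))\<^sup>2 = (A * Re w + B)\<^sup>2 + (A * Im w)\<^sup>2
     + (Im z)\<^sup>2 * ((c * Re w + d)\<^sup>2 + (c * Im w)\<^sup>2) + 2 * Im z * Im w"
    unfolding AB mult_1_right .
  then show ?thesis unfolding A_def B_def .
qed

text \<open>For w in the fundamental domain |p w + q|^2 is a reduced quadratic form: its outer
  coefficients are at least 1 and its middle term is at most |p q| <= (p^2 + q^2) / 2.\<close>

lemma fund_domain_lin_ge:
  assumes "w \<in> fund_domain"
  shows "(p\<^sup>2 + q\<^sup>2) / 2 \<le> (p * Re w + q)\<^sup>2 + (p * Im w)\<^sup>2"
proof -
  have x: "\<bar>Re w\<bar> \<le> 1 / 2" and "1 \<le> cmod w" using assms by (auto simp: fund_domain_def)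
  then have n: "1 \<le> (Re w)\<^sup>2 + (Im w)\<^sup>2" unfolding cmod_power2[symmetric] by (simp add: power2_eq_square mult_ge1_I)
  have "\<bar>2 * p * q * Re w\<bar> = 2 * \<bar>p\<bar> * \<bar>q\<bar> * \<bar>Re w\<bar>" by (simp add: abs_mult)
  also have "\<dots> \<le> 2 * \<bar>p\<bar> * \<bar>q\<bar> * (1 / 2)"
    using x by (intro mult_left_mono) auto
  also have "\<dots> \<le> (p\<^sup>2 + q\<^sup>2) / 2"
    using sum_squares_bound[of "\<bar>p\<bar>" "\<bar>q\<bar>"] by simp
  finally have "\<bar>2 * p * q * Re w\<bar> \<le> (p\<^sup>2 + q\<^sup>2) / 2" .
  then have "- (2 * p * q * Re w) \<le> (p\<^sup>2 + q\<^sup>2) / 2" by (rule abs_le_D2)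
  then have "- ((p\<^sup>2 + q\<^sup>2) / 2) \<le> 2 * p * q * Re w" by (subst minus_le_iff)
  moreover have "p\<^sup>2 * 1 \<le> p\<^sup>2 * ((Re w)\<^sup>2 + (Im w)\<^sup>2)" using n by (intro mult_left_mono) auto
  moreover have "(p * Re w + q)\<^sup>2 + (p * Im w)\<^sup>2 = p\<^sup>2 * ((Re w)\<^sup>2 + (Im w)\<^sup>2) + 2 * p * q * Re w + q\<^sup>2"
    by (simp add: power2_eq_square algebra_simps)
  moreover have "(P + Q) / 2 \<le> X + T + Q" if "- ((P + Q) / 2) \<le> T" "P * 1 \<le> X" for P Q X T :: real
    using that by argo
  ultimately show ?thesis by presburger
qed

lemma kernel_coeff_ge:
  assumes z: "z \<in> fund_domain"
  shows "(p\<^sup>2 + q\<^sup>2) / 2 \<le> (p - Re z * q)\<^sup>2 + (Im z)\<^sup>2 * q\<^sup>2"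
  using fund_domain_lin_ge[OF z, of q "- p"] by (simp add: power2_eq_square algebra_simps)

lemma gsize_ge_1:
  assumes g: "\<gamma> \<in> SL2Z"
  shows "1 \<le> gsize \<gamma>"
proof -
  obtain a b c d where abcd: "\<gamma> = (a, b, c, d)" by (cases \<gamma>)
  have "a \<noteq> 0 \<or> c \<noteq> 0" using g unfolding abcd SL2Z_def by auto
  then have "1 \<le> a\<^sup>2 + c\<^sup>2"
    by (metis add.commute add_nonneg_pos int_one_le_iff_zero_less zero_le_power2 zero_less_power2)
  then have "1 \<le> (real_of_int a)\<^sup>2 + (real_of_int c)\<^sup>2" by (metis of_int_1_le_iff of_int_add of_int_power)
  moreover have "0 \<le> (real_of_int b)\<^sup>2" "0 \<le> (real_of_int d)\<^sup>2" by simp_all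
  ultimately show ?thesis unfolding abcd by (simp only: gsize.simps)
qed

text \<open>\<open>\<kappa>\<close> bounds the quadratic form of w from below: it will be 1/2 in the
  fundamental domain and the constant of \<open>box_region_lin_ge\<close> on boxes. The reduced form
  of z accounts for the further factor 1/2.\<close>

lemma kernel_den_ge_gen:
  assumes g: "\<gamma> \<in> SL2Z" and z: "z \<in> fund_domain" and w: "Im w > 0"
    and \<kappa>: "\<kappa> \<ge> 0" "\<And>p q. \<kappa> * (p\<^sup>2 + q\<^sup>2) \<le> (p * Re w + q)\<^sup>2 + (p * Im w)\<^sup>2"
  shows "\<kappa> / 2 * gsize \<gamma> \<le> (cmod (kernel_den z \<gamma> w))\<^sup>2"
proof -
  obtain a b c d where abcd: "\<gamma> = (a, b, c, d)" by (cases \<gamma>)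
  let ?A = "real_of_int a - Re z * real_of_int c" and ?B = "real_of_int b - Re z * real_of_int d"
  have Iz: "Im z > 0" using z by (auto simp: fund_domain_def upper_half_plane_def)
  have "\<kappa> * (?A\<^sup>2 + ?B\<^sup>2) \<le> (?A * Re w + ?B)\<^sup>2 + (?A * Im w)\<^sup>2" by (rule \<kappa>(2))
  moreover have "(Im z)\<^sup>2 * (\<kappa> * ((real_of_int c)\<^sup>2 + (real_of_int d)\<^sup>2)) \<le> (Im z)\<^sup>2 * ((c * Re w + d)\<^sup>2 + (c * Im w)\<^sup>2)"
    by (intro mult_left_mono \<kappa>(2)) simp
  moreover have "0 \<le> 2 * Im z * Im w" using Iz w by simp
  ultimately have "\<kappa> * (?A\<^sup>2 + ?B\<^sup>2) + (Im z)\<^sup>2 * (\<kappa> * ((real_of_int c)\<^sup>2 + (real_of_int d)\<^sup>2)) \<le> (cmod (kernel_den z \<gamma> w))\<^sup>2"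
    unfolding abcd kernel_den_sq[OF g[unfolded abcd]] by linarith
  moreover have "\<kappa> * (((real_of_int a)\<^sup>2 + (real_of_int c)\<^sup>2) / 2 + ((real_of_int b)\<^sup>2 + (real_of_int d)\<^sup>2) / 2) \<le>
      \<kappa> * ((?A\<^sup>2 + (Im z)\<^sup>2 * (real_of_int c)\<^sup>2) + (?B\<^sup>2 + (Im z)\<^sup>2 * (real_of_int d)\<^sup>2))"
    by (intro mult_left_mono add_mono kernel_coeff_ge[OF z] \<kappa>(1))
  moreover have "\<kappa> * (?A\<^sup>2 + ?B\<^sup>2) + (Im z)\<^sup>2 * (\<kappa> * ((real_of_int c)\<^sup>2 + (real_of_int d)\<^sup>2)) =
      \<kappa> * ((?A\<^sup>2 + (Im z)\<^sup>2 * (real_of_int c)\<^sup>2) + (?B\<^sup>2 + (Im z)\<^sup>2 * (real_of_int d)\<^sup>2))"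
    by (simp only: distrib_left mult_ac add_ac)
  moreover have "\<kappa> / 2 * (p + q + r + s) = \<kappa> * ((p + r) / 2 + (q + s) / 2)" for p q r s :: real
    by (simp add: field_simps)
  ultimately show ?thesis unfolding abcd gsize.simps by (simp only:)
qed

text \<open>The first bound serves the convergence over the group, the second the decay in w at the
  cusp.\<close>

lemma kernel_den_ge:
  assumes g: "\<gamma> \<in> SL2Z" and z: "z \<in> fund_domain" and w: "w \<in> fund_domain"
  shows "gsize \<gamma> / 4 \<le> (cmod (kernel_den z \<gamma> w))\<^sup>2" "(Im w)\<^sup>2 / 2 \<le> (cmod (kernel_den z \<gamma> w))\<^sup>2"
proof -
  have Iw: "Im w > 0" using w by (auto simp: fund_domain_def upper_half_plane_def)
  have Iz: "Im z > 0" using z by (auto simp: fund_domain_def upper_half_plane_def)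
  show "gsize \<gamma> / 4 \<le> (cmod (kernel_den z \<gamma> w))\<^sup>2"
    using kernel_den_ge_gen[OF g z Iw, of "1 / 2"] fund_domain_lin_ge[OF w] by simp
  obtain a b c d where abcd: "\<gamma> = (a, b, c, d)" by (cases \<gamma>)
  let ?A = "real_of_int a - Re z * real_of_int c"
  have "a \<noteq> 0 \<or> c \<noteq> 0" using g unfolding abcd SL2Z_def by auto
  then have "1 \<le> a\<^sup>2 + c\<^sup>2"
    by (metis add.commute add_nonneg_pos int_one_le_iff_zero_less zero_le_power2 zero_less_power2)
  then have 1: "1 \<le> (real_of_int a)\<^sup>2 + (real_of_int c)\<^sup>2" by (metis of_int_1_le_iff of_int_add of_int_power)
  have "((real_of_int a)\<^sup>2 + (real_of_int c)\<^sup>2) / 2 \<le> ?A\<^sup>2 + (Im z)\<^sup>2 * (real_of_int c)\<^sup>2" by (rule kernel_coeff_ge[OF z])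
  moreover have "1 / 2 \<le> ((real_of_int a)\<^sup>2 + (real_of_int c)\<^sup>2) / 2" using 1 by (simp only: divide_right_mono)
  ultimately have "1 / 2 \<le> ?A\<^sup>2 + (Im z)\<^sup>2 * (real_of_int c)\<^sup>2" by (rule order_trans[rotated])
  then have "1 / 2 * (Im w)\<^sup>2 \<le> (?A\<^sup>2 + (Im z)\<^sup>2 * (real_of_int c)\<^sup>2) * (Im w)\<^sup>2" by (intro mult_right_mono) auto
  also have "\<dots> = (?A * Im w)\<^sup>2 + (Im z)\<^sup>2 * (c * Im w)\<^sup>2" 
    by (simp only: power_mult_distrib distrib_right mult.assoc)
  also have "\<dots> \<le> (cmod (kernel_den z \<gamma> w))\<^sup>2"
    unfolding abcd kernel_den_sq[OF g[unfolded abcd]] using Iw Iz by (simp add: distrib_left)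
  finally show "(Im w)\<^sup>2 / 2 \<le> (cmod (kernel_den z \<gamma> w))\<^sup>2" by simp
qed

lemma kernel_den_nonzero:
  assumes g: "\<gamma> \<in> SL2Z" and z: "Im z > 0" and w: "Im w > 0"
  shows "kernel_den z \<gamma> w \<noteq> 0"
proof -
  obtain a b c d where abcd: "\<gamma> = (a, b, c, d)" by (cases \<gamma>)
  have "0 < 2 * Im z * Im w" using z w by simp
  then have "0 < (cmod (kernel_den z \<gamma> w))\<^sup>2"
    unfolding abcd kernel_den_sq[OF g[unfolded abcd]] by (intro add_nonneg_pos) auto
  then show ?thesis by auto
qed

text \<open>The subtracted term lets the induction telescope; for n = 0 both sides are 1.\<close>

lemma sum_inverse_squares_le: "(\<Sum>a\<in>{- int n..int n}. 1 / (1 + (real_of_int a)\<^sup>2)) \<le> 5 - 4 / (real n + 1)"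
proof (induction n)
  case (Suc n)
  have "{- int (Suc n)..int (Suc n)} = insert (- int (Suc n)) (insert (int (Suc n)) {- int n..int n})" by auto
  then have "(\<Sum>a\<in>{- int (Suc n)..int (Suc n)}. 1 / (1 + (real_of_int a)\<^sup>2)) =
      2 / (1 + (real n + 1)\<^sup>2) + (\<Sum>a\<in>{- int n..int n}. 1 / (1 + (real_of_int a)\<^sup>2))"
    by (simp add: power2_eq_square algebra_simps)
  also have "\<dots> \<le> 2 / (1 + (real n + 1)\<^sup>2) + (5 - 4 / (real n + 1))" using Suc.IH by simp
  also have "2 / (1 + (real n + 1)\<^sup>2) \<le> 4 / (real n + 1) - 4 / (real n + 2)"
  proof -
    have "4 / (real n + 1) - 4 / (real n + 2) = 4 / ((real n + 1) * (real n + 2))" by (simp add: field_simps)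
    moreover have "2 / t = 4 / (2 * t)" for t :: real by simp
    then have "2 / (1 + (real n + 1)\<^sup>2) = 4 / (2 * (1 + (real n + 1)\<^sup>2))" .
    moreover have "(real n + 1) * (real n + 2) \<le> 2 * (1 + (real n + 1)\<^sup>2)"
      by (simp add: power2_eq_square algebra_simps)
    ultimately show ?thesis by (simp only:) (intro divide_left_mono mult_pos_pos, auto intro: add_pos_nonneg)
  qed
  finally show ?case by (simp add: add.commute)
qed simp

text \<open>The exponent 4 is the number of entries: each of 1 + a^2, 1 + b^2, 1 + c^2, 1 + d^2 is
  at most twice the size, so the sum is dominated by a product of four one-variable sums.\<close>

lemma gsize_power_summable: "(\<lambda>\<gamma>. 1 / gsize \<gamma> ^ 4) summable_on SL2Z"
proof (rule nonneg_bdd_above_summable_on)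
  show "0 \<le> 1 / gsize \<gamma> ^ 4" if "\<gamma> \<in> SL2Z" for \<gamma> using gsize_ge_1[OF that] by simp
  show "bdd_above (sum (\<lambda>\<gamma>. 1 / gsize \<gamma> ^ 4) ` {F. F \<subseteq> SL2Z \<and> finite F})"
  proof (rule bdd_aboveI2)
    fix F assume F: "F \<in> {F. F \<subseteq> SL2Z \<and> finite F}"
    define h where "h a = 1 / (1 + (real_of_int a)\<^sup>2)" for a
    have hnn: "0 \<le> h a" for a unfolding h_def by (simp add: add_nonneg_nonneg)
    define m where "m = (\<lambda>(a, b, c, d). max (max \<bar>a\<bar> \<bar>b\<bar>) (max \<bar>c\<bar> \<bar>d\<bar>) :: int)"
    obtain n :: nat where n: "\<And>\<gamma>. \<gamma> \<in> F \<Longrightarrow> m \<gamma> \<le> int n"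
    proof -
      have "finite (m ` F)" using F by auto
      then obtain M where "\<And>x. x \<in> m ` F \<Longrightarrow> x \<le> M" by (meson bdd_above_def bdd_above_finite)
      then have "\<And>\<gamma>. \<gamma> \<in> F \<Longrightarrow> m \<gamma> \<le> int (nat M)" by (smt (verit, best) image_eqI int_nat_eq)
      then show ?thesis using that by blast
    qed
    define B where "B = {- int n..int n}"
    have sub: "F \<subseteq> B \<times> B \<times> B \<times> B"
    proof
      fix \<gamma> assume "\<gamma> \<in> F"
      from n[OF this] show "\<gamma> \<in> B \<times> B \<times> B \<times> B" unfolding m_def B_def by (cases \<gamma>) auto
    qed
    have pt: "1 / gsize \<gamma> ^ 4 \<le> 16 * (case \<gamma> of (a, b, c, d) \<Rightarrow> h a * (h b * (h c * h d)))" if "\<gamma> \<in> F" for \<gamma>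
    proof -
      obtain a b c d where abcd: "\<gamma> = (a, b, c, d)" by (cases \<gamma>)
      define g where "g = gsize \<gamma>"
      have g1: "1 \<le> g" unfolding g_def by (rule gsize_ge_1) (use that F in auto)
      have le: "1 + (real_of_int a)\<^sup>2 \<le> 2 * g" "1 + (real_of_int b)\<^sup>2 \<le> 2 * g" "1 + (real_of_int c)\<^sup>2 \<le> 2 * g" "1 + (real_of_int d)\<^sup>2 \<le> 2 * g"
        using g1 zero_le_power2[of "real_of_int a"] zero_le_power2[of "real_of_int b"] zero_le_power2[of "real_of_int c"] zero_le_power2[of "real_of_int d"]
        unfolding g_def abcd gsize.simps by - argo+
      have "(1 + (real_of_int a)\<^sup>2) * ((1 + (real_of_int b)\<^sup>2) * ((1 + (real_of_int c)\<^sup>2) * (1 + (real_of_int d)\<^sup>2))) \<le> (2 * g) * ((2 * g) * ((2 * g) * (2 * g)))"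
        using g1 by (intro mult_mono le) (auto intro!: mult_nonneg_nonneg add_nonneg_nonneg)
      also have "\<dots> = 16 * g ^ 4" by (simp add: power4_eq_xxxx)
      finally have "16 / (16 * g ^ 4) \<le> 16 / ((1 + (real_of_int a)\<^sup>2) * ((1 + (real_of_int b)\<^sup>2) * ((1 + (real_of_int c)\<^sup>2) * (1 + (real_of_int d)\<^sup>2))))"
        using g1 by (intro divide_left_mono) (auto intro!: mult_pos_pos add_pos_nonneg)
      then show ?thesis unfolding h_def abcd[symmetric] g_def[symmetric] by (simp add: abcd)
    qed
    have "sum (\<lambda>\<gamma>. 1 / gsize \<gamma> ^ 4) F \<le> (\<Sum>\<gamma>\<in>F. 16 * (case \<gamma> of (a, b, c, d) \<Rightarrow> h a * (h b * (h c * h d))))"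
      by (intro sum_mono pt)
    also have "\<dots> \<le> (\<Sum>\<gamma>\<in>B \<times> B \<times> B \<times> B. 16 * (case \<gamma> of (a, b, c, d) \<Rightarrow> h a * (h b * (h c * h d))))"
      using hnn by (intro sum_mono2 sub) (auto simp: B_def)
    also have "\<dots> = 16 * (sum h B * (sum h B * (sum h B * sum h B)))"
      by (simp add: sum.cartesian_product' sum_distrib_left sum_distrib_right sum_product mult_ac)
    also have "\<dots> \<le> 16 * (5 * (5 * (5 * 5)))"
    proof -
      have "sum h B \<le> 5 - 4 / (real n + 1)" unfolding h_def B_def by (rule sum_inverse_squares_le)
      then have "sum h B \<le> 5" by (smt (verit) divide_nonneg_nonneg of_nat_0_le_iff)
      moreover have "0 \<le> sum h B" by (intro sum_nonneg hnn)
      ultimately show ?thesis by (intro mult_left_mono mult_mono) auto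
    qed
    finally show "sum (\<lambda>\<gamma>. 1 / gsize \<gamma> ^ 4) F \<le> 16 * (5 * (5 * (5 * 5)))" .
  qed
qed

section \<open>The kernel series: convergence, holomorphy, modularity, decay\<close>

lemma box_region_lin_ge:
  assumes R: "R \<ge> 1" and w: "w \<in> box_region R"
  shows "1 / (2 + R\<^sup>2 + 2 * R ^ 4) * (p\<^sup>2 + q\<^sup>2) \<le> (p * Re w + q)\<^sup>2 + (p * Im w)\<^sup>2"
proof -
  have Iw: "Im w > 0" by (rule box_region_Im_pos[OF _ w]) (use R in simp)
  have ww: "\<bar>Re w\<bar> \<le> R" "1 / R \<le> Im w" using w by (auto simp: box_region_def)
  have x2: "(Re w)\<^sup>2 \<le> R\<^sup>2" using ww(1) by (metis abs_ge_zero power2_abs power_mono)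
  have "1 \<le> R * Im w" using ww(2) R by (simp add: field_simps)
  then have "1\<^sup>2 \<le> (R * Im w)\<^sup>2" by (intro power_mono) auto
  then have "p\<^sup>2 * 1 \<le> p\<^sup>2 * (R * Im w)\<^sup>2" by (intro mult_left_mono) auto
  then have p: "p\<^sup>2 \<le> R\<^sup>2 * (p * Im w)\<^sup>2" by (simp add: power_mult_distrib mult_ac)
  define u where "u = p * Re w + q"
  have "q = u - p * Re w" unfolding u_def by simp
  moreover have "(u - v)\<^sup>2 \<le> 2 * u\<^sup>2 + 2 * v\<^sup>2" for v
    using zero_le_power2[of "u + v"] by (simp add: power2_eq_square algebra_simps)
  ultimately have "q\<^sup>2 \<le> 2 * u\<^sup>2 + 2 * (p * Re w)\<^sup>2" by simp
  also have "(p * Re w)\<^sup>2 \<le> p\<^sup>2 * R\<^sup>2" unfolding power_mult_distrib by (intro mult_left_mono x2) simp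
  finally have q: "q\<^sup>2 \<le> 2 * u\<^sup>2 + 2 * (R\<^sup>2 * p\<^sup>2)" by (simp add: mult.commute)
  have "p\<^sup>2 + q\<^sup>2 \<le> 2 * u\<^sup>2 + (1 + 2 * R\<^sup>2) * p\<^sup>2" using q by (simp add: algebra_simps)
  also have "\<dots> \<le> 2 * u\<^sup>2 + (1 + 2 * R\<^sup>2) * (R\<^sup>2 * (p * Im w)\<^sup>2)" by (intro add_left_mono mult_left_mono p) simp
  also have "\<dots> \<le> (2 + R\<^sup>2 + 2 * R ^ 4) * u\<^sup>2 + (2 + R\<^sup>2 + 2 * R ^ 4) * (p * Im w)\<^sup>2"
  proof (rule add_mono)
    show "2 * u\<^sup>2 \<le> (2 + R\<^sup>2 + 2 * R ^ 4) * u\<^sup>2" by (intro mult_right_mono) auto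
    have "(1 + 2 * R\<^sup>2) * (R\<^sup>2 * (p * Im w)\<^sup>2) = (R\<^sup>2 + 2 * R ^ 4) * (p * Im w)\<^sup>2"
      by (simp add: algebra_simps power4_eq_xxxx power2_eq_square)
    also have "\<dots> \<le> (2 + R\<^sup>2 + 2 * R ^ 4) * (p * Im w)\<^sup>2" by (intro mult_right_mono) auto
    finally show "(1 + 2 * R\<^sup>2) * (R\<^sup>2 * (p * Im w)\<^sup>2) \<le> (2 + R\<^sup>2 + 2 * R ^ 4) * (p * Im w)\<^sup>2" .
  qed
  also have "\<dots> = (2 + R\<^sup>2 + 2 * R ^ 4) * (u\<^sup>2 + (p * Im w)\<^sup>2)" by (simp add: algebra_simps)
  finally have "p\<^sup>2 + q\<^sup>2 \<le> (2 + R\<^sup>2 + 2 * R ^ 4) * (u\<^sup>2 + (p * Im w)\<^sup>2)" .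
  moreover have "0 < 2 + R\<^sup>2 + 2 * R ^ 4" by (simp add: add_pos_nonneg)
  ultimately show ?thesis unfolding u_def[symmetric] by (simp add: pos_divide_le_eq mult.commute)
qed

text \<open>For large even weights this is, up to a constant factor, the cusp form that represents
  evaluation at z in the Petersson inner product. The argument below uses its peak at z.\<close>

definition kernel_form :: "nat \<Rightarrow> complex \<Rightarrow> complex \<Rightarrow> complex" where
  "kernel_form k z w = (if Im w > 0 then (\<Sum>\<^sub>\<infinity>\<gamma>\<in>SL2Z. inverse (kernel_den z \<gamma> w ^ k)) else 0)"

lemma norm_kernel_term_le:
  assumes j: "j \<ge> 4" and g: "\<gamma> \<in> SL2Z" and m: "0 < m" "m * gsize \<gamma> \<le> (cmod (kernel_den z \<gamma> w))\<^sup>2"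
  shows "cmod (inverse (kernel_den z \<gamma> w ^ (2 * j))) \<le> (1 / m) ^ j * (1 / gsize \<gamma> ^ 4)"
proof -
  have g1: "1 \<le> gsize \<gamma>" by (rule gsize_ge_1[OF g])
  have "m ^ j * gsize \<gamma> ^ 4 \<le> m ^ j * gsize \<gamma> ^ j"
    using m g1 j by (intro mult_left_mono power_increasing) auto
  also have "\<dots> = (m * gsize \<gamma>) ^ j" by (simp add: power_mult_distrib)
  also have "\<dots> \<le> ((cmod (kernel_den z \<gamma> w))\<^sup>2) ^ j" using m g1 by (intro power_mono) auto
  finally have le: "m ^ j * gsize \<gamma> ^ 4 \<le> cmod (kernel_den z \<gamma> w) ^ (2 * j)" by (simp add: power_mult)
  moreover have "0 < m ^ j * gsize \<gamma> ^ 4" using m g1 by simp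
  ultimately have "inverse (cmod (kernel_den z \<gamma> w) ^ (2 * j)) \<le> inverse (m ^ j * gsize \<gamma> ^ 4)" by (intro le_imp_inverse_le)
  also have "\<dots> = (1 / m) ^ j * (1 / gsize \<gamma> ^ 4)" by (simp add: inverse_eq_divide power_one_over)
  finally show ?thesis by (simp add: norm_inverse norm_power)
qed

lemma box_region_exists:
  assumes "Im w > 0"
  obtains R e where "R \<ge> 1" "e > 0" "cball w e \<subseteq> box_region R"
proof -
  define R where "R = \<bar>Re w\<bar> + 2 * Im w + 2 / Im w + 1"
  have p: "0 < 2 / Im w" using assms by simp
  have R1: "R \<ge> 1" unfolding R_def using assms p by linarith
  have "cball w (Im w / 2) \<subseteq> box_region R"
  proof
    fix v assume "v \<in> cball w (Im w / 2)"
    then have d: "cmod (v - w) \<le> Im w / 2" by (simp add: dist_norm norm_minus_commute)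
    have "\<bar>Re v - Re w\<bar> \<le> Im w / 2" using abs_Re_le_cmod[of "v - w"] d by simp
    moreover have "\<bar>Im v - Im w\<bar> \<le> Im w / 2" using abs_Im_le_cmod[of "v - w"] d by simp
    moreover have "1 / R \<le> Im w / 2"
    proof -
      have "2 / Im w \<le> R" unfolding R_def using assms by linarith
      then show ?thesis using assms R1 by (simp add: field_simps)
    qed
    moreover have "\<bar>Re w\<bar> + Im w / 2 \<le> R" "Im w + Im w / 2 \<le> R" unfolding R_def using assms p by linarith+
    ultimately have "\<bar>Re v\<bar> \<le> R" "1 / R \<le> Im v" "Im v \<le> R" by linarith+
    then show "v \<in> box_region R" by (simp add: box_region_def)
  qed
  then show ?thesis using that[OF R1, of "Im w / 2"] assms by simp
qed

definition gsize_sum :: real where "gsize_sum = (\<Sum>\<^sub>\<infinity>\<gamma>\<in>SL2Z. 1 / gsize \<gamma> ^ 4)"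

lemma gsize_sum_nonneg: "0 \<le> gsize_sum"
  unfolding gsize_sum_def by (intro infsum_nonneg) (simp add: gsize_ge_1 order_trans[OF zero_le_one])

lemma kernel_terms_box_le:
  assumes z: "z \<in> fund_domain" and R: "R \<ge> 1" and j: "j \<ge> 4"
  shows "\<exists>C. \<forall>w\<in>box_region R. \<forall>\<gamma>\<in>SL2Z. cmod (inverse (kernel_den z \<gamma> w ^ (2 * j))) \<le> C * (1 / gsize \<gamma> ^ 4)"
proof -
  define \<kappa> where "\<kappa> = 1 / (2 + R\<^sup>2 + 2 * R ^ 4)"
  have k: "\<kappa> > 0" unfolding \<kappa>_def by (simp add: add_pos_nonneg)
  show ?thesis
  proof (intro exI ballI)
    fix w \<gamma> assume w: "w \<in> box_region R" and g: "\<gamma> \<in> SL2Z"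
    have Iw: "Im w > 0" by (rule box_region_Im_pos[OF _ w]) (use R in simp)
    have "\<kappa> / 2 * gsize \<gamma> \<le> (cmod (kernel_den z \<gamma> w))\<^sup>2"
      by (rule kernel_den_ge_gen[OF g z Iw]) (use k box_region_lin_ge[OF R w] in \<open>auto simp: \<kappa>_def\<close>)
    then show "cmod (inverse (kernel_den z \<gamma> w ^ (2 * j))) \<le> (1 / (\<kappa> / 2)) ^ j * (1 / gsize \<gamma> ^ 4)"
      using k by (intro norm_kernel_term_le[OF j g]) auto
  qed
qed

lemma kernel_abs_summable:
  assumes z: "z \<in> fund_domain" and w: "Im w > 0" and j: "j \<ge> 4"
  shows "(\<lambda>\<gamma>. norm (inverse (kernel_den z \<gamma> w ^ (2 * j)))) summable_on SL2Z"
proof -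
  obtain R e where R: "R \<ge> 1" "e > 0" "cball w e \<subseteq> box_region R" by (rule box_region_exists[OF w])
  obtain C where C: "\<And>w \<gamma>. w \<in> box_region R \<Longrightarrow> \<gamma> \<in> SL2Z \<Longrightarrow> cmod (inverse (kernel_den z \<gamma> w ^ (2 * j))) \<le> C * (1 / gsize \<gamma> ^ 4)"
    using kernel_terms_box_le[OF z R(1) j] by blast
  have wb: "w \<in> box_region R" using R(2,3) by (auto simp: subset_iff)
  show ?thesis
    by (rule Infinite_Sum.abs_summable_on_comparison_test'[OF summable_on_cmult_right[OF gsize_power_summable, of C]])
      (use C[OF wb] in auto)
qed

lemma kernel_form_holomorphic:
  assumes z: "z \<in> fund_domain" and j: "j \<ge> 4"
  shows "kernel_form (2 * j) z holomorphic_on upper_half_plane"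
proof -
  define h where "h w = (\<Sum>\<^sub>\<infinity>\<gamma>\<in>SL2Z. inverse (kernel_den z \<gamma> w ^ (2 * j)))" for w
  have "h analytic_on {w}" if w: "Im w > 0" for w
  proof -
    obtain R e where R: "R \<ge> 1" "e > 0" "cball w e \<subseteq> box_region R" by (rule box_region_exists[OF w])
    obtain C where C: "\<And>w \<gamma>. w \<in> box_region R \<Longrightarrow> \<gamma> \<in> SL2Z \<Longrightarrow> cmod (inverse (kernel_den z \<gamma> w ^ (2 * j))) \<le> C * (1 / gsize \<gamma> ^ 4)"
      using kernel_terms_box_le[OF z R(1) j] by blast
    have Iz: "Im z > 0" using z by (auto simp: fund_domain_def upper_half_plane_def)
    have nz: "kernel_den z \<gamma> v \<noteq> 0" if "v \<in> cball w e" "\<gamma> \<in> SL2Z" for v \<gamma>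
      using kernel_den_nonzero[OF that(2) Iz, of v] box_region_Im_pos[of R v] R that by auto
    have u: "uniform_limit (cball w e) (\<lambda>X v. \<Sum>\<gamma>\<in>X. inverse (kernel_den z \<gamma> v ^ (2 * j))) h (finite_subsets_at_top SL2Z)"
      unfolding h_def
      by (rule Weierstrass_m_test_general[OF _ summable_on_cmult_right[OF gsize_power_summable, of C]]) (use C R(3) in auto)
    have hol: "(\<lambda>v. inverse (kernel_den z \<gamma> v ^ (2 * j))) holomorphic_on cball w e" if "\<gamma> \<in> SL2Z" for \<gamma>
    proof -
      have "(\<lambda>v. kernel_den z \<gamma> v) holomorphic_on cball w e"
        by (cases \<gamma>) (simp add: kernel_den_def, intro holomorphic_intros)
      then show ?thesis using nz that by (intro holomorphic_intros) auto
    qed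
    have ev: "\<forall>\<^sub>F X in finite_subsets_at_top SL2Z. continuous_on (cball w e) (\<lambda>v. \<Sum>\<gamma>\<in>X. inverse (kernel_den z \<gamma> v ^ (2 * j))) \<and>
        (\<lambda>v. \<Sum>\<gamma>\<in>X. inverse (kernel_den z \<gamma> v ^ (2 * j))) holomorphic_on ball w e"
    proof (rule eventually_finite_subsets_at_top_weakI)
      fix X assume X: "finite X" "X \<subseteq> SL2Z"
      have "(\<lambda>v. \<Sum>\<gamma>\<in>X. inverse (kernel_den z \<gamma> v ^ (2 * j))) holomorphic_on cball w e"
        using hol X by (intro holomorphic_on_sum) auto
      then show "continuous_on (cball w e) (\<lambda>v. \<Sum>\<gamma>\<in>X. inverse (kernel_den z \<gamma> v ^ (2 * j))) \<and>
        (\<lambda>v. \<Sum>\<gamma>\<in>X. inverse (kernel_den z \<gamma> v ^ (2 * j))) holomorphic_on ball w e"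
        using ball_subset_cball holomorphic_on_subset holomorphic_on_imp_continuous_on by blast
    qed
    have "h holomorphic_on ball w e"
      by (rule holomorphic_uniform_limit[OF ev u]) auto
    then show ?thesis using R(2) by (auto simp: analytic_at_ball)
  qed
  then have "h holomorphic_on upper_half_plane"
    by (intro analytic_imp_holomorphic) (metis (mono_tags, lifting) analytic_on_analytic_at mem_Collect_eq upper_half_plane_def)
  then show ?thesis
    by (rule holomorphic_transform) (simp add: kernel_form_def h_def upper_half_plane_def)
qed

fun gmult :: "int \<times> int \<times> int \<times> int \<Rightarrow> int \<times> int \<times> int \<times> int \<Rightarrow> int \<times> int \<times> int \<times> int" where
  "gmult (a, b, c, d) (a', b', c', d') = (a * a' + b * c', a * b' + b * d', c * a' + d * c', c * b' + d * d')"

lemma gmult_bij: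
  assumes g: "\<delta> \<in> SL2Z"
  shows "bij_betw (\<lambda>\<gamma>. gmult \<gamma> \<delta>) SL2Z SL2Z"
proof -
  obtain a b c d where d: "\<delta> = (a, b, c, d)" by (cases \<delta>)
  have det: "a * d - b * c = 1" using g unfolding d SL2Z_def by simp
  have mul: "gmult \<gamma> \<delta>' \<in> SL2Z" if "\<gamma> \<in> SL2Z" "\<delta>' \<in> SL2Z" for \<gamma> \<delta>'
  proof -
    obtain p q r s where p: "\<gamma> = (p, q, r, s)" by (cases \<gamma>)
    obtain a b c d where a: "\<delta>' = (a, b, c, d)" by (cases \<delta>')
    have "(p * a + q * c) * (r * b + s * d) - (p * b + q * d) * (r * a + s * c) = (p * s - q * r) * (a * d - b * c)"
      by (simp add: algebra_simps)
    then show ?thesis using that unfolding p a SL2Z_def by simp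
  qed
  have inv: "(d, - b, - c, a) \<in> SL2Z" using det unfolding SL2Z_def by (simp add: algebra_simps)
  have 1: "gmult (gmult \<gamma> (a, b, c, d)) (d, - b, - c, a) = \<gamma>" for \<gamma>
  proof (cases \<gamma>)
    case (fields p q r s)
    have "(p * a + q * c) * d - (p * b + q * d) * c = p * (a * d - b * c)" "(p * b + q * d) * a - (p * a + q * c) * b = q * (a * d - b * c)"
      "(r * a + s * c) * d - (r * b + s * d) * c = r * (a * d - b * c)" "(r * b + s * d) * a - (r * a + s * c) * b = s * (a * d - b * c)"
      by (simp_all add: algebra_simps)
    then show ?thesis unfolding fields det by simp
  qed
  have 2: "gmult (gmult \<gamma> (d, - b, - c, a)) (a, b, c, d) = \<gamma>" for \<gamma>
  proof (cases \<gamma>)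
    case (fields p q r s)
    have "(p * d - q * c) * a + (q * a - p * b) * c = p * (a * d - b * c)" "(p * d - q * c) * b + (q * a - p * b) * d = q * (a * d - b * c)"
      "(r * d - s * c) * a + (s * a - r * b) * c = r * (a * d - b * c)" "(r * d - s * c) * b + (s * a - r * b) * d = s * (a * d - b * c)"
      by (simp_all add: algebra_simps)
    then show ?thesis unfolding fields det by simp
  qed
  show ?thesis unfolding d
    by (rule bij_betwI[where g = "\<lambda>\<gamma>. gmult \<gamma> (d, - b, - c, a)"]) (use 1 2 mul g inv d in auto)
qed

lemma kernel_den_gmult:
  assumes "\<delta> \<in> SL2Z" "Im w > 0"
  shows "kernel_den z (gmult \<gamma> \<delta>) w = kernel_den z \<gamma> (moebius \<delta> w) * moebius_den \<delta> w"
proof -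
  obtain p q r s where p: "\<gamma> = (p, q, r, s)" by (cases \<gamma>)
  obtain a b c d where a: "\<delta> = (a, b, c, d)" by (cases \<delta>)
  have nz: "moebius_den \<delta> w \<noteq> 0" by (rule moebius_in_upper(3)[OF assms])
  define D where "D = moebius_den \<delta> w"
  define V where "V = moebius \<delta> w"
  have VD: "V * D = of_int a * w + of_int b" "D = of_int c * w + of_int d"
    unfolding V_def D_def moebius_def using nz unfolding a by auto
  have "kernel_den z \<gamma> V * D = (of_int p * (V * D) + of_int q * D) - cnj z * (of_int r * (V * D) + of_int s * D)"
    unfolding kernel_den_def p by (simp add: algebra_simps)
  also have "\<dots> = kernel_den z (gmult \<gamma> \<delta>) w"
    unfolding VD(1) unfolding VD(2) kernel_den_def p a by (simp add: algebra_simps)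
  finally show ?thesis unfolding V_def D_def by simp
qed

text \<open>Right multiplication permutes the group, and by \<open>kernel_den_gmult\<close> it moves
  the argument and splits off the automorphy factor.\<close>

lemma kernel_form_modular:
  assumes \<delta>: "\<delta> \<in> SL2Z" and w: "Im w > 0"
  shows "kernel_form k z (moebius \<delta> w) = moebius_den \<delta> w ^ k * kernel_form k z w"
proof -
  have nz: "moebius_den \<delta> w \<noteq> 0" by (rule moebius_in_upper(3)[OF \<delta> w])
  have "kernel_form k z w = (\<Sum>\<^sub>\<infinity>\<gamma>\<in>SL2Z. inverse (kernel_den z (gmult \<gamma> \<delta>) w ^ k))"
    unfolding kernel_form_def using w infsum_reindex_bij_betw[OF gmult_bij[OF \<delta>], of "\<lambda>\<gamma>. inverse (kernel_den z \<gamma> w ^ k)"] by simp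
  also have "\<dots> = (\<Sum>\<^sub>\<infinity>\<gamma>\<in>SL2Z. inverse (kernel_den z \<gamma> (moebius \<delta> w) ^ k) * inverse (moebius_den \<delta> w ^ k))"
    by (simp add: kernel_den_gmult[OF \<delta> w] power_mult_distrib)
  also have "\<dots> = (\<Sum>\<^sub>\<infinity>\<gamma>\<in>SL2Z. inverse (kernel_den z \<gamma> (moebius \<delta> w) ^ k)) * inverse (moebius_den \<delta> w ^ k)"
    by (rule infsum_cmult_left')
  finally show ?thesis
    unfolding kernel_form_def using moebius_in_upper(2)[OF \<delta> w] w nz by (simp add: field_simps)
qed

text \<open>The exponent is divided: one half is spent on the height of w, the other on the sum over
  the group. The assumption j >= 8 leaves at least 4 for the latter.\<close>

lemma kernel_form_cusp_bound:
  assumes z: "z \<in> fund_domain" and w: "w \<in> fund_domain" and j: "j \<ge> 8"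
  shows "cmod (kernel_form (2 * j) z w) \<le> (8 / (Im w)\<^sup>2) ^ (j div 2) * 4 ^ (j) * gsize_sum"
proof -
  have Iw: "Im w > 0" using w by (auto simp: fund_domain_def upper_half_plane_def)
  have j4: "j \<ge> 4" using j by simp
  define b where "b = 1 / Im w"
  have t: "cmod (inverse (kernel_den z \<gamma> w ^ (2 * j))) \<le> ((8 / (Im w)\<^sup>2) ^ (j div 2) * 4 ^ j) * (1 / gsize \<gamma> ^ 4)" if g: "\<gamma> \<in> SL2Z" for \<gamma>
  proof -
    define P where "P = (cmod (kernel_den z \<gamma> w))\<^sup>2"
    have P: "gsize \<gamma> / 4 \<le> P" "(Im w)\<^sup>2 / 2 \<le> P" unfolding P_def by (rule kernel_den_ge[OF g z w])+
    have g1: "1 \<le> gsize \<gamma>" by (rule gsize_ge_1[OF g])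
    define i where "i = j div 2"
    have i: "i \<ge> 4" "i + (j - i) = j" "j - i \<ge> 4" unfolding i_def using j by auto
    have "((Im w)\<^sup>2 / 8) ^ i * ((1 / 4) ^ j * gsize \<gamma> ^ 4) \<le> ((Im w)\<^sup>2 / 2) ^ i * ((gsize \<gamma> / 4) ^ (j - i))"
    proof (rule mult_mono)
      show "((Im w)\<^sup>2 / 8) ^ i \<le> ((Im w)\<^sup>2 / 2) ^ i" by (intro power_mono) auto
      have "(1 / 4 :: real) ^ j * gsize \<gamma> ^ 4 \<le> (1 / 4) ^ (j - i) * gsize \<gamma> ^ (j - i)"
        using g1 i by (intro mult_mono power_decreasing power_increasing) auto
      then show "(1 / 4) ^ j * gsize \<gamma> ^ 4 \<le> (gsize \<gamma> / 4) ^ (j - i)" by (simp add: power_divide)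
    qed (use g1 in auto)
    also have "\<dots> \<le> P ^ i * P ^ (j - i)"
      using P g1 by (intro mult_mono power_mono) auto
    also have "\<dots> = P ^ j" using i by (simp add: power_add[symmetric])
    finally have le: "((Im w)\<^sup>2 / 8) ^ i * ((1 / 4) ^ j * gsize \<gamma> ^ 4) \<le> P ^ j" .
    have "cmod (inverse (kernel_den z \<gamma> w ^ (2 * j))) = inverse (P ^ j)"
      unfolding P_def by (simp add: norm_inverse norm_power power_mult)
    also have "\<dots> \<le> inverse (((Im w)\<^sup>2 / 8) ^ i * ((1 / 4) ^ j * gsize \<gamma> ^ 4))"
      using le Iw g1 by (intro le_imp_inverse_le) auto
    also have "\<dots> = ((8 / (Im w)\<^sup>2) ^ i * 4 ^ j) * (1 / gsize \<gamma> ^ 4)"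
      by (simp add: power_divide inverse_eq_divide)
    finally show ?thesis unfolding i_def .
  qed
  have "cmod (kernel_form (2 * j) z w) \<le> (\<Sum>\<^sub>\<infinity>\<gamma>\<in>SL2Z. cmod (inverse (kernel_den z \<gamma> w ^ (2 * j))))"
    unfolding kernel_form_def using Iw kernel_abs_summable[OF z Iw j4] by (simp add: norm_infsum_bound)
  also have "\<dots> \<le> (\<Sum>\<^sub>\<infinity>\<gamma>\<in>SL2Z. ((8 / (Im w)\<^sup>2) ^ (j div 2) * 4 ^ j) * (1 / gsize \<gamma> ^ 4))"
    by (intro infsum_mono kernel_abs_summable[OF z Iw j4] summable_on_cmult_right gsize_power_summable t)
  also have "\<dots> = (8 / (Im w)\<^sup>2) ^ (j div 2) * 4 ^ j * gsize_sum"
    unfolding gsize_sum_def by (intro infsum_cmult_right gsize_power_summable)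
  finally show ?thesis .
qed

lemma kernel_form_in_cusp_forms:
  assumes z: "z \<in> fund_domain" and j: "j \<ge> 8"
  shows "kernel_form (2 * j) z \<in> cusp_forms (2 * j)"
proof -
  let ?h = "kernel_form (2 * j) z"
  have mod: "?h ((of_int a * w + of_int b) / (of_int c * w + of_int d)) = (of_int c * w + of_int d) ^ (2 * j) * ?h w"
    if "a * d - b * c = 1" "w \<in> upper_half_plane" for a b c d :: int and w
    using kernel_form_modular[of "(a, b, c, d)" w "2 * j" z] that by (simp add: SL2Z_def moebius_def upper_half_plane_def)
  have lim: "filterlim ?h (nhds 0) (filtercomap Im at_top)"
    unfolding tendsto_iff
  proof (intro allI impI)
    fix e :: real assume e: "e > 0"
    define K where "K = 8 * 4 ^ j * gsize_sum + 1"
    have K: "K > 0" unfolding K_def using gsize_sum_nonneg by (simp add: add_nonneg_pos)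
    \<comment> \<open>Above height 3 the quotient 8 / (Im w)^2 is below 1, so its power j div 2 may
      be lowered to 1.\<close>
    define Y where "Y = max 3 (K / e)"
    have "dist (?h w) 0 < e" if w: "Im w > Y" for w
    proof -
      have Y: "Im w > 3" "Im w > K / e" using w unfolding Y_def by auto
      define n where "n = - round (Re w)"
      define v where "v = w + of_int n"
      have hv: "?h v = ?h w"
        using mod[of 1 1 n 0 w] Y unfolding v_def upper_half_plane_def by simp
      have vD: "v \<in> fund_domain"
      proof -
        have "\<bar>Re v\<bar> \<le> 1 / 2" unfolding v_def n_def using of_int_round_abs_le[of "Re w"] by (simp add: abs_minus_commute)
        moreover have "Im v = Im w" unfolding v_def by simp
        moreover from this have "1 \<le> cmod v" using abs_Im_le_cmod[of v] Y by linarith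
        ultimately show ?thesis using Y unfolding fund_domain_def upper_half_plane_def by auto
      qed
      have Iv: "Im v = Im w" unfolding v_def by simp
      have "cmod (?h v) \<le> (8 / (Im w)\<^sup>2) ^ (j div 2) * 4 ^ j * gsize_sum"
        using kernel_form_cusp_bound[OF z vD j] unfolding Iv .
      also have "\<dots> \<le> (8 / (Im w)\<^sup>2) ^ 1 * 4 ^ j * gsize_sum"
      proof (intro mult_right_mono gsize_sum_nonneg power_decreasing)
        show "1 \<le> j div 2" using j by simp
        have "3\<^sup>2 \<le> (Im w)\<^sup>2" using Y by (intro power_mono) auto
        then show "8 / (Im w)\<^sup>2 \<le> 1" using Y by (simp add: divide_le_eq_1)
      qed auto
      also have "\<dots> = (8 * 4 ^ j * gsize_sum) / (Im w)\<^sup>2" by simp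
      also have "\<dots> \<le> K / (Im w)\<^sup>2" unfolding K_def by (intro divide_right_mono) auto
      also have "\<dots> \<le> K / Im w"
        using Y K by (intro divide_left_mono) (auto simp: power2_eq_square)
      also have "\<dots> < e" using Y e by (simp add: field_simps)
      finally show ?thesis using hv by simp
    qed
    then show "\<forall>\<^sub>F w in filtercomap Im at_top. dist (?h w) 0 < e"
      unfolding eventually_filtercomap using eventually_gt_at_top[of Y] by blast
  qed
  have z0: "?h w = 0" if "w \<notin> upper_half_plane" for w
    using that unfolding kernel_form_def upper_half_plane_def by simp
  have "j \<ge> 4" using j by simp
  then show ?thesis unfolding cusp_forms_def
    using kernel_form_holomorphic[OF z] mod lim z0 by blast
qed

section \<open>Separation of the identity terms from the rest of the series\<close>

definition fund_interior :: "complex set" where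
  "fund_interior = {z. 0 < Im z \<and> \<bar>Re z\<bar> < 1 / 2 \<and> 1 < cmod z}"

lemma open_fund_interior: "open fund_interior"
proof -
  have "fund_interior = {z. 0 < Im z} \<inter> ({z. \<bar>Re z\<bar> < 1 / 2} \<inter> {z. 1 < cmod z})" unfolding fund_interior_def by auto
  also have "open \<dots>" by (intro open_Int open_Collect_less continuous_intros)
  finally show ?thesis .
qed

lemma fund_interior_subset: "fund_interior \<subseteq> fund_domain"
  unfolding fund_interior_def fund_domain_def upper_half_plane_def by auto

lemma int_quadratic_ge_1:
  fixes p q :: int
  assumes "(p, q) \<noteq> (0, 0)"
  shows "1 \<le> p\<^sup>2 - \<bar>p * q\<bar> + q\<^sup>2"
proof -
  have "2 * (p\<^sup>2 - \<bar>p * q\<bar> + q\<^sup>2) = (\<bar>p\<bar> - \<bar>q\<bar>)\<^sup>2 + (p\<^sup>2 + q\<^sup>2)"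
    by (simp add: power2_diff abs_mult)
  moreover have "0 < p\<^sup>2 + q\<^sup>2" using assms by (simp add: sum_power2_gt_zero_iff)
  moreover have "0 \<le> (\<bar>p\<bar> - \<bar>q\<bar>)\<^sup>2" by simp
  ultimately have "0 < 2 * (p\<^sup>2 - \<bar>p * q\<bar> + q\<^sup>2)" by (metis add_nonneg_pos)
  then have "0 < p\<^sup>2 - \<bar>p * q\<bar> + q\<^sup>2" by (rule zero_less_mult_pos) simp
  then show ?thesis by (simp only: int_one_le_iff_zero_less)
qed

lemma cmod_lin_eq: "(cmod (of_int p * u + of_int q))\<^sup>2 = (real_of_int p)\<^sup>2 * (cmod u)\<^sup>2 + 2 * (real_of_int p * real_of_int q) * Re u + (real_of_int q)\<^sup>2"
  unfolding cmod_power2 by (simp add: power2_eq_square algebra_simps)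

lemma lin_cross_ge:
  assumes "\<bar>Re u\<bar> \<le> 1 / 2"
  shows "- \<bar>real_of_int p * real_of_int q\<bar> \<le> 2 * (real_of_int p * real_of_int q) * Re u"
proof -
  have "\<bar>2 * (real_of_int p * real_of_int q) * Re u\<bar> = \<bar>real_of_int p * real_of_int q\<bar> * (2 * \<bar>Re u\<bar>)" by (simp add: abs_mult)
  also have "\<dots> \<le> \<bar>real_of_int p * real_of_int q\<bar> * 1" using assms by (intro mult_left_mono) auto
  finally show ?thesis by linarith
qed

lemma int_quadratic_real:
  fixes p q :: int
  assumes "(p, q) \<noteq> (0, 0)"
  shows "1 \<le> (real_of_int p)\<^sup>2 - \<bar>real_of_int p * real_of_int q\<bar> + (real_of_int q)\<^sup>2"
proof -
  have "real_of_int 1 \<le> real_of_int (p\<^sup>2 - \<bar>p * q\<bar> + q\<^sup>2)" using int_quadratic_ge_1[OF assms] by (simp only: of_int_le_iff)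
  then show ?thesis by simp
qed

text \<open>With u the image of w, (- c u + a) (c w + d) = 1. The second factor has modulus at least
  1, and if c is not 0 the first exceeds 1 because |u| > 1. So c = 0, and up to sign the matrix is a
  translation, by an integer of modulus less than 1.\<close>

lemma moebius_fund_interior:
  assumes g: "\<gamma> \<in> SL2Z" and w: "w \<in> fund_domain" and v: "moebius \<gamma> w \<in> fund_interior"
  shows "\<gamma> = (1, 0, 0, 1) \<or> \<gamma> = (-1, 0, 0, -1)"
proof -
  obtain a b c d where abcd: "\<gamma> = (a, b, c, d)" by (cases \<gamma>)
  have det: "a * d - b * c = 1" using g unfolding abcd SL2Z_def by simp
  have Iw: "Im w > 0" and Rw: "\<bar>Re w\<bar> \<le> 1 / 2" and cw: "1 \<le> cmod w"
    using w by (auto simp: fund_domain_def upper_half_plane_def)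
  define u where "u = moebius \<gamma> w"
  have u: "0 < Im u" "\<bar>Re u\<bar> < 1 / 2" "1 < cmod u" using v unfolding u_def fund_interior_def by auto
  have nz: "of_int c * w + of_int d \<noteq> 0" using den_nonzero[OF Iw] SL2Z_cd_nonzero[of a b c d] g abcd by auto
  have detc: "of_int a * of_int d - of_int b * of_int c = (1 :: complex)"
    using det by (metis of_int_1 of_int_diff of_int_mult)
  have "(of_int (- c) * u + of_int a) * (of_int c * w + of_int d) = of_int a * (of_int c * w + of_int d) - of_int c * (u * (of_int c * w + of_int d))"
    by (simp add: algebra_simps)
  also have "u * (of_int c * w + of_int d) = of_int a * w + of_int b"
    unfolding u_def abcd moebius_def using nz by simp
  also have "of_int a * (of_int c * w + of_int d) - of_int c * (of_int a * w + of_int b) = (1 :: complex)"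
    using detc by (simp add: algebra_simps)
  finally have prod: "cmod (of_int (- c) * u + of_int a) * cmod (of_int c * w + of_int d) = 1"
    by (metis norm_mult norm_one)
  have d1: "1 \<le> cmod (of_int c * w + of_int d)"
  proof -
    have "(real_of_int c)\<^sup>2 * 1 \<le> (real_of_int c)\<^sup>2 * (cmod w)\<^sup>2" using cw by (intro mult_left_mono) (auto simp: power2_eq_square mult_ge1_I)
    then have "1 \<le> (cmod (of_int c * w + of_int d))\<^sup>2"
      using int_quadratic_real[of c d] lin_cross_ge[OF Rw, of c d] SL2Z_cd_nonzero[of a b c d] g abcd
      unfolding cmod_lin_eq by simp
    then show ?thesis by (simp add: power2_eq_square) (metis abs_norm_cancel abs_square_le_1 linorder_le_cases norm_ge_zero one_power2 power2_eq_square power2_le_imp_le)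
  qed
  have c0: "c = 0"
  proof (rule ccontr)
    assume c: "c \<noteq> 0"
    have "1 < (cmod u)\<^sup>2" using u(3) by (simp add: one_less_power)
    then have "(real_of_int (- c))\<^sup>2 * 1 < (real_of_int (- c))\<^sup>2 * (cmod u)\<^sup>2" using c by (intro mult_strict_left_mono) auto
    moreover have "1 \<le> (real_of_int (- c))\<^sup>2 - \<bar>real_of_int (- c) * real_of_int a\<bar> + (real_of_int a)\<^sup>2"
      by (rule int_quadratic_real) (use c in simp)
    moreover have "- \<bar>real_of_int (- c) * real_of_int a\<bar> \<le> 2 * (real_of_int (- c) * real_of_int a) * Re u"
      by (rule lin_cross_ge) (use u(2) in simp)
    ultimately have "1 < (cmod (of_int (- c) * u + of_int a))\<^sup>2"
      unfolding cmod_lin_eq by argo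
    then have "1\<^sup>2 < (cmod (of_int (- c) * u + of_int a))\<^sup>2" by (simp only: one_power2)
    then have "1 < cmod (of_int (- c) * u + of_int a)" by (rule power2_less_imp_less) simp
    then have "1 * 1 < cmod (of_int (- c) * u + of_int a) * cmod (of_int c * w + of_int d)"
      using d1 by (intro mult_less_le_imp_less) auto
    then show False using prod by simp
  qed
  then have "a * d = 1" using det by simp
  then have ad: "(a = 1 \<and> d = 1) \<or> (a = -1 \<and> d = -1)" by (simp add: zmult_eq_1_iff)
  then have "u = w + of_int (a * b)" unfolding u_def abcd moebius_def using c0 by (auto simp: field_simps)
  then have "Re u = Re w + real_of_int (a * b)" by simp
  then have "\<bar>real_of_int (a * b)\<bar> < 1" using u(2) Rw by linarith
  then have "a * b = 0" by linarith
  then show ?thesis using ad c0 unfolding abcd by auto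
qed

text \<open>The squared hyperbolic secant of half the distance from the image of w to z, hence at
  most 1, with equality only if the image is z. Suitably normalised, the terms of the series have
  powers of it as moduli.\<close>

definition kernel_factor :: "complex \<Rightarrow> int \<times> int \<times> int \<times> int \<Rightarrow> complex \<Rightarrow> real" where
  "kernel_factor z \<gamma> w = 4 * Im w * Im z / (cmod (kernel_den z \<gamma> w))\<^sup>2"

lemma cmod_cnj_diff: "(cmod (v - cnj z))\<^sup>2 = (cmod (v - z))\<^sup>2 + 4 * Im v * Im z"
  unfolding cmod_power2 by (simp add: power2_eq_square algebra_simps)

lemma kernel_factor_moebius:
  assumes g: "\<gamma> \<in> SL2Z" and w: "Im w > 0"
  shows "kernel_factor z \<gamma> w = 4 * Im (moebius \<gamma> w) * Im z / (cmod (moebius \<gamma> w - cnj z))\<^sup>2"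
proof -
  have nz: "moebius_den \<gamma> w \<noteq> 0" by (rule moebius_in_upper(3)[OF g w])
  have "kernel_den z \<gamma> w = moebius_den \<gamma> w * (moebius \<gamma> w - cnj z)"
    unfolding kernel_den_def moebius_def using nz by (simp add: algebra_simps)
  then show ?thesis unfolding kernel_factor_def moebius_in_upper(1)[OF g w] using nz
    by (simp add: norm_mult power_mult_distrib mult_ac)
qed

lemma hyperbolic_factor_eq:
  assumes "Im v > 0" "Im z > 0"
  shows "4 * Im v * Im z / (cmod (v - cnj z))\<^sup>2 = 1 - (cmod (v - z))\<^sup>2 / (cmod (v - cnj z))\<^sup>2" "v - cnj z \<noteq> 0"
proof -
  have "Im (v - cnj z) > 0" using assms by simp
  then show nz: "v - cnj z \<noteq> 0" by (metis less_irrefl zero_complex.simps(2))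
  then show "4 * Im v * Im z / (cmod (v - cnj z))\<^sup>2 = 1 - (cmod (v - z))\<^sup>2 / (cmod (v - cnj z))\<^sup>2"
  proof -
    have "4 * Im v * Im z = (cmod (v - cnj z))\<^sup>2 - (cmod (v - z))\<^sup>2" using cmod_cnj_diff[of v z] by simp
    moreover have "(cmod (v - cnj z))\<^sup>2 / (cmod (v - cnj z))\<^sup>2 = 1" using nz by simp
    ultimately show ?thesis by (simp only: diff_divide_distrib)
  qed
qed

text \<open>For all but the two exceptional matrices the image v of w lies outside the open domain,
  hence at distance at least \<delta> from K. Since x / (x + 2 Y') increases in x, the quotient |v -
  z| / |v - cnj z| is at least \<delta> / (\<delta> + 2 Y').\<close>

lemma kernel_factor_isolated:
  assumes K: "compact K" "K \<subseteq> fund_interior"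
  shows "\<exists>\<theta>\<ge>0. \<theta> < 1 \<and> (\<forall>z\<in>K. \<forall>w\<in>fund_domain. \<forall>\<gamma>\<in>SL2Z - {(1, 0, 0, 1), (-1, 0, 0, -1)}. kernel_factor z \<gamma> w \<le> \<theta>)"
proof -
  have "closed (- fund_interior)" using open_fund_interior by (simp add: closed_Compl)
  moreover have "K \<inter> - fund_interior = {}" using K(2) by auto
  ultimately obtain \<delta> where \<delta>: "\<delta> > 0" "\<And>z v. z \<in> K \<Longrightarrow> v \<in> - fund_interior \<Longrightarrow> \<delta> \<le> dist z v"
    using separate_compact_closed[OF K(1)] by metis
  obtain Y where Y: "\<And>z. z \<in> K \<Longrightarrow> cmod z \<le> Y" using compact_imp_bounded[OF K(1)] unfolding bounded_iff by auto
  define Y' where "Y' = max Y 1"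
  define \<theta> where "\<theta> = 1 - (\<delta> / (\<delta> + 2 * Y'))\<^sup>2"
  have Y': "Y' \<ge> 1" unfolding Y'_def by simp
  have q: "0 < \<delta> / (\<delta> + 2 * Y')" "\<delta> / (\<delta> + 2 * Y') \<le> 1" using \<delta> Y' by auto
  have "\<theta> \<ge> 0" unfolding \<theta>_def using q by (simp add: power_le_one)
  moreover have "\<theta> < 1" unfolding \<theta>_def using zero_less_power[OF q(1), of 2] by linarith
  moreover have "kernel_factor z \<gamma> w \<le> \<theta>" if z: "z \<in> K" and w: "w \<in> fund_domain" and g: "\<gamma> \<in> SL2Z - {(1, 0, 0, 1), (-1, 0, 0, -1)}" for z w \<gamma>
  proof -
    have gS: "\<gamma> \<in> SL2Z" using g by auto
    have Iw: "Im w > 0" using w by (auto simp: fund_domain_def upper_half_plane_def)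
    have Iz: "Im z > 0" using z K(2) by (auto simp: fund_interior_def)
    define v where "v = moebius \<gamma> w"
    have Iv: "Im v > 0" unfolding v_def by (rule moebius_in_upper(2)[OF gS Iw])
    have "v \<notin> fund_interior" using moebius_fund_interior[OF gS w] g unfolding v_def by auto
    then have d: "\<delta> \<le> cmod (v - z)" using \<delta>(2)[OF z, of v] by (simp add: dist_norm norm_minus_commute)
    have nz: "cmod (v - cnj z) > 0" using hyperbolic_factor_eq(2)[OF Iv Iz] by simp
    have "cmod (v - cnj z) \<le> cmod (v - z) + cmod (z - cnj z)" using norm_triangle_ineq[of "v - z" "z - cnj z"] by simp
    also have "cmod (z - cnj z) \<le> 2 * Y'"
    proof -
      have "cmod (z - cnj z) \<le> cmod z + cmod (cnj z)" by (rule norm_triangle_ineq4)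
      then show ?thesis using Y[OF z] unfolding Y'_def by simp
    qed
    finally have le: "cmod (v - cnj z) \<le> cmod (v - z) + 2 * Y'" by simp
    have "\<delta> / (\<delta> + 2 * Y') \<le> cmod (v - z) / (cmod (v - z) + 2 * Y')"
    proof -
      have "\<delta> * (cmod (v - z) + 2 * Y') \<le> cmod (v - z) * (\<delta> + 2 * Y')"
        using mult_right_mono[OF d, of "2 * Y'"] Y' by (simp add: algebra_simps)
      moreover have pos: "0 < cmod (v - z) + 2 * Y'" "0 < \<delta> + 2 * Y'" using d \<delta> Y' by linarith+
      ultimately show ?thesis by (simp add: divide_le_eq le_divide_eq mult.commute)
    qed
    also have "\<dots> \<le> cmod (v - z) / cmod (v - cnj z)" using le nz order.strict_trans2[OF nz le] by (intro divide_left_mono mult_pos_pos) auto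
    finally have "(\<delta> / (\<delta> + 2 * Y'))\<^sup>2 \<le> (cmod (v - z) / cmod (v - cnj z))\<^sup>2" using q by (intro power_mono) auto
    then show ?thesis unfolding kernel_factor_moebius[OF gS Iw] v_def[symmetric] hyperbolic_factor_eq(1)[OF Iv Iz] \<theta>_def
      by (simp add: power_divide)
  qed
  ultimately show ?thesis by blast
qed

text \<open>The product of the two bounds in \<open>kernel_den_ge\<close> makes the square of the
  factor at most a constant over the size of the matrix, whatever the height of w. So eight powers
  buy a convergent series.\<close>

lemma kernel_factor_power_le:
  assumes g: "\<gamma> \<in> SL2Z" and z: "z \<in> fund_domain" and w: "w \<in> fund_domain" and Y: "Im z \<le> Y"
  shows "0 \<le> kernel_factor z \<gamma> w" "kernel_factor z \<gamma> w ^ 8 \<le> (128 * Y\<^sup>2) ^ 4 * (1 / gsize \<gamma> ^ 4)"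
proof -
  have Iw: "Im w > 0" using w by (auto simp: fund_domain_def upper_half_plane_def)
  have Iz: "Im z > 0" using z by (auto simp: fund_domain_def upper_half_plane_def)
  have g1: "1 \<le> gsize \<gamma>" by (rule gsize_ge_1[OF g])
  show nn: "0 \<le> kernel_factor z \<gamma> w" unfolding kernel_factor_def using Iw Iz by simp
  define P where "P = (cmod (kernel_den z \<gamma> w))\<^sup>2"
  have P: "gsize \<gamma> / 4 \<le> P" "(Im w)\<^sup>2 / 2 \<le> P" unfolding P_def by (rule kernel_den_ge[OF g z w])+
  have "(Im w)\<^sup>2 / 2 * (gsize \<gamma> / 4) \<le> P * P" using P g1 by (intro mult_mono) auto
  then have PP: "(Im w)\<^sup>2 * gsize \<gamma> \<le> 8 * P\<^sup>2" by (simp add: power2_eq_square)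
  have "(kernel_factor z \<gamma> w)\<^sup>2 = 16 * (Im z)\<^sup>2 * (Im w)\<^sup>2 / P\<^sup>2"
    unfolding kernel_factor_def P_def by (simp add: power_divide power_mult_distrib)
  also have "\<dots> \<le> 128 * Y\<^sup>2 / gsize \<gamma>"
  proof -
    have P0: "0 < P" using P g1 by linarith
    have "(Im z)\<^sup>2 \<le> Y\<^sup>2" using Y Iz by (intro power_mono) auto
    then have "(Im z)\<^sup>2 * ((Im w)\<^sup>2 * gsize \<gamma>) \<le> Y\<^sup>2 * (8 * P\<^sup>2)" by (rule mult_mono) (use PP g1 in auto)
    then have "16 * ((Im z)\<^sup>2 * ((Im w)\<^sup>2 * gsize \<gamma>)) \<le> 16 * (Y\<^sup>2 * (8 * P\<^sup>2))" by (rule mult_left_mono) simp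
    then have "16 * (Im z)\<^sup>2 * (Im w)\<^sup>2 * gsize \<gamma> \<le> 128 * Y\<^sup>2 * P\<^sup>2" by (simp only: mult_ac)
    moreover have "x / p \<le> y / g" if "x * g \<le> y * p" "0 < p" "0 < g" for x y p g :: real
      using that by (simp add: field_simps)
    ultimately show ?thesis using P0 g1 by simp
  qed
  finally have "((kernel_factor z \<gamma> w)\<^sup>2) ^ 4 \<le> (128 * Y\<^sup>2 / gsize \<gamma>) ^ 4" by (intro power_mono) auto
  then show "kernel_factor z \<gamma> w ^ 8 \<le> (128 * Y\<^sup>2) ^ 4 * (1 / gsize \<gamma> ^ 4)"
    by (simp add: power_divide flip: power_mult)
qed

section \<open>The mass of the peak\<close>

lemma fund_domain_area: "(\<integral>\<^sup>+w. indicator fund_domain w \<partial>hyp_area) \<le> 2"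
proof -
  have "(\<integral>\<^sup>+w. indicator fund_domain w \<partial>hyp_area) = (\<integral>\<^sup>+y. \<integral>\<^sup>+x. indicator upper_half_plane (Complex x y) * ennreal (1 / y\<^sup>2) * indicator fund_domain (Complex x y) \<partial>lborel \<partial>lborel)"
    by (subst nn_integral_hyp_area, simp, subst borel_measurable_nn_integral_Complex) auto
  also have "\<dots> \<le> (\<integral>\<^sup>+y. \<integral>\<^sup>+x. ennreal (1 / y\<^sup>2) * indicator {1/2..} y * indicator {- (1/2)..1/2 :: real} x \<partial>lborel \<partial>lborel)"
  proof (intro nn_integral_mono)
    fix y x :: real
    show "indicator upper_half_plane (Complex x y) * ennreal (1 / y\<^sup>2) * indicator fund_domain (Complex x y) \<le> ennreal (1 / y\<^sup>2) * indicator {1/2..} y * indicator {- (1/2)..1/2 :: real} x"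
    proof (cases "Complex x y \<in> fund_domain")
      case True
      then have "y \<in> {1/2..}" "x \<in> {- (1/2)..1/2}" "Complex x y \<in> upper_half_plane"
        using fund_domain_Im_ge[OF True] unfolding fund_domain_def by auto
      then show ?thesis using True by simp
    qed simp
  qed
  also have "\<dots> = (\<integral>\<^sup>+y. ennreal (1 / y\<^sup>2) * indicator {1/2..} y \<partial>lborel)"
  proof (rule nn_integral_cong)
    fix y :: real
    have "(\<integral>\<^sup>+x. ennreal (1 / y\<^sup>2) * indicator {1/2..} y * indicator {- (1/2)..1/2 :: real} x \<partial>lborel) =
        ennreal (1 / y\<^sup>2) * indicator {1/2..} y * (\<integral>\<^sup>+x. indicator {- (1/2)..1/2 :: real} x \<partial>(lborel :: real measure))"
      by (rule nn_integral_cmult) measurable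
    then show "(\<integral>\<^sup>+x. ennreal (1 / y\<^sup>2) * indicator {1/2..} y * indicator {- (1/2)..1/2 :: real} x \<partial>lborel) = ennreal (1 / y\<^sup>2) * indicator {1/2..} y"
      by simp
  qed
  also have "\<dots> = ennreal (0 - (- 1 / (1/2)))"
  proof (rule nn_integral_FTC_atLeast)
    show "((\<lambda>y::real. - 1 / y) \<longlongrightarrow> 0) at_top" by real_asymp
    show "((\<lambda>y. - 1 / y) has_real_derivative 1 / y\<^sup>2) (at y)" if "1/2 \<le> y" for y :: real
      using that by (auto intro!: derivative_eq_intros simp: power2_eq_square)
  qed auto
  finally show ?thesis by simp
qed

lemma nn_integral_gaussian_bump:
  assumes c: "c > 0"
  shows "(\<integral>\<^sup>+w. ennreal (exp (- (c\<^sup>2 * (cmod (w - z))\<^sup>2))) \<partial>lborel) = ennreal (pi / c\<^sup>2)"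
proof -
  have "(\<integral>\<^sup>+w. ennreal (exp (- (c\<^sup>2 * (cmod (w - z))\<^sup>2))) \<partial>lborel) = (\<integral>\<^sup>+w. ennreal (exp (- (c\<^sup>2 * (cmod w)\<^sup>2))) \<partial>lborel)"
    by (subst lborel_distr_plus[of z, symmetric]) (simp add: nn_integral_distr)
  moreover have "ennreal pi = ennreal (c\<^sup>2) * (\<integral>\<^sup>+w. ennreal (exp (- (c\<^sup>2 * (cmod w)\<^sup>2))) \<partial>lborel)"
    using nn_integral_complex_scale[of "\<lambda>w. ennreal (exp (- (cmod w)\<^sup>2))" c] c nn_integral_gaussian_complex[of 0]
    by (simp add: norm_mult power_mult_distrib)
  ultimately have "ennreal (1 / c\<^sup>2) * ennreal pi = ennreal (1 / c\<^sup>2) * (ennreal (c\<^sup>2) * (\<integral>\<^sup>+w. ennreal (exp (- (c\<^sup>2 * (cmod (w - z))\<^sup>2))) \<partial>lborel))" by simp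
  moreover have "ennreal (1 / c\<^sup>2) * ennreal (c\<^sup>2) = 1" using c by (subst ennreal_mult[symmetric]) auto
  moreover have "ennreal (1 / c\<^sup>2) * ennreal pi = ennreal (pi / c\<^sup>2)" by (subst ennreal_mult[symmetric]) auto
  ultimately show ?thesis by (simp only: mult.assoc[symmetric] mult_1)
qed

text \<open>Up to height 16 Y the factor is at most exp (- |w - z|^2 / M^2), whose k-th power has
  mass of order 1 / k. Higher up it is at most 1/4, and 4 ^ k >= k.\<close>

lemma kernel_factor_integral:
  assumes z: "z \<in> fund_domain" and Y: "Im z \<le> Y" "Y \<ge> 1" and k: "k \<ge> (1 :: nat)"
  shows "(\<integral>\<^sup>+w. ennreal ((4 * Im w * Im z / (cmod (w - cnj z))\<^sup>2) ^ k) * indicator fund_domain w \<partial>hyp_area) \<le> ennreal ((4 * pi * (1 + 17 * Y)\<^sup>2 + 2) / real k)"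
proof -
  \<comment> \<open>Bounds |w - cnj z| in the low part: the real parts differ by at most 1 and the
    heights sum to at most 17 Y.\<close>
  define M where "M = 1 + 17 * Y"
  define c where "c = sqrt (real k) / M"
  have M: "M > 0" unfolding M_def using Y by simp
  have c: "c > 0" "c\<^sup>2 = real k / M\<^sup>2" unfolding c_def using M k by (auto simp: power_divide)
  have Iz: "Im z > 0" and Rz: "\<bar>Re z\<bar> \<le> 1 / 2" using z by (auto simp: fund_domain_def upper_half_plane_def)
  let ?F = "\<lambda>w. 4 * Im w * Im z / (cmod (w - cnj z))\<^sup>2"
  have pt: "ennreal (1 / (Im w)\<^sup>2) * (ennreal (?F w ^ k) * indicator fund_domain w) \<le>
      ennreal 4 * ennreal (exp (- (c\<^sup>2 * (cmod (w - z))\<^sup>2))) + ennreal (1 / real k) * (indicator upper_half_plane w * ennreal (1 / (Im w)\<^sup>2) * indicator fund_domain w)" for w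
  proof (cases "w \<in> fund_domain")
    case True
    have Iw: "Im w > 0" and Rw: "\<bar>Re w\<bar> \<le> 1 / 2" and wu: "w \<in> upper_half_plane" using True by (auto simp: fund_domain_def upper_half_plane_def)
    have Iw2: "1 / 2 \<le> Im w" by (rule fund_domain_Im_ge[OF True])
    have nz: "cmod (w - cnj z) > 0" using hyperbolic_factor_eq(2)[OF Iw Iz] by simp
    have F0: "0 \<le> ?F w" using Iw Iz by simp
    show ?thesis
    proof (cases "Im w \<le> 16 * Y")
      case small: True
      have "cmod (w - cnj z) \<le> \<bar>Re (w - cnj z)\<bar> + \<bar>Im (w - cnj z)\<bar>" by (rule cmod_le)
      also have "\<dots> \<le> M" unfolding M_def using Rw Rz Iw Iz small Y by simp
      finally have "(cmod (w - cnj z))\<^sup>2 \<le> M\<^sup>2" using nz by (intro power_mono) auto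
      then have "(cmod (w - z))\<^sup>2 / M\<^sup>2 \<le> (cmod (w - z))\<^sup>2 / (cmod (w - cnj z))\<^sup>2"
        using nz M by (intro divide_left_mono) auto
      then have "?F w \<le> 1 + - ((cmod (w - z))\<^sup>2 / M\<^sup>2)" unfolding hyperbolic_factor_eq(1)[OF Iw Iz] by simp
      also have "\<dots> \<le> exp (- ((cmod (w - z))\<^sup>2 / M\<^sup>2))" by (rule exp_ge_add_one_self)
      finally have "?F w ^ k \<le> exp (- ((cmod (w - z))\<^sup>2 / M\<^sup>2)) ^ k" using F0 by (intro power_mono) auto
      also have "\<dots> = exp (- (c\<^sup>2 * (cmod (w - z))\<^sup>2))" unfolding c(2) by (simp add: exp_of_nat_mult[symmetric])
      finally have 1: "?F w ^ k \<le> exp (- (c\<^sup>2 * (cmod (w - z))\<^sup>2))" .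
      have "(1 / 2)\<^sup>2 \<le> (Im w)\<^sup>2" using Iw2 by (intro power_mono) auto
      then have "1 / (Im w)\<^sup>2 \<le> 4" using Iw by (simp add: divide_le_eq power2_eq_square)
      then have "1 / (Im w)\<^sup>2 * ?F w ^ k \<le> 4 * exp (- (c\<^sup>2 * (cmod (w - z))\<^sup>2))" using 1 F0 by (intro mult_mono) auto
      then have "ennreal (1 / (Im w)\<^sup>2) * ennreal (?F w ^ k) \<le> ennreal 4 * ennreal (exp (- (c\<^sup>2 * (cmod (w - z))\<^sup>2)))"
        using F0 by (subst (1 2) ennreal_mult[symmetric]) (auto intro: ennreal_leI)
      then show ?thesis using True by (simp add: add_increasing2)
    next
      case large: False
      have "(Im w)\<^sup>2 \<le> (cmod (w - cnj z))\<^sup>2"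
        using abs_Im_le_cmod[of "w - cnj z"] Iw Iz by (intro power_mono) auto
      then have "?F w \<le> 4 * Im w * Im z / (Im w)\<^sup>2" using Iw Iz nz by (intro divide_left_mono) auto
      also have "\<dots> = 4 * Im z / Im w" using Iw by (simp add: power2_eq_square)
      also have "\<dots> \<le> 1 / 4" using large Iw Y by (simp add: divide_le_eq)
      finally have "?F w ^ k \<le> (1 / 4) ^ k" using F0 by (intro power_mono) auto
      also have "\<dots> \<le> 1 / real k"
      proof -
        have "real k < 2 ^ k" by (rule of_nat_less_two_power)
        also have "\<dots> \<le> (4::real) ^ k" by (intro power_mono) auto
        finally have "1 / 4 ^ k \<le> 1 / real k" using k by (intro divide_left_mono) auto
        then show ?thesis by (simp add: power_divide)
      qed
      finally have "ennreal (?F w ^ k) \<le> ennreal (1 / real k)" by (rule ennreal_leI)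
      then have "ennreal (1 / (Im w)\<^sup>2) * ennreal (?F w ^ k) \<le> ennreal (1 / (Im w)\<^sup>2) * ennreal (1 / real k)" by (rule mult_left_mono) simp
      then show ?thesis using True wu by (simp add: add_increasing mult.commute)
    qed
  qed simp
  have "(\<integral>\<^sup>+w. ennreal (?F w ^ k) * indicator fund_domain w \<partial>hyp_area) =
     (\<integral>\<^sup>+w. indicator upper_half_plane w * ennreal (1 / (Im w)\<^sup>2) * (ennreal (?F w ^ k) * indicator fund_domain w) \<partial>lborel)"
    by (rule nn_integral_hyp_area) measurable
  also have "\<dots> \<le> (\<integral>\<^sup>+w. ennreal 4 * ennreal (exp (- (c\<^sup>2 * (cmod (w - z))\<^sup>2))) + ennreal (1 / real k) * (indicator upper_half_plane w * ennreal (1 / (Im w)\<^sup>2) * indicator fund_domain w) \<partial>lborel)"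
  proof (intro nn_integral_mono)
    fix w
    have "indicator upper_half_plane w * ennreal (1 / (Im w)\<^sup>2) * (ennreal (?F w ^ k) * indicator fund_domain w) \<le> ennreal (1 / (Im w)\<^sup>2) * (ennreal (?F w ^ k) * indicator fund_domain w)"
      by (auto split: split_indicator)
    then show "indicator upper_half_plane w * ennreal (1 / (Im w)\<^sup>2) * (ennreal (?F w ^ k) * indicator fund_domain w) \<le> ennreal 4 * ennreal (exp (- (c\<^sup>2 * (cmod (w - z))\<^sup>2))) + ennreal (1 / real k) * (indicator upper_half_plane w * ennreal (1 / (Im w)\<^sup>2) * indicator fund_domain w)"
      using pt by (rule order_trans)
  qed
  also have "\<dots> = ennreal 4 * ennreal (pi / c\<^sup>2) + ennreal (1 / real k) * (\<integral>\<^sup>+w. indicator fund_domain w \<partial>hyp_area)"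
  proof -
    have ar: "(\<integral>\<^sup>+w. indicator upper_half_plane w * ennreal (1 / (Im w)\<^sup>2) * indicator fund_domain w \<partial>lborel) = (\<integral>\<^sup>+w. indicator fund_domain w \<partial>hyp_area)"
      by (rule nn_integral_hyp_area[symmetric]) measurable
    show ?thesis
      by (subst nn_integral_add, measurable, subst nn_integral_cmult, measurable, subst nn_integral_cmult, measurable)
        (simp only: nn_integral_gaussian_bump[OF c(1)] ar)
  qed
  also have "\<dots> \<le> ennreal 4 * ennreal (pi / c\<^sup>2) + ennreal (1 / real k) * 2"
    by (intro add_left_mono mult_left_mono fund_domain_area) simp
  also have "\<dots> = ennreal ((4 * pi * (1 + 17 * Y)\<^sup>2 + 2) / real k)"
  proof -
    have "ennreal 4 * ennreal (pi / c\<^sup>2) = ennreal (4 * (pi / c\<^sup>2))" by (rule ennreal_mult[symmetric]) auto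
    moreover have "ennreal (1 / real k) * ennreal 2 = ennreal (1 / real k * 2)" by (rule ennreal_mult[symmetric]) auto
    then have "ennreal (1 / real k) * 2 = ennreal (1 / real k * 2)" by (simp only: ennreal_numeral)
    moreover have "4 * (pi / c\<^sup>2) + 1 / real k * 2 = (4 * pi * (1 + 17 * Y)\<^sup>2 + 2) / real k"
      unfolding c(2) M_def[symmetric] using M k by (simp add: field_simps)
    ultimately show ?thesis by (simp add: ennreal_plus[symmetric] del: ennreal_plus)
  qed
  finally show ?thesis .
qed

lemma norm_inverse_even_power: "cmod (inverse (x ^ (2 * j))) = inverse (((cmod x)\<^sup>2) ^ j)"
  by (simp add: norm_inverse norm_power power_mult)

lemma kernel_term_normalised:
  assumes "Im w > 0" "Im z > 0"
  shows "(4 * Im z * Im w) ^ j * cmod (inverse (kernel_den z \<gamma> w ^ (2 * j))) = kernel_factor z \<gamma> w ^ j"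
  unfolding kernel_factor_def norm_inverse_even_power power_divide by (simp add: inverse_eq_divide mult_ac)

text \<open>The main term occurs twice, for the identity and its negative. In the other terms 8 of
  the j powers of the factor are kept for convergence, the remaining j - 8 are bounded by powers of
  \<theta>.\<close>

lemma kernel_form_split:
  assumes z: "z \<in> fund_domain" and w: "w \<in> fund_domain" and j: "j \<ge> 8" and Y: "Im z \<le> Y"
    and \<theta>: "0 \<le> \<theta>" "\<And>\<gamma>. \<gamma> \<in> SL2Z - {(1, 0, 0, 1), (-1, 0, 0, -1)} \<Longrightarrow> kernel_factor z \<gamma> w \<le> \<theta>"
  shows "(4 * Im z * Im w) ^ j * cmod (kernel_form (2 * j) z w - 2 * inverse ((w - cnj z) ^ (2 * j)))
    \<le> \<theta> ^ (j - 8) * ((128 * Y\<^sup>2) ^ 4 * gsize_sum)"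
proof -
  have Iw: "Im w > 0" using w by (auto simp: fund_domain_def upper_half_plane_def)
  have Iz: "Im z > 0" using z by (auto simp: fund_domain_def upper_half_plane_def)
  have j4: "j \<ge> 4" using j by simp
  define I where "I = {(1, 0, 0, 1), (-1, 0, 0, -1 :: int)} \<inter> (UNIV :: (int \<times> int \<times> int \<times> int) set)"
  have I: "I = {(1, 0, 0, 1), (-1, 0, 0, -1)}" unfolding I_def by simp
  have IS: "I \<subseteq> SL2Z" unfolding I SL2Z_def by auto
  define t where "t \<gamma> = inverse (kernel_den z \<gamma> w ^ (2 * j))" for \<gamma>
  have abs: "(\<lambda>\<gamma>. norm (t \<gamma>)) summable_on SL2Z" unfolding t_def by (rule kernel_abs_summable[OF z Iw j4])
  then have absR: "(\<lambda>\<gamma>. norm (t \<gamma>)) summable_on (SL2Z - I)" by (rule summable_on_subset_banach) auto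
  have sR: "t summable_on (SL2Z - I)" by (rule abs_summable_summable[OF absR])
  have "kernel_form (2 * j) z w = infsum t (I \<union> (SL2Z - I))"
    unfolding kernel_form_def t_def using Iw IS by (simp add: Un_absorb1)
  also have "\<dots> = infsum t I + infsum t (SL2Z - I)"
    by (rule infsum_Un_disjoint) (use sR in \<open>auto simp: I\<close>)
  also have "infsum t I = 2 * inverse ((w - cnj z) ^ (2 * j))"
  proof -
    have "kernel_den z (- 1, 0, 0, - 1) w = - (w - cnj z)" unfolding kernel_den_def by simp
    moreover have "kernel_den z (1, 0, 0, 1) w = w - cnj z" unfolding kernel_den_def by simp
    ultimately show ?thesis unfolding I t_def by (simp add: power_mult power2_commute[of "cnj z" w])
  qed
  finally have eq: "kernel_form (2 * j) z w - 2 * inverse ((w - cnj z) ^ (2 * j)) = infsum t (SL2Z - I)" by simp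
  define q where "q = (4 * Im z * Im w) ^ j"
  have q: "q \<ge> 0" unfolding q_def using Iw Iz by simp
  have "q * cmod (infsum t (SL2Z - I)) \<le> q * (\<Sum>\<^sub>\<infinity>\<gamma>\<in>SL2Z - I. norm (t \<gamma>))"
    using q absR by (intro mult_left_mono norm_infsum_bound)
  also have "\<dots> = (\<Sum>\<^sub>\<infinity>\<gamma>\<in>SL2Z - I. q * norm (t \<gamma>))" by (rule infsum_cmult_right[symmetric]) (rule absR)
  also have "\<dots> \<le> (\<Sum>\<^sub>\<infinity>\<gamma>\<in>SL2Z - I. (\<theta> ^ (j - 8) * (128 * Y\<^sup>2) ^ 4) * (1 / gsize \<gamma> ^ 4))"
  proof (rule infsum_mono)
    show "(\<lambda>\<gamma>. q * norm (t \<gamma>)) summable_on SL2Z - I" by (rule summable_on_cmult_right[OF absR])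
    show "(\<lambda>\<gamma>. (\<theta> ^ (j - 8) * (128 * Y\<^sup>2) ^ 4) * (1 / gsize \<gamma> ^ 4)) summable_on SL2Z - I"
      by (rule summable_on_cmult_right) (rule summable_on_subset_banach[OF gsize_power_summable], auto)
    fix \<gamma> assume g: "\<gamma> \<in> SL2Z - I"
    then have gS: "\<gamma> \<in> SL2Z" by auto
    note kf = kernel_factor_power_le[OF gS z w Y]
    have "q * norm (t \<gamma>) = kernel_factor z \<gamma> w ^ j" unfolding q_def t_def by (rule kernel_term_normalised[OF Iw Iz])
    also have "\<dots> = kernel_factor z \<gamma> w ^ (j - 8) * kernel_factor z \<gamma> w ^ 8" using j by (simp add: power_add[symmetric])
    also have "\<dots> \<le> \<theta> ^ (j - 8) * ((128 * Y\<^sup>2) ^ 4 * (1 / gsize \<gamma> ^ 4))"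
      using kf \<theta>(2)[of \<gamma>] g \<theta>(1) unfolding I by (intro mult_mono power_mono) auto
    finally show "q * norm (t \<gamma>) \<le> (\<theta> ^ (j - 8) * (128 * Y\<^sup>2) ^ 4) * (1 / gsize \<gamma> ^ 4)" by (simp only: mult.assoc)
  qed
  also have "\<dots> = (\<theta> ^ (j - 8) * (128 * Y\<^sup>2) ^ 4) * (\<Sum>\<^sub>\<infinity>\<gamma>\<in>SL2Z - I. 1 / gsize \<gamma> ^ 4)"
    by (rule infsum_cmult_right) (rule summable_on_subset_banach[OF gsize_power_summable], auto)
  also have "\<dots> \<le> (\<theta> ^ (j - 8) * (128 * Y\<^sup>2) ^ 4) * gsize_sum"
  proof (rule mult_left_mono)
    show "(\<Sum>\<^sub>\<infinity>\<gamma>\<in>SL2Z - I. 1 / gsize \<gamma> ^ 4) \<le> gsize_sum" unfolding gsize_sum_def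
    proof (rule infsum_mono_neutral)
      show "(\<lambda>\<gamma>. 1 / gsize \<gamma> ^ 4) summable_on SL2Z - I" by (rule summable_on_subset_banach[OF gsize_power_summable]) auto
      show "0 \<le> 1 / gsize \<gamma> ^ 4" if "\<gamma> \<in> SL2Z - (SL2Z - I)" for \<gamma> using gsize_ge_1[of \<gamma>] that by auto
    qed (auto intro: gsize_power_summable)
  qed (use \<theta> in simp)
  finally show ?thesis unfolding eq q_def by (simp only: mult.assoc)
qed

text \<open>Finds where the error of \<open>kernel_form_split\<close> is at most half of the main
  term at the peak and has a square of order 1 / j.\<close>

lemma geometric_decay:
  fixes \<theta> A :: real
  assumes "0 \<le> \<theta>" "\<theta> < 1" "0 \<le> A"
  shows "\<exists>j0. \<forall>j\<ge>j0. \<theta> ^ (j - 8) * A \<le> 1 \<and> (\<theta> ^ (j - 8) * A)\<^sup>2 * real (2 * j) \<le> 18"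
proof -
  have "(\<lambda>n. real n * \<theta> ^ n) \<longlonglongrightarrow> 0" by (rule powser_times_n_limit_0) (use assms in simp)
  then have "(\<lambda>n. real n * \<theta> ^ n * A) \<longlonglongrightarrow> 0 * A" by (intro tendsto_intros)
  then have "\<forall>\<^sub>F n in sequentially. real n * \<theta> ^ n * A < 1" by (intro order_tendstoD(2)[where y = "0 * A"]) auto
  then obtain n0 where n0: "\<And>n. n \<ge> n0 \<Longrightarrow> real n * \<theta> ^ n * A < 1" unfolding eventually_sequentially by blast
  show ?thesis
  proof (intro exI[of _ "n0 + 9"] allI impI)
    fix j assume j: "n0 + 9 \<le> j"
    define n where "n = j - 8"
    have n: "n \<ge> n0" "n \<ge> 1" "j = n + 8" unfolding n_def using j by auto
    have X0: "0 \<le> \<theta> ^ n * A" using assms by simp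
    have nX: "real n * (\<theta> ^ n * A) \<le> 1" using n0[OF n(1)] by (simp add: mult.assoc)
    have "1 * (\<theta> ^ n * A) \<le> real n * (\<theta> ^ n * A)" using n X0 by (intro mult_right_mono) auto
    then have X1: "\<theta> ^ n * A \<le> 1" using nX by linarith
    have "(\<theta> ^ n * A)\<^sup>2 \<le> (\<theta> ^ n * A) * 1" unfolding power2_eq_square by (rule mult_left_mono[OF X1 X0])
    then have "(\<theta> ^ n * A)\<^sup>2 * real (2 * j) \<le> (\<theta> ^ n * A) * 1 * (18 * real n)"
      by (rule mult_mono) (use X0 n in auto)
    also have "\<dots> = 18 * (real n * (\<theta> ^ n * A))" by simp
    also have "\<dots> \<le> 18 * 1" using nX by (intro mult_left_mono) auto
    finally have "(\<theta> ^ n * A)\<^sup>2 * real (2 * j) \<le> 18" by simp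
    then show "\<theta> ^ (j - 8) * A \<le> 1 \<and> (\<theta> ^ (j - 8) * A)\<^sup>2 * real (2 * j) \<le> 18" using X1 unfolding n_def by simp
  qed
qed

text \<open>Multiplied by (4 Im z Im w) ^ j, the kernel has modulus at least 2 - \<epsilon> >= 1 at
  z and at most 2 F ^ j + \<epsilon> in the fundamental domain, F being the factor of the identity.
  After squaring, the first part has mass of order 1 / k by \<open>kernel_factor_integral\<close>
  and the second by the bound on the square of \<epsilon>.\<close>

lemma peak_forms:
  assumes K: "compact K" "K \<subseteq> fund_interior"
  shows "\<exists>C>0. \<exists>j0. \<forall>j\<ge>j0. \<forall>z\<in>K. \<exists>h\<in>cusp_forms (2 * j). 0 < form_weight (2 * j) h z \<and>
    (\<integral>\<^sup>+w. ennreal (form_weight (2 * j) h w) * indicator fund_domain w \<partial>hyp_area) \<le> ennreal (C / real (2 * j) * form_weight (2 * j) h z)"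
proof -
  obtain \<theta> where \<theta>: "0 \<le> \<theta>" "\<theta> < 1"
    "\<forall>z\<in>K. \<forall>w\<in>fund_domain. \<forall>\<gamma>\<in>SL2Z - {(1, 0, 0, 1), (-1, 0, 0, -1)}. kernel_factor z \<gamma> w \<le> \<theta>"
    using kernel_factor_isolated[OF K] by (elim exE conjE) (rule that)
  obtain Y0 where Y0: "\<And>z. z \<in> K \<Longrightarrow> cmod z \<le> Y0" using compact_imp_bounded[OF K(1)] unfolding bounded_iff by auto
  define Y where "Y = max Y0 1"
  have Y: "Y \<ge> 1" "\<And>z. z \<in> K \<Longrightarrow> Im z \<le> Y"
    unfolding Y_def using Y0 abs_Im_le_cmod by (auto, smt (verit) max.coboundedI1)
  define A where "A = (128 * Y\<^sup>2) ^ 4 * gsize_sum"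
  have A: "0 \<le> A" unfolding A_def using gsize_sum_nonneg by simp
  obtain j0 where j0: "\<And>j. j \<ge> j0 \<Longrightarrow> \<theta> ^ (j - 8) * A \<le> 1" "\<And>j. j \<ge> j0 \<Longrightarrow> (\<theta> ^ (j - 8) * A)\<^sup>2 * real (2 * j) \<le> 18"
    using geometric_decay[OF \<theta>(1,2) A] by blast
  define C1 where "C1 = 4 * pi * (1 + 17 * Y)\<^sup>2 + 2"
  define C where "C = 8 * C1 + 72"
  have C1: "C1 > 0" unfolding C1_def by (simp add: add_nonneg_pos)
  show ?thesis
  proof (intro exI[of _ C] conjI exI[of _ "j0 + 8"] allI impI ballI)
    show "C > 0" unfolding C_def using C1 by simp
    fix j z assume j: "j0 + 8 \<le> j" and zK: "z \<in> K"
    have j8: "j \<ge> 8" and jj: "j \<ge> j0" using j by auto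
    have z: "z \<in> fund_domain" using zK K(2) fund_interior_subset by auto
    have Iz: "Im z > 0" using z by (auto simp: fund_domain_def upper_half_plane_def)
    define h where "h = kernel_form (2 * j) z"
    have hc: "h \<in> cusp_forms (2 * j)" unfolding h_def by (rule kernel_form_in_cusp_forms[OF z j8])
    have [measurable]: "h \<in> borel_measurable borel" by (rule cusp_form_measurable[OF hc])
    define \<epsilon> where "\<epsilon> = \<theta> ^ (j - 8) * A"
    have \<epsilon>: "0 \<le> \<epsilon>" "\<epsilon> \<le> 1" "\<epsilon>\<^sup>2 * real (2 * j) \<le> 18" unfolding \<epsilon>_def using \<theta>(1) A j0[OF jj] by auto
    define T where "T w = (4 * Im z * Im w) ^ j * cmod (h w)" for w
    define F where "F w = 4 * Im w * Im z / (cmod (w - cnj z))\<^sup>2" for w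
    have split: "(4 * Im z * Im w) ^ j * cmod (h w - 2 * inverse ((w - cnj z) ^ (2 * j))) \<le> \<epsilon>" if w: "w \<in> fund_domain" for w
      unfolding h_def \<epsilon>_def A_def by (rule kernel_form_split[OF z w j8 Y(2)[OF zK] \<theta>(1) \<theta>(3)[rule_format, OF zK w]])
    have Fj: "(4 * Im z * Im w) ^ j * cmod (2 * inverse ((w - cnj z) ^ (2 * j))) = 2 * F w ^ j" for w
      unfolding F_def norm_mult norm_inverse_even_power power_divide by (simp add: inverse_eq_divide mult_ac)
    define a where "a = (4 * Im z) ^ (2 * j)"
    have a: "a > 0" unfolding a_def using Iz by simp
    have fT: "form_weight (2 * j) h w * a = (T w)\<^sup>2" for w
      unfolding form_weight_def a_def T_def by (simp add: power_mult_distrib power_mult[symmetric] mult_ac)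
    have Tup: "T w \<le> 2 * F w ^ j + \<epsilon>" if w: "w \<in> fund_domain" for w
    proof -
      have Iw: "Im w > 0" using w by (auto simp: fund_domain_def upper_half_plane_def)
      have "cmod (h w) \<le> cmod (2 * inverse ((w - cnj z) ^ (2 * j))) + cmod (h w - 2 * inverse ((w - cnj z) ^ (2 * j)))"
        by (rule norm_triangle_sub)
      then have "T w \<le> (4 * Im z * Im w) ^ j * (cmod (2 * inverse ((w - cnj z) ^ (2 * j))) + cmod (h w - 2 * inverse ((w - cnj z) ^ (2 * j))))"
        unfolding T_def using Iw Iz by (intro mult_left_mono) auto
      then show ?thesis using split[OF w] unfolding distrib_left Fj by linarith
    qed
    have Tz: "1 \<le> T z"
    proof -
      have Fz: "F z = 1" unfolding F_def using Iz cmod_cnj_diff[of z z] by (simp add: power2_eq_square)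
      have "cmod (2 * inverse ((z - cnj z) ^ (2 * j))) \<le> cmod (h z) + cmod (2 * inverse ((z - cnj z) ^ (2 * j)) - h z)"
        by (rule norm_triangle_sub)
      then have "(4 * Im z * Im z) ^ j * cmod (2 * inverse ((z - cnj z) ^ (2 * j))) \<le> (4 * Im z * Im z) ^ j * (cmod (h z) + cmod (h z - 2 * inverse ((z - cnj z) ^ (2 * j))))"
        using Iz by (intro mult_left_mono) (auto simp: norm_minus_commute)
      then have "2 \<le> T z + \<epsilon>" using split[OF z] Fz unfolding Fj distrib_left T_def by simp
      then show ?thesis using \<epsilon>(2) by linarith
    qed
    have fz: "1 / a \<le> form_weight (2 * j) h z"
    proof -
      have "1 \<le> form_weight (2 * j) h z * a" unfolding fT using Tz by (simp add: power2_eq_square mult_ge1_I)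
      then show ?thesis using a by (simp add: pos_divide_le_eq)
    qed
    have "form_weight (2 * j) h z > 0" using fz a by (meson divide_pos_pos less_le_trans zero_less_one)
    moreover have "(\<integral>\<^sup>+w. ennreal (form_weight (2 * j) h w) * indicator fund_domain w \<partial>hyp_area) \<le> ennreal (C / real (2 * j) * form_weight (2 * j) h z)"
    proof -
      have pt: "ennreal (form_weight (2 * j) h w) * indicator fund_domain w \<le>
          ennreal (8 / a) * (ennreal (F w ^ (2 * j)) * indicator fund_domain w) + ennreal (2 * \<epsilon>\<^sup>2 / a) * indicator fund_domain w" for w
      proof (cases "w \<in> fund_domain")
        case True
        have Iw: "Im w > 0" using True by (auto simp: fund_domain_def upper_half_plane_def)
        have F0: "0 \<le> F w" unfolding F_def using Iw Iz by simp
        have T0: "0 \<le> T w" unfolding T_def using Iw Iz by simp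
        have "(T w)\<^sup>2 \<le> (2 * F w ^ j + \<epsilon>)\<^sup>2" using Tup[OF True] T0 by (intro power_mono) auto
        also have "\<dots> \<le> 2 * (2 * F w ^ j)\<^sup>2 + 2 * \<epsilon>\<^sup>2"
          using zero_le_power2[of "2 * F w ^ j - \<epsilon>"] by (simp add: power2_sum power2_diff)
        also have "(2 * F w ^ j)\<^sup>2 = 4 * F w ^ (2 * j)" by (simp add: power_mult_distrib power_mult[symmetric] mult.commute)
        finally have "form_weight (2 * j) h w * a \<le> 8 * F w ^ (2 * j) + 2 * \<epsilon>\<^sup>2" unfolding fT by simp
        then have "form_weight (2 * j) h w \<le> 8 / a * F w ^ (2 * j) + 2 * \<epsilon>\<^sup>2 / a"
          using a by (simp add: pos_le_divide_eq[symmetric] add_divide_distrib)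
        then have "ennreal (form_weight (2 * j) h w) \<le> ennreal (8 / a * F w ^ (2 * j) + 2 * \<epsilon>\<^sup>2 / a)" by (rule ennreal_leI)
        also have "\<dots> = ennreal (8 / a) * ennreal (F w ^ (2 * j)) + ennreal (2 * \<epsilon>\<^sup>2 / a)"
        proof -
          have "ennreal (8 / a * F w ^ (2 * j)) = ennreal (8 / a) * ennreal (F w ^ (2 * j))"
            by (rule ennreal_mult) (use a F0 in auto)
          moreover have "ennreal (8 / a * F w ^ (2 * j) + 2 * \<epsilon>\<^sup>2 / a) = ennreal (8 / a * F w ^ (2 * j)) + ennreal (2 * \<epsilon>\<^sup>2 / a)"
            by (rule ennreal_plus) (use a F0 in auto)
          ultimately show ?thesis by (simp only:)
        qed
        finally show ?thesis using True by simp
      qed simp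
      have "(\<integral>\<^sup>+w. ennreal (form_weight (2 * j) h w) * indicator fund_domain w \<partial>hyp_area) \<le>
         (\<integral>\<^sup>+w. ennreal (8 / a) * (ennreal (F w ^ (2 * j)) * indicator fund_domain w) + ennreal (2 * \<epsilon>\<^sup>2 / a) * indicator fund_domain w \<partial>hyp_area)"
        by (intro nn_integral_mono pt)
      also have "\<dots> = ennreal (8 / a) * (\<integral>\<^sup>+w. ennreal (F w ^ (2 * j)) * indicator fund_domain w \<partial>hyp_area) + ennreal (2 * \<epsilon>\<^sup>2 / a) * (\<integral>\<^sup>+w. indicator fund_domain w \<partial>hyp_area)"
        unfolding F_def by (subst nn_integral_add, measurable, subst nn_integral_cmult, measurable, subst nn_integral_cmult, measurable)
      also have "\<dots> \<le> ennreal (8 / a) * ennreal (C1 / real (2 * j)) + ennreal (2 * \<epsilon>\<^sup>2 / a) * ennreal 2"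
        unfolding F_def C1_def using kernel_factor_integral[OF z Y(2)[OF zK] Y(1), of "2 * j"] j8 fund_domain_area
        by (intro add_mono mult_left_mono) auto
      also have "\<dots> = ennreal (8 / a * (C1 / real (2 * j)) + 2 * \<epsilon>\<^sup>2 / a * 2)"
        proof -
        have "ennreal (8 / a) * ennreal (C1 / real (2 * j)) = ennreal (8 / a * (C1 / real (2 * j)))"
          by (rule ennreal_mult[symmetric]) (use a C1 in auto)
        moreover have "ennreal (2 * \<epsilon>\<^sup>2 / a) * ennreal 2 = ennreal (2 * \<epsilon>\<^sup>2 / a * 2)"
          by (rule ennreal_mult[symmetric]) (use a in auto)
        moreover have "ennreal (8 / a * (C1 / real (2 * j)) + 2 * \<epsilon>\<^sup>2 / a * 2) = ennreal (8 / a * (C1 / real (2 * j))) + ennreal (2 * \<epsilon>\<^sup>2 / a * 2)"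
          by (rule ennreal_plus) (use a C1 in auto)
        ultimately show ?thesis by (simp only:)
      qed
      also have "\<dots> \<le> ennreal (C / real (2 * j) * form_weight (2 * j) h z)"
      proof (rule ennreal_leI)
        have j0': "real (2 * j) > 0" using j8 by simp
        have "\<epsilon>\<^sup>2 \<le> 18 / real (2 * j)" using \<epsilon>(3) j0' by (simp only: pos_le_divide_eq)
        then have "8 / a * (C1 / real (2 * j)) + 2 * \<epsilon>\<^sup>2 / a * 2 \<le> 8 / a * (C1 / real (2 * j)) + 2 * (18 / real (2 * j)) / a * 2"
          using a by (intro add_left_mono mult_right_mono divide_right_mono mult_left_mono) auto
        also have "\<dots> = C / real (2 * j) * (1 / a)" unfolding C_def using a j0' by (simp add: field_simps)
        also have "\<dots> \<le> C / real (2 * j) * form_weight (2 * j) h z"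
          using C1 j0' by (intro mult_left_mono fz) (auto simp: C_def)
        finally show "8 / a * (C1 / real (2 * j)) + 2 * \<epsilon>\<^sup>2 / a * 2 \<le> C / real (2 * j) * form_weight (2 * j) h z" .
      qed
      finally show ?thesis .
    qed
    ultimately show "\<exists>h\<in>cusp_forms (2 * j). 0 < form_weight (2 * j) h z \<and>
      (\<integral>\<^sup>+w. ennreal (form_weight (2 * j) h w) * indicator fund_domain w \<partial>hyp_area) \<le> ennreal (C / real (2 * j) * form_weight (2 * j) h z)"
      using hc by blast
  qed
qed

section \<open>The dimension of the space of cusp forms\<close>

lemma fun_sum_apply: "(\<Sum>i\<in>A. f i) z = (\<Sum>i\<in>A. f i z)" for f :: "'a \<Rightarrow> 'b \<Rightarrow> 'c::comm_monoid_add"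
  by (induction A rule: infinite_finite_induct) auto

lemma exists_linear_relation:
  fixes c :: "nat \<Rightarrow> nat \<Rightarrow> complex"
  assumes "n < N"
  shows "\<exists>a. (\<exists>j<N. a j \<noteq> 0) \<and> (\<forall>i<n. (\<Sum>j<N. a j * c i j) = 0)"
proof -
  \<comment> \<open>Vectors of length n are modelled as functions supported on the complex numbers
    0, ..., n - 1, so that the dimension theory of \<open>cfun\<close> applies to the columns
    \<open>V j\<close>.\<close>
  define e where "e i = (\<lambda>z::complex. if z = of_nat i then 1 else 0 :: complex)" for i :: nat
  define V where "V j = (\<Sum>i<n. (\<lambda>z. c i j * e i z))" for j
  have Vi: "V j (of_nat i) = c i j" if "i < n" for i j
  proof -
    have "V j (of_nat i) = (\<Sum>l<n. if l = i then c i j else 0)" unfolding V_def fun_sum_apply e_def by (intro sum.cong) auto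
    then show ?thesis using that by simp
  qed
  show ?thesis
  proof (cases "inj_on V {..<N}")
    \<comment> \<open>Equal columns would be merged in the set of columns, so they are treated
      apart; they give a relation at once.\<close>
    case False
    then obtain p q where pq: "p < N" "q < N" "p \<noteq> q" "V p = V q" unfolding inj_on_def by auto
    define a where "a j = (if j = p then 1 else 0) - (if j = q then 1 else 0 :: complex)" for j
    have "(\<Sum>j<N. a j * c i j) = 0" if "i < n" for i
    proof -
      have "(\<Sum>j<N. a j * c i j) = (\<Sum>j<N. if j = p then c i p else 0) - (\<Sum>j<N. if j = q then c i q else 0)"
        unfolding a_def sum_subtractf[symmetric] by (intro sum.cong) auto
      also have "\<dots> = c i p - c i q" using pq by simp
      finally show ?thesis using Vi[OF that, of p] Vi[OF that, of q] pq(4) by simp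
    qed
    moreover have "a p \<noteq> 0" unfolding a_def using pq by simp
    ultimately show ?thesis using pq(1) by blast
  next
    case True
    have "V ` {..<N} \<subseteq> cfun.span (e ` {..<n})"
    proof clarify
      fix j
      show "V j \<in> cfun.span (e ` {..<n})" unfolding V_def
        by (intro cfun.span_sum cfun.span_scale cfun.span_base) auto
    qed
    moreover have "card (V ` {..<N}) = N" using True by (simp add: card_image)
    moreover have "card (e ` {..<n}) \<le> n" using card_image_le[of "{..<n}" e] by simp
    ultimately have "cfun.dependent (V ` {..<N})"
      using cfun.independent_span_bound[of "e ` {..<n}" "V ` {..<N}"] assms by fastforce
    then obtain u where u: "\<exists>v\<in>V ` {..<N}. u v \<noteq> 0" "(\<Sum>v\<in>V ` {..<N}. (\<lambda>z. u v * v z)) = 0"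
      by (subst (asm) cfun.dependent_finite) auto
    define a where "a j = u (V j)" for j
    have "(\<Sum>j<N. a j * c i j) = 0" if "i < n" for i
    proof -
      have "0 = (\<Sum>v\<in>V ` {..<N}. (\<lambda>z. u v * v z)) (of_nat i)" unfolding u(2) by simp
      also have "\<dots> = (\<Sum>v\<in>V ` {..<N}. u v * v (of_nat i))" by (rule fun_sum_apply)
      also have "\<dots> = (\<Sum>j<N. a j * V j (of_nat i))" unfolding a_def by (subst sum.reindex[OF True]) simp
      finally show ?thesis using Vi[OF that] by simp
    qed
    moreover have "\<exists>j<N. a j \<noteq> 0" using u(1) unfolding a_def by auto
    ultimately show ?thesis by blast
  qed
qed

section \<open>Fourier expansions and Siegel's argument\<close>

definition q_expansion :: "(complex \<Rightarrow> complex) \<Rightarrow> complex \<Rightarrow> complex" where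
  "q_expansion f q = (if q = 0 then 0 else f (Ln q / (2 * pi * \<i>)))"

lemma Im_Ln_quotient:
  assumes "q \<noteq> 0"
  shows "Im (Ln q / (2 * pi * \<i>)) = - ln (cmod q) / (2 * pi)"
proof -
  have "Ln q / (2 * pi * \<i>) = (- \<i> * Ln q) / of_real (2 * pi)" by (simp add: field_simps)
  then have "Im (Ln q / (2 * pi * \<i>)) = Im (- \<i> * Ln q) / (2 * pi)" by (simp only: Im_divide_of_real)
  then show ?thesis using assms by simp
qed

lemma cusp_form_shift:
  assumes f: "f \<in> cusp_forms k" and z: "Im z > 0"
  shows "f (z + of_int n) = f z"
  using cusp_formsD(3)[OF f, of "(1, n, 0, 1)" z] z by (simp add: SL2Z_def moebius_def)

text \<open>The principal logarithm recovers z up to an integer, and f has period 1.\<close>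

lemma q_expansion_exp:
  assumes f: "f \<in> cusp_forms k" and z: "Im z > 0" and q: "q = exp (2 * pi * \<i> * z)"
  shows "q_expansion f q = f z"
proof -
  have q0: "q \<noteq> 0" unfolding q by simp
  have "exp (Ln q) = exp (2 * pi * \<i> * z)" using q0 q by simp
  then obtain n :: int where n: "Ln q = 2 * pi * \<i> * z + (of_int (2 * n) * pi) * \<i>" unfolding exp_eq by blast
  have "Ln q / (2 * pi * \<i>) = z + of_int n" unfolding n by (simp add: field_simps)
  then show ?thesis unfolding q_expansion_def using q0 cusp_form_shift[OF f z, of n] by simp
qed

lemma cmod_exp_2pi: "cmod (exp (2 * pi * \<i> * z)) = exp (- 2 * pi * Im z)"
  by simp

text \<open>\<open>Ln\<close> jumps along the negative axis, so the punctured disc is covered by two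
  slit discs. On the one that avoids the positive axis, Ln (- q) and a shift of z by 1/2 give
  another preimage of q. The vanishing at the cusp removes the singularity at 0.\<close>

lemma q_expansion_holomorphic:
  assumes f: "f \<in> cusp_forms k"
  shows "q_expansion f holomorphic_on ball 0 1"
proof -
  have fh: "f holomorphic_on upper_half_plane" by (rule cusp_formsD(1)[OF f])
  have up: "Ln q / (2 * pi * \<i>) \<in> upper_half_plane" if "q \<noteq> 0" "cmod q < 1" for q
  proof -
    have "ln (cmod q) < 0" using that by simp
    then show ?thesis unfolding upper_half_plane_def mem_Collect_eq Im_Ln_quotient[OF that(1)] by (simp add: divide_neg_pos)
  qed
  define U1 where "U1 = ball 0 1 - (\<real>\<^sub>\<le>\<^sub>0 :: complex set)"
  define U2 where "U2 = ball 0 1 - (\<real>\<^sub>\<ge>\<^sub>0 :: complex set)"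
  have o: "open U1" "open U2" unfolding U1_def U2_def by (auto intro: open_Diff)
  have 1: "q_expansion f holomorphic_on U1"
  proof (rule holomorphic_transform)
    have "(\<lambda>q. Ln q / (2 * pi * \<i>)) holomorphic_on U1" unfolding U1_def by (intro holomorphic_intros) auto
    then have "f \<circ> (\<lambda>q. Ln q / (2 * pi * \<i>)) holomorphic_on U1"
      proof (rule holomorphic_on_compose_gen[OF _ fh])
      show "(\<lambda>q. Ln q / (2 * pi * \<i>)) ` U1 \<subseteq> upper_half_plane"
      proof (rule image_subsetI, rule up)
        fix q assume "q \<in> U1"
        then show "q \<noteq> 0" "cmod q < 1" unfolding U1_def by auto
      qed
    qed
    then show "(\<lambda>q. f (Ln q / (2 * pi * \<i>))) holomorphic_on U1" by (simp add: o_def)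
    show "f (Ln q / (2 * pi * \<i>)) = q_expansion f q" if "q \<in> U1" for q using that unfolding U1_def q_expansion_def by auto
  qed
  have up2: "Ln (- q) / (2 * pi * \<i>) + 1 / 2 \<in> upper_half_plane" if "q \<noteq> 0" "cmod q < 1" for q
    using up[of "- q"] that unfolding upper_half_plane_def by simp
  have 2: "q_expansion f holomorphic_on U2"
  proof (rule holomorphic_transform)
    have "(\<lambda>q. Ln (- q) / (2 * pi * \<i>) + 1 / 2) holomorphic_on U2"
      unfolding U2_def by (intro holomorphic_intros) (auto simp: complex_nonpos_Reals_iff complex_nonneg_Reals_iff)
    then have "f \<circ> (\<lambda>q. Ln (- q) / (2 * pi * \<i>) + 1 / 2) holomorphic_on U2"
      proof (rule holomorphic_on_compose_gen[OF _ fh])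
      show "(\<lambda>q. Ln (- q) / (2 * pi * \<i>) + 1 / 2) ` U2 \<subseteq> upper_half_plane"
      proof (rule image_subsetI, rule up2)
        fix q assume "q \<in> U2"
        then show "q \<noteq> 0" "cmod q < 1" unfolding U2_def by auto
      qed
    qed
    then show "(\<lambda>q. f (Ln (- q) / (2 * pi * \<i>) + 1 / 2)) holomorphic_on U2" by (simp add: o_def)
    show "f (Ln (- q) / (2 * pi * \<i>) + 1 / 2) = q_expansion f q" if "q \<in> U2" for q
    proof (rule q_expansion_exp[OF f, symmetric])
      have q: "q \<noteq> 0" "cmod q < 1" using that unfolding U2_def by auto
      show "0 < Im (Ln (- q) / (2 * pi * \<i>) + 1 / 2)" using up2[OF q] by (simp add: upper_half_plane_def)
      have "2 * pi * \<i> * (Ln (- q) / (2 * pi * \<i>) + 1 / 2) = Ln (- q) + pi * \<i>" by (simp add: field_simps)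
      then show "q = exp (2 * pi * \<i> * (Ln (- q) / (2 * pi * \<i>) + 1 / 2))"
        using q by (simp add: exp_add)
    qed
  qed
  have U: "U1 \<union> U2 = ball 0 1 - {0}"
    unfolding U1_def U2_def by (auto simp: complex_nonpos_Reals_iff complex_nonneg_Reals_iff complex_eq_iff)
  have hol: "q_expansion f holomorphic_on ball 0 1 - {0}"
    unfolding U[symmetric] by (rule holomorphic_on_Un[OF 1 2 o])
  have cont0: "(q_expansion f \<longlongrightarrow> 0) (at 0)"
    unfolding tendsto_iff
  proof (intro allI impI)
    fix e :: real assume e: "e > 0"
    have "\<forall>\<^sub>F z in filtercomap Im at_top. dist (f z) 0 < e" using cusp_formsD(4)[OF f] e unfolding tendsto_iff by blast
    then obtain P where P: "eventually P at_top" "\<And>z. P (Im z) \<Longrightarrow> dist (f z) 0 < e" unfolding eventually_filtercomap by blast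
    then obtain Y where Y: "\<And>y. y \<ge> Y \<Longrightarrow> P y" unfolding eventually_at_top_linorder by blast
    have "dist (q_expansion f q) 0 < e" if "q \<noteq> 0" "dist q 0 < exp (- 2 * pi * Y)" for q
    proof -
      have "ln (cmod q) \<le> - 2 * pi * Y" proof -
        have "ln (cmod q) \<le> ln (exp (- 2 * pi * Y))" by (rule ln_mono) (use that in auto)
        then show ?thesis by simp
      qed
      then have "Y \<le> - ln (cmod q) / (2 * pi)" by (simp add: field_simps)
      then have "P (Im (Ln q / (2 * pi * \<i>)))" unfolding Im_Ln_quotient[OF that(1)] by (rule Y)
      then show ?thesis using P(2) that(1) unfolding q_expansion_def by simp
    qed
    then show "\<forall>\<^sub>F q in at 0. dist (q_expansion f q) 0 < e"
      unfolding eventually_at by (intro exI[of _ "exp (- 2 * pi * Y)"]) auto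
  qed
  have "continuous_on (ball 0 1) (q_expansion f)"
    unfolding continuous_on_eq_continuous_at[OF open_ball]
  proof
    fix q :: complex assume q: "q \<in> ball 0 1"
    show "isCont (q_expansion f) q"
    proof (cases "q = 0")
      case True
      then show ?thesis using cont0 unfolding isCont_def by (simp add: q_expansion_def)
    next
      case False
      have "continuous_on (ball 0 1 - {0}) (q_expansion f)" by (rule holomorphic_on_imp_continuous_on[OF hol])
      then show ?thesis using False q by (auto simp: continuous_on_eq_continuous_at open_Diff)
    qed
  qed
  then show ?thesis by (rule no_isolated_singularity[OF _ hol]) auto
qed

text \<open>Schwarz's lemma for a zero of order n: the maximum principle on the disc of radius R,
  applied to the quotient by w ^ n.\<close>

lemma schwarz_order_n:
  fixes b :: "nat \<Rightarrow> complex"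
  assumes G: "\<And>w. cmod w < 1 \<Longrightarrow> (\<lambda>i. b i * w ^ i) sums G w" and b: "\<And>i. i < n \<Longrightarrow> b i = 0"
    and R: "0 < R" "R < 1" and B: "\<And>w. cmod w = R \<Longrightarrow> cmod (G w) \<le> B" and w: "cmod w \<le> R"
  shows "cmod (G w) \<le> (cmod w / R) ^ n * B"
proof -
  define H where "H w = (\<Sum>i. b (i + n) * w ^ i)" for w
  have Hs: "(\<lambda>i. b (i + n) * w ^ i) sums H w" if "cmod w < 1" for w
  proof (cases "w = 0")
    case True
    show ?thesis unfolding H_def True by (rule summable_sums, rule sums_summable, rule powser_sums_zero)
  next
    case False
    have "(\<lambda>i. b (i + n) * w ^ (i + n)) sums (G w - (\<Sum>i<n. b i * w ^ i))" using G[OF that] by (rule sums_split_initial_segment)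
    then have "(\<lambda>i. b (i + n) * w ^ (i + n) / w ^ n) sums ((G w - (\<Sum>i<n. b i * w ^ i)) / w ^ n)" by (rule sums_divide)
    then have "(\<lambda>i. b (i + n) * w ^ i) sums ((G w - (\<Sum>i<n. b i * w ^ i)) / w ^ n)" using False by (simp add: power_add)
    then show ?thesis unfolding H_def by (simp add: sums_iff)
  qed
  have GH: "G w = w ^ n * H w" if "cmod w < 1" for w
  proof -
    have "(\<lambda>i. w ^ n * (b (i + n) * w ^ i)) sums (w ^ n * H w)" by (intro sums_mult Hs that)
    then have "(\<lambda>i. b (i + n) * w ^ (i + n)) sums (w ^ n * H w)" by (simp add: power_add mult_ac)
    moreover have "(\<lambda>i. b (i + n) * w ^ (i + n)) sums (G w - (\<Sum>i<n. b i * w ^ i))" using G[OF that] by (rule sums_split_initial_segment)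
    moreover have "(\<Sum>i<n. b i * w ^ i) = 0" using b by simp
    ultimately show ?thesis using sums_unique2 by fastforce
  qed
  have Hh: "H holomorphic_on ball 0 1"
    by (rule power_series_holomorphic[where a = "\<lambda>i. b (i + n)"]) (use Hs in auto)
  have "cmod (H w) \<le> B / R ^ n"
  proof (rule maximum_modulus_frontier[where f = H and S = "cball 0 R" and \<xi> = w])
    show "H holomorphic_on interior (cball 0 R)" by (rule holomorphic_on_subset[OF Hh]) (use R in auto)
    show "continuous_on (closure (cball 0 R)) H"
      by (rule continuous_on_subset[OF holomorphic_on_imp_continuous_on[OF Hh]]) (use R in auto)
    fix v assume "v \<in> frontier (cball (0::complex) R)"
    then have v: "cmod v = R" using R by (simp add: dist_norm)
    then have "cmod (G v) = R ^ n * cmod (H v)" using GH[of v] R by (simp add: norm_mult norm_power)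
    then have "R ^ n * cmod (H v) \<le> B" using B[OF v] by simp
    then show "cmod (H v) \<le> B / R ^ n" using R by (simp add: pos_le_divide_eq mult.commute)
  qed (use w in auto)
  then have "cmod w ^ n * cmod (H w) \<le> cmod w ^ n * (B / R ^ n)" by (intro mult_left_mono) auto
  then show ?thesis using GH[of w] w R by (simp add: norm_mult norm_power power_divide)
qed

text \<open>The density |g|^2 y^k is bounded, by invariance and decay at the cusp. Suppose its
  supremum s is positive, and take a point of height y in the fundamental domain where it exceeds s
  / 2. Compared with points of height y / 2, the zero of order k gains R^(2 k) with R = exp (- pi
  y), while the weight loses only 2^k. Since 2 R^2 <= 1/2 the density at the point is at most s / 2,
  a contradiction. A near-maximum suffices, so the supremum need not be attained.\<close>

lemma siegel_bound:
  assumes g: "g \<in> cusp_forms k" and k: "k \<ge> 1"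
    and b: "\<And>w. cmod w < 1 \<Longrightarrow> (\<lambda>i. b i * w ^ i) sums q_expansion g w" "\<And>i. i < k \<Longrightarrow> b i = 0"
    and w: "Im w > 0"
  shows "g w = 0"
proof -
  \<comment> \<open>The modulus of q at height 1/2, a lower bound for heights in the fundamental
    domain.\<close>
  define r0 where "r0 = exp (- pi)"
  have r0: "0 < r0" "r0 < 1" unfolding r0_def by auto
  obtain B where B: "\<And>q. cmod q = r0 \<Longrightarrow> cmod (q_expansion g q) \<le> B"
  proof -
    have "continuous_on (sphere 0 r0) (q_expansion g)"
      by (rule continuous_on_subset[OF holomorphic_on_imp_continuous_on[OF q_expansion_holomorphic[OF g]]]) (use r0 in auto)
    then have "bounded (q_expansion g ` sphere 0 r0)" by (intro compact_imp_bounded compact_continuous_image) auto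
    then obtain B where B: "\<forall>q\<in>sphere 0 r0. cmod (q_expansion g q) \<le> B" unfolding bounded_iff by auto
    show ?thesis by (rule that[of B]) (use B in simp)
  qed
  have B0: "0 \<le> B" using order_trans[OF norm_ge_zero B[of "of_real r0"]] r0 by simp
  define \<Phi> where "\<Phi> = form_weight k g"
  have cexp: "cmod (exp (2 * pi * \<i> * z)) = exp (- (2 * pi * Im z))" for z using cmod_exp_2pi[of z] by simp
  have gB: "cmod (g z) \<le> exp (- (2 * pi * Im z)) / r0 * B" if "1 / 2 \<le> Im z" for z
  proof -
    define q where "q = exp (2 * pi * \<i> * z)"
    have qr: "cmod q \<le> r0" unfolding q_def cexp r0_def using that by simp
    have gq: "q_expansion g q = g z" by (rule q_expansion_exp[OF g]) (use that in \<open>auto simp: q_def\<close>)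
    have "cmod (q_expansion g q) \<le> (cmod q / r0) ^ 1 * B"
      by (rule schwarz_order_n[OF b(1) _ r0 B qr]) (use b(2) k in auto)
    then show ?thesis unfolding gq by (simp add: q_def cexp)
  qed
  have bdd: "\<Phi> z \<le> (B / r0)\<^sup>2 * real k ^ k" if "z \<in> fund_domain" for z
  proof -
    have I2: "1 / 2 \<le> Im z" by (rule fund_domain_Im_ge[OF that])
    have "cmod (g z) \<le> B / r0 * exp (- (2 * pi * Im z))" using gB[OF I2] by (simp add: mult_ac)
    also have "\<dots> \<le> B / r0 * exp (- Im z)"
    proof (intro mult_left_mono)
      have "1 * Im z \<le> 2 * pi * Im z" using I2 pi_gt3 by (intro mult_right_mono) auto
      then show "exp (- (2 * pi * Im z)) \<le> exp (- Im z)" by simp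
    qed (use B0 r0 in auto)
    finally have "(cmod (g z))\<^sup>2 \<le> (B / r0 * exp (- Im z))\<^sup>2" by (intro power_mono) auto
    then have "\<Phi> z \<le> (B / r0 * exp (- Im z))\<^sup>2 * (real k ^ k * exp (Im z))"
      unfolding \<Phi>_def form_weight_def using I2 by (intro mult_mono power_le_exp) auto
    also have "\<dots> = (B / r0)\<^sup>2 * real k ^ k * exp (- Im z)"
      by (simp add: power_mult_distrib power2_eq_square mult_ac flip: exp_add)
    also have "\<dots> \<le> (B / r0)\<^sup>2 * real k ^ k * 1" using I2 by (intro mult_left_mono) auto
    finally show ?thesis by simp
  qed
  then have ba: "bdd_above (\<Phi> ` fund_domain)" by (intro bdd_aboveI2)
  define s where "s = (SUP z\<in>fund_domain. \<Phi> z)"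
  have le_s: "\<Phi> z \<le> s" if z: "Im z > 0" for z
  proof -
    obtain \<gamma> where gm: "\<gamma> \<in> SL2Z" "moebius \<gamma> z \<in> fund_domain" using moebius_to_fund_domain[OF z] by blast
    have "\<Phi> z = \<Phi> (moebius \<gamma> z)" unfolding \<Phi>_def by (rule form_weight_moebius[OF g gm(1) z, symmetric])
    also have "\<dots> \<le> s" unfolding s_def by (rule cSUP_upper[OF gm(2) ba])
    finally show ?thesis .
  qed
  have s0: "0 \<le> s" using le_s[of \<i>] by (simp add: \<Phi>_def form_weight_def order_trans[rotated])
  have "s = 0"
  proof (rule ccontr)
    assume "s \<noteq> 0"
    then have sp: "s > 0" using s0 by simp
    have "fund_domain \<noteq> {}" using moebius_to_fund_domain[of \<i>] by auto
    moreover have "s / 2 < s" using sp by simp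
    ultimately obtain z where z: "z \<in> fund_domain" "s / 2 < \<Phi> z"
      using less_cSUP_iff[OF _ ba, of "s / 2"] unfolding s_def by auto
    define y where "y = Im z"
    have y: "1 / 2 \<le> y" unfolding y_def by (rule fund_domain_Im_ge[OF z(1)])
    \<comment> \<open>The modulus of q at height y / 2; at z itself the modulus is R^2.\<close>
    define R where "R = exp (- (pi * y))"
    have R: "0 < R" "R < 1" unfolding R_def using y by auto
    define q where "q = exp (2 * pi * \<i> * z)"
    have cq: "cmod q = R * R" unfolding q_def cexp R_def y_def by (simp flip: exp_add)
    have cqR: "cmod q \<le> R" unfolding cq using R by (simp add: mult_left_le)
    define M where "M = sqrt (s * (2 / y) ^ k)"
    have M: "cmod (q_expansion g v) \<le> M" if "cmod v = R" for v
    proof -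
      have v0: "v \<noteq> 0" using that R by auto
      define u where "u = Ln v / (2 * pi * \<i>)"
      have Iu: "Im u = y / 2" unfolding u_def Im_Ln_quotient[OF v0] that R_def by simp
      have "q_expansion g v = g u" unfolding q_expansion_def u_def using v0 by simp
      moreover have "\<Phi> u \<le> s" by (rule le_s) (use Iu y in simp)
      then have "(cmod (g u))\<^sup>2 * (y / 2) ^ k \<le> s" unfolding \<Phi>_def form_weight_def Iu .
      then have "(cmod (g u))\<^sup>2 \<le> s * (2 / y) ^ k" using y by (simp add: power_divide field_simps)
      then have "cmod (g u) \<le> M" unfolding M_def by (rule real_le_rsqrt)
      ultimately show ?thesis by simp
    qed
    have "q_expansion g q = g z" by (rule q_expansion_exp[OF g]) (use y in \<open>auto simp: q_def y_def\<close>)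
    moreover have "cmod (q_expansion g q) \<le> (cmod q / R) ^ k * M"
      by (rule schwarz_order_n[OF b R M cqR])
    ultimately have "cmod (g z) \<le> R ^ k * M" unfolding cq using R by simp
    then have "(cmod (g z))\<^sup>2 \<le> (R ^ k * M)\<^sup>2" by (intro power_mono) auto
    also have "\<dots> = (R\<^sup>2) ^ k * (s * (2 / y) ^ k)"
      unfolding M_def using sp y by (simp add: power_mult_distrib flip: power_mult) (simp add: mult.commute)
    finally have "\<Phi> z \<le> (R\<^sup>2) ^ k * (s * (2 / y) ^ k) * y ^ k"
      unfolding \<Phi>_def form_weight_def y_def[symmetric] using y by (intro mult_right_mono) auto
    also have "\<dots> = s * (2 * R\<^sup>2) ^ k" using y by (simp add: power_divide power_mult_distrib)
    also have "\<dots> \<le> s * (1 / 2) ^ k"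
    proof (intro mult_left_mono power_mono)
      have "R\<^sup>2 = exp (- (2 * pi * y))" unfolding R_def by (simp add: power2_eq_square flip: exp_add)
      also have "\<dots> \<le> exp (- pi)"
      proof -
        have "pi * 1 \<le> pi * (2 * y)" using y by (intro mult_left_mono) auto
        then show ?thesis by (simp add: mult_ac)
      qed
      also have "\<dots> \<le> 1 / 4"
      proof -
        have "4 \<le> exp pi" using exp_ge_add_one_self[of pi] pi_gt3 by linarith
        then show ?thesis by (simp add: exp_minus field_simps)
      qed
      finally show "2 * R\<^sup>2 \<le> 1 / 2" by simp
    qed (use sp R in auto)
    also have "\<dots> \<le> s * (1 / 2) ^ 1" using sp k by (intro mult_left_mono power_decreasing) auto
    finally show False using z(2) by simp
  qed
  then have "\<Phi> w \<le> 0" using le_s[OF w] by simp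
  moreover have "0 < Im w ^ k" using w by simp
  ultimately show ?thesis unfolding \<Phi>_def form_weight_def by (simp add: mult_le_0_iff)
qed

section \<open>Orthonormal bases\<close>

locale weight_basis =
  fixes k :: nat and f :: "nat \<Rightarrow> complex \<Rightarrow> complex"
  assumes adm: "admissible k f"
begin

abbreviation N :: nat where "N \<equiv> cusp_dim k"

lemma k2: "2 \<le> k" and even_k: "even k" and N1: "1 \<le> N"
  using adm unfolding admissible_def by auto

lemma petersson_basis: "i < N \<Longrightarrow> j < N \<Longrightarrow> petersson k (f i) (f j) = (if i = j then 1 else 0)"
  using adm unfolding admissible_def orthonormal_basis_def by blast

lemma span_basis: "cfun.span (f ` {..<N}) = cusp_forms k"
  using adm unfolding admissible_def orthonormal_basis_def by blast

lemma basis_cusp_form: "j < N \<Longrightarrow> f j \<in> cusp_forms k"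
  unfolding span_basis[symmetric] by (rule cfun.span_base) simp

lemma form_of_coeffs_cusp_form: "form_of_coeffs k f a \<in> cusp_forms k"
proof -
  have "form_of_coeffs k f a = (\<Sum>j<N. (\<lambda>z. a j * f j z))"
    by (rule ext) (simp add: form_of_coeffs_def fun_sum_apply)
  moreover have "\<dots> \<in> cfun.span (f ` {..<N})" by (intro cfun.span_sum cfun.span_scale cfun.span_base) auto
  ultimately show ?thesis unfolding span_basis by simp
qed

lemma basis_inj: "inj_on f {..<N}"
proof (rule inj_onI)
  fix i j assume ij: "i \<in> {..<N}" "j \<in> {..<N}" "f i = f j"
  have "petersson k (f i) (f j) = 1" using petersson_basis[of i i] ij by simp
  then show "i = j" using petersson_basis[of i j] ij by (auto split: if_splits)
qed

lemma cusp_form_coeffs: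
  assumes "h \<in> cusp_forms k"
  obtains c where "h = form_of_coeffs k f c"
proof -
  have "h \<in> range (\<lambda>u. \<Sum>v\<in>f ` {..<N}. (\<lambda>z. u v * v z))"
    using assms unfolding span_basis[symmetric] by (subst (asm) cfun.span_finite) auto
  then obtain u where u: "h = (\<Sum>v\<in>f ` {..<N}. (\<lambda>z. u v * v z))" by blast
  have "h = (\<Sum>j<N. (\<lambda>z. u (f j) * f j z))" unfolding u by (subst sum.reindex[OF basis_inj]) simp
  then have "h = form_of_coeffs k f (\<lambda>j. u (f j))" by (simp add: fun_eq_iff form_of_coeffs_def fun_sum_apply)
  then show ?thesis by (rule that)
qed

lemma form_weight_measurable: "h \<in> cusp_forms k \<Longrightarrow> (\<lambda>z. form_weight k h z) \<in> borel_measurable borel"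
proof -
  assume "h \<in> cusp_forms k"
  note [measurable] = cusp_form_measurable[OF this]
  show ?thesis unfolding form_weight_def by measurable
qed

lemma basis_measurable: "j < N \<Longrightarrow> f j \<in> borel_measurable borel"
  by (rule cusp_form_measurable[OF basis_cusp_form])

lemma petersson_integrand_measurable:
  assumes "i < N" "j < N"
  shows "(\<lambda>z. indicator fund_domain z *\<^sub>R (f i z * cnj (f j z) * complex_of_real (Im z ^ k))) \<in> borel_measurable hyp_area"
proof -
  note [measurable] = basis_measurable[OF assms(1)] basis_measurable[OF assms(2)]
  have [measurable]: "cnj \<in> borel_measurable borel" by (intro borel_measurable_continuous_onI continuous_intros)
  show ?thesis by (simp cong: measurable_cong_sets add: sets_hyp_area)
qed

lemma form_weight_complex: "complex_of_real (form_weight k h z) = h z * cnj (h z) * complex_of_real (Im z ^ k)"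
  unfolding form_weight_def of_real_mult complex_norm_square by simp

text \<open>A non-integrable function has integral 0 by convention, so the value 1 of the Petersson
  norm forces integrability.\<close>

lemma integrable_form_weight_basis:
  assumes j: "j < N"
  shows "integrable hyp_area (\<lambda>z. indicator fund_domain z * form_weight k (f j) z)"
proof -
  have "petersson k (f j) (f j) \<noteq> 0" using petersson_basis[OF j j] by simp
  then have "integrable hyp_area (\<lambda>z. indicator fund_domain z *\<^sub>R (f j z * cnj (f j z) * complex_of_real (Im z ^ k)))"
    unfolding petersson_def set_lebesgue_integral_def using not_integrable_integral_eq by blast
  then have "integrable hyp_area (\<lambda>z. complex_of_real (indicator fund_domain z * form_weight k (f j) z))"
    unfolding of_real_mult form_weight_complex by (simp add: scaleR_conv_of_real)
  then show ?thesis unfolding complex_of_real_integrable_eq .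
qed

lemma integrable_petersson:
  assumes ij: "i < N" "j < N"
  shows "integrable hyp_area (\<lambda>z. indicator fund_domain z *\<^sub>R (f i z * cnj (f j z) * complex_of_real (Im z ^ k)))"
proof (rule Bochner_Integration.integrable_bound[OF Bochner_Integration.integrable_add[OF integrable_form_weight_basis[OF ij(1)] integrable_form_weight_basis[OF ij(2)]]])
  show "(\<lambda>z. indicator fund_domain z *\<^sub>R (f i z * cnj (f j z) * complex_of_real (Im z ^ k))) \<in> borel_measurable hyp_area"
    by (rule petersson_integrand_measurable[OF ij])
  have "norm (indicator fund_domain z *\<^sub>R (f i z * cnj (f j z) * complex_of_real (Im z ^ k)))
     \<le> norm (indicator fund_domain z * form_weight k (f i) z + indicator fund_domain z * form_weight k (f j) z)" for z
  proof (cases "z \<in> fund_domain")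
    case True
    have Iz: "0 \<le> Im z ^ k" using fund_domain_Im_ge[OF True] by simp
    have "cmod (f i z) * cmod (f j z) \<le> (cmod (f i z))\<^sup>2 + (cmod (f j z))\<^sup>2"
      using sum_squares_bound[of "cmod (f i z)" "cmod (f j z)"] mult_nonneg_nonneg[OF norm_ge_zero norm_ge_zero, of "f i z" "f j z"] by argo
    then have "cmod (f i z) * cmod (f j z) * Im z ^ k \<le> ((cmod (f i z))\<^sup>2 + (cmod (f j z))\<^sup>2) * Im z ^ k"
      using Iz by (rule mult_right_mono)
    moreover have "\<bar>Im z\<bar> = Im z" using fund_domain_Im_ge[OF True] by simp
    ultimately show ?thesis using True Iz unfolding form_weight_def by (simp add: norm_mult distrib_right norm_power)
  qed simp
  then show "AE z in hyp_area. norm (indicator fund_domain z *\<^sub>R (f i z * cnj (f j z) * complex_of_real (Im z ^ k)))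
     \<le> norm (indicator fund_domain z * form_weight k (f i) z + indicator fund_domain z * form_weight k (f j) z)" by simp
qed

lemma integral_petersson:
  assumes ij: "i < N" "j < N"
  shows "(LINT z|hyp_area. indicator fund_domain z *\<^sub>R (f i z * cnj (f j z) * complex_of_real (Im z ^ k))) = (if i = j then 1 else 0)"
  using petersson_basis[OF ij] unfolding petersson_def set_lebesgue_integral_def .

text \<open>Parseval's identity: the Petersson norm of a form is the norm of its coefficient vector.
  As a nonnegative integral it combines directly with the bounds on densities.\<close>

lemma nn_integral_form_weight:
  "(\<integral>\<^sup>+z. ennreal (form_weight k (form_of_coeffs k f a) z) * indicator fund_domain z \<partial>hyp_area) = ennreal ((cvec_norm N a)\<^sup>2)"
proof -
  let ?g = "\<lambda>z. indicator fund_domain z * form_weight k (form_of_coeffs k f a) z"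
  let ?p = "\<lambda>i j z. indicator fund_domain z *\<^sub>R (f i z * cnj (f j z) * complex_of_real (Im z ^ k))"
  have eq: "complex_of_real (?g z) = (\<Sum>i<N. \<Sum>j<N. a i * cnj (a j) * ?p i j z)" for z
  proof -
    have "complex_of_real (?g z) = indicator fund_domain z *\<^sub>R ((\<Sum>i<N. a i * f i z) * (\<Sum>j<N. cnj (a j) * cnj (f j z)) * complex_of_real (Im z ^ k))"
      unfolding of_real_mult form_weight_complex form_of_coeffs_def by (simp add: scaleR_conv_of_real cnj_sum)
    also have "\<dots> = (\<Sum>i<N. \<Sum>j<N. indicator fund_domain z *\<^sub>R ((a i * f i z) * (cnj (a j) * cnj (f j z)) * complex_of_real (Im z ^ k)))"
      by (subst sum_product) (simp only: sum_distrib_right scaleR_sum_right)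
    also have "\<dots> = (\<Sum>i<N. \<Sum>j<N. a i * cnj (a j) * ?p i j z)"
      by (intro sum.cong refl) (simp add: scaleR_conv_of_real mult_ac)
    finally show ?thesis .
  qed
  have int: "integrable hyp_area (\<lambda>z. complex_of_real (?g z))"
    unfolding eq by (intro Bochner_Integration.integrable_sum integrable_mult_right integrable_petersson) auto
  then have intg: "integrable hyp_area ?g" unfolding complex_of_real_integrable_eq .
  have "complex_of_real (LINT z|hyp_area. ?g z) = (LINT z|hyp_area. complex_of_real (?g z))" by (rule integral_complex_of_real[symmetric])
  also have "\<dots> = (\<Sum>i<N. \<Sum>j<N. a i * cnj (a j) * (LINT z|hyp_area. ?p i j z))"
  proof -
    have "(LINT z|hyp_area. complex_of_real (?g z)) = (\<Sum>i<N. LINT z|hyp_area. (\<Sum>j<N. a i * cnj (a j) * ?p i j z))"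
      unfolding eq by (intro Bochner_Integration.integral_sum Bochner_Integration.integrable_sum integrable_mult_right integrable_petersson) auto
    also have "\<dots> = (\<Sum>i<N. \<Sum>j<N. LINT z|hyp_area. a i * cnj (a j) * ?p i j z)"
      by (intro sum.cong refl Bochner_Integration.integral_sum integrable_mult_right integrable_petersson) auto
    also have "\<dots> = (\<Sum>i<N. \<Sum>j<N. a i * cnj (a j) * (LINT z|hyp_area. ?p i j z))"
      by (intro sum.cong refl integral_mult_right_zero)
    finally show ?thesis .
  qed
  also have "\<dots> = (\<Sum>i<N. \<Sum>j<N. if i = j then a i * cnj (a j) else 0)"
    by (intro sum.cong refl) (subst integral_petersson; simp)
  also have "\<dots> = (\<Sum>i<N. a i * cnj (a i))" by (intro sum.cong refl) simp
  also have "\<dots> = complex_of_real ((cvec_norm N a)\<^sup>2)" unfolding cvec_norm_sq of_real_sum complex_norm_square ..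
  finally have I: "(LINT z|hyp_area. ?g z) = (cvec_norm N a)\<^sup>2" by (simp only: of_real_eq_iff)
  have nn: "0 \<le> ?g z" for z
    using fund_domain_Im_ge[of z] unfolding form_weight_def by (auto split: split_indicator)
  have "(\<integral>\<^sup>+z. ennreal (form_weight k (form_of_coeffs k f a) z) * indicator fund_domain z \<partial>hyp_area) = (\<integral>\<^sup>+z. ennreal (?g z) \<partial>hyp_area)"
    by (intro nn_integral_cong) (auto split: split_indicator)
  also have "\<dots> = ennreal (LINT z|hyp_area. ?g z)" by (rule nn_integral_eq_integral[OF intg]) (use nn in simp)
  finally show ?thesis unfolding I .
qed

text \<open>If N > k, some nonzero coefficient vector makes the first k Fourier coefficients vanish.
  By \<open>siegel_bound\<close> its form is 0, which contradicts Parseval.\<close>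

lemma dim_le_weight: "N \<le> k"
proof (rule ccontr)
  assume "\<not> N \<le> k"
  then have kN: "k < N" by simp
  define c where "c i j = (deriv ^^ i) (q_expansion (f j)) 0 / fact i" for i j
  obtain a where a: "\<exists>j<N. a j \<noteq> 0" "\<forall>i<k. (\<Sum>j<N. a j * c i j) = 0" using exists_linear_relation[OF kN, of c] by blast
  define g where "g = form_of_coeffs k f a"
  have g: "g \<in> cusp_forms k" unfolding g_def by (rule form_of_coeffs_cusp_form)
  have qg: "q_expansion g w = (\<Sum>j<N. a j * q_expansion (f j) w)" for w
    unfolding q_expansion_def g_def form_of_coeffs_def by simp
  have s: "(\<lambda>i. (\<Sum>j<N. a j * c i j) * w ^ i) sums q_expansion g w" if w: "cmod w < 1" for w
  proof -
    have "(\<lambda>i. c i j * w ^ i) sums q_expansion (f j) w" if "j < N" for j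
      using holomorphic_power_series[OF q_expansion_holomorphic[OF basis_cusp_form[OF that]], of w] w unfolding c_def by simp
    then have "(\<lambda>i. \<Sum>j<N. a j * (c i j * w ^ i)) sums (\<Sum>j<N. a j * q_expansion (f j) w)"
      by (intro sums_sum sums_mult) auto
    then show ?thesis unfolding qg by (simp add: sum_distrib_right mult.assoc)
  qed
  have "g w = 0" if "Im w > 0" for w
    by (rule siegel_bound[OF g _ s _ that]) (use a(2) k2 in auto)
  then have "g = (\<lambda>_. 0)" using cusp_formsD(2)[OF g] by blast
  then have "ennreal ((cvec_norm N a)\<^sup>2) = 0"
    using nn_integral_form_weight[of a] unfolding g_def by (simp add: form_weight_def)
  then have "(cvec_norm N a)\<^sup>2 = 0" by (simp add: ennreal_eq_0_iff order_antisym)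
  then have "\<forall>j\<in>{..<N}. (cmod (a j))\<^sup>2 = 0" unfolding cvec_norm_sq by (subst (asm) sum_nonneg_eq_0_iff) auto
  then show False using a(1) by auto
qed

section \<open>Evaluation at a point as a linear form in the coefficients\<close>

definition basis_vec :: "complex \<Rightarrow> nat \<Rightarrow> complex" where
  "basis_vec z j = complex_of_real (Im z powr (real k / 2)) * f j z"

text \<open>The reproducing kernel on the diagonal times y^k: at a point of the upper half-plane,
  the largest density among forms of norm 1.\<close>

definition total_weight :: "complex \<Rightarrow> real" where
  "total_weight z = (\<Sum>j<N. form_weight k (f j) z)"

lemma powr_half_square: "Im z > 0 \<Longrightarrow> (Im z powr (real k / 2))\<^sup>2 = Im z ^ k"
  by (simp add: power2_eq_square flip: powr_add powr_realpow)

lemma cvec_norm_basis_vec: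
  assumes "Im z > 0"
  shows "(cvec_norm N (basis_vec z))\<^sup>2 = total_weight z"
  unfolding cvec_norm_sq total_weight_def form_weight_def basis_vec_def norm_mult power_mult_distrib
  using powr_half_square[OF assms] by (simp add: mult.commute)

lemma cvec_inner_basis_vec:
  "cvec_inner N a (basis_vec z) = complex_of_real (Im z powr (real k / 2)) * form_of_coeffs k f a z"
  unfolding cvec_inner_def basis_vec_def form_of_coeffs_def by (simp add: sum_distrib_left mult_ac)

lemma cmod_cvec_inner_basis_vec:
  "cmod (cvec_inner N a (basis_vec z)) = Im z powr (real k / 2) * cmod (form_of_coeffs k f a z)"
  unfolding cvec_inner_basis_vec norm_mult by simp

lemma form_weight_eq_inner:
  assumes "Im z > 0"
  shows "form_weight k (form_of_coeffs k f a) z = (cmod (cvec_inner N a (basis_vec z)))\<^sup>2"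
  unfolding cmod_cvec_inner_basis_vec form_weight_def power_mult_distrib powr_half_square[OF assms] by simp

lemma total_weight_nonneg: "Im z > 0 \<Longrightarrow> 0 \<le> total_weight z"
  unfolding total_weight_def form_weight_def by (intro sum_nonneg) simp

text \<open>With T the total weight, the form whose coefficients are conjugate to
  \<open>basis_vec z\<close> has squared norm T and density T^2 at z, so the assumed bound reads T^2
  <= C T.\<close>

lemma total_weight_upper:
  assumes z: "Im z > 0" and C: "C \<ge> 0" and b: "\<And>h. h \<in> cusp_forms k \<Longrightarrow> ennreal (form_weight k h z)
      \<le> ennreal C * (\<integral>\<^sup>+w. ennreal (form_weight k h w) * indicator fund_domain w \<partial>hyp_area)"
  shows "total_weight z \<le> C"
proof (cases "total_weight z = 0")
  case False
  define a where "a j = cnj (basis_vec z j)" for j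
  have an: "(cvec_norm N a)\<^sup>2 = total_weight z"
    unfolding cvec_norm_basis_vec[OF z, symmetric] cvec_norm_sq a_def by simp
  have "cvec_inner N a (basis_vec z) = complex_of_real (total_weight z)"
    unfolding cvec_norm_basis_vec[OF z, symmetric] cvec_norm_sq cvec_inner_def a_def of_real_sum complex_norm_square by (simp add: mult.commute)
  then have "form_weight k (form_of_coeffs k f a) z = (total_weight z)\<^sup>2"
    unfolding form_weight_eq_inner[OF z] using total_weight_nonneg[OF z] by simp
  then have "ennreal ((total_weight z)\<^sup>2) \<le> ennreal C * ennreal (total_weight z)"
    using b[OF form_of_coeffs_cusp_form, of a] unfolding nn_integral_form_weight an by simp
  then have "total_weight z * total_weight z \<le> C * total_weight z"
    using C total_weight_nonneg[OF z] by (simp add: power2_eq_square flip: ennreal_mult)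
  then show ?thesis using False total_weight_nonneg[OF z] by simp
qed (use C in simp)

text \<open>Cauchy-Schwarz between \<open>basis_vec z\<close> and the coefficients of the single
  form h.\<close>

lemma total_weight_lower:
  assumes z: "Im z > 0" and h: "h \<in> cusp_forms k" and C: "C \<ge> 0" and pos: "0 < form_weight k h z"
    and b: "(\<integral>\<^sup>+w. ennreal (form_weight k h w) * indicator fund_domain w \<partial>hyp_area) \<le> ennreal (C * form_weight k h z)"
  shows "1 \<le> C * total_weight z"
proof -
  obtain c where c: "h = form_of_coeffs k f c" by (rule cusp_form_coeffs[OF h])
  have 1: "(cvec_norm N c)\<^sup>2 \<le> C * form_weight k h z"
    using b C pos unfolding c nn_integral_form_weight by (subst (asm) ennreal_le_iff) auto
  have "form_weight k h z \<le> (cvec_norm N c * cvec_norm N (basis_vec z))\<^sup>2"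
    unfolding c form_weight_eq_inner[OF z] by (intro power_mono cmod_cvec_inner_le) auto
  also have "\<dots> = (cvec_norm N c)\<^sup>2 * total_weight z" unfolding power_mult_distrib cvec_norm_basis_vec[OF z] ..
  also have "\<dots> \<le> C * form_weight k h z * total_weight z" by (intro mult_right_mono 1 total_weight_nonneg z)
  finally have "form_weight k h z * 1 \<le> form_weight k h z * (C * total_weight z)" by (simp add: mult_ac)
  then show ?thesis using pos by (simp only: mult_le_cancel_left_pos)
qed

lemma nn_integral_total_weight:
  "(\<integral>\<^sup>+z. ennreal (total_weight z) * indicator fund_domain z \<partial>hyp_area) = ennreal (real N)"
proof -
  have "(\<integral>\<^sup>+z. ennreal (total_weight z) * indicator fund_domain z \<partial>hyp_area)
     = (\<integral>\<^sup>+z. (\<Sum>j<N. ennreal (form_weight k (f j) z) * indicator fund_domain z) \<partial>hyp_area)"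
  proof (rule nn_integral_cong)
    fix z
    show "ennreal (total_weight z) * indicator fund_domain z = (\<Sum>j<N. ennreal (form_weight k (f j) z) * indicator fund_domain z)"
    proof (cases "z \<in> fund_domain")
      case True
      then have "0 \<le> form_weight k (f j) z" for j using fund_domain_Im_ge[OF True] unfolding form_weight_def by simp
      then show ?thesis using True unfolding total_weight_def by (simp add: sum_ennreal)
    qed simp
  qed
  also have "\<dots> = (\<Sum>j<N. (\<integral>\<^sup>+z. ennreal (form_weight k (f j) z) * indicator fund_domain z \<partial>hyp_area))"
  proof (rule nn_integral_sum)
    fix j assume "j \<in> {..<N}"
    then have [measurable]: "(\<lambda>z. form_weight k (f j) z) \<in> borel_measurable borel" by (intro form_weight_measurable basis_cusp_form) simp
    show "(\<lambda>z. ennreal (form_weight k (f j) z) * indicator fund_domain z) \<in> borel_measurable hyp_area"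
      by (simp cong: measurable_cong_sets add: sets_hyp_area)
  qed
  also have "\<dots> = (\<Sum>j<N. 1)"
  proof (intro sum.cong refl)
    fix j assume j: "j \<in> {..<N}"
    have "form_of_coeffs k f (\<lambda>i. if i = j then 1 else 0) = f j"
    proof
      fix z
      have "form_of_coeffs k f (\<lambda>i. if i = j then 1 else 0) z = (\<Sum>i<N. if i = j then f i z else 0)"
        unfolding form_of_coeffs_def by (intro sum.cong) auto
      then show "form_of_coeffs k f (\<lambda>i. if i = j then 1 else 0) z = f j z" using j by simp
    qed
    then show "(\<integral>\<^sup>+z. ennreal (form_weight k (f j) z) * indicator fund_domain z \<partial>hyp_area) = 1"
      using nn_integral_form_weight[of "\<lambda>i. if i = j then 1 else 0"] cvec_norm_unit[of j N] j by simp
  qed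
  also have "\<dots> = ennreal (real N)" by (simp add: ennreal_of_nat_eq_real_of_nat)
  finally show ?thesis .
qed

end

section \<open>The supremum over a compact set\<close>

lemma sigma_finite_hyp_area: "sigma_finite_measure hyp_area"
  unfolding hyp_area_def
  by (subst sigma_finite_measure.sigma_finite_iff_density_finite[OF sigma_finite_lborel]) (auto split: split_indicator)

locale weight_basis_on = weight_basis +
  fixes K :: "complex set" and L :: real
  assumes K: "compact K" "K \<subseteq> upper_half_plane" "K \<noteq> {}"
    and L: "0 < L" "\<And>z. z \<in> K \<Longrightarrow> total_weight z \<le> L\<^sup>2"
begin

abbreviation F :: "(nat \<Rightarrow> complex) \<Rightarrow> real" where "F \<equiv> sup_on K k f"

lemma K_Im: "z \<in> K \<Longrightarrow> 0 < Im z"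
  using K(2) unfolding upper_half_plane_def by auto

lemma basis_vec_le: "z \<in> K \<Longrightarrow> cvec_norm N (basis_vec z) \<le> L"
proof (rule power2_le_imp_le)
  assume z: "z \<in> K"
  show "(cvec_norm N (basis_vec z))\<^sup>2 \<le> L\<^sup>2" unfolding cvec_norm_basis_vec[OF K_Im[OF z]] by (rule L(2)[OF z])
  show "0 \<le> L" using L(1) by simp
qed

lemma sup_on_inner: "F x = (SUP z\<in>K. cmod (cvec_inner N x (basis_vec z)))"
  unfolding sup_on_def cmod_cvec_inner_basis_vec ..

lemma inner_le: "z \<in> K \<Longrightarrow> cmod (cvec_inner N x (basis_vec z)) \<le> L * cvec_norm N x"
  using cmod_cvec_inner_le[of N x "basis_vec z"] mult_left_mono[OF basis_vec_le cvec_norm_nonneg, of z N x] by (simp add: mult.commute)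

lemma inner_bdd: "bdd_above ((\<lambda>z. cmod (cvec_inner N x (basis_vec z))) ` K)"
  by (rule bdd_aboveI2) (rule inner_le)

lemma inner_le_F: "z \<in> K \<Longrightarrow> cmod (cvec_inner N x (basis_vec z)) \<le> F x"
  unfolding sup_on_inner by (rule cSUP_upper[OF _ inner_bdd])

lemma F_le: "(\<And>z. z \<in> K \<Longrightarrow> cmod (cvec_inner N x (basis_vec z)) \<le> c) \<Longrightarrow> F x \<le> c"
  unfolding sup_on_inner by (rule cSUP_least[OF K(3)])

lemma F_nonneg: "0 \<le> F x"
  using K(3) inner_le_F order_trans[OF norm_ge_zero] by blast

lemma cvec_inner_diff: "cvec_inner N x v = cvec_inner N y v + cvec_inner N (\<lambda>j. x j - y j) v"
  unfolding cvec_inner_def by (simp add: left_diff_distrib sum_subtractf)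

lemma F_lipschitz: "F x - F y \<le> L * cvec_norm N (\<lambda>j. x j - y j)"
proof -
  have "F x \<le> F y + L * cvec_norm N (\<lambda>j. x j - y j)"
  proof (rule F_le)
    fix z assume z: "z \<in> K"
    have "cmod (cvec_inner N x (basis_vec z)) \<le> cmod (cvec_inner N y (basis_vec z)) + cmod (cvec_inner N (\<lambda>j. x j - y j) (basis_vec z))"
      by (subst cvec_inner_diff[of x _ y]) (rule norm_triangle_ineq)
    also have "\<dots> \<le> F y + L * cvec_norm N (\<lambda>j. x j - y j)" by (intro add_mono inner_le_F inner_le z)
    finally show "cmod (cvec_inner N x (basis_vec z)) \<le> F y + L * cvec_norm N (\<lambda>j. x j - y j)" .
  qed
  then show ?thesis by simp
qed

lemma inner_continuous: "continuous_on K (\<lambda>z. cmod (cvec_inner N x (basis_vec z)))"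
proof -
  have "continuous_on K (f j)" if "j < N" for j
    by (rule continuous_on_subset[OF holomorphic_on_imp_continuous_on[OF cusp_formsD(1)[OF basis_cusp_form[OF that]]] K(2)])
  then show ?thesis unfolding cvec_inner_def basis_vec_def
    by (intro continuous_intros) (auto dest: K_Im)
qed

text \<open>By continuity the supremum over K equals that over a countable dense subset.\<close>

lemma F_measurable: "F \<in> borel_measurable (Pi\<^sub>M {..<N} (\<lambda>_. borel))"
proof -
  obtain T where T: "countable T" "T \<subseteq> K" "K \<subseteq> closure T" by (rule separable)
  have Tn: "T \<noteq> {}" using T(3) K(3) by auto
  have cl: "closure T \<subseteq> K" using closure_minimal[OF T(2) compact_imp_closed[OF K(1)]] .
  have bT: "bdd_above ((\<lambda>z. cmod (cvec_inner N x (basis_vec z))) ` T)" for x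
    by (rule bdd_above_mono[OF inner_bdd image_mono[OF T(2)]])
  have "F x = (SUP z\<in>T. cmod (cvec_inner N x (basis_vec z)))" for x
  proof (rule antisym)
    show "F x \<le> (SUP z\<in>T. cmod (cvec_inner N x (basis_vec z)))"
    proof (rule F_le)
      fix z assume z: "z \<in> K"
      show "cmod (cvec_inner N x (basis_vec z)) \<le> (SUP z\<in>T. cmod (cvec_inner N x (basis_vec z)))"
        by (rule continuous_le_on_closure[OF continuous_on_subset[OF inner_continuous cl]])
          (use z T(3) in \<open>auto intro: cSUP_upper[OF _ bT]\<close>)
    qed
    show "(SUP z\<in>T. cmod (cvec_inner N x (basis_vec z))) \<le> F x"
      by (rule cSUP_least[OF Tn]) (use T(2) inner_le_F in auto)
  qed
  then have eq: "F = (\<lambda>x. SUP z\<in>T. cmod (cvec_inner N x (basis_vec z)))" by (rule ext)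
  show ?thesis unfolding eq by (rule borel_measurable_cSUP[OF T(1) _ bT]) measurable
qed

lemma F_gauss_lipschitz: "gauss_lipschitz N L F"
  unfolding gauss_lipschitz_def using F_measurable F_lipschitz L(1) by auto

sublocale sphere_functional N L F
proof
  show "N \<ge> 1" by (rule N1)
  show "L > 0" by (rule L(1))
  show "gauss_lipschitz N L F" by (rule F_gauss_lipschitz)
  fix c :: real and x :: "nat \<Rightarrow> complex" assume c: "c > 0"
  have inn: "cmod (cvec_inner N (\<lambda>j. complex_of_real c * x j) v) = c * cmod (cvec_inner N x v)" for v
  proof -
    have "cvec_inner N (\<lambda>j. complex_of_real c * x j) v = complex_of_real c * cvec_inner N x v"
      unfolding cvec_inner_def by (simp add: sum_distrib_left mult_ac)
    then show ?thesis using c by (simp add: norm_mult)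
  qed
  show "F (\<lambda>j. complex_of_real c * x j) = c * F x"
  proof (rule antisym)
    show "F (\<lambda>j. complex_of_real c * x j) \<le> c * F x"
      by (rule F_le) (use c inner_le_F in \<open>simp add: inn\<close>)
    have "F x \<le> F (\<lambda>j. complex_of_real c * x j) / c"
    proof (rule F_le)
      fix z assume "z \<in> K"
      from inner_le_F[OF this, of "\<lambda>j. complex_of_real c * x j"]
      show "cmod (cvec_inner N x (basis_vec z)) \<le> F (\<lambda>j. complex_of_real c * x j) / c"
        unfolding inn using c by (simp add: field_simps)
    qed
    then show "c * F x \<le> F (\<lambda>j. complex_of_real c * x j)" using c by (simp add: field_simps)
  qed
qed

end

section \<open>Moments of the supremum and the upper bound for its Gaussian mean\<close>

context weight_basis
begin

lemma basis_vec_measurable [measurable]: "j < N \<Longrightarrow> (\<lambda>z. basis_vec z j) \<in> borel_measurable borel"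
  using basis_measurable[of j] unfolding basis_vec_def by measurable

lemma inner_pair_measurable:
  "(\<lambda>p. cmod (cvec_inner N (fst p) (basis_vec (snd p)))) \<in> borel_measurable (gauss N \<Otimes>\<^sub>M hyp_area)"
proof -
  have "(\<lambda>p. fst p j * basis_vec (snd p) j) \<in> borel_measurable (Pi\<^sub>M {..<N} (\<lambda>_. borel) \<Otimes>\<^sub>M borel)" if "j \<in> {..<N}" for j
  proof (rule borel_measurable_times)
    show "(\<lambda>p. fst p j) \<in> borel_measurable (Pi\<^sub>M {..<N} (\<lambda>_. borel) \<Otimes>\<^sub>M borel)"
      by (rule measurable_compose[OF measurable_fst measurable_component_singleton[OF that]])
    show "(\<lambda>p. basis_vec (snd p) j) \<in> borel_measurable (Pi\<^sub>M {..<N} (\<lambda>_. borel) \<Otimes>\<^sub>M borel)"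
      by (rule measurable_compose[OF measurable_snd basis_vec_measurable]) (use that in simp)
  qed
  then have "(\<lambda>p. cmod (cvec_inner N (fst p) (basis_vec (snd p)))) \<in> borel_measurable (Pi\<^sub>M {..<N} (\<lambda>_. borel) \<Otimes>\<^sub>M borel)"
    unfolding cvec_inner_def by (intro measurable_compose[OF _ borel_measurable_norm] borel_measurable_sum)
  then show ?thesis by (simp cong: measurable_cong_sets sets_pair_measure_cong add: sets_gauss sets_hyp_area)
qed

text \<open>The n-th power of the L^n norm over A of the form with coefficients x, normalised by
  y^(k/2).\<close>

definition power_mass :: "complex set \<Rightarrow> nat \<Rightarrow> (nat \<Rightarrow> complex) \<Rightarrow> ennreal" where
  "power_mass A n x = (\<integral>\<^sup>+w. ennreal (cmod (cvec_inner N x (basis_vec w)) ^ n) * indicator A w \<partial>hyp_area)"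

lemma
  assumes A: "A \<in> sets borel"
  shows power_mass_measurable: "power_mass A n \<in> borel_measurable (gauss N)"
    and nn_integral_power_mass: "(\<integral>\<^sup>+x. power_mass A n x \<partial>gauss N)
      = (\<integral>\<^sup>+w. (\<integral>\<^sup>+x. ennreal (cmod (cvec_inner N x (basis_vec w)) ^ n) \<partial>gauss N) * indicator A w \<partial>hyp_area)"
proof -
  interpret H: sigma_finite_measure hyp_area by (rule sigma_finite_hyp_area)
  interpret G: prob_space "gauss N" by (rule prob_space_gauss)
  interpret P: pair_sigma_finite "gauss N" hyp_area by unfold_locales
  have [measurable]: "A \<in> sets hyp_area" using A by (simp add: sets_hyp_area)
  note [measurable] = inner_pair_measurable
  have m: "(\<lambda>p. ennreal (cmod (cvec_inner N (fst p) (basis_vec (snd p))) ^ n) * indicator A (snd p)) \<in> borel_measurable (gauss N \<Otimes>\<^sub>M hyp_area)"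
    by measurable
  then have m': "case_prod (\<lambda>x w. ennreal (cmod (cvec_inner N x (basis_vec w)) ^ n) * indicator A w) \<in> borel_measurable (gauss N \<Otimes>\<^sub>M hyp_area)"
    by (simp add: case_prod_beta')
  show "power_mass A n \<in> borel_measurable (gauss N)"
    unfolding power_mass_def by (rule H.borel_measurable_nn_integral[OF m'])
  have "(\<integral>\<^sup>+x. power_mass A n x \<partial>gauss N)
    = (\<integral>\<^sup>+w. (\<integral>\<^sup>+x. ennreal (cmod (cvec_inner N x (basis_vec w)) ^ n) * indicator A w \<partial>gauss N) \<partial>hyp_area)"
    unfolding power_mass_def by (rule P.Fubini'[OF m', symmetric])
  also have "\<dots> = (\<integral>\<^sup>+w. (\<integral>\<^sup>+x. ennreal (cmod (cvec_inner N x (basis_vec w)) ^ n) \<partial>gauss N) * indicator A w \<partial>hyp_area)"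
  proof (rule nn_integral_cong, rule nn_integral_multc)
    fix w show "(\<lambda>x. ennreal (cmod (cvec_inner N x (basis_vec w)) ^ n)) \<in> borel_measurable (gauss N)"
      by (simp cong: measurable_cong_sets add: sets_gauss)
  qed
  finally show "(\<integral>\<^sup>+x. power_mass A n x \<partial>gauss N)
      = (\<integral>\<^sup>+w. (\<integral>\<^sup>+x. ennreal (cmod (cvec_inner N x (basis_vec w)) ^ n) \<partial>gauss N) * indicator A w \<partial>hyp_area)" .
qed

end

context weight_basis_on
begin

text \<open>\<open>weighted_square_mean\<close> asks only for holomorphy, so it applies to the p-th
  power of the form with exponent k p; modular invariance is not involved.\<close>

lemma F_power_le:
  assumes R: "R \<ge> 1" and KR: "K \<subseteq> box_region R" and p: "p \<ge> 1"
  shows "ennreal (F x ^ (2 * p)) \<le> ennreal (512 * real (k * p)) * power_mass (box_region (2 * R)) (2 * p) x"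
proof -
  have R2: "2 * R > 0" using R by simp
  have kp: "1 \<le> k * p" using k2 p by simp
  define g where "g = form_of_coeffs k f x"
  have g: "g \<in> cusp_forms k" unfolding g_def by (rule form_of_coeffs_cusp_form)
  note [measurable] = cusp_form_measurable[OF g]
  have pw: "(cmod (g w ^ p))\<^sup>2 * Im w ^ (k * p) = cmod (cvec_inner N x (basis_vec w)) ^ (2 * p)" if w: "Im w > 0" for w
  proof -
    have "cmod (cvec_inner N x (basis_vec w)) ^ (2 * p) = ((Im w powr (real k / 2))\<^sup>2 * (cmod (g w))\<^sup>2) ^ p"
      unfolding cmod_cvec_inner_basis_vec g_def[symmetric] power_mult by (simp only: power_mult_distrib)
    also have "\<dots> = Im w ^ (k * p) * cmod (g w) ^ (2 * p)"
      by (simp only: powr_half_square[OF w] power_mult_distrib power_mult)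
    also have "cmod (g w) ^ (2 * p) = (cmod (g w ^ p))\<^sup>2" by (simp only: norm_power power_mult[symmetric] mult.commute)
    finally show ?thesis by (simp only: mult.commute)
  qed
  have hol: "(\<lambda>w. g w ^ p) holomorphic_on upper_half_plane" by (intro holomorphic_intros cusp_formsD(1)[OF g])
  have bm: "box_region (2 * R) \<in> sets borel" unfolding box_region_def by measurable
  let ?B = "ennreal (512 * real (k * p)) * power_mass (box_region (2 * R)) (2 * p) x"
  have pt: "ennreal (cmod (cvec_inner N x (basis_vec z)) ^ (2 * p)) \<le> ?B" if z: "z \<in> K" for z
  proof -
    have Iz: "Im z > 0" by (rule K_Im[OF z])
    have zR: "z \<in> box_region R" using z KR by blast
    have "ennreal ((cmod (g z ^ p))\<^sup>2 * Im z ^ (k * p)) \<le> ennreal (512 * real (k * p)) *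
      (\<integral>\<^sup>+w. ennreal ((cmod (g w ^ p))\<^sup>2 * Im w ^ (k * p)) * indicator (square z (Im z / (4 * sqrt (real (k * p))))) w \<partial>hyp_area)"
      by (rule weighted_square_mean[OF hol Iz kp]) measurable
    also have "\<dots> \<le> ?B"
      unfolding power_mass_def
    proof (intro mult_left_mono nn_integral_mono)
      fix w
      show "ennreal ((cmod (g w ^ p))\<^sup>2 * Im w ^ (k * p)) * indicator (square z (Im z / (4 * sqrt (real (k * p))))) w
        \<le> ennreal (cmod (cvec_inner N x (basis_vec w)) ^ (2 * p)) * indicator (box_region (2 * R)) w"
      proof (cases "w \<in> square z (Im z / (4 * sqrt (real (k * p))))")
        case True
        then have wb: "w \<in> box_region (2 * R)" using square_subset_box_region[OF R zR kp] by blast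
        show ?thesis using True wb pw[OF box_region_Im_pos[OF R2 wb]] by simp
      qed simp
    qed simp
    finally show ?thesis unfolding pw[OF Iz] .
  qed
  show ?thesis
  proof (cases "?B = \<top>")
    case False
    then obtain b where b: "b \<ge> 0" "?B = ennreal b" by (cases "?B") auto
    have "F x \<le> root (2 * p) b"
    proof (rule F_le)
      fix z assume z: "z \<in> K"
      have "cmod (cvec_inner N x (basis_vec z)) ^ (2 * p) \<le> b" using pt[OF z] b by simp
      then have "root (2 * p) (cmod (cvec_inner N x (basis_vec z)) ^ (2 * p)) \<le> root (2 * p) b" using p by (intro real_root_le_mono) auto
      then show "cmod (cvec_inner N x (basis_vec z)) \<le> root (2 * p) b" using p by (simp add: real_root_power_cancel)
    qed
    then have "F x ^ (2 * p) \<le> root (2 * p) b ^ (2 * p)" by (intro power_mono F_nonneg)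
    also have "\<dots> = b" using p b(1) by (intro real_root_pow_pos2) auto
    finally show ?thesis unfolding b(2) by (rule ennreal_leI)
  qed simp
qed

lemma gauss_F_moment:
  assumes R: "R \<ge> 1" and KR: "K \<subseteq> box_region R" and p: "p \<ge> 1"
    and L2: "\<And>w. w \<in> box_region (2 * R) \<Longrightarrow> total_weight w \<le> L\<^sup>2"
    and A: "A \<ge> 0" "emeasure hyp_area (box_region (2 * R)) \<le> ennreal A"
  shows "(\<integral>\<^sup>+x. ennreal (F x ^ (2 * p)) \<partial>gauss N) \<le> ennreal (512 * real (k * p) * A * (16 * sqrt (real (2 * p)) * L) ^ (2 * p))"
proof -
  have R2: "2 * R > 0" using R by simp
  have bm: "box_region (2 * R) \<in> sets borel" unfolding box_region_def by measurable
  define T where "T = (16 * sqrt (real (2 * p)) * L) ^ (2 * p)"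
  have T0: "T \<ge> 0" unfolding T_def using L(1) by simp
  have "(\<integral>\<^sup>+x. ennreal (F x ^ (2 * p)) \<partial>gauss N) \<le> (\<integral>\<^sup>+x. ennreal (512 * real (k * p)) * power_mass (box_region (2 * R)) (2 * p) x \<partial>gauss N)"
    by (rule nn_integral_mono, rule F_power_le[OF R KR p])
  also have "\<dots> = ennreal (512 * real (k * p)) * (\<integral>\<^sup>+w. (\<integral>\<^sup>+x. ennreal (cmod (cvec_inner N x (basis_vec w)) ^ (2 * p)) \<partial>gauss N) * indicator (box_region (2 * R)) w \<partial>hyp_area)"
    by (subst nn_integral_cmult[OF power_mass_measurable[OF bm]]) (simp only: nn_integral_power_mass[OF bm])
  also have "\<dots> \<le> ennreal (512 * real (k * p)) * (\<integral>\<^sup>+w. ennreal T * indicator (box_region (2 * R)) w \<partial>hyp_area)"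
  proof (rule mult_left_mono, rule nn_integral_mono)
    fix w
    show "(\<integral>\<^sup>+x. ennreal (cmod (cvec_inner N x (basis_vec w)) ^ (2 * p)) \<partial>gauss N) * indicator (box_region (2 * R)) w \<le> ennreal T * indicator (box_region (2 * R)) w"
    proof (cases "w \<in> box_region (2 * R)")
      case True
      have "(cvec_norm N (basis_vec w))\<^sup>2 \<le> L\<^sup>2" unfolding cvec_norm_basis_vec[OF box_region_Im_pos[OF R2 True]] by (rule L2[OF True])
      then have "cvec_norm N (basis_vec w) \<le> L" by (rule power2_le_imp_le) (use L(1) in simp)
      then have "(16 * sqrt (real (2 * p)) * cvec_norm N (basis_vec w)) ^ (2 * p) \<le> T"
        unfolding T_def by (intro power_mono mult_left_mono) auto
      then have "(\<integral>\<^sup>+x. ennreal (cmod (cvec_inner N x (basis_vec w)) ^ (2 * p)) \<partial>gauss N) \<le> ennreal T"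
        using p by (intro order_trans[OF gauss_inner_moment_upper] ennreal_leI) auto
      then show ?thesis using True by simp
    qed simp
  qed simp
  also have "\<dots> = ennreal (512 * real (k * p)) * (ennreal T * emeasure hyp_area (box_region (2 * R)))"
    using bm by (subst nn_integral_cmult_indicator) (auto simp: sets_hyp_area)
  also have "\<dots> \<le> ennreal (512 * real (k * p)) * (ennreal T * ennreal A)" by (intro mult_left_mono A) auto
  also have "\<dots> = ennreal (512 * real (k * p) * (T * A))"
    unfolding ennreal_mult[OF T0 A(1), symmetric] by (rule ennreal_mult[symmetric]) (use T0 A(1) in auto)
  finally show ?thesis unfolding T_def by (simp add: mult_ac)
qed

lemma gauss_F_upper:
  assumes R: "R \<ge> 1" and KR: "K \<subseteq> box_region R"
    and L2: "\<And>w. w \<in> box_region (2 * R) \<Longrightarrow> total_weight w \<le> L\<^sup>2"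
    and A: "A \<ge> 0" "emeasure hyp_area (box_region (2 * R)) \<le> ennreal A"
  shows "(LINT x|gauss N. F x) \<le> 256 * (1 + 512 * A) * L * sqrt (ln (real k))"
proof -
  define p where "p = nat \<lceil>ln (real k)\<rceil>"
  have lk: "1 / 2 \<le> ln (real k)"
  proof -
    have "1 / 2 \<le> ln (2::real)" using ln2_ge_two_thirds by simp
    also have "\<dots> \<le> ln (real k)" using k2 by (intro ln_mono) auto
    finally show ?thesis .
  qed
  have p1: "p \<ge> 1" unfolding p_def using lk by linarith
  have pl: "ln (real k) \<le> real p" unfolding p_def using lk by linarith
  have pu: "real p \<le> 3 * ln (real k)" unfolding p_def using lk by linarith
  define S where "S = 16 * sqrt (real (2 * p)) * L"
  have S: "S > 0" unfolding S_def using p1 L(1) by simp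
  \<comment> \<open>\<open>S\<close> is the size of the pointwise moment. The extra factor e
    contributes exp (2 p) >= k p to the 2 p-th power and so absorbs the cost of the mean value
    inequality.\<close>
  define T where "T = S * exp 1"
  have T: "T > 0" unfolding T_def using S by simp
  define M where "M = 512 * real (k * p) * A * S ^ (2 * p)"
  have M0: "M \<ge> 0" unfolding M_def using A S by simp
  have mom: "(\<integral>\<^sup>+x. ennreal (F x ^ (2 * p)) \<partial>gauss N) \<le> ennreal M"
    unfolding M_def S_def by (rule gauss_F_moment[OF R KR p1 L2 A])
  interpret G: prob_space "gauss N" by (rule prob_space_gauss)
  have Fint: "integrable (gauss N) F" by (rule gauss_lipschitz_integrable[OF F_gauss_lipschitz])
  have Fm[measurable]: "F \<in> borel_measurable (gauss N)" by (rule gauss_lipschitz_measurable[OF F_gauss_lipschitz])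
  have Pint: "integrable (gauss N) (\<lambda>x. F x ^ (2 * p))"
    by (rule integrableI_nonneg) (use mom F_nonneg in \<open>auto intro: le_less_trans\<close>)
  have PM: "(LINT x|gauss N. F x ^ (2 * p)) \<le> M"
  proof -
    have "ennreal (LINT x|gauss N. F x ^ (2 * p)) \<le> ennreal M"
      using mom by (subst (asm) nn_integral_eq_integral[OF Pint]) (use F_nonneg in auto)
    then show ?thesis using M0 by simp
  qed
  \<comment> \<open>In place of Jensen's inequality: above T the power 2 p of F / T dominates F /
    T.\<close>
  have pt: "F x \<le> T + F x ^ (2 * p) * (T / T ^ (2 * p))" for x
  proof (cases "F x \<le> T")
    case True
    then show ?thesis using F_nonneg[of x] T by (simp add: add_increasing2)
  next
    case False
    then have "1 \<le> F x / T" using T by simp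
    then have "(F x / T) ^ 1 \<le> (F x / T) ^ (2 * p)" using p1 by (intro power_increasing) auto
    then have "T * (F x / T) \<le> T * (F x / T) ^ (2 * p)" using T by (intro mult_left_mono) auto
    then show ?thesis using T by (simp add: power_divide mult.commute)
  qed
  have "(LINT x|gauss N. F x) \<le> (LINT x|gauss N. T + F x ^ (2 * p) * (T / T ^ (2 * p)))"
    by (intro integral_mono Fint Bochner_Integration.integrable_add integrable_mult_left Pint pt) simp
  also have "\<dots> = T + (LINT x|gauss N. F x ^ (2 * p)) * (T / T ^ (2 * p))"
    using Pint by (simp add: G.prob_space)
  also have "\<dots> \<le> T + M * (T / T ^ (2 * p))" using PM T by (intro add_left_mono mult_right_mono) auto
  also have "\<dots> \<le> T + 512 * A * T"
  proof -
    have ex: "T ^ (2 * p) = S ^ (2 * p) * (exp (real p) * exp (real p))"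
      unfolding T_def power_mult_distrib by (simp flip: exp_of_nat_mult exp_add)
    have "real (k * p) \<le> exp (real p) * exp (real p)"
    proof -
      have "real k = exp (ln (real k))" using k2 by simp
      also have "\<dots> \<le> exp (real p)" using pl by simp
      finally have "real k \<le> exp (real p)" .
      moreover have "real p \<le> exp (real p)" using exp_ge_add_one_self[of "real p"] by linarith
      ultimately show ?thesis unfolding of_nat_mult by (intro mult_mono) auto
    qed
    then have "512 * A * S ^ (2 * p) * real (k * p) \<le> 512 * A * S ^ (2 * p) * (exp (real p) * exp (real p))"
      using A S by (intro mult_left_mono) auto
    then have "M \<le> 512 * A * T ^ (2 * p)" unfolding M_def ex by (simp add: mult_ac)
    then have "M * (T / T ^ (2 * p)) \<le> 512 * A * T ^ (2 * p) * (T / T ^ (2 * p))" using T by (intro mult_right_mono) auto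
    then show ?thesis using T by simp
  qed
  also have "\<dots> = (1 + 512 * A) * T" by (simp add: algebra_simps)
  also have "\<dots> \<le> (1 + 512 * A) * (256 * L * sqrt (ln (real k)))"
  proof (intro mult_left_mono)
    have "sqrt (real (2 * p)) \<le> sqrt (6 * ln (real k))" using pu by (intro real_sqrt_le_mono) simp
    also have "\<dots> \<le> sqrt (3\<^sup>2 * ln (real k))" using lk by (intro real_sqrt_le_mono) auto
    also have "\<dots> = 3 * sqrt (ln (real k))" by (simp add: real_sqrt_mult)
    finally have s: "sqrt (real (2 * p)) \<le> 3 * sqrt (ln (real k))" .
    have "T = 16 * L * (sqrt (real (2 * p)) * exp 1)" unfolding T_def S_def by simp
    also have "\<dots> \<le> 16 * L * (3 * sqrt (ln (real k)) * 3)" using s exp_le L(1) lk by (intro mult_left_mono mult_mono) auto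
    also have "\<dots> = 144 * (L * sqrt (ln (real k)))" by simp
    also have "\<dots> \<le> 256 * (L * sqrt (ln (real k)))" using L(1) lk by (intro mult_right_mono) auto
    finally show "T \<le> 256 * L * sqrt (ln (real k))" by simp
  qed (use A in auto)
  finally show ?thesis by (simp add: mult_ac)
qed

end

text \<open>Convexity of the n-th power at s / a and t / b, with weights proportional to a and b.
  When a and b bound the L^n norms of the two summands, integration gives Minkowski's inequality
  without a loss in the constant.\<close>

lemma power_add_le_weighted:
  fixes s t a b :: real
  assumes st: "0 \<le> s" "0 \<le> t" and ab: "0 < a" "0 < b"
  shows "(s + t) ^ n \<le> (a + b) ^ n * (a / (a + b) / a ^ n) * s ^ n + (a + b) ^ n * (b / (a + b) / b ^ n) * t ^ n"
proof -
  have conv: "convex_on {0::real..} (\<lambda>x. x ^ n)"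
  proof (cases "even n")
    case True
    show ?thesis by (rule convex_on_subset[OF convex_power_even[OF True]]) auto
  qed (rule convex_power_odd)
  have w: "a / (a + b) + b / (a + b) = 1" using ab by (simp flip: add_divide_distrib)
  have "((a / (a + b)) *\<^sub>R (s / a) + (b / (a + b)) *\<^sub>R (t / b)) ^ n \<le> a / (a + b) * (s / a) ^ n + b / (a + b) * (t / b) ^ n"
    by (rule conv[unfolded convex_on_def, THEN conjunct2, rule_format]) (use w st ab in auto)
  moreover have "(a / (a + b)) *\<^sub>R (s / a) + (b / (a + b)) *\<^sub>R (t / b) = (s + t) / (a + b)"
    using ab by (simp add: add_divide_distrib)
  ultimately have "((s + t) / (a + b)) ^ n \<le> a / (a + b) * (s / a) ^ n + b / (a + b) * (t / b) ^ n" by simp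
  then have "(a + b) ^ n * ((s + t) / (a + b)) ^ n \<le> (a + b) ^ n * (a / (a + b) * (s / a) ^ n + b / (a + b) * (t / b) ^ n)"
    using ab by (intro mult_left_mono) auto
  moreover have "(a + b) ^ n * ((s + t) / (a + b)) ^ n = (s + t) ^ n" using ab by (simp add: power_divide)
  ultimately show ?thesis by (simp add: power_divide distrib_left)
qed

section \<open>The lower bound for the Gaussian mean, by L^n norms over a set of large total
  weight\<close>

locale peak_set = weight_basis_on +
  fixes A :: "complex set" and m l :: real
  assumes A: "A \<in> sets borel" "A \<subseteq> K" and KD: "K \<subseteq> fund_domain"
    and m: "0 < m" "m \<le> 1" "ennreal m \<le> emeasure hyp_area A"
    and l: "0 < l" "\<And>w. w \<in> A \<Longrightarrow> l\<^sup>2 \<le> total_weight w"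
begin

lemma power_mass_F: "power_mass A n x \<le> ennreal (2 * F x ^ n)"
proof -
  have "power_mass A n x \<le> (\<integral>\<^sup>+w. ennreal (F x ^ n) * indicator fund_domain w \<partial>hyp_area)"
    unfolding power_mass_def
  proof (rule nn_integral_mono)
    fix w
    show "ennreal (cmod (cvec_inner N x (basis_vec w)) ^ n) * indicator A w \<le> ennreal (F x ^ n) * indicator fund_domain w"
    proof (cases "w \<in> A")
      case True
      then have "w \<in> K" "w \<in> fund_domain" using A KD by auto
      then show ?thesis using True by (auto intro!: ennreal_leI power_mono inner_le_F)
    qed simp
  qed
  also have "\<dots> = ennreal (F x ^ n) * (\<integral>\<^sup>+w. indicator fund_domain w \<partial>hyp_area)"
    by (rule nn_integral_cmult) (simp cong: measurable_cong_sets add: sets_hyp_area)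
  also have "\<dots> \<le> ennreal (F x ^ n) * ennreal 2" using fund_domain_area by (intro mult_left_mono) auto
  also have "\<dots> = ennreal (F x ^ n * 2)" by (rule ennreal_mult[symmetric]) (use F_nonneg in auto)
  finally show ?thesis by (simp add: mult.commute)
qed

lemma power_mass_finite: "power_mass A n x < \<top>"
  by (rule le_less_trans[OF power_mass_F]) simp

lemma inner_pt_measurable: "(\<lambda>w. ennreal (cmod (cvec_inner N x (basis_vec w)) ^ n) * indicator A w) \<in> borel_measurable hyp_area"
proof -
  have "(\<lambda>w. cvec_inner N x (basis_vec w)) \<in> borel_measurable borel"
    unfolding cvec_inner_def by (intro borel_measurable_sum borel_measurable_times basis_vec_measurable) auto
  note [measurable] = this A(1)
  show ?thesis by (simp cong: measurable_cong_sets add: sets_hyp_area)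
qed

lemma power_mass_add:
  assumes ab: "0 < a" "0 < b" and y: "power_mass A n y \<le> ennreal (a ^ n)" and d: "power_mass A n d \<le> ennreal (b ^ n)"
  shows "power_mass A n (\<lambda>j. y j + d j) \<le> ennreal ((a + b) ^ n)"
proof -
  define u where "u = (a + b) ^ n * (a / (a + b) / a ^ n)"
  define v where "v = (a + b) ^ n * (b / (a + b) / b ^ n)"
  have uv: "0 \<le> u" "0 \<le> v" unfolding u_def v_def using ab by auto
  have sum: "u * a ^ n + v * b ^ n = (a + b) ^ n"
  proof -
    have "u * a ^ n = (a + b) ^ n * (a / (a + b))" "v * b ^ n = (a + b) ^ n * (b / (a + b))" unfolding u_def v_def using ab by auto
    then have "u * a ^ n + v * b ^ n = (a + b) ^ n * ((a + b) / (a + b))" by (simp only: distrib_left[symmetric] add_divide_distrib[symmetric])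
    then show ?thesis using ab by simp
  qed
  have "power_mass A n (\<lambda>j. y j + d j) \<le> (\<integral>\<^sup>+w. ennreal u * (ennreal (cmod (cvec_inner N y (basis_vec w)) ^ n) * indicator A w)
      + ennreal v * (ennreal (cmod (cvec_inner N d (basis_vec w)) ^ n) * indicator A w) \<partial>hyp_area)"
    unfolding power_mass_def
  proof (rule nn_integral_mono)
    fix w
    define S where "S = cmod (cvec_inner N y (basis_vec w))"
    define T where "T = cmod (cvec_inner N d (basis_vec w))"
    have ST: "0 \<le> S" "0 \<le> T" unfolding S_def T_def by auto
    have "cvec_inner N (\<lambda>j. y j + d j) (basis_vec w) = cvec_inner N y (basis_vec w) + cvec_inner N d (basis_vec w)"
      unfolding cvec_inner_def by (simp add: distrib_right sum.distrib)
    then have "cmod (cvec_inner N (\<lambda>j. y j + d j) (basis_vec w)) \<le> S + T" unfolding S_def T_def by (simp add: norm_triangle_ineq)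
    then have "cmod (cvec_inner N (\<lambda>j. y j + d j) (basis_vec w)) ^ n \<le> (S + T) ^ n" by (intro power_mono) auto
    also have "\<dots> \<le> u * S ^ n + v * T ^ n" unfolding u_def v_def by (rule power_add_le_weighted[OF ST ab])
    finally have "ennreal (cmod (cvec_inner N (\<lambda>j. y j + d j) (basis_vec w)) ^ n) \<le> ennreal (u * S ^ n + v * T ^ n)" by (rule ennreal_leI)
    also have "\<dots> = ennreal u * ennreal (S ^ n) + ennreal v * ennreal (T ^ n)"
    proof -
      have "ennreal (u * S ^ n + v * T ^ n) = ennreal (u * S ^ n) + ennreal (v * T ^ n)" by (rule ennreal_plus) (use uv ST in auto)
      moreover have "ennreal (u * S ^ n) = ennreal u * ennreal (S ^ n)" by (rule ennreal_mult) (use uv ST in auto)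
      moreover have "ennreal (v * T ^ n) = ennreal v * ennreal (T ^ n)" by (rule ennreal_mult) (use uv ST in auto)
      ultimately show ?thesis by (simp only:)
    qed
    finally show "ennreal (cmod (cvec_inner N (\<lambda>j. y j + d j) (basis_vec w)) ^ n) * indicator A w \<le>
      ennreal u * (ennreal (cmod (cvec_inner N y (basis_vec w)) ^ n) * indicator A w) + ennreal v * (ennreal (cmod (cvec_inner N d (basis_vec w)) ^ n) * indicator A w)"
      unfolding S_def[symmetric] T_def[symmetric] by (cases "w \<in> A") auto
  qed
  also have "\<dots> = ennreal u * power_mass A n y + ennreal v * power_mass A n d"
    unfolding power_mass_def
    unfolding nn_integral_cmult[OF inner_pt_measurable, symmetric]
    by (rule nn_integral_add) (intro borel_measurable_times_ennreal borel_measurable_const inner_pt_measurable)+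
  also have "\<dots> \<le> ennreal u * ennreal (a ^ n) + ennreal v * ennreal (b ^ n)" by (intro add_mono mult_left_mono y d) auto
  also have "\<dots> = ennreal ((a + b) ^ n)"
  proof -
    have "ennreal (u * a ^ n + v * b ^ n) = ennreal (u * a ^ n) + ennreal (v * b ^ n)" by (rule ennreal_plus) (use uv ab in auto)
    moreover have "ennreal (u * a ^ n) = ennreal u * ennreal (a ^ n)" by (rule ennreal_mult) (use uv ab in auto)
    moreover have "ennreal (v * b ^ n) = ennreal v * ennreal (b ^ n)" by (rule ennreal_mult) (use uv ab in auto)
    ultimately show ?thesis unfolding sum by (simp only:)
  qed
  finally show ?thesis .
qed

text \<open>Interpolation: n - 2 of the powers are bounded by the supremum over K, and the other two
  integrate to at most the squared norm of d. The n-th root L^(1 - 2/n) improves on the Lipschitz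
  constant L of the supremum by L^(2/n).\<close>

lemma power_mass_le:
  assumes n: "n \<ge> 2"
  shows "power_mass A n d \<le> ennreal (L ^ (n - 2) * cvec_norm N d ^ n)"
proof -
  define c where "c = (L * cvec_norm N d) ^ (n - 2)"
  have c0: "0 \<le> c" unfolding c_def using L(1) by simp
  note [measurable] = form_weight_measurable[OF form_of_coeffs_cusp_form[of d]]
  have "power_mass A n d \<le> (\<integral>\<^sup>+w. ennreal c * (ennreal (form_weight k (form_of_coeffs k f d) w) * indicator fund_domain w) \<partial>hyp_area)"
    unfolding power_mass_def
  proof (rule nn_integral_mono)
    fix w
    show "ennreal (cmod (cvec_inner N d (basis_vec w)) ^ n) * indicator A w \<le> ennreal c * (ennreal (form_weight k (form_of_coeffs k f d) w) * indicator fund_domain w)"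
    proof (cases "w \<in> A")
      case True
      then have w: "w \<in> K" "w \<in> fund_domain" using A KD by auto
      have "cmod (cvec_inner N d (basis_vec w)) ^ n = cmod (cvec_inner N d (basis_vec w)) ^ (n - 2) * (cmod (cvec_inner N d (basis_vec w)))\<^sup>2"
        by (simp only: power_add[symmetric] le_add_diff_inverse2[OF n])
      also have "\<dots> \<le> c * form_weight k (form_of_coeffs k f d) w"
        unfolding c_def form_weight_eq_inner[OF K_Im[OF w(1)]] by (intro mult_right_mono power_mono inner_le w) auto
      finally have "ennreal (cmod (cvec_inner N d (basis_vec w)) ^ n) \<le> ennreal (c * form_weight k (form_of_coeffs k f d) w)" by (rule ennreal_leI)
      also have "\<dots> = ennreal c * ennreal (form_weight k (form_of_coeffs k f d) w)"
        by (rule ennreal_mult[OF c0]) (simp add: form_weight_eq_inner[OF K_Im[OF w(1)]])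
      finally show ?thesis using True w by simp
    qed simp
  qed
  also have "\<dots> = ennreal c * ennreal ((cvec_norm N d)\<^sup>2)"
    by (subst nn_integral_cmult) (simp_all cong: measurable_cong_sets add: sets_hyp_area nn_integral_form_weight)
  also have "\<dots> = ennreal (c * (cvec_norm N d)\<^sup>2)" by (rule ennreal_mult[symmetric]) (use c0 in auto)
  also have "c * (cvec_norm N d)\<^sup>2 = L ^ (n - 2) * cvec_norm N d ^ n"
  proof -
    have "c * (cvec_norm N d)\<^sup>2 = L ^ (n - 2) * (cvec_norm N d ^ (n - 2) * (cvec_norm N d)\<^sup>2)" unfolding c_def power_mult_distrib by simp
    also have "cvec_norm N d ^ (n - 2) * (cvec_norm N d)\<^sup>2 = cvec_norm N d ^ n" by (simp only: power_add[symmetric] le_add_diff_inverse2[OF n])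
    finally show ?thesis .
  qed
  finally show ?thesis .
qed

definition Lp_norm :: "nat \<Rightarrow> (nat \<Rightarrow> complex) \<Rightarrow> real" where
  "Lp_norm n x = root n (enn2real (power_mass A n x))"

lemma Lp_norm_nonneg: "0 \<le> Lp_norm n x"
  unfolding Lp_norm_def by (cases "n = 0") auto

lemma Lp_norm_power: "n \<ge> 1 \<Longrightarrow> ennreal (Lp_norm n x ^ n) = power_mass A n x"
  unfolding Lp_norm_def using power_mass_finite[of n x] by (subst real_root_pow_pos2) auto

lemma Lp_norm_le: "n \<ge> 1 \<Longrightarrow> 0 \<le> c \<Longrightarrow> power_mass A n x \<le> ennreal (c ^ n) \<Longrightarrow> Lp_norm n x \<le> c"
proof -
  assume n: "n \<ge> 1" and c: "0 \<le> c" and le: "power_mass A n x \<le> ennreal (c ^ n)"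
  have "Lp_norm n x ^ n \<le> c ^ n" using le c unfolding Lp_norm_power[OF n, symmetric] by (subst (asm) ennreal_le_iff) auto
  then show ?thesis using power_mono_iff[OF Lp_norm_nonneg c] n by simp
qed

lemma Lp_norm_lipschitz:
  assumes n: "n \<ge> 2"
  shows "gauss_lipschitz N (root n (L ^ (n - 2))) (Lp_norm n)"
proof -
  define M where "M = root n (L ^ (n - 2))"
  have n1: "n \<ge> 1" using n by simp
  have M0: "0 \<le> M" unfolding M_def using n L(1) by (intro real_root_ge_zero) auto
  have Mn: "M ^ n = L ^ (n - 2)" unfolding M_def using n L(1) by (intro real_root_pow_pos2) auto
  have "Lp_norm n \<in> borel_measurable (gauss N)"
    unfolding Lp_norm_def using power_mass_measurable[OF A(1), of n] by measurable
  then have meas: "Lp_norm n \<in> borel_measurable (Pi\<^sub>M {..<N} (\<lambda>_. borel))"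
    by (simp cong: measurable_cong_sets add: sets_gauss)
  have "Lp_norm n x \<le> Lp_norm n y + M * cvec_norm N (\<lambda>j. x j - y j)" for x y
  proof (rule field_le_epsilon)
    fix e :: real assume e: "e > 0"
    define d where "d j = x j - y j" for j
    \<comment> \<open>The slack e / 2 makes both bounds positive, as \<open>power_mass_add\<close>
      requires.\<close>
    have a: "0 < Lp_norm n y + e / 2" using Lp_norm_nonneg[of n y] e by simp
    have b: "0 < M * cvec_norm N d + e / 2" using M0 e by (simp add: add_nonneg_pos)
    have "power_mass A n y \<le> ennreal ((Lp_norm n y + e / 2) ^ n)"
      unfolding Lp_norm_power[OF n1, symmetric] using e Lp_norm_nonneg by (intro ennreal_leI power_mono) auto
    moreover have "power_mass A n d \<le> ennreal ((M * cvec_norm N d + e / 2) ^ n)"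
    proof (rule order_trans[OF power_mass_le[OF n] ennreal_leI])
      have "L ^ (n - 2) * cvec_norm N d ^ n = (M * cvec_norm N d) ^ n" unfolding power_mult_distrib Mn ..
      also have "\<dots> \<le> (M * cvec_norm N d + e / 2) ^ n" using M0 e by (intro power_mono) auto
      finally show "L ^ (n - 2) * cvec_norm N d ^ n \<le> (M * cvec_norm N d + e / 2) ^ n" .
    qed
    ultimately have "power_mass A n (\<lambda>j. y j + d j) \<le> ennreal ((Lp_norm n y + e / 2 + (M * cvec_norm N d + e / 2)) ^ n)"
      by (rule power_mass_add[OF a b])
    then have "power_mass A n x \<le> ennreal ((Lp_norm n y + e / 2 + (M * cvec_norm N d + e / 2)) ^ n)" unfolding d_def by simp
    then have "Lp_norm n x \<le> Lp_norm n y + e / 2 + (M * cvec_norm N d + e / 2)" using a b by (intro Lp_norm_le[OF n1]) auto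
    then show "Lp_norm n x \<le> Lp_norm n y + M * cvec_norm N (\<lambda>j. x j - y j) + e" unfolding d_def by simp
  qed
  then have "Lp_norm n x - Lp_norm n y \<le> M * cvec_norm N (\<lambda>j. x j - y j)" for x y by (simp add: diff_le_eq add.commute)
  then show ?thesis unfolding gauss_lipschitz_def M_def[symmetric] using meas M0 by blast
qed

lemma Lp_norm_moment_lower:
  assumes n: "n \<ge> 1"
  shows "ennreal (m * (sqrt (real n) * l / 1024) ^ n) \<le> (\<integral>\<^sup>+x. ennreal (Lp_norm n x ^ n) \<partial>gauss N)"
proof -
  define Q where "Q = (sqrt (real n) * l / 1024) ^ n"
  have Q0: "0 \<le> Q" unfolding Q_def using l(1) by simp
  have "ennreal (m * Q) = ennreal m * ennreal Q" by (rule ennreal_mult) (use m Q0 in auto)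
  also have "\<dots> \<le> emeasure hyp_area A * ennreal Q" by (rule mult_right_mono[OF m(3)]) simp
  also have "\<dots> = (\<integral>\<^sup>+w. ennreal Q * indicator A w \<partial>hyp_area)"
    using A(1) by (subst nn_integral_cmult_indicator) (auto simp: sets_hyp_area mult.commute)
  also have "\<dots> \<le> (\<integral>\<^sup>+w. (\<integral>\<^sup>+x. ennreal (cmod (cvec_inner N x (basis_vec w)) ^ n) \<partial>gauss N) * indicator A w \<partial>hyp_area)"
  proof (rule nn_integral_mono)
    fix w
    show "ennreal Q * indicator A w \<le> (\<integral>\<^sup>+x. ennreal (cmod (cvec_inner N x (basis_vec w)) ^ n) \<partial>gauss N) * indicator A w"
    proof (cases "w \<in> A")
      case True
      then have wK: "w \<in> K" using A by auto
      have "l\<^sup>2 \<le> (cvec_norm N (basis_vec w))\<^sup>2" unfolding cvec_norm_basis_vec[OF K_Im[OF wK]] by (rule l(2)[OF True])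
      then have "l \<le> cvec_norm N (basis_vec w)" by (rule power2_le_imp_le) simp
      then have "Q \<le> (sqrt (real n) * cvec_norm N (basis_vec w) / 1024) ^ n"
        unfolding Q_def using l(1) by (intro power_mono divide_right_mono mult_left_mono) auto
      then have "ennreal Q \<le> (\<integral>\<^sup>+x. ennreal (cmod (cvec_inner N x (basis_vec w)) ^ n) \<partial>gauss N)"
        by (rule order_trans[OF ennreal_leI gauss_inner_moment_lower[OF n]])
      then show ?thesis using True by simp
    qed simp
  qed
  also have "\<dots> = (\<integral>\<^sup>+x. ennreal (Lp_norm n x ^ n) \<partial>gauss N)"
    unfolding nn_integral_power_mass[OF A(1), symmetric] Lp_norm_power[OF n] ..
  finally show ?thesis unfolding Q_def .
qed

text \<open>The assumption \<open>big\<close> says that the gain L^(2/n) is at least 16384 L / (m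
  l). It puts the contribution of the fluctuations, (8 M sqrt n) ^ n, below half of the lower bound
  m a ^ n for the n-th moment, so the mean has to supply the rest. The constant is 8 from the
  fluctuations, 1024 from the pointwise moments and 2 from the halving.\<close>

lemma Lp_norm_mean_lower:
  assumes n: "n \<ge> 2" and big: "(16384 * L / (m * l)) ^ n \<le> L\<^sup>2"
  shows "sqrt (real n) * l * m / 4096 \<le> (LINT x|gauss N. Lp_norm n x)"
proof -
  have n1: "n \<ge> 1" using n by simp
  define G where "G = Lp_norm n"
  define M where "M = root n (L ^ (n - 2))"
  define \<mu> where "\<mu> = (LINT x|gauss N. G x)"
  define a where "a = sqrt (real n) * l / 1024"
  have a: "0 < a" unfolding a_def using n l(1) by simp
  have M: "0 < M" unfolding M_def using n L(1) by simp
  have Mn: "M ^ n = L ^ (n - 2)" unfolding M_def using n L(1) by (intro real_root_pow_pos2) auto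
  have lip: "gauss_lipschitz N M G" unfolding M_def G_def by (rule Lp_norm_lipschitz[OF n])
  have G0: "0 \<le> G x" for x unfolding G_def by (rule Lp_norm_nonneg)
  have \<mu>0: "0 \<le> \<mu>" unfolding \<mu>_def by (intro Bochner_Integration.integral_nonneg G0)
  note mom = gauss_lipschitz_moment[OF lip M n1, folded \<mu>_def]
  interpret G: prob_space "gauss N" by (rule prob_space_gauss)
  have [measurable]: "G \<in> borel_measurable (gauss N)" by (rule gauss_lipschitz_measurable[OF lip])
  have pt: "G x ^ n \<le> (2 * \<mu>) ^ n + 2 ^ n * \<bar>G x - \<mu>\<bar> ^ n" for x
  proof (cases "\<bar>G x - \<mu>\<bar> \<le> \<mu>")
    case True
    then have "G x ^ n \<le> (2 * \<mu>) ^ n" using G0 by (intro power_mono) auto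
    moreover have "0 \<le> 2 ^ n * \<bar>G x - \<mu>\<bar> ^ n" by simp
    ultimately show ?thesis by linarith
  next
    case False
    then have "G x \<le> 2 * \<bar>G x - \<mu>\<bar>" unfolding mult_2 using abs_ge_self[of "G x - \<mu>"] by linarith
    then have "G x ^ n \<le> (2 * \<bar>G x - \<mu>\<bar>) ^ n" using G0 by (intro power_mono) auto
    then have "G x ^ n \<le> 2 ^ n * \<bar>G x - \<mu>\<bar> ^ n" by (simp only: power_mult_distrib)
    moreover have "0 \<le> (2 * \<mu>) ^ n" using \<mu>0 by simp
    ultimately show ?thesis by linarith
  qed
  have "ennreal (m * a ^ n) \<le> (\<integral>\<^sup>+x. ennreal (G x ^ n) \<partial>gauss N)" unfolding a_def G_def by (rule Lp_norm_moment_lower[OF n1])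
  also have "\<dots> \<le> (\<integral>\<^sup>+x. ennreal ((2 * \<mu>) ^ n + 2 ^ n * \<bar>G x - \<mu>\<bar> ^ n) \<partial>gauss N)" by (intro nn_integral_mono ennreal_leI pt)
  also have "\<dots> = ennreal (LINT x|gauss N. (2 * \<mu>) ^ n + 2 ^ n * \<bar>G x - \<mu>\<bar> ^ n)"
    by (rule nn_integral_eq_integral) (use mom(1) \<mu>0 in auto)
  finally have "m * a ^ n \<le> (LINT x|gauss N. (2 * \<mu>) ^ n + 2 ^ n * \<bar>G x - \<mu>\<bar> ^ n)"
    using \<mu>0 by (subst (asm) ennreal_le_iff) (auto intro!: Bochner_Integration.integral_nonneg)
  also have "\<dots> = (2 * \<mu>) ^ n + 2 ^ n * (LINT x|gauss N. \<bar>G x - \<mu>\<bar> ^ n)" using mom(1) by (simp add: G.prob_space)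
  also have "\<dots> \<le> (2 * \<mu>) ^ n + 2 ^ n * (4 * M * sqrt (real n)) ^ n" using mom(2) by (intro add_left_mono mult_left_mono) auto
  finally have 1: "m * a ^ n \<le> (2 * \<mu>) ^ n + 2 ^ n * (4 * M * sqrt (real n)) ^ n" .
  define \<Lambda> where "\<Lambda> = 16384 * L / (m * l)"
  have \<Lambda>: "0 < \<Lambda>" unfolding \<Lambda>_def using L(1) m l by simp
  have "2 ^ n * (4 * M * sqrt (real n)) ^ n * \<Lambda> ^ n = 8 ^ n * sqrt (real n) ^ n * L ^ (n - 2) * \<Lambda> ^ n"
    by (simp add: power_mult_distrib Mn flip: power_mult_distrib[of 2 4])
  also have "\<dots> \<le> 8 ^ n * sqrt (real n) ^ n * L ^ (n - 2) * L\<^sup>2"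
    using big L(1) unfolding \<Lambda>_def by (intro mult_left_mono) auto
  also have "\<dots> = 8 ^ n * sqrt (real n) ^ n * L ^ n" unfolding mult.assoc by (simp only: power_add[symmetric] le_add_diff_inverse2[OF n])
  also have "\<dots> = (a * (m / 2)) ^ n * \<Lambda> ^ n"
  proof -
    have "8 * sqrt (real n) * L = a * (m / 2) * \<Lambda>" unfolding a_def \<Lambda>_def using m l by simp
    then show ?thesis by (simp only: power_mult_distrib[symmetric])
  qed
  finally have "2 ^ n * (4 * M * sqrt (real n)) ^ n \<le> (a * (m / 2)) ^ n" using \<Lambda> by (simp only: mult_le_cancel_right_pos zero_less_power)
  moreover have am: "(a * (m / 2)) ^ n \<le> a ^ n * (m / 2)"
  proof -
    have "(m / 2) ^ n \<le> (m / 2) ^ 1" using m n1 by (intro power_decreasing) auto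
    then show ?thesis using a unfolding power_mult_distrib by (intro mult_left_mono) auto
  qed
  ultimately have "m * a ^ n - a ^ n * (m / 2) \<le> (2 * \<mu>) ^ n" using 1 by linarith
  then have "(a * (m / 2)) ^ n \<le> (2 * \<mu>) ^ n" using am by (simp add: algebra_simps)
  then have "a * (m / 2) \<le> 2 * \<mu>" using a m \<mu>0 n1 by (subst (asm) power_mono_iff) auto
  then show ?thesis unfolding a_def \<mu>_def G_def by simp
qed

lemma gauss_F_lower:
  assumes n: "n \<ge> 2" and big: "(16384 * L / (m * l)) ^ n \<le> L\<^sup>2"
  shows "sqrt (real n) * l * m / 8192 \<le> (LINT x|gauss N. F x)"
proof -
  have n1: "n \<ge> 1" using n by simp
  have "Lp_norm n x \<le> 2 * F x" for x
  proof (rule Lp_norm_le[OF n1])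
    show "0 \<le> 2 * F x" using F_nonneg by simp
    have "(2::real) ^ 1 \<le> 2 ^ n" using n1 by (intro power_increasing) auto
    then have "2 * F x ^ n \<le> (2 * F x) ^ n" unfolding power_mult_distrib using F_nonneg by (intro mult_right_mono) auto
    then show "power_mass A n x \<le> ennreal ((2 * F x) ^ n)" by (rule order_trans[OF power_mass_F ennreal_leI])
  qed
  then have "(LINT x|gauss N. Lp_norm n x) \<le> (LINT x|gauss N. 2 * F x)"
    by (intro integral_mono integrable_mult_right gauss_lipschitz_integrable[OF Lp_norm_lipschitz[OF n]] gauss_lipschitz_integrable[OF F_gauss_lipschitz])
  then show ?thesis using Lp_norm_mean_lower[OF n big] by simp
qed

lemma dim_lower: "m * l\<^sup>2 \<le> real N"
proof -
  have "ennreal (m * l\<^sup>2) = ennreal m * ennreal (l\<^sup>2)" by (rule ennreal_mult) (use m in auto)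
  also have "\<dots> \<le> emeasure hyp_area A * ennreal (l\<^sup>2)" by (rule mult_right_mono[OF m(3)]) simp
  also have "\<dots> = (\<integral>\<^sup>+w. ennreal (l\<^sup>2) * indicator A w \<partial>hyp_area)"
    using A(1) by (subst nn_integral_cmult_indicator) (auto simp: sets_hyp_area mult.commute)
  also have "\<dots> \<le> (\<integral>\<^sup>+w. ennreal (total_weight w) * indicator fund_domain w \<partial>hyp_area)"
  proof (rule nn_integral_mono)
    fix w
    show "ennreal (l\<^sup>2) * indicator A w \<le> ennreal (total_weight w) * indicator fund_domain w"
      using l(2)[of w] A(2) KD by (cases "w \<in> A") (auto intro!: ennreal_leI)
  qed
  also have "\<dots> = ennreal (real N)" by (rule nn_integral_total_weight)
  finally show ?thesis by simp
qed

end

section \<open>A crude lower bound, for weights taken one at a time\<close>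

context weight_basis_on
begin

text \<open>Only positivity is wanted. The identity F x = |x| F u, with u the direction of x, is
  split by the inequality of means so that the mean of |x|^2 uses up at most half of the lower bound
  for the Gaussian mean of F. What remains depends on the basis only through
  \<open>total_weight\<close>.\<close>

lemma sphere_F_lower_crude:
  assumes z: "z \<in> K"
  shows "total_weight z / (1024\<^sup>2 * ((LINT x|gauss N. (cvec_norm N x)\<^sup>2) + 1) * L) \<le> (LINT a|uniform_sphere N. F a)"
proof -
  interpret G: prob_space "gauss N" by (rule prob_space_gauss)
  define V where "V = (LINT x|gauss N. (cvec_norm N x)\<^sup>2)"
  have V0: "0 \<le> V" unfolding V_def by simp
  define e where "e = cvec_norm N (basis_vec z)"
  have e2: "e\<^sup>2 = total_weight z" unfolding e_def by (rule cvec_norm_basis_vec[OF K_Im[OF z]])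
  have e0: "0 \<le> e" unfolding e_def by simp
  have Fint: "integrable (gauss N) F" by (rule gauss_lipschitz_integrable[OF F_gauss_lipschitz])
  define I where "I = (LINT a|uniform_sphere N. F a)"
  have I_eq: "I = (LINT x|gauss N. F (direction N x))" unfolding I_def by (rule integral_sphere)
  have I0: "0 \<le> I" unfolding I_eq by (intro Bochner_Integration.integral_nonneg F_nonneg)
  have EF: "e / 1024 \<le> (LINT x|gauss N. F x)"
  proof -
    have "ennreal (e / 1024) \<le> (\<integral>\<^sup>+x. ennreal (cmod (cvec_inner N x (basis_vec z))) \<partial>gauss N)"
      using gauss_inner_moment_lower[of 1 N "basis_vec z"] unfolding e_def by simp
    also have "\<dots> \<le> (\<integral>\<^sup>+x. ennreal (F x) \<partial>gauss N)" by (intro nn_integral_mono ennreal_leI inner_le_F z)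
    also have "\<dots> = ennreal (LINT x|gauss N. F x)" by (rule nn_integral_eq_integral[OF Fint]) (use F_nonneg in simp)
    finally show ?thesis by (subst (asm) ennreal_le_iff) (auto intro!: Bochner_Integration.integral_nonneg F_nonneg)
  qed
  show ?thesis
  proof (cases "e = 0")
    case True
    then show ?thesis using I0 e2 unfolding I_def by simp
  next
    case False
    then have ep: "e > 0" using e0 by simp
    \<comment> \<open>The parameter in the inequality of means; it makes s V / 2 at most half of e /
      1024.\<close>
    define s where "s = e / (1024 * (V + 1))"
    have s: "0 < s" unfolding s_def using ep V0 by simp
    have sq: "integrable (gauss N) (\<lambda>x. (cvec_norm N x)\<^sup>2)"
    proof -
      have lip: "gauss_lipschitz N 1 (cvec_norm N)" by (rule gauss_lipschitz_cvec_norm)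
      define r where "r = (LINT x|gauss N. cvec_norm N x)"
      have "integrable (gauss N) (\<lambda>x. \<bar>cvec_norm N x - r\<bar> ^ 2)" unfolding r_def by (rule gauss_lipschitz_moment(1)[OF lip]) auto
      then have "integrable (gauss N) (\<lambda>x. \<bar>cvec_norm N x - r\<bar> ^ 2 + 2 * r * cvec_norm N x - r\<^sup>2)"
        using gauss_lipschitz_integrable[OF lip] by simp
      moreover have "\<bar>cvec_norm N x - r\<bar> ^ 2 + 2 * r * cvec_norm N x - r\<^sup>2 = (cvec_norm N x)\<^sup>2" for x by (simp add: power2_eq_square algebra_simps)
      ultimately show ?thesis by simp
    qed
    have dirint: "integrable (gauss N) (\<lambda>x. F (direction N x))"
    proof (rule G.integrable_const_bound[where B = L])
      show "AE x in gauss N. norm (F (direction N x)) \<le> L" using abs_F_direction_le by simp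
      show "(\<lambda>x. F (direction N x)) \<in> borel_measurable (gauss N)" by measurable
    qed
    have pt: "F x \<le> s / 2 * (cvec_norm N x)\<^sup>2 + L / (2 * s) * F (direction N x)" for x
    proof -
      define c where "c = cvec_norm N x"
      define M where "M = F (direction N x)"
      have M: "0 \<le> M" "M \<le> L" unfolding M_def using F_nonneg abs_F_direction_le[of x] by auto
      have "0 \<le> (s * c - M)\<^sup>2" by simp
      then have "2 * s * (M * c) \<le> s\<^sup>2 * c\<^sup>2 + M * M" by (simp add: power2_eq_square algebra_simps)
      also have "\<dots> \<le> s\<^sup>2 * c\<^sup>2 + L * M" using M by (intro add_left_mono mult_right_mono) auto
      also have "\<dots> = 2 * s * (s / 2 * c\<^sup>2 + L / (2 * s) * M)" using s by (simp add: power2_eq_square algebra_simps)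
      finally have "M * c \<le> s / 2 * c\<^sup>2 + L / (2 * s) * M" using s by (simp only: mult_le_cancel_left_pos zero_less_mult_iff zero_less_numeral simp_thms)
      then show ?thesis unfolding M_def c_def F_direction .
    qed
    have "(LINT x|gauss N. F x) \<le> (LINT x|gauss N. s / 2 * (cvec_norm N x)\<^sup>2 + L / (2 * s) * F (direction N x))"
      by (intro integral_mono Fint Bochner_Integration.integrable_add integrable_mult_right sq dirint pt)
    also have "\<dots> = s / 2 * V + L / (2 * s) * I" unfolding V_def I_eq using sq dirint by simp
    finally have "e / 1024 \<le> s / 2 * V + L / (2 * s) * I" by (rule order_trans[OF EF])
    moreover have "s / 2 * V \<le> e / 2048"
    proof -
      have "s * V \<le> s * (V + 1)" using s by simp
      also have "\<dots> = e / 1024"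
      proof -
        have "e / (1024 * W) * W = e / 1024" if "W \<noteq> 0" for W :: real using that by simp
        moreover have "V + 1 \<noteq> 0" using V0 by linarith
        ultimately show ?thesis unfolding s_def by blast
      qed
      finally show ?thesis by (simp add: mult_ac)
    qed
    ultimately have "e / 2048 \<le> L / (2 * s) * I" by simp
    then have "e / 2048 * (2 * s / L) \<le> L / (2 * s) * I * (2 * s / L)" using s L(1) by (intro mult_right_mono) auto
    also have "\<dots> = I" using s L(1) by simp
    finally have "e / 2048 * (2 * s / L) \<le> I" .
    moreover have "e / 2048 * (2 * s / L) = e\<^sup>2 / (1024\<^sup>2 * (V + 1) * L)" unfolding s_def by (simp add: power2_eq_square)
    ultimately show ?thesis unfolding e2 V_def I_def by simp
  qed
qed

end

section \<open>The compact set: interior part, enclosing boxes, zeros of forms\<close>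

lemma emeasure_hyp_area_null:
  assumes "S \<in> null_sets lborel"
  shows "emeasure hyp_area S = 0"
proof -
  have "S \<in> sets lborel" using assms by auto
  then show ?thesis unfolding hyp_area_def by (subst emeasure_density) (auto intro!: nn_integral_null_set[OF assms])
qed

lemma fund_domain_boundary_null:
  "emeasure hyp_area ({z. Re z = 1 / 2} \<union> {z. Re z = - 1 / 2} \<union> sphere 0 1) = 0"
proof (rule emeasure_hyp_area_null)
  have n: "S \<in> null_sets lborel" if "negligible S" "closed S" for S :: "complex set"
    using that by (simp add: negligible_iff_null_sets null_sets_completion_iff)
  have "negligible {z::complex. 1 \<bullet> z = c}" for c by (rule negligible_hyperplane) simp
  then have re: "negligible {z. Re z = c}" for c by (simp add: inner_complex_def)
  have cl: "closed {z. Re z = c}" for c by (intro closed_Collect_eq continuous_intros)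
  have sp: "negligible (sphere (0::complex) 1)"
    using negligible_convex_frontier[OF convex_cball[of "0::complex" 1]] by simp
  show "{z. Re z = 1 / 2} \<union> {z. Re z = - 1 / 2} \<union> sphere 0 1 \<in> null_sets lborel"
    by (intro null_sets.Un n re cl sp closed_sphere)
qed

text \<open>Peak forms exist uniformly only away from the boundary of the fundamental domain. The
  boundary is a null set, so the parts of K bounded away from it exhaust K up to measure 0, and one
  of them has positive area.\<close>

lemma compact_part_of_interior:
  assumes K: "compact K" "K \<subseteq> fund_domain" "emeasure hyp_area K > 0"
  obtains A where "compact A" "A \<subseteq> K" "A \<subseteq> fund_interior" "emeasure hyp_area A > 0"
proof -
  define A where "A n = K \<inter> ({z. \<bar>Re z\<bar> \<le> 1 / 2 - inverse (real (Suc n))} \<inter> {z. 1 + inverse (real (Suc n)) \<le> cmod z})" for n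
  have cpt: "compact (A n)" for n
    unfolding A_def by (intro compact_Int_closed K(1) closed_Int closed_Collect_le continuous_intros)
  have sub: "A n \<subseteq> fund_interior" for n
  proof
    fix z assume z: "z \<in> A n"
    have i: "0 < inverse (real (Suc n))" by simp
    have zz: "z \<in> K" "\<bar>Re z\<bar> \<le> 1 / 2 - inverse (real (Suc n))" "1 + inverse (real (Suc n)) \<le> cmod z"
      using z unfolding A_def by auto
    have "\<bar>Re z\<bar> < 1 / 2" "1 < cmod z" using i zz by linarith+
    moreover have "0 < Im z" using zz(1) K(2) unfolding fund_domain_def upper_half_plane_def by auto
    ultimately show "z \<in> fund_interior" unfolding fund_interior_def by simp
  qed
  have "\<exists>n. emeasure hyp_area (A n) > 0"
  proof (rule ccontr)
    assume "\<not> ?thesis"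
    then have "emeasure hyp_area (A n) = 0" for n by (simp add: not_less)
    moreover have Am: "A n \<in> sets hyp_area" for n using cpt[of n] by (simp add: sets_hyp_area borel_compact)
    ultimately have 0: "emeasure hyp_area (\<Union>n. A n) = 0" by (intro emeasure_UN_eq_0) auto
    let ?B = "{z. Re z = 1 / 2} \<union> {z. Re z = - 1 / 2} \<union> sphere 0 1"
    have Bm: "?B \<in> sets hyp_area" unfolding sets_hyp_area
      by (intro sets.Un borel_closed closed_Collect_eq continuous_intros closed_sphere)
    have "K \<subseteq> (\<Union>n. A n) \<union> ?B"
    proof
      fix z assume z: "z \<in> K"
      then have zD: "\<bar>Re z\<bar> \<le> 1 / 2" "1 \<le> cmod z" using K(2) unfolding fund_domain_def by auto
      show "z \<in> (\<Union>n. A n) \<union> ?B"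
      proof (cases "\<bar>Re z\<bar> < 1 / 2 \<and> 1 < cmod z")
        case True
        then have "0 < min (1 / 2 - \<bar>Re z\<bar>) (cmod z - 1)" by simp
        then obtain n where "inverse (real (Suc n)) < min (1 / 2 - \<bar>Re z\<bar>) (cmod z - 1)" using reals_Archimedean by blast
        then have "z \<in> A n" using z unfolding A_def by simp
        then show ?thesis by blast
      next
        case False
        then have "\<bar>Re z\<bar> = 1 / 2 \<or> cmod z = 1" using zD by linarith
        then have "Re z = 1 / 2 \<or> Re z = - 1 / 2 \<or> cmod z = 1" by linarith
        then show ?thesis by auto
      qed
    qed
    then have "emeasure hyp_area K \<le> emeasure hyp_area ((\<Union>n. A n) \<union> ?B)"
      using Am Bm by (intro emeasure_mono) auto
    also have "\<dots> \<le> emeasure hyp_area (\<Union>n. A n) + emeasure hyp_area ?B"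
      using Am Bm by (intro emeasure_subadditive) auto
    finally show False using K(3) 0 fund_domain_boundary_null by simp
  qed
  then obtain n where n: "emeasure hyp_area (A n) > 0" by blast
  show ?thesis by (rule that[OF cpt _ sub n]) (simp add: A_def)
qed

lemma compact_in_box_region:
  assumes "compact K" "K \<subseteq> fund_domain"
  obtains R where "R \<ge> 1" "K \<subseteq> box_region R"
proof -
  obtain b where b: "\<And>z. z \<in> K \<Longrightarrow> cmod z \<le> b" using compact_imp_bounded[OF assms(1)] unfolding bounded_iff by auto
  define R where "R = max b 2"
  have "K \<subseteq> box_region R"
  proof
    fix z assume z: "z \<in> K"
    have "1 / R \<le> 1 / 2" unfolding R_def by (intro divide_left_mono) auto
    also have "1 / 2 \<le> Im z" using z assms(2) fund_domain_Im_ge by blast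
    finally have "1 / R \<le> Im z" .
    moreover have "\<bar>Re z\<bar> \<le> R" "\<bar>Im z\<bar> \<le> R"
      using b[OF z] abs_Re_le_cmod[of z] abs_Im_le_cmod[of z] unfolding R_def by linarith+
    ultimately show "z \<in> box_region R" unfolding box_region_def by simp
  qed
  moreover have "R \<ge> 1" unfolding R_def by simp
  ultimately show ?thesis using that by blast
qed

lemma box_region_mono: "R \<ge> 1 \<Longrightarrow> box_region R \<subseteq> box_region (2 * R)"
proof
  fix z assume R: "R \<ge> 1" and z: "z \<in> box_region R"
  have "1 / (2 * R) \<le> 1 / R" using R by (intro divide_left_mono) auto
  then show "z \<in> box_region (2 * R)" using z R unfolding box_region_def by auto
qed

lemma box_region_area_finite:
  assumes R: "R \<ge> 1"
  shows "emeasure hyp_area (box_region R) < \<top>"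
proof -
  have bm: "box_region R \<in> sets borel" unfolding box_region_def by measurable
  have bd: "bounded (box_region R)"
  proof (rule boundedI)
    fix z assume z: "z \<in> box_region R"
    then have "\<bar>Re z\<bar> \<le> R" "\<bar>Im z\<bar> \<le> R" using box_region_Im_pos[OF _ z] R unfolding box_region_def by auto
    then show "cmod z \<le> R + R" using cmod_le[of z] by linarith
  qed
  have "emeasure hyp_area (box_region R) = (\<integral>\<^sup>+w. indicator (box_region R) w \<partial>hyp_area)" using bm by (simp add: sets_hyp_area)
  also have "\<dots> = (\<integral>\<^sup>+w. indicator upper_half_plane w * ennreal (1 / (Im w)\<^sup>2) * indicator (box_region R) w \<partial>lborel)"
    using bm by (intro nn_integral_hyp_area) simp
  also have "\<dots> \<le> (\<integral>\<^sup>+w. ennreal (R\<^sup>2) * indicator (box_region R) w \<partial>lborel)"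
  proof (rule nn_integral_mono)
    fix w
    show "indicator upper_half_plane w * ennreal (1 / (Im w)\<^sup>2) * indicator (box_region R) w \<le> ennreal (R\<^sup>2) * indicator (box_region R) w"
    proof (cases "w \<in> box_region R")
      case True
      have I: "0 < Im w" using box_region_Im_pos[OF _ True] R by simp
      have "1 / R \<le> Im w" using True unfolding box_region_def by simp
      then have "1 / Im w \<le> R" using R I by (simp add: field_simps)
      then have "(1 / Im w)\<^sup>2 \<le> R\<^sup>2" using I by (intro power_mono) auto
      then show ?thesis using True by (auto simp: power_divide intro!: ennreal_leI split: split_indicator)
    qed simp
  qed
  also have "\<dots> = ennreal (R\<^sup>2) * emeasure lborel (box_region R)" using bm by (intro nn_integral_cmult_indicator) simp
  also have "\<dots> < \<top>" using emeasure_bounded_finite[OF bd] by (simp add: ennreal_mult_less_top)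
  finally show ?thesis .
qed

lemma holomorphic_zero_on_compact:
  assumes K: "compact K" "K \<subseteq> upper_half_plane" "infinite K"
    and h: "h holomorphic_on upper_half_plane" "\<And>z. z \<in> K \<Longrightarrow> h z = 0" and w: "w \<in> upper_half_plane"
  shows "h w = 0"
proof -
  obtain \<xi> where \<xi>: "\<xi> \<in> K" "\<xi> islimpt K"
    using K(1,3) unfolding compact_eq_Bolzano_Weierstrass by blast
  show ?thesis
    by (rule analytic_continuation[OF h(1) upper_half_plane_open convex_connected[OF upper_half_plane_convex] K(2) _ \<xi>(2) h(2) w])
      (use \<xi>(1) K(2) in auto)
qed

lemma infinite_of_positive_area:
  assumes "emeasure hyp_area K > 0"
  shows "infinite K"
proof
  assume "finite K"
  then have "K \<in> null_sets lborel" by (rule finite_imp_null_set_lborel)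
  then show False using emeasure_hyp_area_null[of K] assms by simp
qed

text \<open>A form taken from one basis is not identically 0, so by the identity theorem it is
  nonzero at some z in K. Its Petersson norm does not depend on any basis, so
  \<open>total_weight_lower\<close> bounds the total weight at z from below for all bases at
  once.\<close>

lemma expectation_lower_fixed_weight:
  assumes K: "compact K" "K \<subseteq> upper_half_plane" "emeasure hyp_area K > 0" and L: "L > 0"
    and bound: "\<And>f z. admissible k f \<Longrightarrow> z \<in> K \<Longrightarrow> weight_basis.total_weight k f z \<le> L\<^sup>2"
  shows "\<exists>\<delta>>0. \<forall>f. admissible k f \<longrightarrow> \<delta> \<le> (LINT a|uniform_sphere (cusp_dim k). sup_on K k f a)"
proof (cases "\<exists>f0. admissible k f0")
  case True
  then obtain f0 where f0: "admissible k f0" by blast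
  have Kinf: "infinite K" by (rule infinite_of_positive_area[OF K(3)])
  have Kne: "K \<noteq> {}" using Kinf by auto
  interpret W0: weight_basis k f0 by unfold_locales (rule f0)
  define h where "h = f0 0"
  have N1: "0 < cusp_dim k" using W0.N1 by simp
  have h: "h \<in> cusp_forms k" unfolding h_def by (rule W0.basis_cusp_form[OF N1])
  have "\<exists>z\<in>K. h z \<noteq> 0"
  proof (rule ccontr)
    assume "\<not> ?thesis"
    then have "h w = 0" if "w \<in> upper_half_plane" for w
      by (intro holomorphic_zero_on_compact[OF K(1,2) Kinf cusp_formsD(1)[OF h] _ that]) blast
    then have "h w = 0" for w using cusp_formsD(2)[OF h, of w] unfolding upper_half_plane_def by blast
    then have "petersson k (f0 0) (f0 0) = 0" unfolding h_def petersson_def set_lebesgue_integral_def by simp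
    then show False using W0.petersson_basis[OF N1 N1] by simp
  qed
  then obtain z where z: "z \<in> K" "h z \<noteq> 0" by blast
  have Iz: "Im z > 0" using z K(2) unfolding upper_half_plane_def by auto
  have pos: "0 < form_weight k h z" unfolding form_weight_def using z(2) Iz by simp
  obtain c where c: "h = form_of_coeffs k f0 c" by (rule W0.cusp_form_coeffs[OF h])
  define b where "b = (cvec_norm (cusp_dim k) c)\<^sup>2 / form_weight k h z"
  have b0: "0 \<le> b" unfolding b_def using pos by simp
  have "b * form_weight k h z = (cvec_norm (cusp_dim k) c)\<^sup>2" unfolding b_def using pos by simp
  then have int: "(\<integral>\<^sup>+w. ennreal (form_weight k h w) * indicator fund_domain w \<partial>hyp_area) \<le> ennreal (b * form_weight k h z)"
    using W0.nn_integral_form_weight[of c] unfolding c[symmetric] by simp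
  have tw: "1 \<le> b * weight_basis.total_weight k f z" if f: "admissible k f" for f
  proof -
    interpret W: weight_basis k f by unfold_locales (rule f)
    show ?thesis by (rule W.total_weight_lower[OF Iz h b0 pos int])
  qed
  have bp: "0 < b" using tw[OF f0] b0 by (cases "b = 0") auto
  define V where "V = (LINT x|gauss (cusp_dim k). (cvec_norm (cusp_dim k) x)\<^sup>2)"
  have V0: "0 \<le> V" unfolding V_def by simp
  define q where "q = 1024\<^sup>2 * (V + 1) * L"
  have q: "0 < q" unfolding q_def using V0 L by simp
  have "1 / b / q \<le> (LINT a|uniform_sphere (cusp_dim k). sup_on K k f a)" if f: "admissible k f" for f
  proof -
    interpret W: weight_basis_on k f K L
      by unfold_locales (use f K Kne L bound in auto)
    have "1 / b \<le> W.total_weight z" using tw[OF f] bp by (simp add: field_simps)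
    then have "1 / b / q \<le> W.total_weight z / q" using q by (intro divide_right_mono) auto
    also have "\<dots> \<le> (LINT a|uniform_sphere (cusp_dim k). sup_on K k f a)"
      using W.sphere_F_lower_crude[OF z(1)] unfolding q_def V_def .
    finally show ?thesis .
  qed
  moreover have "0 < 1 / b / q" using bp q by simp
  ultimately show ?thesis by blast
qed (auto intro: exI[of _ 1])

section \<open>The choice of the exponent n and of the constants\<close>

lemma nat_floor_log:
  fixes \<Lambda> x :: real
  assumes \<Lambda>: "\<Lambda> > 1" and x: "x > 0" and big: "2 * ln \<Lambda> \<le> ln x"
  obtains n :: nat where "n \<ge> 2" "\<Lambda> ^ n \<le> x" "ln x / (2 * ln \<Lambda>) \<le> real n"
proof -
  define t where "t = ln x / ln \<Lambda>"
  have l: "0 < ln \<Lambda>" using \<Lambda> by simp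
  have t2: "2 \<le> t" unfolding t_def using big l by (simp add: pos_le_divide_eq)
  define n where "n = nat \<lfloor>t\<rfloor>"
  have n1: "real n \<le> t" "t - 1 \<le> real n" unfolding n_def using t2 by linarith+
  have "n \<ge> 2" unfolding n_def using t2 by linarith
  moreover have "\<Lambda> ^ n \<le> x"
  proof -
    have "ln (\<Lambda> ^ n) = real n * ln \<Lambda>" using \<Lambda> by (simp add: ln_realpow)
    also have "\<dots> \<le> t * ln \<Lambda>" using n1 l by (intro mult_right_mono) auto
    also have "\<dots> = ln x" unfolding t_def using l by simp
    finally show ?thesis using \<Lambda> x by simp
  qed
  moreover have "ln x / (2 * ln \<Lambda>) \<le> real n"
  proof -
    have "ln x / (2 * ln \<Lambda>) = t / 2" unfolding t_def by simp
    then show ?thesis using n1 t2 by linarith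
  qed
  ultimately show ?thesis using that by blast
qed

theorem theorem1p1:
  fixes K :: "complex set"
  assumes "compact K" and "K \<subseteq> fund_domain" and "emeasure hyp_area K > 0"
  shows
    "(\<exists>c0 c1 :: real. 0 < c0 \<and> c0 < c1 \<and>
        (\<forall>k f. admissible k f \<longrightarrow>
           integrable (uniform_sphere (cusp_dim k)) (sup_on K k f) \<and>
           c0 * sqrt (ln (real k)) \<le> (LINT a|uniform_sphere (cusp_dim k). sup_on K k f a) \<and>
           (LINT a|uniform_sphere (cusp_dim k). sup_on K k f a) \<le> c1 * sqrt (ln (real k))))
     \<and>
     (\<exists>C :: real. \<forall>k f \<mu>. admissible k f \<and> is_median (uniform_sphere (cusp_dim k)) (sup_on K k f) \<mu> \<longrightarrow>
        \<bar>\<mu> - (LINT a|uniform_sphere (cusp_dim k). sup_on K k f a)\<bar> \<le> C)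
     \<and>
     (\<exists>c :: real. c > 0 \<and>
        (\<forall>k f \<mu>. admissible k f \<and> is_median (uniform_sphere (cusp_dim k)) (sup_on K k f) \<mu> \<longrightarrow>
           (\<forall>r > 0. measure (uniform_sphere (cusp_dim k))
                {a \<in> space (uniform_sphere (cusp_dim k)). \<bar>sup_on K k f a - \<mu>\<bar> > r}
              \<le> 2 * exp (- c * r\<^sup>2))))"
proof -
  have Kne: "K \<noteq> {}" using assms(3) by auto
  have KH: "K \<subseteq> upper_half_plane" using assms(2) unfolding fund_domain_def by auto
  obtain R where R: "R \<ge> 1" "K \<subseteq> box_region R" by (rule compact_in_box_region[OF assms(1,2)])
  have R2: "2 * R \<ge> 1" using R(1) by simp
  obtain C0 where C0: "C0 > 0" "\<And>k f z. 1 \<le> k \<Longrightarrow> f \<in> cusp_forms k \<Longrightarrow> z \<in> box_region (2 * R) \<Longrightarrow>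
      ennreal (form_weight k f z) \<le> ennreal (C0 * real k) * (\<integral>\<^sup>+w. ennreal (form_weight k f w) * indicator fund_domain w \<partial>hyp_area)"
    using cusp_form_pointwise_bound[OF R2] by blast
  \<comment> \<open>At least 1, so that k <= (L k)^2 and the choice of n with \<Lambda> ^ n <= k
    yields the hypothesis \<open>big\<close>.\<close>
  define C where "C = max C0 1"
  have C1: "C \<ge> 1" unfolding C_def by simp
  define L where "L k = sqrt (C * real k)" for k :: nat
  have Lsq: "(L k)\<^sup>2 = C * real k" for k unfolding L_def using C1 by simp
  have upper: "weight_basis.total_weight k f z \<le> (L k)\<^sup>2" if f: "admissible k f" and z: "z \<in> box_region (2 * R)" for k f z
  proof -
    interpret W: weight_basis k f by unfold_locales (rule f)
    have "W.total_weight z \<le> C0 * real k"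
    proof (rule W.total_weight_upper)
      show "0 < Im z" using box_region_Im_pos[OF _ z] R by simp
      show "0 \<le> C0 * real k" using C0(1) by simp
      show "ennreal (form_weight k h z) \<le> ennreal (C0 * real k) * (\<integral>\<^sup>+w. ennreal (form_weight k h w) * indicator fund_domain w \<partial>hyp_area)"
        if "h \<in> cusp_forms k" for h by (rule C0(2)[OF _ that z]) (use W.k2 in simp)
    qed
    also have "\<dots> \<le> C * real k" unfolding C_def by (intro mult_right_mono) auto
    finally show ?thesis unfolding Lsq .
  qed
  have upperK: "weight_basis.total_weight k f z \<le> (L k)\<^sup>2" if "admissible k f" "z \<in> K" for k f z
    using upper[OF that(1)] that(2) R(2) box_region_mono[OF R(1)] by blast
  have wbo: "weight_basis_on k f K (L k)" if f: "admissible k f" for k f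
  proof -
    interpret W: weight_basis k f by unfold_locales (rule f)
    show ?thesis
    proof
      show "compact K" by (rule assms(1))
      show "K \<subseteq> upper_half_plane" by (rule KH)
      show "K \<noteq> {}" by (rule Kne)
      show "0 < L k" unfolding L_def using C1 W.k2 by simp
      show "W.total_weight z \<le> (L k)\<^sup>2" if "z \<in> K" for z by (rule upperK[OF f that])
    qed
  qed
  define Ar where "Ar = enn2real (emeasure hyp_area (box_region (2 * R)))"
  have Ar: "0 \<le> Ar" "emeasure hyp_area (box_region (2 * R)) \<le> ennreal Ar"
    unfolding Ar_def using box_region_area_finite[OF R2] by auto
  obtain A where A: "compact A" "A \<subseteq> K" "A \<subseteq> fund_interior" "emeasure hyp_area A > 0"
    by (rule compact_part_of_interior[OF assms])
  have Ab: "A \<in> sets borel" using A(1) by (simp add: borel_compact)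
  have Afin: "emeasure hyp_area A < \<top>"
  proof -
    have "emeasure hyp_area A \<le> emeasure hyp_area (box_region (2 * R))"
      using A(2) R(2) box_region_mono[OF R(1)] by (intro emeasure_mono) (auto simp: sets_hyp_area box_region_def)
    then show ?thesis using box_region_area_finite[OF R2] by (rule le_less_trans)
  qed
  \<comment> \<open>Capped at 1, which gives (m / 2) ^ n <= m / 2 in
    \<open>Lp_norm_mean_lower\<close>.\<close>
  define m where "m = min 1 (enn2real (emeasure hyp_area A))"
  have m: "0 < m" "m \<le> 1" "ennreal m \<le> emeasure hyp_area A"
  proof -
    show "0 < m" unfolding m_def using A(4) Afin by (simp add: enn2real_positive_iff)
    show "m \<le> 1" unfolding m_def by simp
    have "ennreal m \<le> ennreal (enn2real (emeasure hyp_area A))" unfolding m_def by (intro ennreal_leI) simp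
    then show "ennreal m \<le> emeasure hyp_area A" using Afin by simp
  qed
  obtain P0 j0 where P0: "P0 > 0" "\<And>j z. j0 \<le> j \<Longrightarrow> z \<in> A \<Longrightarrow> \<exists>h\<in>cusp_forms (2 * j). 0 < form_weight (2 * j) h z \<and>
    (\<integral>\<^sup>+w. ennreal (form_weight (2 * j) h w) * indicator fund_domain w \<partial>hyp_area) \<le> ennreal (P0 / real (2 * j) * form_weight (2 * j) h z)"
    using peak_forms[OF A(1,3)] by blast
  define P where "P = max P0 1"
  have P1: "P \<ge> 1" unfolding P_def by simp
  define l where "l k = sqrt (real k / P)" for k :: nat
  have lsq: "(l k)\<^sup>2 = real k / P" for k unfolding l_def using P1 by simp
  have peak: "peak_set k f K (L k) A m (l k)" if f: "admissible k f" and k: "2 * j0 \<le> k" for k f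
  proof -
    interpret W: weight_basis_on k f K "L k" by (rule wbo[OF f])
    show ?thesis
    proof
      show "A \<in> sets borel" by (rule Ab)
      show "A \<subseteq> K" by (rule A(2))
      show "K \<subseteq> fund_domain" by (rule assms(2))
      show "0 < m" "m \<le> 1" "ennreal m \<le> emeasure hyp_area A" by (rule m)+
      show "0 < l k" unfolding l_def using W.k2 P1 by simp
      fix w assume w: "w \<in> A"
      obtain j where j: "k = 2 * j" using W.even_k by blast
      obtain h where h: "h \<in> cusp_forms k" "0 < form_weight k h w"
        "(\<integral>\<^sup>+w. ennreal (form_weight k h w) * indicator fund_domain w \<partial>hyp_area) \<le> ennreal (P0 / real k * form_weight k h w)"
        using P0(2)[of j w] w k unfolding j by auto
      have Iw: "0 < Im w" using w A(2) W.K_Im by blast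
      have "1 \<le> P0 / real k * W.total_weight w"
        by (rule W.total_weight_lower[OF Iw h(1) _ h(2,3)]) (use P0(1) in simp)
      also have "\<dots> \<le> P / real k * W.total_weight w"
        unfolding P_def by (intro mult_right_mono divide_right_mono W.total_weight_nonneg Iw) auto
      finally show "(l k)\<^sup>2 \<le> W.total_weight w"
        unfolding lsq using P1 W.k2 by (simp add: field_simps)
    qed
  qed
  \<comment> \<open>Below weight 2 j0 only N >= 1 is known, and there k / (2 j0 + 1) is at most
    1.\<close>
  define cN where "cN = min (m / P) (1 / (2 * real j0 + 1))"
  have cN: "cN > 0" unfolding cN_def using m P1 by simp
  have dim: "cN * real k \<le> real (cusp_dim k)" if f: "admissible k f" for k f
  proof (cases "2 * j0 \<le> k")
    case True
    interpret W: peak_set k f K "L k" A m "l k" by (rule peak[OF f True])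
    have "cN * real k \<le> m / P * real k" unfolding cN_def by (intro mult_right_mono) auto
    also have "\<dots> = m * (l k)\<^sup>2" unfolding lsq by simp
    also have "\<dots> \<le> real (cusp_dim k)" by (rule W.dim_lower)
    finally show ?thesis .
  next
    case False
    have "cN * real k \<le> 1 / (2 * real j0 + 1) * real k" unfolding cN_def by (intro mult_right_mono) auto
    also have "\<dots> \<le> 1" using False by (simp add: divide_le_eq)
    also have "1 \<le> real (cusp_dim k)" using f unfolding admissible_def by simp
    finally show ?thesis .
  qed
  \<comment> \<open>\<open>L k\<close> and the mean norm are both of order sqrt k, so the
    fluctuation scale is bounded over all weights. This is why the rate in (ii) does not depend on
    k.\<close>
  define S where "S = 1024 * sqrt (C / cN)"
  have S: "0 < S" unfolding S_def using C1 cN by simp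
  have scale: "sphere_functional.scale (cusp_dim k) (L k) \<le> S" if f: "admissible k f" for k f
  proof -
    interpret W: weight_basis_on k f K "L k" by (rule wbo[OF f])
    have k0: "0 < real k" using W.k2 by simp
    have "sqrt (cN * real k) / 1024 \<le> sqrt (real (cusp_dim k)) / 1024" using dim[OF f] by simp
    also have "\<dots> \<le> gauss_mean_norm (cusp_dim k)" by (rule gauss_mean_norm_lower)
    finally have g: "sqrt (cN * real k) / 1024 \<le> gauss_mean_norm (cusp_dim k)" .
    have "W.scale \<le> L k / (sqrt (cN * real k) / 1024)"
      unfolding W.scale_def using g W.L(1) cN k0 by (intro divide_left_mono mult_pos_pos W.mean_norm_pos) auto
    also have "\<dots> = S" unfolding S_def L_def using k0 by (simp add: real_sqrt_mult real_sqrt_divide)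
    finally show ?thesis .
  qed
  have ln_lower: "1 / 2 \<le> sqrt (ln (real k))" if f: "admissible k f" for k f
  proof -
    have "k \<ge> 2" using f unfolding admissible_def by simp
    then have "ln 2 \<le> ln (real k)" by (intro ln_mono) auto
    then have "(1 / 2)\<^sup>2 \<le> ln (real k)" using ln2_ge_two_thirds by (simp add: power2_eq_square)
    then show ?thesis by (rule real_le_rsqrt)
  qed
  have sqrt_ln_nonneg: "0 \<le> sqrt (ln (real k))" if "admissible k f" for k f
    using ln_lower[OF that] by linarith
  \<comment> \<open>16 comes from the error 8 S between center and expectation, absorbed through 1
    <= 2 sqrt (ln k).\<close>
  define c1 where "c1 = (256 * (1 + 512 * Ar) + 16) * S"
  have c1: "0 < c1" unfolding c1_def using Ar S by (intro mult_pos_pos) auto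
  have E_upper: "(LINT a|uniform_sphere (cusp_dim k). sup_on K k f a) \<le> c1 * sqrt (ln (real k))" if f: "admissible k f" for k f
  proof -
    interpret W: weight_basis_on k f K "L k" by (rule wbo[OF f])
    define s where "s = sqrt (ln (real k))"
    have s: "1 / 2 \<le> s" unfolding s_def by (rule ln_lower[OF f])
    have "W.center \<le> 256 * (1 + 512 * Ar) * L k * s / gauss_mean_norm (cusp_dim k)"
      unfolding W.center_def s_def using W.mean_norm_pos
      by (intro divide_right_mono W.gauss_F_upper[OF R _ Ar] upper[OF f]) auto
    also have "\<dots> = 256 * (1 + 512 * Ar) * s * W.scale" unfolding W.scale_def by simp
    also have "\<dots> \<le> 256 * (1 + 512 * Ar) * s * S" using scale[OF f] Ar s by (intro mult_left_mono) auto
    finally have c: "W.center \<le> 256 * (1 + 512 * Ar) * s * S" .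
    have "8 * W.scale \<le> 8 * S" using scale[OF f] by simp
    also have "\<dots> \<le> 8 * S * (2 * s)" using S s by simp
    finally have "W.center + 8 * W.scale \<le> 256 * (1 + 512 * Ar) * s * S + 8 * S * (2 * s)" using c by (rule add_mono[rotated])
    also have "\<dots> = c1 * s" unfolding c1_def by (simp add: algebra_simps)
    finally show ?thesis using W.expectation_center unfolding s_def[symmetric] by linarith
  qed
  \<comment> \<open>The ratio in \<open>big\<close>. It is free of k because \<open>L k\<close> and
    \<open>l k\<close> grow alike.\<close>
  define \<Lambda> where "\<Lambda> = 16384 * sqrt (C * P) / m"
  have \<Lambda>: "\<Lambda> > 1"
  proof -
    have "1 * 1 \<le> C * P" using C1 P1 by (intro mult_mono) auto
    then have "1 \<le> sqrt (C * P)" by simp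
    then have "1 * m < 16384 * sqrt (C * P)" using m(2) by linarith
    then show ?thesis unfolding \<Lambda>_def using m(1) by (simp only: pos_less_divide_eq)
  qed
  have l\<Lambda>: "0 < ln \<Lambda>" using \<Lambda> by simp
  \<comment> \<open>4194304 = 8192 * 512, from \<open>gauss_F_lower\<close> and
    \<open>gauss_mean_norm_upper\<close>. The last root comes from n >= ln k / (2 ln
    \<Lambda>).\<close>
  define d where "d = m / (4194304 * sqrt P * sqrt (2 * ln \<Lambda>))"
  have d: "0 < d" unfolding d_def using m P1 l\<Lambda> by simp
  have center_lower: "d * sqrt (ln (real k)) - 8 * S \<le> (LINT a|uniform_sphere (cusp_dim k). sup_on K k f a)"
    if f: "admissible k f" and k: "2 * j0 \<le> k" "2 * ln \<Lambda> \<le> ln (real k)" for k f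
  proof -
    interpret W: peak_set k f K "L k" A m "l k" by (rule peak[OF f k(1)])
    have k0: "0 < real k" using W.k2 by simp
    obtain n where n: "n \<ge> 2" "\<Lambda> ^ n \<le> real k" "ln (real k) / (2 * ln \<Lambda>) \<le> real n"
      by (rule nat_floor_log[OF \<Lambda> k0 k(2)])
    have "16384 * L k / (m * l k) = \<Lambda>"
      unfolding L_def l_def \<Lambda>_def using k0 m P1 by (simp add: real_sqrt_mult real_sqrt_divide field_simps)
    then have "(16384 * L k / (m * l k)) ^ n = \<Lambda> ^ n" by simp
    also have "\<dots> \<le> (L k)\<^sup>2"
    proof -
      have "1 * real k \<le> C * real k" using C1 by (intro mult_right_mono) auto
      then show ?thesis unfolding Lsq using n(2) by linarith
    qed
    finally have big: "(16384 * L k / (m * l k)) ^ n \<le> (L k)\<^sup>2" .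
    note E = W.gauss_F_lower[OF n(1) big]
    have "gauss_mean_norm (cusp_dim k) \<le> 512 * sqrt (real (cusp_dim k))" by (rule gauss_mean_norm_upper)
    also have "\<dots> \<le> 512 * sqrt (real k)" using W.dim_le_weight by simp
    finally have g: "gauss_mean_norm (cusp_dim k) \<le> 512 * sqrt (real k)" .
    have "d * sqrt (ln (real k)) = sqrt (ln (real k) / (2 * ln \<Lambda>)) * l k * m / 8192 / (512 * sqrt (real k))"
      unfolding d_def l_def using k0 by (simp add: real_sqrt_divide real_sqrt_mult mult_ac)
    also have "\<dots> \<le> sqrt (real n) * l k * m / 8192 / (512 * sqrt (real k))"
      using n(3) m W.l(1) by (intro divide_right_mono mult_right_mono real_sqrt_le_mono) auto
    also have "\<dots> \<le> (LINT x|gauss (cusp_dim k). sup_on K k f x) / (512 * sqrt (real k))" by (intro divide_right_mono E) auto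
    also have "\<dots> \<le> W.center"
      unfolding W.center_def using g k0 by (intro divide_left_mono mult_pos_pos W.mean_norm_pos Bochner_Integration.integral_nonneg W.F_nonneg) auto
    finally have "d * sqrt (ln (real k)) \<le> W.center" .
    then show ?thesis using W.expectation_center scale[OF f] by linarith
  qed
  \<comment> \<open>The first entry makes n >= 2 possible, the second lets half of d sqrt (ln k)
    absorb the error 8 S.\<close>
  define X where "X = max (2 * ln \<Lambda>) ((16 * S / d)\<^sup>2)"
  define k1 where "k1 = max (2 * j0) (nat \<lceil>exp X\<rceil>)"
  have large: "d / 2 * sqrt (ln (real k)) \<le> (LINT a|uniform_sphere (cusp_dim k). sup_on K k f a)"
    if f: "admissible k f" and k: "k1 \<le> k" for k f
  proof -
    have "exp X \<le> real k" using k unfolding k1_def by linarith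
    then have "ln (exp X) \<le> ln (real k)" by (intro ln_mono) auto
    then have X: "2 * ln \<Lambda> \<le> ln (real k)" "(16 * S / d)\<^sup>2 \<le> ln (real k)" unfolding X_def by auto
    have "16 * S / d \<le> sqrt (ln (real k))" by (rule real_le_rsqrt[OF X(2)])
    then have "8 * S \<le> d / 2 * sqrt (ln (real k))" using d by (simp add: pos_divide_le_eq mult.commute)
    moreover have "2 * j0 \<le> k" using k unfolding k1_def by simp
    ultimately show ?thesis using center_lower[OF f _ X(1)] by auto
  qed
  have "\<exists>\<delta>>0. \<forall>f. admissible k f \<longrightarrow> \<delta> \<le> (LINT a|uniform_sphere (cusp_dim k). sup_on K k f a)" for k
  proof (cases "k = 0")
    case False
    then have "0 < L k" unfolding L_def using C1 by simp
    then show ?thesis by (rule expectation_lower_fixed_weight[OF assms(1) KH assms(3) _ upperK])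
  qed (auto simp: admissible_def intro: exI[of _ 1])
  then obtain \<delta> where \<delta>: "\<And>k. 0 < \<delta> k" "\<And>k f. admissible k f \<Longrightarrow> \<delta> k \<le> (LINT a|uniform_sphere (cusp_dim k). sup_on K k f a)"
    by metis
  \<comment> \<open>The summand 1 keeps the denominator positive for every k.\<close>
  define e where "e k = \<delta> k / (\<bar>sqrt (ln (real k))\<bar> + 1)" for k
  have e0: "0 < e k" for k unfolding e_def using \<delta>(1) by (simp add: add_nonneg_pos)
  have e: "e k * sqrt (ln (real k)) \<le> \<delta> k" for k
  proof -
    have "e k * sqrt (ln (real k)) \<le> e k * (\<bar>sqrt (ln (real k))\<bar> + 1)" using e0[of k] by (intro mult_left_mono) auto
    also have "\<dots> = \<delta> k"
    proof -
      have "\<bar>sqrt (ln (real k))\<bar> + 1 \<noteq> 0" using abs_ge_zero[of "sqrt (ln (real k))"] by linarith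
      then show ?thesis unfolding e_def by (rule nonzero_eq_divide_eq[THEN iffD1, OF _ refl])
    qed
    finally show ?thesis .
  qed
  \<comment> \<open>Only finitely many weights lie below \<open>k1\<close>, and each has its own
    positive bound.\<close>
  define c0 where "c0 = Min (insert (d / 2) (e ` {..<k1}))"
  have c0: "0 < c0" unfolding c0_def using d e0 by (subst Min_gr_iff) auto
  have E_lower: "c0 * sqrt (ln (real k)) \<le> (LINT a|uniform_sphere (cusp_dim k). sup_on K k f a)" if f: "admissible k f" for k f
  proof (cases "k1 \<le> k")
    case True
    have "c0 \<le> d / 2" unfolding c0_def by (rule Min_le) auto
    then have "c0 * sqrt (ln (real k)) \<le> d / 2 * sqrt (ln (real k))" by (rule mult_right_mono) (rule sqrt_ln_nonneg[OF f])
    then show ?thesis using large[OF f True] by linarith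
  next
    case False
    then have "c0 \<le> e k" unfolding c0_def by (intro Min_le) auto
    then have "c0 * sqrt (ln (real k)) \<le> e k * sqrt (ln (real k))" by (rule mult_right_mono) (rule sqrt_ln_nonneg[OF f])
    then show ?thesis using e[of k] \<delta>(2)[OF f] by linarith
  qed
  show ?thesis
  proof (intro conjI)
    show "\<exists>c0 c1 :: real. 0 < c0 \<and> c0 < c1 \<and>
        (\<forall>k f. admissible k f \<longrightarrow>
           integrable (uniform_sphere (cusp_dim k)) (sup_on K k f) \<and>
           c0 * sqrt (ln (real k)) \<le> (LINT a|uniform_sphere (cusp_dim k). sup_on K k f a) \<and>
           (LINT a|uniform_sphere (cusp_dim k). sup_on K k f a) \<le> c1 * sqrt (ln (real k)))"
    \<comment> \<open>Taking \<open>c0 + c1\<close> as the upper constant makes the required strict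
      order of the two constants automatic.\<close>
    proof (rule exI[of _ c0], rule exI[of _ "c0 + c1"], intro conjI allI impI)
      fix k f assume f: "admissible k f"
      interpret W: weight_basis_on k f K "L k" by (rule wbo[OF f])
      show "integrable (uniform_sphere (cusp_dim k)) (sup_on K k f)" by (rule W.integrable_sphere)
      show "c0 * sqrt (ln (real k)) \<le> (LINT a|uniform_sphere (cusp_dim k). sup_on K k f a)" by (rule E_lower[OF f])
      have "c1 * sqrt (ln (real k)) \<le> (c0 + c1) * sqrt (ln (real k))" using c0 by (intro mult_right_mono sqrt_ln_nonneg[OF f]) simp
      then show "(LINT a|uniform_sphere (cusp_dim k). sup_on K k f a) \<le> (c0 + c1) * sqrt (ln (real k))"
        using E_upper[OF f] by linarith
    qed (use c0 c1 in auto)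
    show "\<exists>C :: real. \<forall>k f \<mu>. admissible k f \<and> is_median (uniform_sphere (cusp_dim k)) (sup_on K k f) \<mu> \<longrightarrow>
        \<bar>\<mu> - (LINT a|uniform_sphere (cusp_dim k). sup_on K k f a)\<bar> \<le> C"
    proof (intro exI[of _ "13 * S"] allI impI)
      fix k f \<mu> assume a: "admissible k f \<and> is_median (uniform_sphere (cusp_dim k)) (sup_on K k f) \<mu>"
      then have f: "admissible k f" and med: "is_median (uniform_sphere (cusp_dim k)) (sup_on K k f) \<mu>" by auto
      interpret W: weight_basis_on k f K "L k" by (rule wbo[OF f])
      show "\<bar>\<mu> - (LINT a|uniform_sphere (cusp_dim k). sup_on K k f a)\<bar> \<le> 13 * S"
        using W.median_expectation[OF med] scale[OF f] by linarith
    qed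
    show "\<exists>c :: real. c > 0 \<and>
        (\<forall>k f \<mu>. admissible k f \<and> is_median (uniform_sphere (cusp_dim k)) (sup_on K k f) \<mu> \<longrightarrow>
           (\<forall>r > 0. measure (uniform_sphere (cusp_dim k))
                {a \<in> space (uniform_sphere (cusp_dim k)). \<bar>sup_on K k f a - \<mu>\<bar> > r}
              \<le> 2 * exp (- c * r\<^sup>2)))"
    proof (intro exI[of _ "1 / (200 * S\<^sup>2)"] conjI allI impI)
      show "0 < 1 / (200 * S\<^sup>2)" using S by simp
      fix k f \<mu> and r :: real
      assume a: "admissible k f \<and> is_median (uniform_sphere (cusp_dim k)) (sup_on K k f) \<mu>" and r: "r > 0"
      then have f: "admissible k f" and med: "is_median (uniform_sphere (cusp_dim k)) (sup_on K k f) \<mu>" by auto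
      interpret W: weight_basis_on k f K "L k" by (rule wbo[OF f])
      show "measure (uniform_sphere (cusp_dim k)) {a \<in> space (uniform_sphere (cusp_dim k)). \<bar>sup_on K k f a - \<mu>\<bar> > r}
          \<le> 2 * exp (- (1 / (200 * S\<^sup>2)) * r\<^sup>2)"
        by (rule W.tail_median[OF med r scale[OF f]])
    qed
  qed
qed

end
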